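(* Let $Q^N(t,x)=Q^N(x;\theta(t))$ be the width-$N$ neural network trained with clipped gradient descent, and let $Q(t,x)$ be the solution of the limit equation $$\frac{\partial Q(t,x)}{\partial t}=-\alpha\int_\Omega U_{Q(t)}(x,y)\big(\mathcal{A}_{Q(t)}Q(t,y)-g(y)\big)\mu(dy),\qquad Q(0,x)=0 .$$ Then for every $T<\infty$ and every multi-index $i$ with $|i|\le2$, as $N\to\infty$, $$\sup_{t\in[0,T]}\sup_{x\in\Omega}\big|\partial_x^iQ^N(t,x)-\partial_x^iQ(t,x)\big|\to0\quad\text{almost surely},$$ and consequently $$\sup_{t\in[0,T]}\|Q^N(t)-Q(t)\|_{H^2}\to0\quad\text{almost surely}.$$
   Context: PDE. $\Omega\subset\mathbb{R}^n$ is a compact domain with smooth boundary; $\mu$ is the uniform probability measure on $\Omega$, and $L^2$ norms and inner products are taken with respect to $\mu$. $H^2_{(0)}=H^2(\Omega)\cap H^1_0(\Omega)$. $\mathcal{L}u=-\sum_{i,j=1}^n\frac{\partial}{\partial x_i}\big[a_{ij}(x)\frac{\partial u}{\partial x_j}\big]+\sum_{i=1}^n c_i(x)\frac{\partial u}{\partial x_i}-d(x)u$ is a uniformly elliptic linear operator with smooth coefficients whose (Dirichlet) eigenvalues satisfy $\inf_n\lambda_n>0$, and it satisfies the coercivity condition: there is $K>0$ with $K\|h\|_{L^2}^2\le\langle\mathcal{L}h,h\rangle$ for $h\in H^2_{(0)}$. The function $f(v,w):\mathbb{R}\times\mathbb{R}^n\to\mathbb{R}$ and its first two derivatives are uniformly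 bounded and measurable; $g$ is bounded on $\Omega$. Write $\mathcal{A}_uu=\mathcal{L}u+f(u,u_x)$ ($u_x$ the spatial gradient) and $D_Qh=\mathcal{L}h+f_v(Q,Q_x)h+\sum_{i=1}^nf_{w_i}(Q,Q_x)\frac{\partial h}{\partial x_i}$. Network. $Q^N(x;\theta)=\eta(x)N^{-\beta}\sum_{i=1}^Nc^i\sigma(w^i\cdot x+b^i)$, with $\frac12<\beta<1$ and $\theta=(\theta_i)_{i=1}^N$, $\theta_i=(c^i,w^i,b^i)$. At time $0$ the $\theta_i$ are i.i.d. with law $\mu_0$ on $\mathbb{R}\times\mathbb{R}^n\times\mathbb{R}$, under which $c,w,b$ are independent, $(w,b)$ has full support on $\mathbb{R}^{n+1}$, $w$ has bounded (finite) moments, and $c$ is mean-zero and bounded. $\sigma$ is bounded, has at least three bounded derivatives, and is a discriminatory function (such as a sigmoid or tanh). $\eta\in C^3_b$ has bounded derivatives, $\eta>0$ in the interior of $\Omega$, $\eta=0$ on $\partial\Omega$, and $\nabla\eta\cdot\mathbf{n}_x\neq0$ on $\partial\Omega$ ($\mathbf{n}_x$ the outward unit normal). Training. $\{\phi^N\}$ are smooth clipping functions with parameter $\gamma>0$, $\gamma+\beta<1$: $\phi^N\in C^2_b(\mathbb{R})$ is increasing, $|\phi^N|\le2N^\gamma$, $\phi^N(z)=z$ for $|z|\le N^\gamma$, and $|(\phi^N)'|\le1$. The parameters evolve by $\frac{d\theta}{dt}=-\alpha N^{2\beta-1}G^N(\theta(t))$, $\alpha>0$ a constant, where $$G^N_i(\theta)=N^{-\beta}\phi^N\Big(\int_\Omega\big(\mathcal{A}_{Q^N}Q^N(x;\theta)-g(x)\big)D_{Q^N}\nabla_{\theta_i}[\eta(x)c^i\sigma(w^i\cdot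 x+b^i)]\,\mu(dx)\Big),$$ with $\phi^N$ applied element-wise. Limit equation. With $\nabla_\theta$ the gradient in $(c,w,b)$ and $\langle h,\mu_0\rangle=\int h\,d\mu_0$, $U_Q(x,y)=\langle\nabla_\theta[\eta(x)c\,\sigma(w\cdot x+b)]\cdot D_Q[\nabla_\theta(\eta(y)c\,\sigma(w\cdot y+b))],\mu_0\rangle$, where $D_Q$ acts componentwise in $y$. $Q$ is the solution belonging to $C([0,T];H^2_{(0)})$ for every $T>0$, the equation being understood in time-integrated form. *)

theory Defs
  imports "HOL-Probability.Probability"
begin

section \<open>Classical partial derivatives\<close>

text \<open>
  Derivatives are taken within a set \<open>S\<close>.  At interior points of \<open>S\<close> this is the ordinary
  derivative; on the boundary of a compact smooth domain it is the one-sided derivative, which is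
  unique there because the inward directions span the space.  Thus \<open>C\<^sup>k\<close> on a compact domain
  means \<open>C\<^sup>k\<close> up to the boundary.
\<close>

definition pd :: "'a::euclidean_space set \<Rightarrow> 'a \<Rightarrow> ('a \<Rightarrow> real) \<Rightarrow> 'a \<Rightarrow> real" where
  "pd S e f x = frechet_derivative f (at x within S) e"

text \<open>Iterated partials are indexed by lists of basis vectors: a multi-index of order \<open>k\<close> is
  represented by the lists of length \<open>k\<close> enumerating it.\<close>

fun pds :: "'a::euclidean_space set \<Rightarrow> 'a list \<Rightarrow> ('a \<Rightarrow> real) \<Rightarrow> 'a \<Rightarrow> real" where
  "pds S [] f = f"
| "pds S (e # es) f = pd S e (pds S es f)"

definition Ck_on :: "nat \<Rightarrow> 'a::euclidean_space set \<Rightarrow> ('a \<Rightarrow> real) \<Rightarrow> bool" where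
  "Ck_on k S f \<longleftrightarrow>
     (\<forall>es\<in>lists Basis. (length es < k \<longrightarrow> pds S es f differentiable_on S)
                     \<and> (length es \<le> k \<longrightarrow> continuous_on S (pds S es f)))"

definition Ckb_on :: "nat \<Rightarrow> 'a::euclidean_space set \<Rightarrow> ('a \<Rightarrow> real) \<Rightarrow> bool" where
  "Ckb_on k S f \<longleftrightarrow>
     Ck_on k S f \<and> (\<forall>es\<in>lists Basis. length es \<le> k \<longrightarrow> bounded (pds S es f ` S))"

definition smooth_on :: "'a::euclidean_space set \<Rightarrow> ('a \<Rightarrow> real) \<Rightarrow> bool" where
  "smooth_on S f \<longleftrightarrow> (\<forall>k. Ck_on k S f)"

definition cpd :: "(real^'n) set \<Rightarrow> 'n \<Rightarrow> (real^'n \<Rightarrow> real) \<Rightarrow> real^'n \<Rightarrow> real" where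
  "cpd S i = pd S (axis i 1)"

text \<open>The operators below are parametrised by a differentiation operator \<open>D\<close>, which is either the
  classical derivative \<open>cpd \<Omega>\<close> or the weak derivative \<open>wpd \<Omega>\<close> of the next section.\<close>

definition grad ::
  "('n \<Rightarrow> (real^'n \<Rightarrow> real) \<Rightarrow> real^'n \<Rightarrow> real) \<Rightarrow> (real^'n \<Rightarrow> real) \<Rightarrow> real^'n \<Rightarrow> real^'n" where
  "grad D u x = (\<chi> i. D i u x)"


section \<open>The domain\<close>

definition boundary_chart ::
  "(real^'n) set \<Rightarrow> real^'n \<Rightarrow> (real^'n) set \<Rightarrow> (real^'n \<Rightarrow> real) \<Rightarrow> bool" where
  "boundary_chart \<Omega> x V \<psi> \<longleftrightarrow>
     open V \<and> x \<in> V \<and> smooth_on V \<psi> \<and> grad (cpd V) \<psi> x \<noteq> 0 \<and> \<Omega> \<inter> V = {y\<in>V. \<psi> y \<le> 0}"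

definition compact_smooth_domain :: "(real^'n) set \<Rightarrow> bool" where
  "compact_smooth_domain \<Omega> \<longleftrightarrow>
     compact \<Omega> \<and> interior \<Omega> \<noteq> {} \<and> connected (interior \<Omega>) \<and>
     (\<forall>x\<in>frontier \<Omega>. \<exists>V \<psi>. boundary_chart \<Omega> x V \<psi>)"

definition outward_unit_normal :: "(real^'n) set \<Rightarrow> real^'n \<Rightarrow> real^'n \<Rightarrow> bool" where
  "outward_unit_normal \<Omega> x \<nu> \<longleftrightarrow>
     x \<in> frontier \<Omega> \<and>
     (\<exists>V \<psi>. boundary_chart \<Omega> x V \<psi> \<and>
            \<nu> = (1 / norm (grad (cpd V) \<psi> x)) *\<^sub>R grad (cpd V) \<psi> x)"

text \<open>The underlying space is restricted to \<open>\<Omega>\<close>, so that measurability and integrals do not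
  depend on the values of functions outside \<open>\<Omega>\<close>.\<close>

definition unif :: "(real^'n) set \<Rightarrow> (real^'n) measure" where
  "unif \<Omega> = restrict_space (uniform_measure lborel \<Omega>) \<Omega>"


section \<open>Sobolev spaces\<close>

definition L2 :: "(real^'n) set \<Rightarrow> (real^'n \<Rightarrow> real) set" where
  "L2 \<Omega> = {u. u \<in> borel_measurable (unif \<Omega>) \<and> integrable (unif \<Omega>) (\<lambda>x. (u x)\<^sup>2)}"

definition L2_inner :: "(real^'n) set \<Rightarrow> (real^'n \<Rightarrow> real) \<Rightarrow> (real^'n \<Rightarrow> real) \<Rightarrow> real" where
  "L2_inner \<Omega> u v = (LINT x|unif \<Omega>. u x * v x)"

definition L2_norm :: "(real^'n) set \<Rightarrow> (real^'n \<Rightarrow> real) \<Rightarrow> real" where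
  "L2_norm \<Omega> u = sqrt (L2_inner \<Omega> u u)"

definition test_function :: "(real^'n) set \<Rightarrow> (real^'n \<Rightarrow> real) \<Rightarrow> bool" where
  "test_function \<Omega> \<psi> \<longleftrightarrow>
     smooth_on UNIV \<psi> \<and> compact (closure {x. \<psi> x \<noteq> 0}) \<and> closure {x. \<psi> x \<noteq> 0} \<subseteq> interior \<Omega>"

definition locally_integrable :: "(real^'n) set \<Rightarrow> (real^'n \<Rightarrow> real) \<Rightarrow> bool" where
  "locally_integrable \<Omega> u \<longleftrightarrow>
     u \<in> borel_measurable (unif \<Omega>) \<and>
     (\<forall>K. compact K \<and> K \<subseteq> interior \<Omega> \<longrightarrow> set_integrable (unif \<Omega>) K u)"

definition weak_partial ::
  "(real^'n) set \<Rightarrow> 'n \<Rightarrow> (real^'n \<Rightarrow> real) \<Rightarrow> (real^'n \<Rightarrow> real) \<Rightarrow> bool" where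
  "weak_partial \<Omega> i u v \<longleftrightarrow>
     locally_integrable \<Omega> u \<and> locally_integrable \<Omega> v \<and>
     (\<forall>\<psi>. test_function \<Omega> \<psi> \<longrightarrow>
        (LINT x|unif \<Omega>. u x * cpd UNIV i \<psi> x) = - (LINT x|unif \<Omega>. v x * \<psi> x))"

text \<open>A version of the weak derivative; it is determined up to null sets, and is only used under
  integrals over \<open>\<Omega>\<close> or in almost-everywhere statements.\<close>

definition wpd :: "(real^'n) set \<Rightarrow> 'n \<Rightarrow> (real^'n \<Rightarrow> real) \<Rightarrow> real^'n \<Rightarrow> real" where
  "wpd \<Omega> i u = (SOME v. weak_partial \<Omega> i u v)"

definition H1 :: "(real^'n) set \<Rightarrow> (real^'n \<Rightarrow> real) set" where
  "H1 \<Omega> = {u\<in>L2 \<Omega>. \<forall>i. \<exists>v\<in>L2 \<Omega>. weak_partial \<Omega> i u v}"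

definition H1_norm :: "(real^'n) set \<Rightarrow> (real^'n \<Rightarrow> real) \<Rightarrow> real" where
  "H1_norm \<Omega> u = sqrt ((L2_norm \<Omega> u)\<^sup>2 + (\<Sum>i\<in>UNIV. (L2_norm \<Omega> (wpd \<Omega> i u))\<^sup>2))"

definition H10 :: "(real^'n) set \<Rightarrow> (real^'n \<Rightarrow> real) set" where
  "H10 \<Omega> = {u\<in>H1 \<Omega>. \<exists>\<psi>. (\<forall>k::nat. test_function \<Omega> (\<psi> k)) \<and>
                           (\<lambda>k. H1_norm \<Omega> (\<lambda>x. u x - \<psi> k x)) \<longlonglongrightarrow> 0}"

definition H2 :: "(real^'n) set \<Rightarrow> (real^'n \<Rightarrow> real) set" where
  "H2 \<Omega> = {u\<in>H1 \<Omega>. \<forall>i. wpd \<Omega> i u \<in> H1 \<Omega>}"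

text \<open>Extended-valued, with value \<open>\<infinity>\<close> off \<open>H\<^sup>2\<close>, so that a bound on the norm includes membership.\<close>

definition H2_norm :: "(real^'n) set \<Rightarrow> (real^'n \<Rightarrow> real) \<Rightarrow> ennreal" where
  "H2_norm \<Omega> u =
     (if u \<in> H2 \<Omega>
      then ennreal (sqrt ((L2_norm \<Omega> u)\<^sup>2 + (\<Sum>i\<in>UNIV. (L2_norm \<Omega> (wpd \<Omega> i u))\<^sup>2)
             + (\<Sum>i\<in>UNIV. \<Sum>j\<in>UNIV. (L2_norm \<Omega> (wpd \<Omega> i (wpd \<Omega> j u)))\<^sup>2)))
      else \<infinity>)"

definition H2_0 :: "(real^'n) set \<Rightarrow> (real^'n \<Rightarrow> real) set" where
  "H2_0 \<Omega> = H2 \<Omega> \<inter> H10 \<Omega>"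


section \<open>The differential operators\<close>

definition L_op ::
  "('n \<Rightarrow> (real^'n \<Rightarrow> real) \<Rightarrow> real^'n \<Rightarrow> real) \<Rightarrow> ('n \<Rightarrow> 'n \<Rightarrow> real^'n \<Rightarrow> real) \<Rightarrow>
   ('n \<Rightarrow> real^'n \<Rightarrow> real) \<Rightarrow> (real^'n \<Rightarrow> real) \<Rightarrow> (real^'n \<Rightarrow> real) \<Rightarrow> real^'n \<Rightarrow> real" where
  "L_op D a c d u x =
     - (\<Sum>i\<in>UNIV. \<Sum>j\<in>UNIV. D i (\<lambda>y. a i j y * D j u y) x) + (\<Sum>i\<in>UNIV. c i x * D i u x) - d x * u x"

definition A_op ::
  "('n \<Rightarrow> (real^'n \<Rightarrow> real) \<Rightarrow> real^'n \<Rightarrow> real) \<Rightarrow> ('n \<Rightarrow> 'n \<Rightarrow> real^'n \<Rightarrow> real) \<Rightarrow>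
   ('n \<Rightarrow> real^'n \<Rightarrow> real) \<Rightarrow> (real^'n \<Rightarrow> real) \<Rightarrow> (real \<Rightarrow> real^'n \<Rightarrow> real) \<Rightarrow>
   (real^'n \<Rightarrow> real) \<Rightarrow> real^'n \<Rightarrow> real" where
  "A_op D a c d f u x = L_op D a c d u x + f (u x) (grad D u x)"

definition f_v :: "(real \<Rightarrow> real^'n \<Rightarrow> real) \<Rightarrow> real \<Rightarrow> real^'n \<Rightarrow> real" where
  "f_v f v w = pd UNIV (1, 0) (case_prod f) (v, w)"

definition f_w :: "(real \<Rightarrow> real^'n \<Rightarrow> real) \<Rightarrow> 'n \<Rightarrow> real \<Rightarrow> real^'n \<Rightarrow> real" where
  "f_w f i v w = pd UNIV (0, axis i 1) (case_prod f) (v, w)"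

text \<open>The linearised operator \<open>D\<^sub>Q\<close>.  The argument \<open>h\<close> is always classically differentiable; \<open>q\<close> is
  differentiated with \<open>D\<close>, which is weak for the limit and classical for the network.\<close>

definition D_op ::
  "('n \<Rightarrow> (real^'n \<Rightarrow> real) \<Rightarrow> real^'n \<Rightarrow> real) \<Rightarrow> (real^'n) set \<Rightarrow>
   ('n \<Rightarrow> 'n \<Rightarrow> real^'n \<Rightarrow> real) \<Rightarrow> ('n \<Rightarrow> real^'n \<Rightarrow> real) \<Rightarrow> (real^'n \<Rightarrow> real) \<Rightarrow>
   (real \<Rightarrow> real^'n \<Rightarrow> real) \<Rightarrow> (real^'n \<Rightarrow> real) \<Rightarrow> (real^'n \<Rightarrow> real) \<Rightarrow> real^'n \<Rightarrow> real" where
  "D_op D \<Omega> a c d f q h x =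
     L_op (cpd \<Omega>) a c d h x + f_v f (q x) (grad D q x) * h x
     + (\<Sum>i\<in>UNIV. f_w f i (q x) (grad D q x) * cpd \<Omega> i h x)"

definition uniformly_elliptic ::
  "(real^'n) set \<Rightarrow> ('n \<Rightarrow> 'n \<Rightarrow> real^'n \<Rightarrow> real) \<Rightarrow> bool" where
  "uniformly_elliptic \<Omega> a \<longleftrightarrow>
     (\<exists>\<kappa>>0. \<forall>x\<in>\<Omega>. \<forall>\<xi>. \<kappa> * (norm \<xi>)\<^sup>2 \<le> (\<Sum>i\<in>UNIV. \<Sum>j\<in>UNIV. a i j x * \<xi> $ i * \<xi> $ j))"

definition dirichlet_eigenvalue ::
  "(real^'n) set \<Rightarrow> ('n \<Rightarrow> 'n \<Rightarrow> real^'n \<Rightarrow> real) \<Rightarrow> ('n \<Rightarrow> real^'n \<Rightarrow> real) \<Rightarrow>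
   (real^'n \<Rightarrow> real) \<Rightarrow> real \<Rightarrow> bool" where
  "dirichlet_eigenvalue \<Omega> a c d r \<longleftrightarrow>
     (\<exists>u\<in>H2_0 \<Omega>. \<not> (AE x in unif \<Omega>. u x = 0) \<and>
                 (AE x in unif \<Omega>. L_op (wpd \<Omega>) a c d u x = r * u x))"

definition coercive ::
  "(real^'n) set \<Rightarrow> ('n \<Rightarrow> 'n \<Rightarrow> real^'n \<Rightarrow> real) \<Rightarrow> ('n \<Rightarrow> real^'n \<Rightarrow> real) \<Rightarrow>
   (real^'n \<Rightarrow> real) \<Rightarrow> bool" where
  "coercive \<Omega> a c d \<longleftrightarrow>
     (\<exists>K>0. \<forall>h\<in>H2_0 \<Omega>. K * (L2_norm \<Omega> h)\<^sup>2 \<le> L2_inner \<Omega> (L_op (wpd \<Omega>) a c d h) h)"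

definition bounded_nonlinearity :: "(real \<Rightarrow> real^'n \<Rightarrow> real) \<Rightarrow> bool" where
  "bounded_nonlinearity f \<longleftrightarrow>
     (\<forall>es\<in>lists Basis.
        (length es < 2 \<longrightarrow> pds UNIV es (case_prod f) differentiable_on UNIV) \<and>
        (length es \<le> 2 \<longrightarrow> bounded (range (pds UNIV es (case_prod f))) \<and>
                          pds UNIV es (case_prod f) \<in> borel_measurable borel))"


section \<open>The neural network\<close>

text \<open>A parameter \<open>\<theta>\<^sub>i = (c\<^sup>i, w\<^sup>i, b\<^sup>i)\<close>; gradients in \<open>\<theta>\<close> are handled componentwise over
  the standard basis of this Euclidean space.\<close>

type_synonym 'n param = "real \<times> (real^'n) \<times> real"

definition neuron :: "(real \<Rightarrow> real) \<Rightarrow> 'n::finite param \<Rightarrow> real^'n \<Rightarrow> real" where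
  "neuron \<sigma> \<theta> x = (case \<theta> of (c, w, b) \<Rightarrow> c * \<sigma> (w \<bullet> x + b))"

definition net ::
  "real \<Rightarrow> (real^'n \<Rightarrow> real) \<Rightarrow> (real \<Rightarrow> real) \<Rightarrow> nat \<Rightarrow> (nat \<Rightarrow> 'n::finite param) \<Rightarrow> real^'n \<Rightarrow> real" where
  "net \<beta> \<eta> \<sigma> N \<theta> x = \<eta> x * real N powr (-\<beta>) * (\<Sum>i<N. neuron \<sigma> (\<theta> i) x)"

definition feature_grad ::
  "(real^'n \<Rightarrow> real) \<Rightarrow> (real \<Rightarrow> real) \<Rightarrow> 'n::finite param \<Rightarrow> 'n param \<Rightarrow> real^'n \<Rightarrow> real" where
  "feature_grad \<eta> \<sigma> \<theta> e x = pd UNIV e (\<lambda>p. \<eta> x * neuron \<sigma> p x) \<theta>"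

definition G_step ::
  "(real^'n) set \<Rightarrow> ('n::finite \<Rightarrow> 'n \<Rightarrow> real^'n \<Rightarrow> real) \<Rightarrow> ('n \<Rightarrow> real^'n \<Rightarrow> real) \<Rightarrow>
   (real^'n \<Rightarrow> real) \<Rightarrow> (real \<Rightarrow> real^'n \<Rightarrow> real) \<Rightarrow> (real^'n \<Rightarrow> real) \<Rightarrow>
   real \<Rightarrow> (real^'n \<Rightarrow> real) \<Rightarrow> (real \<Rightarrow> real) \<Rightarrow> (nat \<Rightarrow> real \<Rightarrow> real) \<Rightarrow>
   nat \<Rightarrow> (nat \<Rightarrow> 'n param) \<Rightarrow> nat \<Rightarrow> 'n param" where
  "G_step \<Omega> a c d f g \<beta> \<eta> \<sigma> \<phi> N \<theta> i =
     (let q = net \<beta> \<eta> \<sigma> N \<theta> in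
      real N powr (-\<beta>) *\<^sub>R
        (\<Sum>e\<in>Basis.
           \<phi> N (LINT x|unif \<Omega>. (A_op (cpd \<Omega>) a c d f q x - g x)
                  * D_op (cpd \<Omega>) \<Omega> a c d f q (feature_grad \<eta> \<sigma> (\<theta> i) e) x) *\<^sub>R e))"

text \<open>Cybenko's notion: a finite signed Borel measure \<open>\<nu>\<^sub>1 - \<nu>\<^sub>2\<close> on \<open>K\<close> annihilating all
  ridge functions \<open>x \<mapsto> \<sigma> (w \<bullet> x + b)\<close> vanishes; there, \<open>K\<close> is the unit cube.\<close>

definition discriminatory_on :: "(real^'n) set \<Rightarrow> (real \<Rightarrow> real) \<Rightarrow> bool" where
  "discriminatory_on K \<sigma> \<longleftrightarrow>
     (\<forall>\<nu>\<^sub>1 \<nu>\<^sub>2 :: (real^'n) measure.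
        finite_measure \<nu>\<^sub>1 \<and> finite_measure \<nu>\<^sub>2 \<and> sets \<nu>\<^sub>1 = sets borel \<and> sets \<nu>\<^sub>2 = sets borel \<and>
        emeasure \<nu>\<^sub>1 (- K) = 0 \<and> emeasure \<nu>\<^sub>2 (- K) = 0 \<and>
        (\<forall>w b. (LINT x|\<nu>\<^sub>1. \<sigma> (w \<bullet> x + b)) = (LINT x|\<nu>\<^sub>2. \<sigma> (w \<bullet> x + b)))
        \<longrightarrow> \<nu>\<^sub>1 = \<nu>\<^sub>2)"

definition activation :: "'n::finite itself \<Rightarrow> (real \<Rightarrow> real) \<Rightarrow> bool" where
  "activation _ \<sigma> \<longleftrightarrow> Ckb_on 3 UNIV \<sigma> \<and> discriminatory_on (cbox 0 (1 :: real^'n)) \<sigma>"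

definition auxiliary_function :: "(real^'n) set \<Rightarrow> (real^'n \<Rightarrow> real) \<Rightarrow> bool" where
  "auxiliary_function \<Omega> \<eta> \<longleftrightarrow>
     Ckb_on 3 \<Omega> \<eta> \<and> (\<forall>x\<in>interior \<Omega>. 0 < \<eta> x) \<and> (\<forall>x\<in>frontier \<Omega>. \<eta> x = 0) \<and>
     (\<forall>x \<nu>. outward_unit_normal \<Omega> x \<nu> \<longrightarrow> grad (cpd \<Omega>) \<eta> x \<bullet> \<nu> \<noteq> 0)"

definition initial_law :: "'n::finite param measure \<Rightarrow> bool" where
  "initial_law \<mu>\<^sub>0 \<longleftrightarrow>
     prob_space \<mu>\<^sub>0 \<and> sets \<mu>\<^sub>0 = sets borel \<and>
     (\<forall>A\<in>sets borel. \<forall>B\<in>sets borel. \<forall>C\<in>sets borel.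
        measure \<mu>\<^sub>0 (A \<times> B \<times> C) =
          measure \<mu>\<^sub>0 (A \<times> UNIV) * measure \<mu>\<^sub>0 (UNIV \<times> B \<times> UNIV) * measure \<mu>\<^sub>0 (UNIV \<times> UNIV \<times> C)) \<and>
     (\<forall>V. open V \<and> V \<noteq> {} \<longrightarrow> 0 < emeasure (distr \<mu>\<^sub>0 borel snd) V) \<and>
     (\<forall>k::nat. integrable \<mu>\<^sub>0 (\<lambda>\<theta>. norm (fst (snd \<theta>)) ^ k)) \<and>
     (\<exists>C. AE \<theta> in \<mu>\<^sub>0. \<bar>fst \<theta>\<bar> \<le> C) \<and>
     (LINT \<theta>|\<mu>\<^sub>0. fst \<theta>) = 0"

definition smooth_clipping :: "real \<Rightarrow> (nat \<Rightarrow> real \<Rightarrow> real) \<Rightarrow> bool" where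
  "smooth_clipping \<gamma> \<phi> \<longleftrightarrow>
     (\<forall>N\<ge>1. Ckb_on 2 UNIV (\<phi> N) \<and> mono (\<phi> N) \<and>
        (\<forall>z. \<bar>\<phi> N z\<bar> \<le> 2 * real N powr \<gamma>) \<and>
        (\<forall>z. \<bar>z\<bar> \<le> real N powr \<gamma> \<longrightarrow> \<phi> N z = z) \<and>
        (\<forall>z. \<bar>deriv (\<phi> N) z\<bar> \<le> 1))"

text \<open>\<open>\<theta> t i\<close> is the \<open>i\<close>-th parameter at time \<open>t\<close> (\<open>i < N\<close>), started from \<open>\<theta>\<^sub>0\<close>.\<close>

definition trained ::
  "(real^'n) set \<Rightarrow> ('n::finite \<Rightarrow> 'n \<Rightarrow> real^'n \<Rightarrow> real) \<Rightarrow> ('n \<Rightarrow> real^'n \<Rightarrow> real) \<Rightarrow>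
   (real^'n \<Rightarrow> real) \<Rightarrow> (real \<Rightarrow> real^'n \<Rightarrow> real) \<Rightarrow> (real^'n \<Rightarrow> real) \<Rightarrow>
   real \<Rightarrow> real \<Rightarrow> (real^'n \<Rightarrow> real) \<Rightarrow> (real \<Rightarrow> real) \<Rightarrow> (nat \<Rightarrow> real \<Rightarrow> real) \<Rightarrow>
   nat \<Rightarrow> (nat \<Rightarrow> 'n param) \<Rightarrow> (real \<Rightarrow> nat \<Rightarrow> 'n param) \<Rightarrow> bool" where
  "trained \<Omega> a c d f g \<alpha> \<beta> \<eta> \<sigma> \<phi> N \<theta>\<^sub>0 \<theta> \<longleftrightarrow>
     (\<forall>i<N. \<theta> 0 i = \<theta>\<^sub>0 i \<and>
        (\<forall>t\<ge>0. ((\<lambda>s. \<theta> s i) has_vector_derivative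
                 (- \<alpha> * real N powr (2 * \<beta> - 1)) *\<^sub>R G_step \<Omega> a c d f g \<beta> \<eta> \<sigma> \<phi> N (\<theta> t) i)
                (at t within {0..})))"


section \<open>The limit equation\<close>

definition U_ker ::
  "(real^'n) set \<Rightarrow> ('n::finite \<Rightarrow> 'n \<Rightarrow> real^'n \<Rightarrow> real) \<Rightarrow> ('n \<Rightarrow> real^'n \<Rightarrow> real) \<Rightarrow>
   (real^'n \<Rightarrow> real) \<Rightarrow> (real \<Rightarrow> real^'n \<Rightarrow> real) \<Rightarrow> (real^'n \<Rightarrow> real) \<Rightarrow> (real \<Rightarrow> real) \<Rightarrow>
   'n param measure \<Rightarrow> (real^'n \<Rightarrow> real) \<Rightarrow> real^'n \<Rightarrow> real^'n \<Rightarrow> real" where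
  "U_ker \<Omega> a c d f \<eta> \<sigma> \<mu>\<^sub>0 q x y =
     (LINT \<theta>|\<mu>\<^sub>0. (\<Sum>e\<in>Basis.
        feature_grad \<eta> \<sigma> \<theta> e x * D_op (wpd \<Omega>) \<Omega> a c d f q (feature_grad \<eta> \<sigma> \<theta> e) y))"

text \<open>The right-hand side is a continuous function of \<open>x\<close>, so the time-integrated equation is
  required at every \<open>x \<in> \<Omega>\<close>; this selects the continuous (in fact \<open>C\<^sup>2\<close>) representative of
  \<open>Q t\<close>.\<close>

definition limit_solution ::
  "(real^'n) set \<Rightarrow> ('n::finite \<Rightarrow> 'n \<Rightarrow> real^'n \<Rightarrow> real) \<Rightarrow> ('n \<Rightarrow> real^'n \<Rightarrow> real) \<Rightarrow>
   (real^'n \<Rightarrow> real) \<Rightarrow> (real \<Rightarrow> real^'n \<Rightarrow> real) \<Rightarrow> (real^'n \<Rightarrow> real) \<Rightarrow>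
   real \<Rightarrow> (real^'n \<Rightarrow> real) \<Rightarrow> (real \<Rightarrow> real) \<Rightarrow> 'n param measure \<Rightarrow>
   (real \<Rightarrow> real^'n \<Rightarrow> real) \<Rightarrow> bool" where
  "limit_solution \<Omega> a c d f g \<alpha> \<eta> \<sigma> \<mu>\<^sub>0 Q \<longleftrightarrow>
     (\<forall>t\<ge>0. Q t \<in> H2_0 \<Omega>) \<and>
     (\<forall>t\<ge>0. ((\<lambda>s. H2_norm \<Omega> (\<lambda>x. Q s x - Q t x)) \<longlongrightarrow> 0) (at t within {0..})) \<and>
     (\<forall>x\<in>\<Omega>. Q 0 x = 0) \<and>
     (\<forall>t\<ge>0. \<forall>x\<in>\<Omega>.
        ((\<lambda>s. - \<alpha> * (LINT y|unif \<Omega>. U_ker \<Omega> a c d f \<eta> \<sigma> \<mu>\<^sub>0 (Q s) x y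
                       * (A_op (wpd \<Omega>) a c d f (Q s) y - g y)))
          has_integral Q t x) {0..t})"

end

(*
  Both the network and the limit are eta times a function R whose second-order jet (value, gradient,
  Hessian) evolves by an integral equation in time.  The velocity of the jet of R is an average, over
  the current parameters for the network and over mu_0 for the limit, of a vector field V p x theta
  that depends on the solution only through its jet p, and does so Lipschitz continuously with respect
  to the L^2 norm of p.  Because of the clipping, parameters move by O(N^(beta + gamma - 1)), so they
  stay close to the i.i.d. initial ones, and a uniform law of large numbers over the equicontinuous
  family of the fields V p x along the limit trajectory replaces one average by the other.  The clipping
  itself changes the velocity by O(N^(-gamma)), since |phi z - z| <= 2 z^2 N^(-gamma).  The jet of the
  initial network tends to 0 uniformly because beta > 1/2 and the output weights are centred.  A Gronwall
  estimate for the supremum over x closes the argument; the weak derivatives of Q agree with its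
  classical jet, so the H^2 norm is controlled by the supremum.
*)
theory Submission
  imports Defs "HOL-Computational_Algebra.Polynomial" "HOL-Real_Asymp.Real_Asymp"
begin

section \<open>Derivatives within thick sets\<close>

text \<open>Q is given only as a curve in H^2, with weak derivatives known almost everywhere,
  whereas the network is smooth and convergence is asked at every point up to the boundary. Writing
  all operators as functions of a second-order jet lets one set of estimates serve both; the factor
  \<eta> is kept apart because it vanishes on the boundary and cannot be divided out. The obstacle
  in the comparison is that the network has no a priori L^2 bound: its residual may be large and the
  clipping may be active. All Lipschitz and clipping estimates are therefore arranged so that their
  constants involve the norm of the limit alone, which is bounded on compact time intervals; the
  difference then enters linearly, and the stability argument closes without stopping times. The
  input weights are unbounded, so no estimate is uniform in the parameter. Every bound carries a
  power of one weight, \<open>growth\<close>, all of whose moments are finite; the empirical mean of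
  its fourth power is almost surely bounded, by truncation at slowly growing levels and
  Borel-Cantelli.\<close>

text \<open>At each point an open set of directions stays in the set for a short time, which makes
  derivatives within the set unique.\<close>

definition thick :: "'a::euclidean_space set \<Rightarrow> bool" where
  "thick S \<longleftrightarrow> (\<forall>x\<in>S. \<exists>v r. 0 < r \<and> (\<forall>u\<in>ball v r. \<exists>\<delta>>0. \<forall>t\<in>{0<..<\<delta>}. x + t *\<^sub>R u \<in> S))"

lemma thick_open:
  assumes "open S" shows "thick S"
  unfolding thick_def
proof
  fix x assume "x \<in> S"
  then obtain e where e: "e > 0" "ball x e \<subseteq> S" using assms open_contains_ball by blast
  have "\<exists>\<delta>>0. \<forall>t\<in>{0<..<\<delta>}. x + t *\<^sub>R u \<in> S" if "u \<in> ball 0 1" for u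
  proof (intro exI[of _ e] conjI ballI)
    fix t assume t: "t \<in> {0<..<e}"
    have "norm (t *\<^sub>R u) < e" using t that
      by (auto intro: le_less_trans[OF mult_left_mono[of "norm u" 1 t]])
    then have "x + t *\<^sub>R u \<in> ball x e" by (simp add: dist_norm)
    then show "x + t *\<^sub>R u \<in> S" using e by blast
  qed (use e in auto)
  then show "\<exists>v r. 0 < r \<and> (\<forall>u\<in>ball v r. \<exists>\<delta>>0. \<forall>t\<in>{0<..<\<delta>}. x + t *\<^sub>R u \<in> S)"
    by (intro exI[of _ 0] exI[of _ 1]) auto
qed

text \<open>Along a ray that stays in \<open>S\<close> for a short time, the derivative within
  \<open>S\<close> becomes a one-sided limit of difference quotients, whatever the shape of
  \<open>S\<close> elsewhere.\<close>

lemma has_derivative_direction_limit: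
  fixes f :: "'a::euclidean_space \<Rightarrow> real"
  assumes f: "(f has_derivative f') (at x within S)"
    and d: "\<delta> > 0" "\<forall>t\<in>{0<..<\<delta>}. x + t *\<^sub>R u \<in> S"
  shows "((\<lambda>t. (f (x + t *\<^sub>R u) - f x) / t) \<longlongrightarrow> f' u) (at_right 0)"
proof -
  have S: "(\<lambda>t. x + t *\<^sub>R u) ` {0<..<\<delta>} \<subseteq> S" using d by auto
  have "((\<lambda>t. f (x + t *\<^sub>R u)) has_derivative (\<lambda>t. f' (t *\<^sub>R u))) (at 0 within {0<..<\<delta>})"
    by (rule has_derivative_in_compose[where f = "\<lambda>t. x + t *\<^sub>R u" and g = f, simplified])
       (auto intro!: derivative_eq_intros has_derivative_subset[OF f S])
  then have "((\<lambda>t. f (x + t *\<^sub>R u)) has_real_derivative f' u) (at 0 within {0<..<\<delta>})"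
    by (simp add: has_field_derivative_def linear_cmul[OF has_derivative_linear[OF f]] mult.commute[of _ "f' u"])
  then have "((\<lambda>t. (f (x + t *\<^sub>R u) - f x) / t) \<longlongrightarrow> f' u) (at 0 within {0<..<\<delta>})"
    by (simp add: has_field_derivative_iff)
  moreover have "at_right 0 = at 0 within {0<..<\<delta>}"
    by (rule at_within_nhd[of _ "{-\<delta><..<\<delta>}"]) (use d in auto)
  ultimately show ?thesis by simp
qed

text \<open>Both derivatives are limits of the same difference quotients for an open ball of
  directions, and a linear map is determined by its values on such a ball.\<close>

lemma thick_unique:
  fixes f :: "'a::euclidean_space \<Rightarrow> real"
  assumes S: "thick S" "x \<in> S"
    and f: "(f has_derivative f') (at x within S)" "(f has_derivative f'') (at x within S)"
  shows "f' = f''"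
proof -
  obtain v r where r: "0 < r" "\<And>u. u \<in> ball v r \<Longrightarrow> \<exists>\<delta>>0. \<forall>t\<in>{0<..<\<delta>}. x + t *\<^sub>R u \<in> S"
    using S unfolding thick_def by meson
  have eq: "f' u = f'' u" if u: "u \<in> ball v r" for u
  proof -
    obtain \<delta> where d: "\<delta> > 0" "\<forall>t\<in>{0<..<\<delta>}. x + t *\<^sub>R u \<in> S" using r(2)[OF u] by blast
    from has_derivative_direction_limit[OF f(1) d] has_derivative_direction_limit[OF f(2) d]
    show ?thesis by (rule tendsto_unique[rotated]) simp
  qed
  interpret l1: linear f' using f(1) by (rule has_derivative_linear)
  interpret l2: linear f'' using f(2) by (rule has_derivative_linear)
  show ?thesis
  proof
    fix h :: 'a
    \<comment> \<open>This scale keeps \<open>v + s *\<^sub>R h\<close> within distance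
      \<open>r / 2\<close> of \<open>v\<close>, whatever the size of \<open>h\<close>.\<close>
    define s where "s = r / (2 * (norm h + 1))"
    have s: "s > 0" using r by (simp add: s_def add_nonneg_pos)
    have "s * norm h \<le> r / 2 * (norm h / (norm h + 1))" by (simp add: s_def)
    also have "\<dots> \<le> r/2 * 1" using r by (intro mult_left_mono) (auto simp: divide_le_eq_1 add_nonneg_pos)
    finally have "v + s *\<^sub>R h \<in> ball v r" using r s by (simp add: dist_norm)
    then have "f' (v + s *\<^sub>R h) = f'' (v + s *\<^sub>R h)" "f' v = f'' v" using eq r by auto
    then show "f' h = f'' h" using s by (simp add: l1.add l1.scale l2.add l2.scale)
  qed
qed

text \<open>\<open>pd\<close> rests on a choice of derivative; uniqueness makes it computable from
  any derivative at hand, also at boundary points.\<close>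

lemma pd_eq:
  assumes "thick S" "x \<in> S" "(f has_derivative f') (at x within S)"
  shows "pd S e f x = f' e"
  using thick_unique[OF assms(1,2) assms(3)] assms(3)
  unfolding pd_def by (metis frechet_derivative_works differentiableI)

lemma pd_cong:
  assumes "x \<in> S" "\<And>y. y \<in> S \<Longrightarrow> f y = g y"
  shows "pd S e f x = pd S e g x"
proof -
  have "(f has_derivative D) (at x within S) \<longleftrightarrow> (g has_derivative D) (at x within S)" for D
    using has_derivative_transform[OF assms(1), of f g D] has_derivative_transform[OF assms(1), of g f D] assms(2) by metis
  then show ?thesis unfolding pd_def frechet_derivative_def by simp
qed

lemma differentiable_pd:
  fixes f :: "'a::euclidean_space \<Rightarrow> real"
  assumes "f differentiable (at x within S)"
  shows "(f has_derivative (\<lambda>h. \<Sum>b\<in>Basis. (h \<bullet> b) * pd S b f x)) (at x within S)"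
proof -
  have f: "(f has_derivative frechet_derivative f (at x within S)) (at x within S)"
    using assms frechet_derivative_works by blast
  interpret l: linear "frechet_derivative f (at x within S)" using f by (rule has_derivative_linear)
  have "frechet_derivative f (at x within S) h = (\<Sum>b\<in>Basis. (h \<bullet> b) * pd S b f x)" for h
    unfolding pd_def
    by (subst euclidean_representation[of h, symmetric], subst l.sum) (simp add: l.scale)
  with f show ?thesis by (metis (no_types, lifting) ext)
qed

lemma Basis_vec_real: "(Basis :: (real^'n) set) = range (\<lambda>i. axis i 1)"
  by (auto simp: Basis_vec_def)

lemma sum_Basis_vec: "(\<Sum>b\<in>(Basis::(real^'n) set). F b) = (\<Sum>i\<in>UNIV. F (axis i 1))"
  unfolding Basis_vec_real by (subst sum.reindex) (auto intro!: injI simp: axis_eq_axis)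

lemma lists_Basis_vec: "es \<in> lists (Basis :: (real^'n) set) \<longleftrightarrow> (\<exists>js. es = map (\<lambda>i. axis i 1) js)"
proof
  assume "es \<in> lists (Basis :: (real^'n) set)"
  then show "\<exists>js. es = map (\<lambda>i. axis i 1) js"
  proof (induction es)
    case (Cons e es)
    then obtain js i where "es = map (\<lambda>i. axis i 1) js" "e = axis i 1" by (auto simp: Basis_vec_real)
    then show ?case by (intro exI[of _ "i # js"]) simp
  qed simp
qed (auto simp: Basis_vec_real)

section \<open>Second-order jets\<close>

type_synonym 'n jet = "real \<times> (real^'n) \<times> (real^'n^'n)"

definition jet ::
  "('n \<Rightarrow> (real^'n \<Rightarrow> real) \<Rightarrow> real^'n \<Rightarrow> real) \<Rightarrow> (real^'n \<Rightarrow> real) \<Rightarrow> real^'n \<Rightarrow> 'n::finite jet" where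
  "jet D u x = (u x, grad D u x, \<chi> i j. D i (D j u) x)"

text \<open>A certificate that can be added, multiplied and integrated without evaluating nested
  choices of derivatives; \<open>has_jet_cpd\<close> recovers the iterated partials on thick sets.
  In the Hessian the row index is the outer derivative, and symmetry is not imposed.\<close>

definition has_jet :: "(real^'n) set \<Rightarrow> (real^'n \<Rightarrow> real) \<Rightarrow> (real^'n \<Rightarrow> 'n::finite jet) \<Rightarrow> bool" where
  "has_jet S u J \<longleftrightarrow> continuous_on S J \<and> (\<forall>x\<in>S. fst (J x) = u x
     \<and> (u has_derivative (\<lambda>h. fst (snd (J x)) \<bullet> h)) (at x within S)
     \<and> (\<forall>j. ((\<lambda>y. fst (snd (J y)) $ j) has_derivative (\<lambda>h. \<Sum>i\<in>UNIV. snd (snd (J x)) $ i $ j * h $ i))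
             (at x within S)))"

lemma has_jet_D:
  assumes "has_jet S u J" "x \<in> S"
  shows "fst (J x) = u x" "(u has_derivative (\<lambda>h. fst (snd (J x)) \<bullet> h)) (at x within S)"
    "((\<lambda>y. fst (snd (J y)) $ j) has_derivative (\<lambda>h. \<Sum>i\<in>UNIV. snd (snd (J x)) $ i $ j * h $ i)) (at x within S)"
  using assms unfolding has_jet_def by blast+

lemma has_jet_subset: "has_jet S u J \<Longrightarrow> T \<subseteq> S \<Longrightarrow> has_jet T u J"
  unfolding has_jet_def by (meson continuous_on_subset has_derivative_subset subsetD)

lemma has_jet_cpd:
  fixes u :: "real^'n::finite \<Rightarrow> real"
  assumes "thick S" "has_jet S u J" "x \<in> S"
  shows "cpd S i u x = fst (snd (J x)) $ i" "cpd S i (cpd S j u) x = snd (snd (J x)) $ i $ j"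
proof -
  have 1: "cpd S i u x = fst (snd (J x)) $ i" if "x \<in> S" for x i
    unfolding cpd_def using pd_eq[OF assms(1) that has_jet_D(2)[OF assms(2) that]]
    by (simp add: inner_axis)
  then show "cpd S i u x = fst (snd (J x)) $ i" using assms by simp
  \<comment> \<open>The outer derivative within \<open>S\<close> sees the inner function only on
    \<open>S\<close>, where the inner partial is already known to be a component of
    \<open>J\<close>.\<close>
  have "cpd S i (cpd S j u) x = cpd S i (\<lambda>y. fst (snd (J y)) $ j) x"
    unfolding cpd_def by (rule pd_cong) (use 1 assms in \<open>auto simp: cpd_def\<close>)
  also have "\<dots> = (\<Sum>k\<in>UNIV. snd (snd (J x)) $ k $ j * (axis i 1 :: real^'n) $ k)"
    unfolding cpd_def by (rule pd_eq[OF assms(1,3) has_jet_D(3)[OF assms(2,3)]])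
  also have "\<dots> = snd (snd (J x)) $ i $ j"
    by (subst sum.remove[of _ i]) (auto simp: axis_def)
  finally show "cpd S i (cpd S j u) x = snd (snd (J x)) $ i $ j" .
qed

text \<open>Every partial derivative of order at most two is a coordinate of the jet, so uniform
  convergence of jets implies all the pointwise claims at once.\<close>

lemma jet_pds_diff:
  fixes J K :: "real^'n \<Rightarrow> 'n::finite jet"
  assumes S: "thick S" and J: "has_jet S u J" and K: "has_jet S v K" and x: "x \<in> S" and js: "length js \<le> 2"
  shows "\<bar>pds S (map (\<lambda>i. axis i 1) js) u x - pds S (map (\<lambda>i. axis i 1) js) v x\<bar> \<le> norm (J x - K x)"
proof -
  define p0 p1 p2 where "p0 = fst (J x - K x)" and "p1 = fst (snd (J x - K x))" and "p2 = snd (snd (J x - K x))"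
  have p: "J x - K x = (p0, p1, p2)" by (simp add: p0_def p1_def p2_def prod_eq_iff)
  have 0: "\<bar>p0\<bar> \<le> norm (J x - K x)" and 1: "norm p1 \<le> norm (J x - K x)" and 2: "norm p2 \<le> norm (J x - K x)"
    unfolding p norm_Pair by (auto intro!: real_le_rsqrt)
  consider "js = []" | i where "js = [i]" | i j where "js = [i, j]"
    using js by (cases js; cases "tl js"; auto)
  then show ?thesis
  proof cases
    case 1
    then show ?thesis using has_jet_D(1)[OF J x] has_jet_D(1)[OF K x] 0 by (simp add: p0_def)
  next
    case (2 i)
    then show ?thesis using has_jet_cpd(1)[OF S J x, of i] has_jet_cpd(1)[OF S K x, of i] 1
        component_le_norm_cart[of p1 i]
      by (simp add: cpd_def p1_def)
  next
    case (3 i j)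
    then show ?thesis using has_jet_cpd(2)[OF S J x, of i j] has_jet_cpd(2)[OF S K x, of i j] 2
        component_le_norm_cart[of "p2 $ i" j] Finite_Cartesian_Product.norm_nth_le[of p2 i]
      by (simp add: cpd_def p2_def)
  qed
qed

lemma has_jet_add:
  assumes "has_jet S u J" "has_jet S v K"
  shows "has_jet S (\<lambda>x. u x + v x) (\<lambda>x. J x + K x)"
  using assms unfolding has_jet_def
  by (auto intro!: continuous_intros derivative_eq_intros simp: inner_add_left distrib_right sum.distrib)

lemma has_jet_scale:
  assumes "has_jet S u J"
  shows "has_jet S (\<lambda>x. k * u x) (\<lambda>x. k *\<^sub>R J x)"
  using assms unfolding has_jet_def
  by (auto intro!: continuous_intros derivative_eq_intros simp: sum_distrib_left mult_ac)

lemma has_jet_zero: "has_jet S (\<lambda>x. 0) (\<lambda>x. 0)"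
  unfolding has_jet_def by (auto intro!: derivative_eq_intros)

lemma has_jet_sum:
  assumes "\<And>i. i \<in> I \<Longrightarrow> has_jet S (u i) (J i)"
  shows "has_jet S (\<lambda>x. \<Sum>i\<in>I. u i x) (\<lambda>x. \<Sum>i\<in>I. J i x)"
  using assms by (induction I rule: infinite_finite_induct) (auto intro: has_jet_zero has_jet_add)

section \<open>The Leibniz rule for jets\<close>

definition outer :: "real^'n \<Rightarrow> real^'m \<Rightarrow> real^'m^'n" where
  "outer u v = (\<chi> i j. u $ i * v $ j)"

lemma norm_outer: "norm (outer u v) = norm u * norm v"
proof -
  have "norm (outer u v $ i) = norm v * \<bar>u $ i\<bar>" for i
  proof -
    have "outer u v $ i = (u $ i) *\<^sub>R v" by (simp add: outer_def vec_eq_iff)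
    then show ?thesis by simp
  qed
  then have "norm (outer u v) = L2_set (\<lambda>i. norm v * \<bar>u $ i\<bar>) UNIV"
    by (simp only: norm_vec_def[of "outer u v"])
  also have "\<dots> = norm v * norm u" by (simp add: L2_set_right_distrib norm_vec_def[of u])
  finally show ?thesis by simp
qed

lemma bounded_bilinear_outer: "bounded_bilinear (outer :: real^'n \<Rightarrow> real^'m \<Rightarrow> real^'m^'n)"
proof (rule bounded_bilinear.intro)
  show "\<exists>K. \<forall>a b. norm (outer a b :: real^'m^'n) \<le> norm a * norm b * K"
    by (rule exI[of _ 1]) (simp add: norm_outer)
qed (auto simp: outer_def vec_eq_iff algebra_simps)

lemmas continuous_on_outer [continuous_intros] = bounded_bilinear.continuous_on[OF bounded_bilinear_outer]

text \<open>The second-order Leibniz rule, read off from the jets of the two factors.\<close>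

definition jmul :: "'n::finite jet \<Rightarrow> 'n jet \<Rightarrow> 'n jet" where
  "jmul p q = (fst p * fst q, fst p *\<^sub>R fst (snd q) + fst q *\<^sub>R fst (snd p),
     fst p *\<^sub>R snd (snd q) + outer (fst (snd p)) (fst (snd q)) + outer (fst (snd q)) (fst (snd p))
       + fst q *\<^sub>R snd (snd p))"

lemma norm_le_triple:
  fixes p :: "'n::finite jet"
  shows "\<bar>fst p\<bar> \<le> norm p" "norm (fst (snd p)) \<le> norm p" "norm (snd (snd p)) \<le> norm p"
    "norm p \<le> \<bar>fst p\<bar> + norm (fst (snd p)) + norm (snd (snd p))"
proof -
  obtain a b c where p: "p = (a, b, c)" by (cases p)
  show "\<bar>fst p\<bar> \<le> norm p" "norm (fst (snd p)) \<le> norm p" "norm (snd (snd p)) \<le> norm p"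
    unfolding p norm_Pair by (auto intro!: real_le_rsqrt)
  have "norm p \<le> norm a + norm (b, c)" unfolding p by (rule norm_Pair_le)
  also have "norm (b, c) \<le> norm b + norm c" by (rule norm_Pair_le)
  finally show "norm p \<le> \<bar>fst p\<bar> + norm (fst (snd p)) + norm (snd (snd p))" unfolding p by simp
qed

text \<open>The constant counts the terms of the Leibniz rule: one in the value, two in the
  gradient, four in the Hessian.\<close>

lemma norm_jmul: "norm (jmul p q) \<le> 7 * norm p * norm q"
proof -
  have *: "a * b \<le> norm p * norm q" if "0 \<le> a" "a \<le> norm p" "0 \<le> b" "b \<le> norm q" for a b
    using that by (intro mult_mono) auto
  have "norm (fst (jmul p q)) \<le> norm p * norm q"
    using *[of "\<bar>fst p\<bar>" "\<bar>fst q\<bar>"] norm_le_triple[of p] norm_le_triple[of q] by (simp add: jmul_def abs_mult)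
  moreover have "norm (fst (snd (jmul p q))) \<le> 2 * (norm p * norm q)"
    using *[of "\<bar>fst p\<bar>" "norm (fst (snd q))"] *[of "norm (fst (snd p))" "\<bar>fst q\<bar>"]
      norm_le_triple[of p] norm_le_triple[of q]
      norm_triangle_ineq[of "fst p *\<^sub>R fst (snd q)" "fst q *\<^sub>R fst (snd p)"]
    by (simp add: jmul_def mult.commute)
  moreover have "norm (snd (snd (jmul p q))) \<le> 4 * (norm p * norm q)"
  proof -
    have "norm (snd (snd (jmul p q))) \<le> norm (fst p *\<^sub>R snd (snd q)) + norm (outer (fst (snd p)) (fst (snd q)))
       + norm (outer (fst (snd q)) (fst (snd p))) + norm (fst q *\<^sub>R snd (snd p))"
      unfolding jmul_def snd_conv
      by (intro order_trans[OF norm_triangle_ineq] add_right_mono norm_triangle_ineq)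
    then show ?thesis
      using *[of "\<bar>fst p\<bar>" "norm (snd (snd q))"] *[of "norm (snd (snd p))" "\<bar>fst q\<bar>"]
        *[of "norm (fst (snd p))" "norm (fst (snd q))"]
        norm_le_triple[of p] norm_le_triple[of q]
      by (simp add: norm_outer mult.commute)
  qed
  ultimately show ?thesis using norm_le_triple(4)[of "jmul p q"] by simp
qed

lemma jmul_linear: "jmul p (q + r) = jmul p q + jmul p r" "jmul p (q - r) = jmul p q - jmul p r"
  "jmul p (k *\<^sub>R q) = k *\<^sub>R jmul p q"
  by (auto simp: jmul_def outer_def prod_eq_iff vec_eq_iff algebra_simps)

lemma continuous_on_jmul [continuous_intros]:
  assumes "continuous_on S F" "continuous_on S G"
  shows "continuous_on S (\<lambda>x. jmul (F x) (G x))"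
  unfolding jmul_def by (intro continuous_intros assms)

lemma has_jet_mult:
  assumes u: "has_jet S u J" and v: "has_jet S v K"
  shows "has_jet S (\<lambda>x. u x * v x) (\<lambda>x. jmul (J x) (K x))"
  unfolding has_jet_def
proof (intro conjI ballI allI)
  show "continuous_on S (\<lambda>x. jmul (J x) (K x))"
    using assms by (intro continuous_intros) (auto simp: has_jet_def)
  fix x assume x: "x \<in> S"
  note U = has_jet_D[OF u x] and V = has_jet_D[OF v x]
  show "fst (jmul (J x) (K x)) = u x * v x" using U(1) V(1) by (simp add: jmul_def)
  show "((\<lambda>x. u x * v x) has_derivative (\<bullet>) (fst (snd (jmul (J x) (K x))))) (at x within S)"
    by (rule derivative_eq_intros U(2) V(2) refl)+
       (auto simp: jmul_def U(1) V(1) inner_add_left fun_eq_iff)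
  fix j
  \<comment> \<open>The function values replace the first jet components here, because their
    derivatives are the ones that \<open>has_jet\<close> supplies; the two expressions agree on
    \<open>S\<close>.\<close>
  have "((\<lambda>y. u y * fst (snd (K y)) $ j + v y * fst (snd (J y)) $ j) has_derivative
     (\<lambda>h. \<Sum>i\<in>UNIV. snd (snd (jmul (J x) (K x))) $ i $ j * h $ i)) (at x within S)"
    by (rule derivative_eq_intros U(2,3) V(2,3) refl)+
       (auto simp: jmul_def U(1) V(1) outer_def inner_vec_def fun_eq_iff sum.distrib sum_distrib_left sum_distrib_right algebra_simps)
  then show "((\<lambda>y. fst (snd (jmul (J y) (K y))) $ j) has_derivative
     (\<lambda>h. \<Sum>i\<in>UNIV. snd (snd (jmul (J x) (K x))) $ i $ j * h $ i)) (at x within S)"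
    by (rule has_derivative_transform[OF x, rotated])
       (use has_jet_D(1)[OF u] has_jet_D(1)[OF v] in \<open>simp add: jmul_def\<close>)
qed

lemma inner_grad: "grad D u x \<bullet> h = (\<Sum>i\<in>UNIV. h $ i * D i u x)"
  by (simp add: grad_def inner_vec_def mult.commute)

lemma has_jet_C2:
  fixes u :: "real^'n::finite \<Rightarrow> real"
  assumes S: "thick S" and C: "Ck_on 2 S u"
  shows "has_jet S u (jet (cpd S) u)"
proof -
  have c: "continuous_on S (pds S (map (\<lambda>i. axis i 1) js) u)" if "length js \<le> 2" for js :: "'n list"
    using C that lists_Basis_vec[of "map (\<lambda>i. axis i 1) js"] unfolding Ck_on_def by (metis length_map)
  have d: "pds S (map (\<lambda>i. axis i 1) js) u differentiable_on S" if "length js < 2" for js :: "'n list"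
    using C that lists_Basis_vec[of "map (\<lambda>i. axis i 1) js"] unfolding Ck_on_def by (metis length_map)
  have d0: "u differentiable_on S" and d1: "\<And>j. cpd S j u differentiable_on S"
    and c0: "continuous_on S u" and c1: "\<And>i. continuous_on S (cpd S i u)"
    and c2: "\<And>i j. continuous_on S (cpd S i (cpd S j u))"
    using d[of "[]"] d[of "[j]" for j] c[of "[]"] c[of "[i]" for i] c[of "[i,j]" for i j]
    by (auto simp: cpd_def)
  show ?thesis unfolding has_jet_def
  proof (intro conjI ballI allI)
    show "continuous_on S (jet (cpd S) u)"
      unfolding jet_def grad_def by (intro continuous_intros c0 c1 c2)
    fix x assume x: "x \<in> S"
    show "fst (jet (cpd S) u x) = u x" by (simp add: jet_def)
    show "(u has_derivative (\<bullet>) (fst (snd (jet (cpd S) u x)))) (at x within S)"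
      by (rule has_derivative_eq_rhs[OF differentiable_pd])
         (use d0 x in \<open>auto simp: differentiable_on_def sum_Basis_vec jet_def inner_grad
           inner_axis cpd_def fun_eq_iff\<close>)
    show "((\<lambda>y. fst (snd (jet (cpd S) u y)) $ j) has_derivative
       (\<lambda>h. \<Sum>i\<in>UNIV. snd (snd (jet (cpd S) u x)) $ i $ j * h $ i)) (at x within S)" for j
      apply (simp add: jet_def grad_def)
      by (rule has_derivative_eq_rhs[OF differentiable_pd])
         (use d1[of j] x in \<open>auto simp: differentiable_on_def sum_Basis_vec
           inner_axis cpd_def mult.commute fun_eq_iff\<close>)
  qed
qed

section \<open>The domain\<close>

lemma boundary_chart_deriv:
  fixes \<Omega> :: "(real^'n) set"
  assumes "boundary_chart \<Omega> x V \<psi>"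
  shows "continuous_on V (grad (cpd V) \<psi>)"
    and "\<And>z. z \<in> V \<Longrightarrow> (\<psi> has_derivative (\<lambda>h. grad (cpd V) \<psi> z \<bullet> h)) (at z)"
    and "continuous_on V \<psi>"
proof -
  have V: "open V" and C: "Ck_on 2 V \<psi>" using assms by (auto simp: boundary_chart_def smooth_on_def)
  note J = has_jet_C2[OF thick_open[OF V] C]
  have "continuous_on V (jet (cpd V) \<psi>)" using J by (simp add: has_jet_def)
  then have "continuous_on V (\<lambda>z. fst (snd (jet (cpd V) \<psi> z)))" by (intro continuous_intros)
  then show "continuous_on V (grad (cpd V) \<psi>)" by (simp add: jet_def)
  show d: "(\<psi> has_derivative (\<lambda>h. grad (cpd V) \<psi> z \<bullet> h)) (at z)" if "z \<in> V" for z
    using has_jet_D(2)[OF J that] at_within_open[OF that V] by (simp add: jet_def)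
  then show "continuous_on V \<psi>"
    using V by (meson continuous_at_imp_continuous_on has_derivative_continuous)
qed

text \<open>At a boundary point the defining function of a chart strictly decreases along all
  directions close to minus its gradient, so short rays in these directions remain in its sublevel
  set, hence in the domain.\<close>

lemma thick_domain:
  fixes \<Omega> :: "(real^'n) set"
  assumes "compact_smooth_domain \<Omega>"
  shows "thick \<Omega>"
  unfolding thick_def
proof
  fix x assume x: "x \<in> \<Omega>"
  show "\<exists>v r. 0 < r \<and> (\<forall>u\<in>ball v r. \<exists>\<delta>>0. \<forall>t\<in>{0<..<\<delta>}. x + t *\<^sub>R u \<in> \<Omega>)"
  proof (cases "x \<in> interior \<Omega>")
    case True
    then show ?thesis
      using thick_open[OF open_interior, of \<Omega>] interior_subset[of \<Omega>] unfolding thick_def by (meson subsetD)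
  next
    case False
    then have "x \<in> frontier \<Omega>" using x by (simp add: frontier_def closure_subset[THEN subsetD])
    then obtain V \<psi> where ch: "boundary_chart \<Omega> x V \<psi>"
      using assms unfolding compact_smooth_domain_def by blast
    then have V: "open V" "x \<in> V" "\<Omega> \<inter> V = {y\<in>V. \<psi> y \<le> 0}" and g0: "grad (cpd V) \<psi> x \<noteq> 0"
      by (auto simp: boundary_chart_def)
    define g where "g = grad (cpd V) \<psi> x"
    \<comment> \<open>By Cauchy-Schwarz the ball about \<open>- g\<close> whose radius is the norm
      of \<open>g\<close> contains only directions with \<open>g \<bullet> u < 0\<close>.\<close>
    have "\<exists>\<delta>>0. \<forall>t\<in>{0<..<\<delta>}. x + t *\<^sub>R u \<in> \<Omega>" if u: "u \<in> ball (- g) (norm g)" for u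
    proof -
      have "g \<bullet> (u + g) \<le> norm g * norm (u + g)" by (rule norm_cauchy_schwarz)
      also have "\<dots> < norm g * norm g"
        using u g0 by (intro mult_strict_left_mono) (auto simp: g_def dist_norm norm_minus_commute algebra_simps)
      also have "\<dots> = g \<bullet> g" by (simp add: dot_square_norm power2_eq_square)
      finally have gu: "g \<bullet> u < 0" by (simp add: inner_add_right)
      obtain d where d: "d > 0" "\<forall>t\<in>{0<..<d}. x + t *\<^sub>R u \<in> V"
      proof -
        have "((\<lambda>t. x + t *\<^sub>R u) \<longlongrightarrow> x + 0 *\<^sub>R u) (at_right 0)" by (intro tendsto_intros)
        then have "\<forall>\<^sub>F t in at_right 0. x + t *\<^sub>R u \<in> V" using V by (simp add: topological_tendstoD)
        then show ?thesis using that unfolding eventually_at_right_field by (metis greaterThanLessThan_iff)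
      qed
      have "((\<lambda>t. (\<psi> (x + t *\<^sub>R u) - \<psi> x) / t) \<longlongrightarrow> g \<bullet> u) (at_right 0)"
        using has_derivative_direction_limit[OF has_derivative_at_withinI[OF boundary_chart_deriv(2)[OF ch V(2)]] d]
        by (simp add: g_def)
      then have "\<forall>\<^sub>F t in at_right 0. (\<psi> (x + t *\<^sub>R u) - \<psi> x) / t < 0" using gu by (rule order_tendstoD)
      then obtain e where e: "e > 0" "\<And>t. 0 < t \<Longrightarrow> t < e \<Longrightarrow> (\<psi> (x + t *\<^sub>R u) - \<psi> x) / t < 0"
        unfolding eventually_at_right_field by auto
      have "x + t *\<^sub>R u \<in> \<Omega>" if "t \<in> {0<..<min d e}" for t
      proof -
        have "\<psi> x \<le> 0" using x V by auto
        moreover have "\<psi> (x + t *\<^sub>R u) < \<psi> x" using e(2)[of t] that by (simp add: divide_less_0_iff)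
        moreover have "x + t *\<^sub>R u \<in> V" using d that by auto
        ultimately have "x + t *\<^sub>R u \<in> {y\<in>V. \<psi> y \<le> 0}" by auto
        then show ?thesis using V(3) by blast
      qed
      then show ?thesis using d e by (intro exI[of _ "min d e"]) auto
    qed
    then show ?thesis using g0 by (intro exI[of _ "- g"] exI[of _ "norm g"]) (auto simp: g_def)
  qed
qed

text \<open>Near a boundary point the level set of the chart is met at most once by each ray from a
  point far enough behind the boundary, so it is starlike and hence null.\<close>

lemma negligible_frontier_domain:
  fixes \<Omega> :: "(real^'n) set"
  assumes dom: "compact_smooth_domain \<Omega>"
  shows "negligible (frontier \<Omega>)"
proof -
  have cl: "closed \<Omega>" using dom by (simp add: compact_smooth_domain_def compact_imp_closed)
  have loc: "\<exists>r>0. negligible (frontier \<Omega> \<inter> cball x r)" if x: "x \<in> frontier \<Omega>" for x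
  proof -
    obtain V \<psi> where ch: "boundary_chart \<Omega> x V \<psi>"
      using dom x unfolding compact_smooth_domain_def by blast
    then have V: "open V" "x \<in> V" "\<Omega> \<inter> V = {y\<in>V. \<psi> y \<le> 0}" and g0: "grad (cpd V) \<psi> x \<noteq> 0"
      by (auto simp: boundary_chart_def)
    define G where "G = grad (cpd V) \<psi>"
    note cG = boundary_chart_deriv(1)[OF ch, folded G_def]
      and dG = boundary_chart_deriv(2)[OF ch, folded G_def] and c\<psi> = boundary_chart_deriv(3)[OF ch]
    \<comment> \<open>Points of the chart where the defining function is negative form an open
      subset of the domain, so frontier points must lie on the zero level.\<close>
    have zero: "\<psi> y = 0" if y: "y \<in> frontier \<Omega>" "y \<in> V" for y
    proof (rule ccontr)
      assume "\<psi> y \<noteq> 0"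
      moreover have "y \<in> \<Omega>" using y cl frontier_subset_closed by blast
      ultimately have neg: "\<psi> y < 0" using V y by force
      have "open {z\<in>V. \<psi> z < 0}"
        using continuous_open_preimage[OF c\<psi> V(1), of "{..<0}"] by (simp add: vimage_def Collect_conj_eq)
      moreover have "{z\<in>V. \<psi> z < 0} \<subseteq> \<Omega>" using V(3) by force
      ultimately have "y \<in> interior \<Omega>" using neg y by (auto intro: interiorI)
      then show False using y by (simp add: frontier_def)
    qed
    have ng: "norm (G x) > 0" using g0 by (simp add: G_def)
    have "\<forall>\<^sub>F z in at x. dist (G z) (G x) < norm (G x) / 2"
      using cG V ng by (intro tendstoD) (auto simp: continuous_on_eq_continuous_at isCont_def)
    then obtain e1 where e1: "e1 > 0" "\<And>z. z \<noteq> x \<Longrightarrow> dist z x < e1 \<Longrightarrow> dist (G z) (G x) < norm (G x) / 2"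
      unfolding eventually_at by auto
    obtain e2 where e2: "e2 > 0" "cball x e2 \<subseteq> V" using V open_contains_cball by blast
    define r where "r = min (e1/2) e2"
    have r: "r > 0" "cball x r \<subseteq> V" using e1 e2 by (auto simp: r_def)
    have Gz: "norm (G z - G x) \<le> norm (G x) / 2" if "z \<in> cball x r" for z
      using e1(1) e1(2)[of z] that by (cases "z = x") (auto simp: r_def dist_norm norm_minus_commute min_def split: if_splits)
    \<comment> \<open>The centre lies at distance \<open>4 * r\<close> behind the boundary. On the
      ball the gradient deviates from \<open>G x\<close> by at most half its norm, so moving from
      \<open>a\<close> to the ball gains at least \<open>2 * r * norm (G x)\<close> up to
      \<open>x\<close>, and the remaining step loses at most \<open>3/2\<close> of
      \<open>r * norm (G x)\<close>.\<close>
    define a where "a = x - (4 * r / norm (G x)) *\<^sub>R G x"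
    have pos: "G z \<bullet> (y - a) > 0" if z: "z \<in> cball x r" and y: "y \<in> cball x r" for z y
    proof -
      define s where "s = 4 * r / norm (G x)"
      have s: "s > 0" "s * norm (G x) = 4 * r" using r ng by (auto simp: s_def)
      have "norm (G z) \<le> norm (G x) + norm (G z - G x)" by (metis add_diff_cancel_left' diff_add_cancel norm_triangle_ineq add.commute)
      then have nz: "norm (G z) \<le> 3/2 * norm (G x)" using Gz[OF z] by simp
      have "- (G z \<bullet> (y - x)) \<le> norm (G z) * norm (y - x)"
        using Cauchy_Schwarz_ineq2[of "G z" "y - x"] by linarith
      also have "\<dots> \<le> (3/2 * norm (G x)) * r"
        using nz y by (intro mult_mono) (auto simp: dist_norm norm_minus_commute)
      finally have 1: "- (G z \<bullet> (y - x)) \<le> 3/2 * norm (G x) * r" by simp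
      have "\<bar>(G z - G x) \<bullet> G x\<bar> \<le> norm (G z - G x) * norm (G x)" by (rule Cauchy_Schwarz_ineq2)
      also have "\<dots> \<le> norm (G x) / 2 * norm (G x)" using Gz[OF z] by (intro mult_right_mono) auto
      finally have "\<bar>G z \<bullet> G x - norm (G x) * norm (G x)\<bar> \<le> norm (G x) / 2 * norm (G x)"
        by (simp add: inner_diff_left dot_square_norm power2_eq_square)
      then have "G z \<bullet> G x \<ge> norm (G x) * norm (G x) / 2" unfolding abs_le_iff by simp
      then have "s * (G z \<bullet> G x) \<ge> s * (norm (G x) * norm (G x) / 2)" using s by simp
      also have "s * (norm (G x) * norm (G x) / 2) = (s * norm (G x)) * norm (G x) / 2" by simp
      finally have 2: "s * (G z \<bullet> G x) \<ge> 2 * r * norm (G x)" using s by simp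
      have "G z \<bullet> (y - a) = G z \<bullet> (y - x) + s * (G z \<bullet> G x)"
        by (simp add: a_def s_def algebra_simps inner_add_right inner_diff_right)
      moreover have "r * norm (G x) > 0" using r ng by simp
      ultimately show ?thesis using 1 2 by (simp add: algebra_simps)
    qed
    have "negligible (frontier \<Omega> \<inter> cball x r)"
    proof (rule starlike_negligible_strong[where a = a])
      show "closed (frontier \<Omega> \<inter> cball x r)" by auto
      fix c :: real and h assume c: "0 \<le> c" "c < 1" and y: "a + h \<in> frontier \<Omega> \<inter> cball x r"
      show "a + c *\<^sub>R h \<notin> frontier \<Omega> \<inter> cball x r"
      proof
        assume y': "a + c *\<^sub>R h \<in> frontier \<Omega> \<inter> cball x r"
        define p where "p = (\<lambda>t. a + c *\<^sub>R h + t *\<^sub>R ((1 - c) *\<^sub>R h))"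
        have pin: "p t \<in> cball x r" if "t \<in> {0..1}" for t
        proof -
          have "p t = (1 - t) *\<^sub>R (a + c *\<^sub>R h) + t *\<^sub>R (a + h)" by (simp add: p_def algebra_simps)
          then show ?thesis using that y y' convex_cball[of x r] by (auto simp: convex_alt)
        qed
        \<comment> \<open>Two zeros on one ray would, by the mean value theorem on the segment
          between them, give a point where the gradient is orthogonal to the ray, against
          \<open>pos\<close>.\<close>
        have "\<exists>t\<in>{0<..<1}. \<psi> (p 1) - \<psi> (p 0) = G (p t) \<bullet> ((1 - 0) *\<^sub>R ((1 - c) *\<^sub>R h))"
        proof (rule mvt_simple[where f = "\<lambda>t. \<psi> (p t)" and f' = "\<lambda>t s. G (p t) \<bullet> (s *\<^sub>R ((1 - c) *\<^sub>R h))"])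
          fix t :: real assume t: "0 \<le> t" "t \<le> 1"
          have "(p has_derivative (\<lambda>s. s *\<^sub>R ((1 - c) *\<^sub>R h))) (at t within {0..1})"
            unfolding p_def by (auto intro!: derivative_eq_intros)
          then show "((\<lambda>t. \<psi> (p t)) has_derivative (\<lambda>s. G (p t) \<bullet> (s *\<^sub>R ((1 - c) *\<^sub>R h)))) (at t within {0..1})"
            by (rule has_derivative_compose) (rule dG, use pin[of t] t r in auto)
        qed auto
        then obtain t where t: "t \<in> {0<..<1}" "\<psi> (p 1) - \<psi> (p 0) = (1 - c) * (G (p t) \<bullet> h)" by auto
        have "p 1 = a + h" "p 0 = a + c *\<^sub>R h" by (auto simp: p_def algebra_simps)
        then have "\<psi> (p 1) = 0" "\<psi> (p 0) = 0" using zero y y' r by auto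
        then have "G (p t) \<bullet> h = 0" using t c by auto
        moreover have "G (p t) \<bullet> ((a + h) - a) > 0"
          by (rule pos) (use pin[of t] t y in auto)
        ultimately show False by simp
      qed
    qed
    then show ?thesis using r by blast
  qed
  then obtain r where r: "\<And>x. x \<in> frontier \<Omega> \<Longrightarrow> r x > 0 \<and> negligible (frontier \<Omega> \<inter> cball x (r x))" by metis
  have cpt: "compact (frontier \<Omega>)" using dom by (simp add: compact_smooth_domain_def compact_frontier)
  have cov: "frontier \<Omega> \<subseteq> (\<Union>x\<in>frontier \<Omega>. ball x (r x))"
  proof
    fix x assume x: "x \<in> frontier \<Omega>"
    then have "x \<in> ball x (r x)" using r by simp
    then show "x \<in> (\<Union>x\<in>frontier \<Omega>. ball x (r x))" using x by blast
  qed
  obtain F where F: "F \<subseteq> frontier \<Omega>" "finite F" "frontier \<Omega> \<subseteq> (\<Union>x\<in>F. ball x (r x))"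
    by (rule compactE_image[OF cpt open_ball cov])
  have "frontier \<Omega> \<subseteq> (\<Union>x\<in>F. frontier \<Omega> \<inter> cball x (r x))"
    using F(3) ball_subset_cball by blast
  moreover have "negligible (\<Union>x\<in>F. frontier \<Omega> \<inter> cball x (r x))"
    using F r by (intro negligible_Union) auto
  ultimately show ?thesis using negligible_subset by blast
qed

section \<open>The uniform probability measure on the domain\<close>

locale smooth_domain =
  fixes \<Omega> :: "(real^'n) set"
  assumes dom: "compact_smooth_domain \<Omega>"
begin

abbreviation \<mu> where "\<mu> \<equiv> unif \<Omega>"

lemma compact_dom: "compact \<Omega>" and int_ne: "interior \<Omega> \<noteq> {}"
  using dom by (auto simp: compact_smooth_domain_def)

lemma sets_dom [measurable]: "\<Omega> \<in> sets borel" using compact_dom by (simp add: borel_compact)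

lemma thick: "thick \<Omega>" using dom by (rule thick_domain)

lemma emeasure_dom: "emeasure lborel \<Omega> \<noteq> 0" "emeasure lborel \<Omega> < \<infinity>"
proof -
  show "emeasure lborel \<Omega> < \<infinity>" using compact_dom emeasure_compact_finite by blast
  obtain a e where "e > 0" "ball a e \<subseteq> \<Omega>" using int_ne by (meson ex_in_conv mem_interior)
  then have "emeasure lborel (ball a e) \<le> emeasure lborel \<Omega>" by (intro emeasure_mono) auto
  moreover have "emeasure lborel (ball a e) > 0"
    using \<open>e > 0\<close> emeasure_lborel_ball_finite[of a e] content_ball_pos[of e a]
    by (simp add: emeasure_eq_ennreal_measure)
  ultimately show "emeasure lborel \<Omega> \<noteq> 0" by auto
qed

lemma measure_dom_pos: "measure lborel \<Omega> > 0"
  using emeasure_dom by (simp add: measure_def enn2real_positive_iff zero_less_iff_neq_zero)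

lemma space_unif [simp]: "space \<mu> = \<Omega>" by (simp add: unif_def space_restrict_space)

lemma sets_unif: "sets \<mu> = sets (restrict_space borel \<Omega>)"
  by (simp add: unif_def sets_restrict_space)

lemma measurable_unif_iff: "measurable \<mu> N = measurable (restrict_space borel \<Omega>) N"
  by (rule measurable_cong_sets) (simp_all add: sets_unif)

lemma prob_space_unif: "prob_space \<mu>"
proof -
  interpret u: prob_space "uniform_measure lborel \<Omega>"
    using emeasure_dom by (intro prob_space_uniform_measure) auto
  show ?thesis
  proof (rule prob_spaceI)
    have "emeasure \<mu> \<Omega> = emeasure (uniform_measure lborel \<Omega>) \<Omega>"
      unfolding unif_def by (rule emeasure_restrict_space) auto
    also have "\<dots> = 1" using emeasure_dom by (simp add: less_top)
    finally show "emeasure \<mu> (space \<mu>) = 1" by simp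
  qed
qed

sublocale P: prob_space \<mu> by (rule prob_space_unif)

lemma borel_measurable_continuous: "continuous_on \<Omega> F \<Longrightarrow> F \<in> borel_measurable \<mu>"
  unfolding measurable_unif_iff by (rule borel_measurable_continuous_on_restrict)

lemma AE_unif: "(AE x in \<mu>. Q x) \<longleftrightarrow> (AE x in lborel. x \<in> \<Omega> \<longrightarrow> Q x)"
proof -
  have "(AE x in \<mu>. Q x) \<longleftrightarrow> (AE x in uniform_measure lborel \<Omega>. x \<in> \<Omega> \<longrightarrow> Q x)"
    unfolding unif_def by (subst AE_restrict_space_iff) auto
  also have "\<dots> \<longleftrightarrow> (AE x in lborel. x \<in> \<Omega> \<longrightarrow> Q x)"
    using emeasure_dom by (subst AE_uniform_measure) auto
  finally show ?thesis .
qed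

text \<open>Since the boundary is null, almost-everywhere statements need checking only at interior
  points, where derivatives within the domain are ordinary derivatives.\<close>

lemma AE_interior: "AE x in \<mu>. x \<in> interior \<Omega>"
proof -
  have "frontier \<Omega> \<in> null_sets lebesgue" using negligible_frontier_domain[OF dom] negligible_iff_null_sets by blast
  then have "frontier \<Omega> \<in> null_sets lborel" by (subst (asm) null_sets_completion_iff) auto
  then have "AE x in lborel. x \<notin> frontier \<Omega>" by (rule AE_not_in)
  then show ?thesis unfolding AE_unif
    by eventually_elim (use compact_dom in \<open>auto simp: frontier_def closure_closed compact_imp_closed\<close>)
qed

text \<open>The density of the uniform measure is constant on the domain. The identity holds for
  every \<open>F\<close>: without integrability both integrals have the default value 0.\<close>

lemma integral_unif:
  fixes F :: "real^'n \<Rightarrow> real"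
  shows "(LINT x|\<mu>. F x) = (LINT x|lborel. indicator \<Omega> x * F x) / measure lborel \<Omega>"
    and "integrable \<mu> F \<longleftrightarrow> integrable lborel (\<lambda>x. indicator \<Omega> x * F x)"
proof -
  define u where "u = uniform_measure lborel \<Omega>"
  have d: "u = density lborel (\<lambda>x. ennreal (indicator \<Omega> x / measure lborel \<Omega>))"
    unfolding u_def uniform_measure_def
    by (rule density_cong) (use measure_dom_pos emeasure_dom in
      \<open>auto simp: emeasure_eq_ennreal_measure less_top divide_ennreal[symmetric] split: split_indicator\<close>)
  define G where "G = (\<lambda>x. indicator \<Omega> x *\<^sub>R F x)"
  have i: "integrable \<mu> F \<longleftrightarrow> integrable u G"
    unfolding unif_def u_def G_def by (subst integrable_restrict_space) (auto simp: sets_eq_imp_space_eq)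
  have l: "(LINT x|\<mu>. F x) = (LINT x|u. G x)"
    unfolding unif_def u_def G_def by (subst integral_restrict_space) auto
  have eq: "(\<lambda>x. (indicator \<Omega> x / measure lborel \<Omega>) *\<^sub>R G x) = (\<lambda>x. (1/measure lborel \<Omega>) * (indicator \<Omega> x * F x))"
    by (auto simp: G_def split: split_indicator)
  have GF: "G = (\<lambda>x. indicator \<Omega> x * F x)" by (simp add: G_def)
  have m: "G \<in> borel_measurable lborel" if "integrable u G"
    using borel_measurable_integrable[OF that] unfolding u_def by (simp cong: measurable_cong_sets)
  have cmul: "integrable lborel (\<lambda>x. (1/measure lborel \<Omega>) * (indicator \<Omega> x * F x))
      \<longleftrightarrow> integrable lborel (\<lambda>x. indicator \<Omega> x * F x)"
  proof
    assume "integrable lborel (\<lambda>x. (1/measure lborel \<Omega>) * (indicator \<Omega> x * F x))"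
    then have "integrable lborel (\<lambda>x. measure lborel \<Omega> * ((1/measure lborel \<Omega>) * (indicator \<Omega> x * F x)))"
      by (rule integrable_mult_right)
    moreover have "(\<lambda>x. measure lborel \<Omega> * ((1/measure lborel \<Omega>) * (indicator \<Omega> x * F x)))
        = (\<lambda>x. indicator \<Omega> x * F x)"
      using measure_dom_pos by (simp add: fun_eq_iff)
    ultimately show "integrable lborel (\<lambda>x. indicator \<Omega> x * F x)" by (simp only:)
  qed (intro integrable_mult_right)
  have D: "integrable u G \<longleftrightarrow> integrable lborel (\<lambda>x. (indicator \<Omega> x / measure lborel \<Omega>) *\<^sub>R G x)"
    if "G \<in> borel_measurable lborel"
    unfolding d by (rule integrable_density) (use that measure_dom_pos in auto)
  show I: "integrable \<mu> F \<longleftrightarrow> integrable lborel (\<lambda>x. indicator \<Omega> x * F x)"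
  proof
    assume "integrable \<mu> F"
    then have "integrable u G" using i by simp
    then show "integrable lborel (\<lambda>x. indicator \<Omega> x * F x)" using D[OF m] cmul unfolding eq by blast
  next
    assume A: "integrable lborel (\<lambda>x. indicator \<Omega> x * F x)"
    then have "G \<in> borel_measurable lborel" unfolding GF by (rule borel_measurable_integrable)
    then show "integrable \<mu> F" using D A cmul i unfolding eq by blast
  qed
  show "(LINT x|\<mu>. F x) = (LINT x|lborel. indicator \<Omega> x * F x) / measure lborel \<Omega>"
  proof (cases "integrable \<mu> F")
    case True
    then have "G \<in> borel_measurable lborel" using m i by simp
    then have "(LINT x|u. G x) = (LINT x|lborel. (indicator \<Omega> x / measure lborel \<Omega>) *\<^sub>R G x)"
      unfolding d by (rule integral_density) (use measure_dom_pos in auto)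
    then show ?thesis unfolding l eq by simp
  next
    case False
    then show ?thesis using I by (simp add: not_integrable_integral_eq)
  qed
qed

lemma integrable_bounded:
  fixes F :: "real^'n \<Rightarrow> 'b::{banach, second_countable_topology}"
  assumes "F \<in> borel_measurable \<mu>" "\<And>x. x \<in> \<Omega> \<Longrightarrow> norm (F x) \<le> B"
  shows "integrable \<mu> F"
  by (rule P.integrable_const_bound[of _ B]) (use assms in auto)

lemma continuous_bounded:
  fixes F :: "real^'n \<Rightarrow> 'b::real_normed_vector"
  assumes "continuous_on \<Omega> F"
  obtains B where "B > 0" "\<And>x. x \<in> \<Omega> \<Longrightarrow> norm (F x) \<le> B"
proof -
  have "bounded (F ` \<Omega>)" using assms compact_dom compact_continuous_image compact_imp_bounded by blast
  then show ?thesis using that unfolding bounded_pos by auto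
qed

end

section \<open>Smooth test functions\<close>

text \<open>A class of differentiable functions that is closed under partial derivatives consists of
  smooth functions. This replaces formulas for derivatives of all orders by a single closure
  step.\<close>

lemma smooth_on_class:
  fixes u :: "'a::euclidean_space \<Rightarrow> real"
  assumes cl: "\<And>v. v \<in> \<S> \<Longrightarrow> (\<forall>x. v differentiable (at x)) \<and> (\<forall>e\<in>Basis. pd UNIV e v \<in> \<S>)"
    and u: "u \<in> \<S>"
  shows "smooth_on UNIV u"
proof -
  have "pds UNIV es u \<in> \<S>" if "es \<in> lists Basis" for es
    using that by (induction es) (use cl u in auto)
  then have "pds UNIV es u differentiable_on UNIV" if "es \<in> lists Basis" for es
    using cl that by (auto simp: differentiable_on_def)
  then show ?thesis
    unfolding smooth_on_def Ck_on_def using differentiable_imp_continuous_on by blast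
qed

lemma pd_add:
  fixes u v :: "'a::euclidean_space \<Rightarrow> real"
  assumes "u differentiable (at x)" "v differentiable (at x)"
  shows "pd UNIV e (\<lambda>x. u x + v x) x = pd UNIV e u x + pd UNIV e v x"
proof -
  obtain D E where d: "(u has_derivative D) (at x)" "(v has_derivative E) (at x)"
    using assms unfolding differentiable_def by blast
  show ?thesis
    using pd_eq[OF thick_open[OF open_UNIV] UNIV_I has_derivative_add[OF d]]
      pd_eq[OF thick_open[OF open_UNIV] UNIV_I d(1)] pd_eq[OF thick_open[OF open_UNIV] UNIV_I d(2)] by simp
qed

section \<open>Smooth bumps supported in boxes\<close>

definition expo :: "real \<Rightarrow> real poly \<Rightarrow> real \<Rightarrow> real" where
  "expo \<kappa> p t = (if t > 0 then poly p (1/t) * exp (- \<kappa> / t) else 0)"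

text \<open>The derivative of p(1/t) exp(-\<kappa>/t) is t^-2 (\<kappa> p - p')(1/t)
  exp(-\<kappa>/t), again of the same form with this polynomial. Allowing polynomial factors in
  \<open>expo\<close> thus makes the family closed under differentiation.\<close>

definition expo_deriv :: "real \<Rightarrow> real poly \<Rightarrow> real poly" where
  "expo_deriv \<kappa> p = [:0, 0, 1:] * (smult \<kappa> p - pderiv p)"

lemma poly_times_exp_tendsto_0:
  fixes p :: "real poly"
  assumes "\<kappa> > 0"
  shows "((\<lambda>s. poly p s * exp (- \<kappa> * s)) \<longlongrightarrow> 0) at_top"
proof -
  have m: "((\<lambda>s::real. s ^ n * exp (- \<kappa> * s)) \<longlongrightarrow> 0) at_top" for n
  proof -
    have "filterlim (\<lambda>s. \<kappa> * s) at_top at_top"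
      using assms by (rule filterlim_tendsto_pos_mult_at_top[OF tendsto_const _ filterlim_ident])
    from filterlim_compose[OF tendsto_power_div_exp_0 this, of n]
    have "((\<lambda>s. (1/\<kappa>)^n * ((\<kappa> * s) ^ n / exp (\<kappa> * s))) \<longlongrightarrow> (1/\<kappa>)^n * 0) at_top"
      by (intro tendsto_intros)
    moreover have "(1/\<kappa>)^n * ((\<kappa> * s) ^ n / exp (\<kappa> * s)) = s ^ n * exp (- \<kappa> * s)" for s
      using assms by (simp add: exp_minus field_simps power_mult_distrib)
    ultimately show ?thesis by simp
  qed
  have "((\<lambda>s. \<Sum>i\<le>degree p. coeff p i * (s ^ i * exp (- \<kappa> * s))) \<longlongrightarrow> (\<Sum>i\<le>degree p. coeff p i * 0)) at_top"
    by (intro tendsto_intros m)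
  then show ?thesis by (simp add: poly_altdef sum_distrib_right mult.assoc)
qed

lemma expo_has_derivative:
  assumes k: "\<kappa> > 0"
  shows "(expo \<kappa> p has_real_derivative expo \<kappa> (expo_deriv \<kappa> p) t) (at t)"
proof -
  consider "t > 0" | "t < 0" | "t = 0" by linarith
  then show ?thesis
  proof cases
    case 1
    have "((\<lambda>t. poly p (1/t) * exp (- \<kappa> / t)) has_real_derivative expo \<kappa> (expo_deriv \<kappa> p) t) (at t)"
      using 1 by (auto intro!: derivative_eq_intros simp: expo_def expo_deriv_def field_simps power2_eq_square)
    then show ?thesis
      by (rule has_field_derivative_transform_within_open[where S = "{0<..}"]) (use 1 in \<open>auto simp: expo_def\<close>)
  next
    case 2
    have "((\<lambda>t. 0::real) has_real_derivative expo \<kappa> (expo_deriv \<kappa> p) t) (at t)"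
      using 2 by (auto simp: expo_def)
    then show ?thesis
      by (rule has_field_derivative_transform_within_open[where S = "{..<0}"]) (use 2 in \<open>auto simp: expo_def\<close>)
  next
    case 3
    have l: "((\<lambda>y. expo \<kappa> p y / y) \<longlongrightarrow> 0) (at_left 0)"
      by (rule tendsto_eventually) (auto simp: eventually_at_filter expo_def)
    \<comment> \<open>With s = 1/y the difference quotient at 0 from the right is s p(s)
      exp(-\<kappa> s), and the factor s is absorbed into the polynomial.\<close>
    have "((\<lambda>s. poly ([:0,1:] * p) s * exp (- \<kappa> * s)) \<longlongrightarrow> 0) at_top"
      by (rule poly_times_exp_tendsto_0[OF k])
    from filterlim_compose[OF this filterlim_inverse_at_top_right]
    have "((\<lambda>y. poly ([:0,1:] * p) (inverse y) * exp (- \<kappa> * inverse y)) \<longlongrightarrow> 0) (at_right 0)" .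
    moreover have "\<forall>\<^sub>F y in at_right 0. poly ([:0,1:] * p) (inverse y) * exp (- \<kappa> * inverse y) = expo \<kappa> p y / y"
      by (auto simp: eventually_at_filter expo_def field_simps)
    ultimately have r: "((\<lambda>y. expo \<kappa> p y / y) \<longlongrightarrow> 0) (at_right 0)" by (rule Lim_transform_eventually)
    have "((\<lambda>y. expo \<kappa> p y / y) \<longlongrightarrow> 0) (at 0)"
      using l r by (simp add: filterlim_at_split)
    then show ?thesis using 3 by (simp add: has_field_derivative_iff expo_def)
  qed
qed

text \<open>Each of the two faces in each coordinate has its own polynomial, so that a partial
  derivative changes one polynomial at a time; the factors in \<open>b $ i - x $ i\<close>
  contribute a minus sign.\<close>

definition box_prod ::
  "real \<Rightarrow> real^'n \<Rightarrow> real^'n \<Rightarrow> ('n \<Rightarrow> real poly) \<Rightarrow> ('n \<Rightarrow> real poly) \<Rightarrow> real^'n \<Rightarrow> real" where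
  "box_prod \<kappa> a b p q x = (\<Prod>i\<in>UNIV. expo \<kappa> (p i) (x $ i - a $ i) * expo \<kappa> (q i) (b $ i - x $ i))"

lemma box_prod_remove:
  "box_prod \<kappa> a b p q x = expo \<kappa> (p j) (x $ j - a $ j) * expo \<kappa> (q j) (b $ j - x $ j) *
     (\<Prod>i\<in>UNIV-{j}. expo \<kappa> (p i) (x $ i - a $ i) * expo \<kappa> (q i) (b $ i - x $ i))"
  unfolding box_prod_def by (rule prod.remove) auto

lemma box_prod_deriv:
  fixes x :: "real^'n"
  assumes k: "\<kappa> > 0"
  shows "\<exists>D. (box_prod \<kappa> a b p q has_derivative D) (at x) \<and>
    (\<forall>j. D (axis j 1) = box_prod \<kappa> a b (p(j := expo_deriv \<kappa> (p j))) q x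
                       + box_prod \<kappa> a b p (q(j := - expo_deriv \<kappa> (q j))) x)"
proof -
  define F where "F = (\<lambda>i (x::real^'n). expo \<kappa> (p i) (x $ i - a $ i) * expo \<kappa> (q i) (b $ i - x $ i))"
  define F' where "F' = (\<lambda>i x. expo \<kappa> (expo_deriv \<kappa> (p i)) (x $ i - a $ i) * expo \<kappa> (q i) (b $ i - x $ i)
      - expo \<kappa> (p i) (x $ i - a $ i) * expo \<kappa> (expo_deriv \<kappa> (q i)) (b $ i - x $ i))"
  have d: "(F i has_derivative (\<lambda>h. F' i x * h $ i)) (at x)" for i
  proof -
    have 1: "((\<lambda>x. expo \<kappa> r (x $ i - a $ i)) has_derivative (\<lambda>h. expo \<kappa> (expo_deriv \<kappa> r) (x $ i - a $ i) * h $ i)) (at x)" for r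
      by (rule has_derivative_compose[OF _ expo_has_derivative[OF k, unfolded has_field_derivative_def]])
         (auto intro!: derivative_eq_intros bounded_linear_imp_has_derivative bounded_linear_vec_nth)
    have 2: "((\<lambda>x. expo \<kappa> r (b $ i - x $ i)) has_derivative (\<lambda>h. expo \<kappa> (expo_deriv \<kappa> r) (b $ i - x $ i) * (- h $ i))) (at x)" for r
      by (rule has_derivative_compose[OF _ expo_has_derivative[OF k, unfolded has_field_derivative_def]])
         (auto intro!: derivative_eq_intros bounded_linear_imp_has_derivative bounded_linear_vec_nth)
    show ?thesis unfolding F_def F'_def
      by (rule has_derivative_eq_rhs[OF has_derivative_mult[OF 1 2]]) (auto simp: algebra_simps)
  qed
  have "((\<lambda>x. \<Prod>i\<in>UNIV. F i x) has_derivative (\<lambda>h. \<Sum>i\<in>UNIV. (F' i x * h $ i) * (\<Prod>j\<in>UNIV-{i}. F j x))) (at x)"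
    by (rule has_derivative_prod) (rule d)
  moreover have "(\<lambda>x. \<Prod>i\<in>UNIV. F i x) = box_prod \<kappa> a b p q" by (simp add: F_def box_prod_def fun_eq_iff)
  moreover have "(\<Sum>i\<in>UNIV. (F' i x * (axis j 1 :: real^'n) $ i) * (\<Prod>j\<in>UNIV-{i}. F j x))
     = box_prod \<kappa> a b (p(j := expo_deriv \<kappa> (p j))) q x + box_prod \<kappa> a b p (q(j := - expo_deriv \<kappa> (q j))) x" for j
  proof -
    have "(\<Sum>i\<in>UNIV. (F' i x * (axis j 1 :: real^'n) $ i) * (\<Prod>j\<in>UNIV-{i}. F j x)) = F' j x * (\<Prod>i\<in>UNIV-{j}. F i x)"
      by (subst sum.remove[of _ j]) (auto simp: axis_def)
    moreover have "(\<Prod>i\<in>UNIV-{j}. expo \<kappa> ((p(j := r)) i) (x $ i - a $ i) * expo \<kappa> ((q(j := s)) i) (b $ i - x $ i))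
        = (\<Prod>i\<in>UNIV-{j}. F i x)" for r s
      by (rule prod.cong) (auto simp: F_def)
    from this[of _ "q j"] this[of "p j"] show ?thesis
      unfolding box_prod_remove[of _ _ _ _ _ _ j] calculation
      by (simp add: F'_def expo_def algebra_simps)
  qed
  ultimately show ?thesis by (intro exI[of _ "\<lambda>h. \<Sum>i\<in>UNIV. (F' i x * h $ i) * (\<Prod>j\<in>UNIV-{i}. F j x)"]) simp
qed

text \<open>By the product rule a partial of one such product is a sum of two of them, so sums are
  what closure under differentiation requires.\<close>

inductive_set box_class :: "real \<Rightarrow> real^'n \<Rightarrow> real^'n \<Rightarrow> (real^'n \<Rightarrow> real) set" for \<kappa> a b where
  base: "box_prod \<kappa> a b p q \<in> box_class \<kappa> a b"
| add: "u \<in> box_class \<kappa> a b \<Longrightarrow> v \<in> box_class \<kappa> a b \<Longrightarrow> (\<lambda>x. u x + v x) \<in> box_class \<kappa> a b"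

lemma box_class_closed:
  assumes k: "\<kappa> > 0" and "u \<in> box_class \<kappa> a b"
  shows "(\<forall>x. u differentiable (at x)) \<and> (\<forall>e\<in>Basis. pd UNIV e u \<in> box_class \<kappa> a b)"
  using assms(2)
proof induction
  case (base p q)
  have "pd UNIV (axis j 1) (box_prod \<kappa> a b p q) = (\<lambda>x. box_prod \<kappa> a b (p(j := expo_deriv \<kappa> (p j))) q x
                       + box_prod \<kappa> a b p (q(j := - expo_deriv \<kappa> (q j))) x)" for j
  proof
    fix x
    obtain D where D: "(box_prod \<kappa> a b p q has_derivative D) (at x)"
      "\<forall>j. D (axis j 1) = box_prod \<kappa> a b (p(j := expo_deriv \<kappa> (p j))) q x
                       + box_prod \<kappa> a b p (q(j := - expo_deriv \<kappa> (q j))) x"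
      using box_prod_deriv[OF k] by blast
    show "pd UNIV (axis j 1) (box_prod \<kappa> a b p q) x = box_prod \<kappa> a b (p(j := expo_deriv \<kappa> (p j))) q x
                       + box_prod \<kappa> a b p (q(j := - expo_deriv \<kappa> (q j))) x"
      using pd_eq[OF thick_open[OF open_UNIV] _ D(1)] D(2) by simp
  qed
  then have "\<forall>e\<in>Basis. pd UNIV e (box_prod \<kappa> a b p q) \<in> box_class \<kappa> a b"
    by (auto simp: Basis_vec_real intro!: box_class.intros)
  then show ?case using box_prod_deriv[OF k, of a b p q] unfolding differentiable_def by blast
next
  case (add u v)
  have "pd UNIV e (\<lambda>x. u x + v x) = (\<lambda>x. pd UNIV e u x + pd UNIV e v x)" for e
  proof
    fix x
    show "pd UNIV e (\<lambda>x. u x + v x) x = pd UNIV e u x + pd UNIV e v x"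
      by (rule pd_add) (use add in auto)
  qed
  then show ?case using add by (auto intro: box_class.intros)
qed

definition box_bump :: "real \<Rightarrow> real^'n \<Rightarrow> real^'n \<Rightarrow> real^'n \<Rightarrow> real" where
  "box_bump \<kappa> a b = box_prod \<kappa> a b (\<lambda>_. 1) (\<lambda>_. 1)"

lemma smooth_box_bump: "\<kappa> > 0 \<Longrightarrow> smooth_on UNIV (box_bump \<kappa> a b)"
  unfolding box_bump_def
  by (rule smooth_on_class[of "box_class \<kappa> a b"], erule box_class_closed, assumption, rule box_class.base)

lemma box_bump_outside: "x \<notin> box a b \<Longrightarrow> box_bump \<kappa> a b x = 0"
proof -
  assume "x \<notin> box a b"
  then obtain i where "\<not> (a $ i < x $ i \<and> x $ i < b $ i)" by (auto simp: mem_box_cart)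
  then show ?thesis unfolding box_bump_def box_prod_remove[of _ _ _ _ _ _ i] by (auto simp: expo_def)
qed

lemma expo_1_bounds: "\<kappa> > 0 \<Longrightarrow> 0 \<le> expo \<kappa> 1 t \<and> expo \<kappa> 1 t \<le> 1"
  by (auto simp: expo_def)

lemma box_bump_bounds: "\<kappa> > 0 \<Longrightarrow> 0 \<le> box_bump \<kappa> a b x \<and> box_bump \<kappa> a b x \<le> 1"
  unfolding box_bump_def box_prod_def
  using expo_1_bounds by (intro conjI prod_nonneg prod_le_1) (auto intro: mult_le_one)

text \<open>Letting the exponent \<kappa> tend to 0 turns the bumps into the indicator of the open
  box, with values in [0,1] throughout, as dominated convergence needs.\<close>

lemma box_bump_limit:
  assumes "x \<in> box a b"
  shows "(\<lambda>k. box_bump (1 / real (Suc k)) a b x) \<longlonglongrightarrow> 1"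
proof -
  have e: "(\<lambda>k. expo (1 / real (Suc k)) 1 t) \<longlonglongrightarrow> 1" if "t > 0" for t
  proof -
    have "(\<lambda>k. exp (- (1 / real (Suc k)) / t)) \<longlonglongrightarrow> exp (- 0 / t)"
      by (intro tendsto_intros LIMSEQ_Suc[OF lim_1_over_n]) (use that in auto)
    then show ?thesis using that by (simp add: expo_def)
  qed
  have "(\<lambda>k. \<Prod>i\<in>UNIV. expo (1 / real (Suc k)) 1 (x $ i - a $ i) * expo (1 / real (Suc k)) 1 (b $ i - x $ i))
     \<longlonglongrightarrow> (\<Prod>i\<in>(UNIV::'a set). 1 * 1)"
    by (intro tendsto_intros e) (use assms in \<open>auto simp: mem_box_cart\<close>)
  then show ?thesis by (simp add: box_bump_def box_prod_def)
qed

lemma test_function_box_bump: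
  assumes "\<kappa> > 0" "cbox a b \<subseteq> interior \<Omega>"
  shows "test_function \<Omega> (box_bump \<kappa> a b)"
proof -
  have "{x. box_bump \<kappa> a b x \<noteq> 0} \<subseteq> cbox a b" using box_bump_outside box_subset_cbox by blast
  then have c: "closure {x. box_bump \<kappa> a b x \<noteq> 0} \<subseteq> cbox a b" by (simp add: closure_minimal closed_cbox)
  then have "compact (closure {x. box_bump \<kappa> a b x \<noteq> 0})"
    using compact_cbox closed_closure by (metis compact_Int_closed inf.absorb_iff2)
  then show ?thesis unfolding test_function_def using smooth_box_bump[OF assms(1)] assms c by blast
qed

section \<open>Smooth coefficients times test functions\<close>

lemma pds_zero_on_open:
  fixes f :: "'a::euclidean_space \<Rightarrow> real"
  assumes "open U" "\<And>x. x \<in> U \<Longrightarrow> f x = 0"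
  shows "x \<in> U \<Longrightarrow> pds UNIV es f x = 0"
proof (induction es arbitrary: x)
  case (Cons e es)
  have "((\<lambda>x. 0::real) has_derivative (\<lambda>h. 0)) (at x)" by simp
  then have "(pds UNIV es f has_derivative (\<lambda>h. 0)) (at x)"
    by (rule has_derivative_transform_within_open[OF _ assms(1) Cons.prems]) (use Cons.IH in auto)
  then show ?case using pd_eq[OF thick_open[OF open_UNIV], of x] by simp
qed (use assms in auto)

text \<open>Derivatives of the coefficient are taken within the domain and those of the test
  function on the whole space; the Leibniz rule keeps sums of such products closed under
  partials.\<close>

inductive_set prod_class :: "(real^'n) set \<Rightarrow> (real^'n \<Rightarrow> real) \<Rightarrow> (real^'n \<Rightarrow> real) \<Rightarrow> (real^'n \<Rightarrow> real) set"
  for \<Omega> a \<psi> where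
  base: "es \<in> lists Basis \<Longrightarrow> es' \<in> lists Basis \<Longrightarrow> (\<lambda>x. pds \<Omega> es a x * pds UNIV es' \<psi> x) \<in> prod_class \<Omega> a \<psi>"
| add: "u \<in> prod_class \<Omega> a \<psi> \<Longrightarrow> v \<in> prod_class \<Omega> a \<psi> \<Longrightarrow> (\<lambda>x. u x + v x) \<in> prod_class \<Omega> a \<psi>"

lemma smooth_onD:
  assumes "smooth_on S f" "es \<in> lists Basis"
  shows "pds S es f differentiable_on S" "continuous_on S (pds S es f)"
  using assms unfolding smooth_on_def Ck_on_def by (meson le_refl lessI)+

text \<open>The coefficient is controlled only on the domain. Off the support of the test function
  all derivatives of the latter vanish on an open set, so the product is smooth there whatever the
  values of the coefficient.\<close>

lemma test_function_mult:
  fixes \<Omega> :: "(real^'n) set"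
  assumes a: "smooth_on \<Omega> a" and \<psi>: "test_function \<Omega> \<psi>"
  shows "test_function \<Omega> (\<lambda>x. a x * \<psi> x)"
proof -
  define K where "K = closure {x. \<psi> x \<noteq> 0}"
  have K: "compact K" "K \<subseteq> interior \<Omega>" and s: "smooth_on UNIV \<psi>"
    using \<psi> by (auto simp: test_function_def K_def)
  have opK: "open (- K)" using K by (simp add: compact_imp_closed open_Compl)
  have z: "pds UNIV es \<psi> x = 0" if "x \<notin> K" for es x
    by (rule pds_zero_on_open[OF opK]) (use that closure_subset[of "{x. \<psi> x \<noteq> 0}"] in \<open>auto simp: K_def\<close>)
  have der: "((\<lambda>x. pds \<Omega> es a x * pds UNIV es' \<psi> x) has_derivative
      (\<lambda>h. \<Sum>e\<in>Basis. (h \<bullet> e) * (pds \<Omega> (e # es) a x * pds UNIV es' \<psi> x + pds \<Omega> es a x * pds UNIV (e # es') \<psi> x))) (at x)"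
    if es: "es \<in> lists Basis" "es' \<in> lists Basis" for es es' x
  proof (cases "x \<in> K")
    case True
    then have xi: "x \<in> interior \<Omega>" "x \<in> \<Omega>" using K interior_subset by auto
    have "pds \<Omega> es a differentiable (at x within \<Omega>)"
      using smooth_onD(1)[OF a es(1)] xi by (simp add: differentiable_on_def)
    from differentiable_pd[OF this] have 1: "(pds \<Omega> es a has_derivative (\<lambda>h. \<Sum>e\<in>Basis. (h \<bullet> e) * pds \<Omega> (e # es) a x)) (at x)"
      using at_within_interior[OF xi(1)] by simp
    have "pds UNIV es' \<psi> differentiable (at x)"
      using smooth_onD(1)[OF s es(2)] by (simp add: differentiable_on_def)
    from differentiable_pd[OF this]
    have 2: "(pds UNIV es' \<psi> has_derivative (\<lambda>h. \<Sum>e\<in>Basis. (h \<bullet> e) * pds UNIV (e # es') \<psi> x)) (at x)" by simp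
    show ?thesis
      by (rule has_derivative_eq_rhs[OF has_derivative_mult[OF 1 2]])
         (simp add: sum_distrib_left sum_distrib_right sum.distrib[symmetric] algebra_simps)
  next
    case False
    have "((\<lambda>x. 0::real) has_derivative (\<lambda>h. 0)) (at x)" by simp
    then have "((\<lambda>x. pds \<Omega> es a x * pds UNIV es' \<psi> x) has_derivative (\<lambda>h. 0)) (at x)"
      by (rule has_derivative_transform_within_open[OF _ opK]) (use False z in auto)
    then show ?thesis using z[OF False] by (simp del: pds.simps)
  qed
  have cl: "(\<forall>x. v differentiable (at x)) \<and> (\<forall>e\<in>Basis. pd UNIV e v \<in> prod_class \<Omega> a \<psi>)"
    if "v \<in> prod_class \<Omega> a \<psi>" for v
    using that
  proof induction
    case (base es es')
    have "pd UNIV e (\<lambda>x. pds \<Omega> es a x * pds UNIV es' \<psi> x) =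
       (\<lambda>x. pds \<Omega> (e # es) a x * pds UNIV es' \<psi> x + pds \<Omega> es a x * pds UNIV (e # es') \<psi> x)" if e: "e \<in> Basis" for e
    proof
      fix x
      have "(\<Sum>e'\<in>Basis. (e \<bullet> e') * (pds \<Omega> (e' # es) a x * pds UNIV es' \<psi> x + pds \<Omega> es a x * pds UNIV (e' # es') \<psi> x))
        = pds \<Omega> (e # es) a x * pds UNIV es' \<psi> x + pds \<Omega> es a x * pds UNIV (e # es') \<psi> x"
        using e by (subst sum.remove[of _ e]) (auto simp: inner_Basis intro!: sum.neutral split: if_splits)
      then show "pd UNIV e (\<lambda>x. pds \<Omega> es a x * pds UNIV es' \<psi> x) x =
        pds \<Omega> (e # es) a x * pds UNIV es' \<psi> x + pds \<Omega> es a x * pds UNIV (e # es') \<psi> x"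
        using pd_eq[OF thick_open[OF open_UNIV] _ der[OF base], of x e] by simp
    qed
    moreover have "(\<lambda>x. pds \<Omega> (e # es) a x * pds UNIV es' \<psi> x + pds \<Omega> es a x * pds UNIV (e # es') \<psi> x)
        \<in> prod_class \<Omega> a \<psi>" if "e \<in> Basis" for e
      using base that by (intro prod_class.intros) auto
    ultimately show ?case using der[OF base] by (auto simp: differentiable_def simp del: pds.simps)
  next
    case (add u v)
    have "pd UNIV e (\<lambda>x. u x + v x) = (\<lambda>x. pd UNIV e u x + pd UNIV e v x)" for e
    proof
      fix x
      show "pd UNIV e (\<lambda>x. u x + v x) x = pd UNIV e u x + pd UNIV e v x"
        by (rule pd_add) (use add in auto)
    qed
    then show ?case using add by (auto intro: prod_class.intros)
  qed
  have "smooth_on UNIV (\<lambda>x. a x * \<psi> x)"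
    by (rule smooth_on_class[of "prod_class \<Omega> a \<psi>"])
       (use cl prod_class.base[of "[]" "[]" \<Omega> a \<psi>] in auto)
  moreover have sub: "closure {x. a x * \<psi> x \<noteq> 0} \<subseteq> K" unfolding K_def by (rule closure_mono) auto
  then have "closure {x. a x * \<psi> x \<noteq> 0} \<subseteq> interior \<Omega>" using K by (meson order_trans)
  moreover have "compact (closure {x. a x * \<psi> x \<noteq> 0})"
    using compact_Int_closed[OF K(1) closed_closure[of "{x. a x * \<psi> x \<noteq> 0}"]] Int_absorb1[OF sub] by simp
  ultimately show ?thesis unfolding test_function_def by simp
qed

lemma has_derivative_test_function:
  assumes "test_function \<Omega> \<psi>"
  shows "(\<psi> has_derivative (\<lambda>h. \<Sum>i\<in>UNIV. h $ i * cpd UNIV i \<psi> x)) (at x)"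
proof -
  have "\<psi> differentiable (at x)"
    using smooth_onD(1)[of UNIV \<psi> "[]"] assms by (auto simp: test_function_def differentiable_on_def)
  from differentiable_pd[OF this] show ?thesis by (simp add: sum_Basis_vec inner_axis cpd_def)
qed

text \<open>Translation invariance makes the integral of every difference quotient vanish, and
  dominated convergence passes to the derivative. A bound on the derivative suffices; its continuity
  does not enter.\<close>

lemma integral_directional_derivative_zero:
  fixes F :: "'a::euclidean_space \<Rightarrow> real"
  assumes d: "\<And>x. (F has_derivative F' x) (at x)"
    and B: "\<And>x. \<bar>F' x e\<bar> \<le> B" and supp: "\<And>x. norm x > R \<Longrightarrow> F x = 0"
  shows "integrable lborel (\<lambda>x. F' x e)" "(LINT x|lborel. F' x e) = 0"
proof -
  have cF: "continuous_on UNIV F" using d has_derivative_continuous by (metis continuous_at_imp_continuous_on)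
  then have mF: "F \<in> borel_measurable borel" by (rule borel_measurable_continuous_onI)
  define s where "s = (\<lambda>n x. (F (x + (1 / real (Suc n)) *\<^sub>R e) - F x) * real (Suc n))"
  have ms: "s n \<in> borel_measurable lborel" for n unfolding s_def using mF by measurable
  have lim: "(\<lambda>n. s n x) \<longlonglongrightarrow> F' x e" for x
  proof -
    have "((\<lambda>t. (F (x + t *\<^sub>R e) - F x) / t) \<longlongrightarrow> F' x e) (at_right 0)"
      by (rule has_derivative_direction_limit[OF d, of 1]) auto
    moreover have "filterlim (\<lambda>n. 1 / real (Suc n)) (at_right 0) sequentially"
      by (rule tendsto_imp_filterlim_at_right[OF LIMSEQ_Suc[OF lim_1_over_n]]) auto
    ultimately show ?thesis using filterlim_compose by (fastforce simp: s_def)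
  qed
  \<comment> \<open>The increments are at most \<open>norm e\<close> long, so all quotients vanish
    outside the enlarged ball; inside it the mean value theorem bounds them by
    \<open>B\<close>.\<close>
  have bnd: "\<bar>s n x\<bar> \<le> B * indicator (cball 0 (R + norm e)) x" for n x
  proof (cases "x \<in> cball 0 (R + norm e)")
    case True
    define t where "t = 1 / real (Suc n)"
    have t: "t > 0" by (simp add: t_def)
    have B0: "0 \<le> B" using B[of 0] by linarith
    have "norm (F (x + t *\<^sub>R e) - F (x + 0 *\<^sub>R e)) \<le> B * norm (t - 0)"
    proof (rule differentiable_bound[of UNIV "\<lambda>s. F (x + s *\<^sub>R e)" "\<lambda>s r. F' (x + s *\<^sub>R e) (r *\<^sub>R e)"])
      fix r :: real
      show "((\<lambda>s. F (x + s *\<^sub>R e)) has_derivative (\<lambda>h. F' (x + r *\<^sub>R e) (h *\<^sub>R e))) (at r within UNIV)"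
        by (rule has_derivative_compose[OF _ d]) (auto intro!: derivative_eq_intros)
      show "onorm (\<lambda>h. F' (x + r *\<^sub>R e) (h *\<^sub>R e)) \<le> B"
      proof (rule onorm_bound[OF B0])
        fix h :: real
        have "F' (x + r *\<^sub>R e) (h *\<^sub>R e) = h * F' (x + r *\<^sub>R e) e"
          using linear_cmul[OF has_derivative_linear[OF d]] by simp
        then show "norm (F' (x + r *\<^sub>R e) (h *\<^sub>R e)) \<le> B * norm h"
          using mult_right_mono[OF B[of "x + r *\<^sub>R e"], of "\<bar>h\<bar>"] by (simp add: abs_mult mult.commute)
      qed
    qed auto
    then have "\<bar>F (x + t *\<^sub>R e) - F x\<bar> / t \<le> B" using t by (simp add: field_simps)
    moreover have "\<bar>s n x\<bar> = \<bar>F (x + t *\<^sub>R e) - F x\<bar> / t"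
      unfolding s_def t_def abs_mult by simp
    ultimately show ?thesis using True by simp
  next
    case False
    define t where "t = 1 / real (Suc n)"
    have "norm (t *\<^sub>R e) \<le> norm e" by (simp add: t_def field_simps)
    moreover have "norm x \<le> norm (x + t *\<^sub>R e) + norm (t *\<^sub>R e)" by (metis add_diff_cancel_right' norm_triangle_ineq4)
    ultimately have "norm (x + t *\<^sub>R e) > R" "norm x > R" using False by (auto simp: not_le intro: le_less_trans[of R "R + norm e"])
    then show ?thesis using supp False by (simp add: s_def t_def)
  qed
  have w: "integrable lborel (\<lambda>x. B * indicator (cball 0 (R + norm e)) x :: real)"
    by (intro integrable_mult_right integrable_real_indicator) (use emeasure_compact_finite[OF compact_cball, of 0 "R + norm e"] in auto)
  have mF': "(\<lambda>x. F' x e) \<in> borel_measurable lborel"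
    by (rule borel_measurable_LIMSEQ_real[OF lim]) (use ms in auto)
  show "integrable lborel (\<lambda>x. F' x e)"
    by (rule integrable_dominated_convergence[where s = s, OF mF' ms w]) (use lim bnd in auto)
  have c: "(\<lambda>n. LINT x|lborel. s n x) \<longlonglongrightarrow> (LINT x|lborel. F' x e)"
    by (rule integral_dominated_convergence[where s = s, OF mF' ms w]) (use lim bnd in auto)
  have "(LINT x|lborel. s n x) = 0" for n
  proof -
    have iF: "integrable lborel F"
    proof -
      have "integrable lborel (\<lambda>x. indicator (cball 0 R) x *\<^sub>R F x)"
        by (rule borel_integrable_compact) (auto intro: continuous_on_subset[OF cF])
      moreover have "(\<lambda>x. indicator (cball 0 R) x *\<^sub>R F x) = F"
        using supp by (auto simp: fun_eq_iff not_le split: split_indicator)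
      ultimately show ?thesis by simp
    qed
    have tr: "integrable lborel (\<lambda>x. F (c + x))" "(LINT x|lborel. F (c + x)) = (LINT x|lborel. F x)" for c
    proof -
      have "integrable (distr lborel borel ((+) c)) F" using iF by (simp add: lborel_distr_plus)
      then show "integrable lborel (\<lambda>x. F (c + x))" by (subst (asm) integrable_distr_eq) (use mF in auto)
      have "(LINT x|lborel. F x) = (LINT x|distr lborel borel ((+) c). F x)" by (simp add: lborel_distr_plus)
      also have "\<dots> = (LINT x|lborel. F (c + x))" by (rule integral_distr) (use mF in auto)
      finally show "(LINT x|lborel. F (c + x)) = (LINT x|lborel. F x)" by simp
    qed
    show ?thesis unfolding s_def using tr iF by (simp add: add.commute[of _ "_ *\<^sub>R e"])
  qed
  then show "(LINT x|lborel. F' x e) = 0" using c by (simp add: LIMSEQ_const_iff)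
qed

section \<open>Weak derivatives\<close>

lemma finite_measure_eqI_box:
  fixes M N :: "(real^'n) measure"
  assumes s: "sets M = sets borel" "sets N = sets borel"
    and f: "emeasure M UNIV \<noteq> \<infinity>"
    and b: "\<And>a b. emeasure M (box a b) = emeasure N (box a b)"
  shows "M = N"
proof (rule measure_eqI_generator_eq)
  let ?E = "range (\<lambda>(a, b). box a b::(real^'n) set)"
  let ?A = "\<lambda>n::nat. box (- (real n *\<^sub>R One)) (real n *\<^sub>R One) :: (real^'n) set"
  show "Int_stable ?E" by (auto simp: Int_stable_def box_Int_box)
  show "?E \<subseteq> Pow UNIV" "sets M = sigma_sets UNIV ?E" "sets N = sigma_sets UNIV ?E"
    using s by (simp_all add: borel_eq_box)
  show "range ?A \<subseteq> ?E" by auto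
  show "(\<Union>i. ?A i) = UNIV" unfolding UN_box_eq_UNIV by simp
  show "emeasure M (?A i) \<noteq> \<infinity>" for i
    using f emeasure_mono[of "?A i" UNIV M] s by (auto simp: top_unique)
qed (use b in auto)

text \<open>The positive and negative parts of \<open>w\<close> are densities of two finite measures
  that agree on boxes. Boxes generate the Borel sets and are stable under intersection, so the
  measures and hence the densities coincide.\<close>

lemma AE_zero_of_box_integrals:
  fixes w :: "real^'n \<Rightarrow> real"
  assumes w: "integrable lborel w" and z: "\<And>a b. (LINT x|lborel. indicator (box a b) x * w x) = 0"
  shows "AE x in lborel. w x = 0"
proof -
  let ?p = "\<lambda>x. ennreal (max 0 (w x))" and ?m = "\<lambda>x. ennreal (max 0 (- w x))"
  have [measurable]: "w \<in> borel_measurable borel" using w by auto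
  have pm: "integrable lborel (\<lambda>x. max 0 (w x))" "integrable lborel (\<lambda>x. max 0 (- w x))"
    using w by (auto intro!: integrable_max)
  have I: "emeasure (density lborel (\<lambda>x. ennreal (f x))) A = ennreal (LINT x|lborel. indicator A x * f x)"
    if f: "integrable lborel f" "\<And>x. f x \<ge> 0" and A: "A \<in> sets borel" for f :: "real^'n \<Rightarrow> real" and A
  proof -
    have [measurable]: "f \<in> borel_measurable borel" using f by auto
    have "emeasure (density lborel (\<lambda>x. ennreal (f x))) A = (\<integral>\<^sup>+x. ennreal (indicator A x * f x) \<partial>lborel)"
      using A by (subst emeasure_density) (auto intro!: nn_integral_cong split: split_indicator)
    also have "\<dots> = ennreal (LINT x|lborel. indicator A x * f x)"
      using A f integrable_real_mult_indicator[of A lborel f]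
      by (intro nn_integral_eq_integral) (auto simp: mult.commute)
    finally show ?thesis .
  qed
  have "density lborel ?p = density lborel ?m"
  proof (rule finite_measure_eqI_box)
    show "emeasure (density lborel ?p) UNIV \<noteq> \<infinity>" using I[OF pm(1)] by simp
    fix a b :: "real^'n"
    have i: "integrable lborel (\<lambda>x. indicator (box a b) x * max 0 (w x))"
      "integrable lborel (\<lambda>x. indicator (box a b) x * max 0 (- w x))"
      using integrable_real_mult_indicator[OF _ pm(1), of "box a b"]
        integrable_real_mult_indicator[OF _ pm(2), of "box a b"] by (auto simp: mult.commute)
    have "(LINT x|lborel. indicator (box a b) x * max 0 (w x)) - (LINT x|lborel. indicator (box a b) x * max 0 (- w x))
        = (LINT x|lborel. indicator (box a b) x * w x)"
      unfolding Bochner_Integration.integral_diff[OF i, symmetric]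
      by (rule Bochner_Integration.integral_cong) (auto simp: max_def)
    then show "emeasure (density lborel ?p) (box a b) = emeasure (density lborel ?m) (box a b)"
      using z I[OF pm(1)] I[OF pm(2)] by simp
  qed auto
  then have "AE x in lborel. ?p x = ?m x"
    by (subst (asm) sigma_finite_measure.density_unique_iff[OF sigma_finite_lborel]) auto
  then show ?thesis
  proof eventually_elim
    fix x assume "ennreal (max 0 (w x)) = ennreal (max 0 (- w x))"
    then have "max 0 (w x) = max 0 (- w x)" by (subst (asm) ennreal_inj) auto
    then show "w x = 0" by (simp add: max_def split: if_splits)
  qed
qed

context smooth_domain
begin

lemma locally_integrableI: "integrable \<mu> u \<Longrightarrow> locally_integrable \<Omega> u"
  unfolding locally_integrable_def set_integrable_def
proof (intro conjI allI impI)
  fix K assume u: "integrable \<mu> u" and K: "compact K \<and> K \<subseteq> interior \<Omega>"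
  then have "K \<in> sets borel" "K \<subseteq> \<Omega>" using interior_subset[of \<Omega>] by (auto simp: borel_compact)
  then have "K \<in> sets \<mu>" unfolding sets_unif by (auto simp: sets_restrict_space_iff)
  then show "integrable \<mu> (\<lambda>x. indicator K x *\<^sub>R u x)" using u by (intro integrable_mult_indicator)
qed auto

lemma integrable_li_mult:
  assumes u: "locally_integrable \<Omega> u" and K: "compact K" "K \<subseteq> interior \<Omega>"
    and m: "\<psi> \<in> borel_measurable borel" and B: "\<And>x. \<bar>\<psi> x\<bar> \<le> B" and z: "\<And>x. x \<notin> K \<Longrightarrow> \<psi> x = 0"
  shows "integrable \<mu> (\<lambda>x. u x * \<psi> x)"
proof (rule Bochner_Integration.integrable_bound)
  have "integrable \<mu> (\<lambda>x. indicator K x *\<^sub>R u x)" using u K by (auto simp: locally_integrable_def set_integrable_def)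
  then show "integrable \<mu> (\<lambda>x. B * norm (indicator K x *\<^sub>R u x))" by (intro integrable_mult_right integrable_norm)
  have "\<psi> \<in> borel_measurable \<mu>" unfolding measurable_unif_iff using m by (intro measurable_restrict_space1) auto
  then show "(\<lambda>x. u x * \<psi> x) \<in> borel_measurable \<mu>" using u by (auto simp: locally_integrable_def)
  have "B \<ge> 0" using B[of 0] by linarith
  show "AE x in \<mu>. norm (u x * \<psi> x) \<le> norm (B * norm (indicator K x *\<^sub>R u x))"
  proof (rule AE_I2)
    fix x show "norm (u x * \<psi> x) \<le> norm (B * norm (indicator K x *\<^sub>R u x))"
      using mult_right_mono[OF B[of x], of "\<bar>u x\<bar>"] \<open>B \<ge> 0\<close> z
      by (cases "x \<in> K") (auto simp: abs_mult mult.commute)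
  qed
qed

lemma test_function_props:
  assumes "test_function \<Omega> \<psi>"
  obtains K B where "compact K" "K \<subseteq> interior \<Omega>" "\<And>x. x \<notin> K \<Longrightarrow> \<psi> x = 0"
    "\<And>i x. x \<notin> K \<Longrightarrow> cpd UNIV i \<psi> x = 0" "\<And>x. \<bar>\<psi> x\<bar> \<le> B" "\<And>i x. \<bar>cpd UNIV i \<psi> x\<bar> \<le> B"
    "\<psi> \<in> borel_measurable borel" "\<And>i. cpd UNIV i \<psi> \<in> borel_measurable borel"
proof -
  define K where "K = closure {x. \<psi> x \<noteq> 0}"
  have K: "compact K" "K \<subseteq> interior \<Omega>" using assms by (auto simp: test_function_def K_def)
  have sm: "smooth_on UNIV \<psi>" using assms by (simp add: test_function_def)
  have opK: "open (- K)" using K by (simp add: compact_imp_closed open_Compl)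
  have z: "\<And>x. x \<notin> K \<Longrightarrow> \<psi> x = 0" using closure_subset[of "{x. \<psi> x \<noteq> 0}"] by (auto simp: K_def)
  have z': "\<And>i x. x \<notin> K \<Longrightarrow> cpd UNIV i \<psi> x = 0"
    using pds_zero_on_open[OF opK, of \<psi> _ "[axis i 1]" for i] z by (simp add: cpd_def)
  have c: "continuous_on UNIV \<psi>" and c': "continuous_on UNIV (cpd UNIV i \<psi>)" for i
    using smooth_onD(2)[OF sm, of "[]"] smooth_onD(2)[OF sm, of "[axis i 1]"] by (auto simp: cpd_def Basis_vec_real)
  have bd: "\<exists>B. \<forall>x. \<bar>g x\<bar> \<le> B" if "continuous_on UNIV g" "\<And>x. x \<notin> K \<Longrightarrow> g x = 0" for g :: "real^'n \<Rightarrow> real"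
  proof -
    have "bounded (g ` K)"
      by (rule compact_imp_bounded[OF compact_continuous_image[OF continuous_on_subset[OF that(1)] K(1)]]) simp
    then obtain B where B: "\<And>x. x \<in> K \<Longrightarrow> \<bar>g x\<bar> \<le> B" unfolding bounded_iff by auto
    have "\<bar>g x\<bar> \<le> max B 0" for x using that(2)[of x] B[of x] by (cases "x \<in> K") auto
    then show ?thesis by blast
  qed
  obtain B0 where B0: "\<And>x. \<bar>\<psi> x\<bar> \<le> B0" using bd[OF c z] by blast
  have "\<forall>i. \<exists>B. \<forall>x. \<bar>cpd UNIV i \<psi> x\<bar> \<le> B" using bd[OF c' z'] by blast
  then obtain Bi where Bi: "\<And>i x. \<bar>cpd UNIV i \<psi> x\<bar> \<le> Bi i" by metis
  define B where "B = max B0 (Max (range Bi))"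
  have "\<bar>\<psi> x\<bar> \<le> B" "\<bar>cpd UNIV i \<psi> x\<bar> \<le> B" for i x
    using B0[of x] Bi[of i x] Max_ge[of "range Bi" "Bi i"] by (auto simp: B_def le_max_iff_disj intro: order_trans)
  then show ?thesis
    using that[OF K z z' _ _ borel_measurable_continuous_onI[OF c] borel_measurable_continuous_onI[OF c'], of B] by blast
qed

lemma integrable_test:
  assumes "test_function \<Omega> \<psi>" "locally_integrable \<Omega> u"
  shows "integrable \<mu> (\<lambda>x. u x * \<psi> x)" "integrable \<mu> (\<lambda>x. u x * cpd UNIV i \<psi> x)"
proof -
  obtain K B where p: "compact K" "K \<subseteq> interior \<Omega>" "\<And>x. x \<notin> K \<Longrightarrow> \<psi> x = 0"
    "\<And>i x. x \<notin> K \<Longrightarrow> cpd UNIV i \<psi> x = 0" "\<And>x. \<bar>\<psi> x\<bar> \<le> B" "\<And>i x. \<bar>cpd UNIV i \<psi> x\<bar> \<le> B"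
    "\<psi> \<in> borel_measurable borel" "\<And>i. cpd UNIV i \<psi> \<in> borel_measurable borel"
    using test_function_props[OF assms(1)] by blast
  show "integrable \<mu> (\<lambda>x. u x * \<psi> x)" by (rule integrable_li_mult[OF assms(2) p(1,2,7,5,3)])
  show "integrable \<mu> (\<lambda>x. u x * cpd UNIV i \<psi> x)" by (rule integrable_li_mult[OF assms(2) p(1,2,8,6,4)])
qed

text \<open>Bumps converge to indicators of boxes, so the integral of \<open>w\<close> over every
  box compactly inside the domain vanishes. Countably many such boxes cover the interior, and the
  boundary is null.\<close>

lemma AE_zero_of_test_integrals:
  assumes w: "locally_integrable \<Omega> w" and z: "\<And>\<psi>. test_function \<Omega> \<psi> \<Longrightarrow> (LINT x|\<mu>. w x * \<psi> x) = 0"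
  shows "AE x in \<mu>. w x = 0"
proof -
  have boxes: "AE x in lborel. indicator (box l r) x * w x = 0" if lr: "cbox l r \<subseteq> interior \<Omega>" for l r
  proof -
    have sub: "cbox l r \<subseteq> \<Omega>" using lr interior_subset by blast
    have i1: "integrable \<mu> (\<lambda>x. w x * indicator (cbox l r) x)"
      by (rule integrable_li_mult[OF w compact_cbox lr, where B = 1]) (auto split: split_indicator)
    have "integrable lborel (\<lambda>x. (indicator \<Omega> x * (w x * indicator (cbox l r) x)) * indicator (box l r) x)"
      by (rule integrable_real_mult_indicator[OF _ i1[unfolded integral_unif(2)]]) simp
    moreover have "(\<lambda>x. (indicator \<Omega> x * (w x * indicator (cbox l r) x)) * indicator (box l r) x) = (\<lambda>x. indicator (box l r) x * w x)"
      using sub box_subset_cbox[of l r] by (auto simp: fun_eq_iff split: split_indicator)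
    ultimately have i: "integrable lborel (\<lambda>x. indicator (box l r) x * w x)" by simp
    show ?thesis
    proof (rule AE_zero_of_box_integrals[OF i])
      fix a b :: "real^'n"
      have "\<exists>a' b'. box a b \<inter> box l r = box a' b'" unfolding box_Int_box by blast
      then obtain a' b' where ab: "box a b \<inter> box l r = box a' b'" by blast
      show "(LINT x|lborel. indicator (box a b) x * (indicator (box l r) x * w x)) = 0"
      proof (cases "box a' b' = {}")
        case True
        then have "(\<lambda>x. indicator (box a b) x * (indicator (box l r) x * w x)) = (\<lambda>x. 0)"
          using ab by (auto simp: fun_eq_iff split: split_indicator)
        then show ?thesis by (simp only: Bochner_Integration.integral_zero)
      next
        case False
        \<comment> \<open>The closed box stays inside the domain only because the open one is
          nonempty, hence has it as closure; then its bump is a test function.\<close>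
        have c: "cbox a' b' \<subseteq> interior \<Omega>"
          proof -
          have "box a' b' \<subseteq> cbox l r" using ab box_subset_cbox by blast
          then have "closure (box a' b') \<subseteq> cbox l r" by (simp add: closure_minimal closed_cbox)
          then show ?thesis using lr closure_box[OF False] by simp
        qed
        define s where "s = (\<lambda>k x. w x * box_bump (1 / real (Suc k)) a' b' x)"
        have t: "test_function \<Omega> (box_bump (1 / real (Suc k)) a' b')" for k
          by (rule test_function_box_bump[OF _ c]) simp
        have i1: "integrable \<mu> (\<lambda>x. norm (w x * indicator (cbox a' b') x))"
          by (intro integrable_norm integrable_li_mult[OF w compact_cbox c, where B = 1]) (auto split: split_indicator)
        have i2: "integrable \<mu> (\<lambda>x. w x * indicator (box a' b') x)"
          by (rule integrable_li_mult[OF w compact_cbox c, where B = 1]) (use box_subset_cbox in \<open>auto split: split_indicator\<close>)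
        have "(\<lambda>k. LINT x|\<mu>. s k x) \<longlonglongrightarrow> (LINT x|\<mu>. w x * indicator (box a' b') x)"
        proof (rule integral_dominated_convergence[where s = s, OF _ _ i1])
          show "(\<lambda>x. w x * indicator (box a' b') x) \<in> borel_measurable \<mu>" using i2 by auto
          show "s k \<in> borel_measurable \<mu>" for k unfolding s_def using integrable_test(1)[OF t w] by auto
          show "AE x in \<mu>. (\<lambda>k. s k x) \<longlonglongrightarrow> w x * indicator (box a' b') x"
          proof (rule AE_I2)
            fix x show "(\<lambda>k. s k x) \<longlonglongrightarrow> w x * indicator (box a' b') x"
              unfolding s_def by (intro tendsto_mult tendsto_const)
                (use box_bump_limit[of x a' b'] box_bump_outside[of x a' b'] in \<open>auto split: split_indicator\<close>)
          qed
          show "AE x in \<mu>. norm (s k x) \<le> norm (w x * indicator (cbox a' b') x)" for k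
          proof (rule AE_I2)
            fix x
            have "\<bar>box_bump (1 / real (Suc k)) a' b' x\<bar> \<le> indicator (cbox a' b') x"
              using box_bump_bounds[of "1 / real (Suc k)" a' b' x] box_bump_outside[of x a' b'] box_subset_cbox[of a' b']
              by (cases "x \<in> box a' b'") (auto split: split_indicator)
            then show "norm (s k x) \<le> norm (w x * indicator (cbox a' b') x)"
              unfolding s_def by (auto simp: abs_mult intro: mult_left_mono)
          qed
        qed
        moreover have "(LINT x|\<mu>. s k x) = 0" for k unfolding s_def by (rule z[OF t])
        ultimately have "(LINT x|\<mu>. w x * indicator (box a' b') x) = 0" by (simp add: LIMSEQ_const_iff)
        then have 0: "(LINT x|lborel. indicator \<Omega> x * (w x * indicator (box a' b') x)) = 0"
          unfolding integral_unif(1) using measure_dom_pos by simp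
        have "(\<lambda>x. indicator \<Omega> x * (w x * indicator (box a' b') x)) = (\<lambda>x. indicator (box a b) x * (indicator (box l r) x * w x))"
          using ab c interior_subset[of \<Omega>] box_subset_cbox[of a' b'] by (auto simp: fun_eq_iff split: split_indicator)
        then show ?thesis using 0 by (simp only:)
      qed
    qed
  qed
  obtain D where D: "countable D" "\<And>X. X \<in> D \<Longrightarrow> \<exists>a b. X = box a b \<and> cbox a b \<subseteq> interior \<Omega>" "interior \<Omega> \<subseteq> \<Union>D"
  proof -
    \<comment> \<open>Rational corners make the cover countable, so the exceptional null sets of its
      boxes can be united.\<close>
    define D where "D = {X. \<exists>a b. X = box a b \<and> cbox a b \<subseteq> interior \<Omega> \<and> (\<forall>i. a $ i \<in> \<rat>) \<and> (\<forall>i. b $ i \<in> \<rat>)}"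
    have "countable {a::real^'n. \<forall>i. a $ i \<in> \<rat>}"
    proof -
      have "countable ({f. \<forall>i::'n. f i \<in> \<rat>} :: ('n \<Rightarrow> real) set)"
        using countable_PiE[of "UNIV::'n set" "\<lambda>_. \<rat>"] countable_rat by (simp add: PiE_UNIV_domain Pi_def)
      moreover have "{a::real^'n. \<forall>i. a $ i \<in> \<rat>} \<subseteq> vec_lambda ` {f. \<forall>i::'n. f i \<in> \<rat>}"
        by (auto intro!: image_eqI[of _ vec_lambda "vec_nth _"])
      ultimately show ?thesis by (meson countable_image countable_subset)
    qed
    then have "countable ((\<lambda>(a, b). box a b) ` ({a::real^'n. \<forall>i. a $ i \<in> \<rat>} \<times> {a::real^'n. \<forall>i. a $ i \<in> \<rat>}))" by auto
    moreover have "D \<subseteq> (\<lambda>(a, b). box a b) ` ({a::real^'n. \<forall>i. a $ i \<in> \<rat>} \<times> {a::real^'n. \<forall>i. a $ i \<in> \<rat>})"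
      by (auto simp: D_def)
    ultimately have "countable D" by (rule countable_subset[rotated])
    moreover have "interior \<Omega> \<subseteq> \<Union>D"
    proof
      fix x assume "x \<in> interior \<Omega>"
      then obtain e where e: "e > 0" "ball x e \<subseteq> interior \<Omega>" using open_contains_ball by blast
      obtain a b where ab: "\<forall>i\<in>Basis. a \<bullet> i \<in> \<rat> \<and> b \<bullet> i \<in> \<rat>" "x \<in> box a b" "box a b \<subseteq> ball x (e/2)"
        using rational_boxes[of "e/2" x] e by auto
      have "cbox a b \<subseteq> cball x (e/2)"
      proof -
        have "box a b \<noteq> {}" using ab by blast
        moreover have "box a b \<subseteq> cball x (e/2)" using ab ball_subset_cball by blast
        then have "closure (box a b) \<subseteq> cball x (e/2)" by (simp add: closure_minimal)
        ultimately show ?thesis using closure_box by metis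
      qed
      also have "\<dots> \<subseteq> ball x e" using e by auto
      finally have "cbox a b \<subseteq> interior \<Omega>" using e by auto
      then have "box a b \<in> D" unfolding D_def
        using ab(1) by (intro CollectI exI[of _ a] exI[of _ b]) (simp add: Basis_vec_real inner_axis)
      then show "x \<in> \<Union>D" using ab by blast
    qed
    moreover have "\<exists>a b. X = box a b \<and> cbox a b \<subseteq> interior \<Omega>" if "X \<in> D" for X using that unfolding D_def by blast
    ultimately show ?thesis by (intro that[of D])
  qed
  have "AE x in lborel. \<forall>X\<in>D. indicator X x * w x = 0"
    by (rule AE_ball_countable'[OF _ D(1)]) (use D(2) boxes in blast)
  then have "AE x in lborel. x \<in> interior \<Omega> \<longrightarrow> w x = 0"
  proof eventually_elim
    fix x assume x: "\<forall>X\<in>D. indicator X x * w x = 0"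
    show "x \<in> interior \<Omega> \<longrightarrow> w x = 0"
    proof
      assume "x \<in> interior \<Omega>"
      then obtain X where "X \<in> D" "x \<in> X" using D(3) by blast
      then show "w x = 0" using x by force
    qed
  qed
  then have "AE x in \<mu>. x \<in> interior \<Omega> \<longrightarrow> w x = 0" unfolding AE_unif by auto
  with AE_interior show ?thesis by eventually_elim auto
qed

section \<open>Calculus of weak partial derivatives\<close>

lemma locally_integrable_diff:
  assumes "locally_integrable \<Omega> u" "locally_integrable \<Omega> v"
  shows "locally_integrable \<Omega> (\<lambda>x. u x - v x)"
  using assms unfolding locally_integrable_def by (auto intro: set_integral_diff(1))

lemma locally_integrable_add:
  assumes "locally_integrable \<Omega> u" "locally_integrable \<Omega> v"
  shows "locally_integrable \<Omega> (\<lambda>x. u x + v x)"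
  using assms unfolding locally_integrable_def by (auto intro: set_integral_add(1))

lemma weak_partial_unique:
  assumes "weak_partial \<Omega> i u v" "weak_partial \<Omega> i u v'"
  shows "AE x in \<mu>. v x = v' x"
proof -
  have l: "locally_integrable \<Omega> v" "locally_integrable \<Omega> v'" using assms by (auto simp: weak_partial_def)
  have "AE x in \<mu>. v x - v' x = 0"
  proof (rule AE_zero_of_test_integrals[OF locally_integrable_diff[OF l]])
    fix \<psi> assume t: "test_function \<Omega> \<psi>"
    then show "(LINT x|\<mu>. (v x - v' x) * \<psi> x) = 0"
      using assms integrable_test(1)[OF t l(1)] integrable_test(1)[OF t l(2)]
      unfolding weak_partial_def by (simp add: left_diff_distrib)
  qed
  then show ?thesis by eventually_elim simp
qed

lemma weak_partial_wpd: "weak_partial \<Omega> i u v \<Longrightarrow> weak_partial \<Omega> i u (wpd \<Omega> i u)"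
  unfolding wpd_def by (rule someI[of "\<lambda>v. weak_partial \<Omega> i u v"])

lemma wpd_AE: "weak_partial \<Omega> i u v \<Longrightarrow> AE x in \<mu>. wpd \<Omega> i u x = v x"
  using weak_partial_unique weak_partial_wpd by blast

lemma locally_integrable_cong_AE:
  assumes "locally_integrable \<Omega> u" "AE x in \<mu>. u x = u' x" "u' \<in> borel_measurable \<mu>"
  shows "locally_integrable \<Omega> u'"
  unfolding locally_integrable_def
proof (intro conjI allI impI)
  fix K assume K: "compact K \<and> K \<subseteq> interior \<Omega>"
  then have "K \<in> sets borel" "K \<subseteq> \<Omega>" using interior_subset[of \<Omega>] by (auto simp: borel_compact)
  then have KM: "K \<in> sets \<mu>" unfolding sets_unif by (auto simp: sets_restrict_space_iff)
  have "integrable \<mu> (\<lambda>x. indicator K x *\<^sub>R u x)" using assms(1) K by (auto simp: locally_integrable_def set_integrable_def)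
  then show "set_integrable \<mu> K u'" unfolding set_integrable_def
    by (rule integrable_cong_AE_imp) (use assms KM in \<open>auto intro: borel_measurable_scaleR borel_measurable_indicator\<close>)
qed (rule assms)

lemma weak_partial_cong_AE:
  assumes w: "weak_partial \<Omega> i u v" and u: "AE x in \<mu>. u x = u' x" "u' \<in> borel_measurable \<mu>"
  shows "weak_partial \<Omega> i u' v"
  unfolding weak_partial_def
proof (intro conjI allI impI)
  show l: "locally_integrable \<Omega> u'"
    using w u by (auto simp: weak_partial_def intro: locally_integrable_cong_AE)
  show "locally_integrable \<Omega> v" using w by (simp add: weak_partial_def)
  fix \<psi> assume t: "test_function \<Omega> \<psi>"
  have "(LINT x|\<mu>. u x * cpd UNIV i \<psi> x) = (LINT x|\<mu>. u' x * cpd UNIV i \<psi> x)"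
    using w u integrable_test(2)[OF t l] integrable_test(2)[OF t, of u]
    by (intro integral_cong_AE) (auto simp: weak_partial_def)
  then show "(LINT x|\<mu>. u' x * cpd UNIV i \<psi> x) = - (LINT x|\<mu>. v x * \<psi> x)"
    using w t by (simp add: weak_partial_def)
qed

lemma weak_partial_diff:
  assumes "weak_partial \<Omega> i u v" "weak_partial \<Omega> i u' v'"
  shows "weak_partial \<Omega> i (\<lambda>x. u x - u' x) (\<lambda>x. v x - v' x)"
  unfolding weak_partial_def
proof (intro conjI allI impI)
  have l: "locally_integrable \<Omega> u" "locally_integrable \<Omega> u'" "locally_integrable \<Omega> v" "locally_integrable \<Omega> v'"
    using assms by (auto simp: weak_partial_def)
  show "locally_integrable \<Omega> (\<lambda>x. u x - u' x)" "locally_integrable \<Omega> (\<lambda>x. v x - v' x)"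
    by (intro locally_integrable_diff l)+
  fix \<psi> assume t: "test_function \<Omega> \<psi>"
  show "(LINT x|\<mu>. (u x - u' x) * cpd UNIV i \<psi> x) = - (LINT x|\<mu>. (v x - v' x) * \<psi> x)"
    using assms t integrable_test[OF t l(1)] integrable_test[OF t l(2)] integrable_test[OF t l(3)] integrable_test[OF t l(4)]
    by (simp add: weak_partial_def left_diff_distrib)
qed

text \<open>Multiplied by a test function, \<open>u\<close> extends by zero to a function
  differentiable on the whole space with bounded derivative in direction \<open>axis i 1\<close>;
  the integral of that derivative vanishes, which is integration by parts.\<close>

lemma weak_partial_classical:
  assumes cu: "continuous_on \<Omega> u" and cv: "continuous_on \<Omega> v"
    and d: "\<And>x. x \<in> interior \<Omega> \<Longrightarrow> (u has_derivative D x) (at x)"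
    and v: "\<And>x. x \<in> interior \<Omega> \<Longrightarrow> D x (axis i 1) = v x"
  shows "weak_partial \<Omega> i u v"
  unfolding weak_partial_def
proof (intro conjI allI impI)
  have int: "integrable \<mu> u" "integrable \<mu> v"
    using continuous_bounded[OF cu] continuous_bounded[OF cv]
    by (metis integrable_bounded borel_measurable_continuous cu cv)+
  then show l: "locally_integrable \<Omega> u" "locally_integrable \<Omega> v" by (auto intro: locally_integrableI)
  fix \<psi> assume t: "test_function \<Omega> \<psi>"
  obtain K B where K: "compact K" "K \<subseteq> interior \<Omega>" "\<And>x. x \<notin> K \<Longrightarrow> \<psi> x = 0"
    "\<And>i x. x \<notin> K \<Longrightarrow> cpd UNIV i \<psi> x = 0" "\<And>x. \<bar>\<psi> x\<bar> \<le> B" "\<And>i x. \<bar>cpd UNIV i \<psi> x\<bar> \<le> B"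
    "\<psi> \<in> borel_measurable borel" "\<And>i. cpd UNIV i \<psi> \<in> borel_measurable borel"
    using test_function_props[OF t] by blast
  have opK: "open (- K)" using K by (simp add: compact_imp_closed open_Compl)
  define F' where "F' = (\<lambda>x h. if x \<in> K then u x * (\<Sum>i\<in>UNIV. h $ i * cpd UNIV i \<psi> x) + D x h * \<psi> x else 0)"
  have dF: "((\<lambda>x. u x * \<psi> x) has_derivative F' x) (at x)" for x
  proof (cases "x \<in> K")
    case True
    then have "((\<lambda>x. u x * \<psi> x) has_derivative (\<lambda>h. u x * (\<Sum>i\<in>UNIV. h $ i * cpd UNIV i \<psi> x) + D x h * \<psi> x)) (at x)"
      using K(2) by (intro has_derivative_mult d has_derivative_test_function[OF t]) auto
    then show ?thesis using True by (simp add: F'_def)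
  next
    case False
    have "((\<lambda>x. 0::real) has_derivative F' x) (at x)" using False by (simp add: F'_def)
    then show ?thesis
      by (rule has_derivative_transform_within_open[OF _ opK]) (use False K in auto)
  qed
  have F'e: "F' x (axis i 1) = indicator \<Omega> x * (u x * cpd UNIV i \<psi> x + v x * \<psi> x)" for x
  proof (cases "x \<in> K")
    case True
    have "(\<Sum>k\<in>UNIV. (axis i 1 :: real^'n) $ k * cpd UNIV k \<psi> x) = cpd UNIV i \<psi> x"
      by (subst sum.remove[of _ i]) (auto simp: axis_def)
    then show ?thesis using True K(2) v interior_subset[of \<Omega>] by (auto simp: F'_def indicator_def)
  next
    case False
    then show ?thesis using K by (simp add: F'_def)
  qed
  obtain Bu where Bu: "Bu > 0" "\<And>x. x \<in> \<Omega> \<Longrightarrow> norm (u x) \<le> Bu" using continuous_bounded[OF cu] by blast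
  obtain Bv where Bv: "Bv > 0" "\<And>x. x \<in> \<Omega> \<Longrightarrow> norm (v x) \<le> Bv" using continuous_bounded[OF cv] by blast
  have B0: "B \<ge> 0" using K(5)[of 0] by linarith
  have bF: "\<bar>F' x (axis i 1)\<bar> \<le> Bu * B + Bv * B" for x
  proof (cases "x \<in> \<Omega>")
    case True
    have "\<bar>u x * cpd UNIV i \<psi> x + v x * \<psi> x\<bar> \<le> \<bar>u x\<bar> * \<bar>cpd UNIV i \<psi> x\<bar> + \<bar>v x\<bar> * \<bar>\<psi> x\<bar>"
      by (metis abs_mult abs_triangle_ineq)
    also have "\<dots> \<le> Bu * B + Bv * B"
      using Bu Bv K True B0 by (intro add_mono mult_mono) auto
    finally show ?thesis using True by (simp add: F'e)
  qed (use Bu Bv B0 F'e in simp)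
  obtain R where R: "\<And>x. x \<in> K \<Longrightarrow> norm x \<le> R" using K(1) compact_imp_bounded bounded_iff by metis
  have "u x * \<psi> x = 0" if "norm x > R" for x using R[of x] K(3)[of x] that by (cases "x \<in> K") auto
  then have "(LINT x|lborel. F' x (axis i 1)) = 0"
    by (rule integral_directional_derivative_zero(2)[where R = R, OF dF bF])
  then have "(LINT x|\<mu>. u x * cpd UNIV i \<psi> x + v x * \<psi> x) = 0" unfolding integral_unif(1) F'e by simp
  then show "(LINT x|\<mu>. u x * cpd UNIV i \<psi> x) = - (LINT x|\<mu>. v x * \<psi> x)"
    using integrable_test(2)[OF t l(1)] integrable_test(1)[OF t l(2)] by simp
qed

lemma smooth_on_cpd:
  assumes "smooth_on \<Omega> a"
  shows "continuous_on \<Omega> a" "continuous_on \<Omega> (cpd \<Omega> i a)"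
    "x \<in> \<Omega> \<Longrightarrow> (a has_derivative (\<lambda>h. \<Sum>i\<in>UNIV. h $ i * cpd \<Omega> i a x)) (at x within \<Omega>)"
proof -
  show "continuous_on \<Omega> a" "continuous_on \<Omega> (cpd \<Omega> i a)"
    using smooth_onD(2)[OF assms, of "[]"] smooth_onD(2)[OF assms, of "[axis i 1]"] by (auto simp: cpd_def Basis_vec_real)
  assume x: "x \<in> \<Omega>"
  have "a differentiable (at x within \<Omega>)" using smooth_onD(1)[OF assms, of "[]"] x by (auto simp: differentiable_on_def)
  from differentiable_pd[OF this]
  show "(a has_derivative (\<lambda>h. \<Sum>i\<in>UNIV. h $ i * cpd \<Omega> i a x)) (at x within \<Omega>)"
    by (simp add: sum_Basis_vec inner_axis cpd_def)
qed

lemma locally_integrable_mult: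
  assumes a: "continuous_on \<Omega> a" and u: "locally_integrable \<Omega> u"
  shows "locally_integrable \<Omega> (\<lambda>x. a x * u x)"
  unfolding locally_integrable_def
proof (intro conjI allI impI)
  have m: "a \<in> borel_measurable \<mu>" by (rule borel_measurable_continuous[OF a])
  show m': "(\<lambda>x. a x * u x) \<in> borel_measurable \<mu>" using m u by (auto simp: locally_integrable_def)
  fix K assume K: "compact K \<and> K \<subseteq> interior \<Omega>"
  then have "K \<in> sets borel" "K \<subseteq> \<Omega>" using interior_subset[of \<Omega>] by (auto simp: borel_compact)
  then have KM: "K \<in> sets \<mu>" unfolding sets_unif by (auto simp: sets_restrict_space_iff)
  obtain B where B: "B > 0" "\<And>x. x \<in> \<Omega> \<Longrightarrow> norm (a x) \<le> B" using continuous_bounded[OF a] by blast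
  have i: "integrable \<mu> (\<lambda>x. indicator K x *\<^sub>R u x)" using u K by (auto simp: locally_integrable_def set_integrable_def)
  show "set_integrable \<mu> K (\<lambda>x. a x * u x)" unfolding set_integrable_def
  proof (rule Bochner_Integration.integrable_bound[of _ "\<lambda>x. B * norm (indicator K x *\<^sub>R u x)"])
    show "integrable \<mu> (\<lambda>x. B * norm (indicator K x *\<^sub>R u x))" using i by (intro integrable_mult_right integrable_norm)
    show "(\<lambda>x. indicator K x *\<^sub>R (a x * u x)) \<in> borel_measurable \<mu>"
      using m' KM by (intro borel_measurable_scaleR borel_measurable_indicator)
    show "AE x in \<mu>. norm (indicator K x *\<^sub>R (a x * u x)) \<le> norm (B * norm (indicator K x *\<^sub>R u x))"
    proof (rule AE_I2)
      fix x assume "x \<in> space \<mu>"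
      then have "norm (a x) \<le> B" using B by simp
      then show "norm (indicator K x *\<^sub>R (a x * u x)) \<le> norm (B * norm (indicator K x *\<^sub>R u x))"
        using B(1) by (auto simp: abs_mult mult_right_mono split: split_indicator)
    qed
  qed
qed

text \<open>The smooth coefficient is moved to the test function, \<open>a\<close> times a test
  function being one again. This is what expands the divergence form of the operator for weak
  derivatives.\<close>

lemma weak_partial_mult:
  assumes a: "smooth_on \<Omega> a" and u: "weak_partial \<Omega> i u v"
  shows "weak_partial \<Omega> i (\<lambda>x. a x * u x) (\<lambda>x. cpd \<Omega> i a x * u x + a x * v x)"
  unfolding weak_partial_def
proof (intro conjI allI impI)
  have l: "locally_integrable \<Omega> u" "locally_integrable \<Omega> v" using u by (auto simp: weak_partial_def)
  note l1 = locally_integrable_mult[OF smooth_on_cpd(1)[OF a] l(1)]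
    and l2 = locally_integrable_mult[OF smooth_on_cpd(1)[OF a] l(2)]
    and l3 = locally_integrable_mult[OF smooth_on_cpd(2)[OF a] l(1)]
  show "locally_integrable \<Omega> (\<lambda>x. a x * u x)" by (rule l1)
  show "locally_integrable \<Omega> (\<lambda>x. cpd \<Omega> i a x * u x + a x * v x)"
    by (rule locally_integrable_add[OF l3 l2])
  fix \<psi> assume t: "test_function \<Omega> \<psi>"
  note t' = test_function_mult[OF a t]
  have cp: "cpd UNIV i (\<lambda>x. a x * \<psi> x) x = a x * cpd UNIV i \<psi> x + cpd \<Omega> i a x * \<psi> x" if x: "x \<in> interior \<Omega>" for x
  proof -
    have xO: "x \<in> \<Omega>" using x interior_subset by blast
    have 1: "(a has_derivative (\<lambda>h. \<Sum>i\<in>UNIV. h $ i * cpd \<Omega> i a x)) (at x)"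
      using smooth_on_cpd(3)[OF a xO] at_within_interior[OF x] by simp
    have s: "(\<Sum>k\<in>UNIV. (axis i 1 :: real^'n) $ k * f k) = f i" for f :: "'n \<Rightarrow> real"
      by (subst sum.remove[of _ i]) (auto simp: axis_def)
    show ?thesis unfolding cpd_def[of UNIV]
      using pd_eq[OF thick_open[OF open_UNIV] UNIV_I has_derivative_mult[OF 1 has_derivative_test_function[OF t]], of "axis i 1"]
      by (simp add: s cpd_def)
  qed
  have "AE x in \<mu>. u x * cpd UNIV i (\<lambda>x. a x * \<psi> x) x = (a x * u x) * cpd UNIV i \<psi> x + (cpd \<Omega> i a x * u x) * \<psi> x"
    using AE_interior by eventually_elim (subst cp, assumption, simp add: algebra_simps)
  then have "(LINT x|\<mu>. u x * cpd UNIV i (\<lambda>x. a x * \<psi> x) x) = (LINT x|\<mu>. (a x * u x) * cpd UNIV i \<psi> x + (cpd \<Omega> i a x * u x) * \<psi> x)"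
    using integrable_test(2)[OF t' l(1)] integrable_test(2)[OF t l1] integrable_test(1)[OF t l3]
    by (intro integral_cong_AE borel_measurable_add borel_measurable_integrable) auto
  moreover have "(LINT x|\<mu>. u x * cpd UNIV i (\<lambda>x. a x * \<psi> x) x) = - (LINT x|\<mu>. v x * (a x * \<psi> x))"
    using u t' by (simp add: weak_partial_def)
  moreover have "(\<lambda>x. v x * (a x * \<psi> x)) = (\<lambda>x. (a x * v x) * \<psi> x)" by (simp add: fun_eq_iff mult_ac)
  ultimately show "(LINT x|\<mu>. a x * u x * cpd UNIV i \<psi> x) = - (LINT x|\<mu>. (cpd \<Omega> i a x * u x + a x * v x) * \<psi> x)"
    using integrable_test(2)[OF t l1] integrable_test(1)[OF t l3] integrable_test(1)[OF t l2]
    by (simp add: distrib_right)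
qed

end

section \<open>Jets of Sobolev functions\<close>

text \<open>The divergence form with the outer derivative carried out by the Leibniz rule: one term
  falls on the coefficient, one on the gradient, and the result is linear in the jet.\<close>

definition Lj ::
  "(real^'n) set \<Rightarrow> ('n \<Rightarrow> 'n \<Rightarrow> real^'n \<Rightarrow> real) \<Rightarrow> ('n \<Rightarrow> real^'n \<Rightarrow> real) \<Rightarrow> (real^'n \<Rightarrow> real)
     \<Rightarrow> real^'n \<Rightarrow> 'n::finite jet \<Rightarrow> real" where
  "Lj \<Omega> a c d x p =
     - (\<Sum>i\<in>UNIV. \<Sum>j\<in>UNIV. cpd \<Omega> i (a i j) x * fst (snd p) $ j + a i j x * snd (snd p) $ i $ j)
     + (\<Sum>i\<in>UNIV. c i x * fst (snd p) $ i) - d x * fst p"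

lemma norm_vec_squared: "(norm (v::'a::real_normed_vector^'n))\<^sup>2 = (\<Sum>i\<in>UNIV. (norm (v $ i))\<^sup>2)"
  by (simp add: norm_vec_def L2_set_def sum_nonneg)

lemma norm_jet_squared:
  fixes p :: "'n::finite jet"
  shows "(norm p)\<^sup>2 = (fst p)\<^sup>2 + (\<Sum>i\<in>UNIV. (fst (snd p) $ i)\<^sup>2) + (\<Sum>i\<in>UNIV. \<Sum>j\<in>UNIV. (snd (snd p) $ i $ j)\<^sup>2)"
  by (cases p) (auto simp: norm_Pair norm_vec_squared intro!: add_nonneg_nonneg sum_nonneg)

lemma borel_measurable_vec_lambda:
  assumes "\<And>i. (\<lambda>x. f x i) \<in> borel_measurable M"
  shows "(\<lambda>x. (\<chi> i. f x i) :: ('a::euclidean_space)^'n) \<in> borel_measurable M"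
proof -
  have "(\<lambda>x. (\<chi> i. f x i) \<bullet> b) \<in> borel_measurable M" if b: "b \<in> Basis" for b :: "'a^'n"
  proof -
    obtain i u where "b = axis i u" using b unfolding Basis_vec_def by blast
    then show ?thesis using assms by (simp add: inner_axis)
  qed
  then show ?thesis by (subst borel_measurable_euclidean_space) blast
qed

context smooth_domain
begin

lemma L2_cong_AE:
  assumes "u \<in> L2 \<Omega>" "AE x in \<mu>. u x = u' x" "u' \<in> borel_measurable \<mu>"
  shows "u' \<in> L2 \<Omega>"
proof -
  have "integrable \<mu> (\<lambda>x. (u x)\<^sup>2)" using assms by (simp add: L2_def)
  then have "integrable \<mu> (\<lambda>x. (u' x)\<^sup>2)"
    by (rule integrable_cong_AE_imp) (use assms in auto)
  then show ?thesis using assms by (simp add: L2_def)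
qed

lemma weak_partial_measurable:
  "weak_partial \<Omega> i u v \<Longrightarrow> u \<in> borel_measurable \<mu>" "weak_partial \<Omega> i u v \<Longrightarrow> v \<in> borel_measurable \<mu>"
  by (auto simp: weak_partial_def locally_integrable_def)

lemma H1_wpd:
  assumes "u \<in> H1 \<Omega>"
  shows "weak_partial \<Omega> i u (wpd \<Omega> i u)" "wpd \<Omega> i u \<in> L2 \<Omega>" "u \<in> L2 \<Omega>" "u \<in> borel_measurable \<mu>"
proof -
  obtain v where v: "v \<in> L2 \<Omega>" "weak_partial \<Omega> i u v" using assms by (auto simp: H1_def)
  show w: "weak_partial \<Omega> i u (wpd \<Omega> i u)" using v weak_partial_wpd by blast
  have "AE x in \<mu>. v x = wpd \<Omega> i u x" using wpd_AE[OF v(2)] by eventually_elim simp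
  then show "wpd \<Omega> i u \<in> L2 \<Omega>" using L2_cong_AE v(1) weak_partial_measurable(2)[OF w] by blast
  show "u \<in> L2 \<Omega>" "u \<in> borel_measurable \<mu>" using assms by (auto simp: H1_def L2_def)
qed

lemma H1_cong_AE:
  assumes "u \<in> H1 \<Omega>" "AE x in \<mu>. u x = u' x" "u' \<in> borel_measurable \<mu>"
  shows "u' \<in> H1 \<Omega>"
  using assms L2_cong_AE weak_partial_cong_AE unfolding H1_def by blast

lemma L2_diff:
  assumes "u \<in> L2 \<Omega>" "v \<in> L2 \<Omega>"
  shows "(\<lambda>x. u x - v x) \<in> L2 \<Omega>"
proof -
  have "integrable \<mu> (\<lambda>x. (u x - v x)\<^sup>2)"
  proof (rule Bochner_Integration.integrable_bound)
    show "integrable \<mu> (\<lambda>x. 2 * (u x)\<^sup>2 + 2 * (v x)\<^sup>2)" using assms by (auto simp: L2_def)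
    have "(s - t)\<^sup>2 \<le> 2 * s\<^sup>2 + 2 * t\<^sup>2" for s t :: real
      using zero_le_power2[of "s + t"] by (simp add: power2_eq_square algebra_simps)
    then show "AE x in \<mu>. norm ((u x - v x)\<^sup>2) \<le> norm (2 * (u x)\<^sup>2 + 2 * (v x)\<^sup>2)" by simp
  qed (use assms in \<open>auto simp: L2_def\<close>)
  then show ?thesis using assms by (auto simp: L2_def)
qed

lemma H1_diff:
  assumes "u \<in> H1 \<Omega>" "v \<in> H1 \<Omega>"
  shows "(\<lambda>x. u x - v x) \<in> H1 \<Omega>"
  unfolding H1_def
proof (intro CollectI conjI allI)
  note U = H1_wpd[OF assms(1)] and V = H1_wpd[OF assms(2)]
  show "(\<lambda>x. u x - v x) \<in> L2 \<Omega>" by (rule L2_diff[OF U(3) V(3)])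
  show "\<exists>w\<in>L2 \<Omega>. weak_partial \<Omega> i (\<lambda>x. u x - v x) w" for i
    by (intro bexI[where x = "\<lambda>x. wpd \<Omega> i u x - wpd \<Omega> i v x"] weak_partial_diff L2_diff U V)
qed

lemma H2_D:
  assumes "u \<in> H2 \<Omega>"
  shows "u \<in> L2 \<Omega>" "wpd \<Omega> i u \<in> L2 \<Omega>" "wpd \<Omega> i (wpd \<Omega> j u) \<in> L2 \<Omega>"
    "weak_partial \<Omega> i u (wpd \<Omega> i u)" "weak_partial \<Omega> i (wpd \<Omega> j u) (wpd \<Omega> i (wpd \<Omega> j u))"
  using assms H1_wpd unfolding H2_def by auto

text \<open>\<open>wpd\<close> is a choice and hence linear only almost everywhere. The second
  derivatives are chosen for a chosen version of the first, so each level needs its own transfer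
  along equality almost everywhere.\<close>

lemma H2_diff:
  assumes u: "u \<in> H2 \<Omega>" and v: "v \<in> H2 \<Omega>"
  shows "(\<lambda>x. u x - v x) \<in> H2 \<Omega>"
    "AE x in \<mu>. jet (wpd \<Omega>) (\<lambda>x. u x - v x) x = jet (wpd \<Omega>) u x - jet (wpd \<Omega>) v x"
proof -
  let ?w = "\<lambda>x. u x - v x"
  note U = H2_D[OF u] and V = H2_D[OF v]
  have w1: "weak_partial \<Omega> i ?w (\<lambda>x. wpd \<Omega> i u x - wpd \<Omega> i v x)" for i by (rule weak_partial_diff[OF U(4) V(4)])
  have e1: "AE x in \<mu>. wpd \<Omega> i ?w x = wpd \<Omega> i u x - wpd \<Omega> i v x" for i by (rule wpd_AE[OF w1])
  have m: "wpd \<Omega> i ?w \<in> borel_measurable \<mu>" for i using weak_partial_measurable(2)[OF weak_partial_wpd[OF w1]] .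
  have e1': "AE x in \<mu>. wpd \<Omega> i u x - wpd \<Omega> i v x = wpd \<Omega> i ?w x" for i using e1[of i] by eventually_elim simp
  have h: "wpd \<Omega> i ?w \<in> H1 \<Omega>" for i
    by (rule H1_cong_AE[OF H1_diff e1' m]) (use u v in \<open>auto simp: H2_def\<close>)
  then show "?w \<in> H2 \<Omega>" using u v H1_diff by (auto simp: H2_def)
  have w2: "weak_partial \<Omega> i (wpd \<Omega> j ?w) (\<lambda>x. wpd \<Omega> i (wpd \<Omega> j u) x - wpd \<Omega> i (wpd \<Omega> j v) x)" for i j
    by (rule weak_partial_cong_AE[OF weak_partial_diff[OF U(5) V(5)] e1' m])
  have e2: "AE x in \<mu>. wpd \<Omega> i (wpd \<Omega> j ?w) x = wpd \<Omega> i (wpd \<Omega> j u) x - wpd \<Omega> i (wpd \<Omega> j v) x" for i j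
    by (rule wpd_AE[OF w2])
  have "AE x in \<mu>. (\<forall>i. wpd \<Omega> i ?w x = wpd \<Omega> i u x - wpd \<Omega> i v x) \<and>
      (\<forall>i j. wpd \<Omega> i (wpd \<Omega> j ?w) x = wpd \<Omega> i (wpd \<Omega> j u) x - wpd \<Omega> i (wpd \<Omega> j v) x)"
    using e1 e2 by (simp add: AE_conj_iff AE_all_countable)
  then show "AE x in \<mu>. jet (wpd \<Omega>) ?w x = jet (wpd \<Omega>) u x - jet (wpd \<Omega>) v x"
    by eventually_elim (simp add: jet_def grad_def prod_eq_iff vec_eq_iff)
qed

text \<open>The bridge from classical to weak derivatives: continuity up to the boundary gives
  square integrability, and integration by parts uses the derivatives at interior points.\<close>

lemma has_jet_H2:
  assumes J: "has_jet \<Omega> u J"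
  shows "u \<in> H2 \<Omega>" "AE x in \<mu>. jet (wpd \<Omega>) u x = J x"
proof -
  have cJ: "continuous_on \<Omega> J" using J by (simp add: has_jet_def)
  have c1: "continuous_on \<Omega> (\<lambda>x. fst (snd (J x)) $ i)" and c2: "continuous_on \<Omega> (\<lambda>x. snd (snd (J x)) $ i $ j)" for i j
    by (intro continuous_intros cJ)+
  have cu: "continuous_on \<Omega> u"
    by (rule continuous_on_cong[THEN iffD1, OF refl _ continuous_on_fst[OF cJ]]) (use has_jet_D(1)[OF J] in auto)
  have bl: "g \<in> L2 \<Omega>" if g: "continuous_on \<Omega> g" for g :: "real^'n \<Rightarrow> real"
  proof -
    have "continuous_on \<Omega> (\<lambda>x. (g x)\<^sup>2)" using g by (intro continuous_intros)
    then have "integrable \<mu> (\<lambda>x. (g x)\<^sup>2)"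
      using continuous_bounded integrable_bounded borel_measurable_continuous by metis
    then show ?thesis using borel_measurable_continuous[OF g] by (simp add: L2_def)
  qed
  have w1: "weak_partial \<Omega> i u (\<lambda>x. fst (snd (J x)) $ i)" for i
  proof (rule weak_partial_classical[OF cu c1])
    fix x assume x: "x \<in> interior \<Omega>"
    then show "(u has_derivative (\<lambda>h. fst (snd (J x)) \<bullet> h)) (at x)"
      using has_jet_D(2)[OF J] at_within_interior[OF x] interior_subset by (metis subsetD)
    show "fst (snd (J x)) \<bullet> axis i 1 = fst (snd (J x)) $ i" by (simp add: inner_axis)
  qed
  have w2: "weak_partial \<Omega> i (\<lambda>x. fst (snd (J x)) $ j) (\<lambda>x. snd (snd (J x)) $ i $ j)" for i j
  proof (rule weak_partial_classical[OF c1 c2])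
    fix x assume x: "x \<in> interior \<Omega>"
    then show "((\<lambda>y. fst (snd (J y)) $ j) has_derivative (\<lambda>h. \<Sum>i\<in>UNIV. snd (snd (J x)) $ i $ j * h $ i)) (at x)"
      using has_jet_D(3)[OF J, of x j] at_within_interior[OF x] interior_subset[of \<Omega>] by auto
    show "(\<Sum>k\<in>UNIV. snd (snd (J x)) $ k $ j * (axis i 1 :: real^'n) $ k) = snd (snd (J x)) $ i $ j"
      by (subst sum.remove[of _ i]) (auto simp: axis_def)
  qed
  have e1: "AE x in \<mu>. wpd \<Omega> i u x = fst (snd (J x)) $ i" for i by (rule wpd_AE[OF w1])
  have e1': "AE x in \<mu>. fst (snd (J x)) $ i = wpd \<Omega> i u x" for i using e1[of i] by eventually_elim simp
  have m: "wpd \<Omega> i u \<in> borel_measurable \<mu>" for i using weak_partial_measurable(2)[OF weak_partial_wpd[OF w1]] .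
  have w2': "weak_partial \<Omega> i (wpd \<Omega> j u) (\<lambda>x. snd (snd (J x)) $ i $ j)" for i j
    by (rule weak_partial_cong_AE[OF w2 e1' m])
  have h: "wpd \<Omega> j u \<in> H1 \<Omega>" for j
    unfolding H1_def using L2_cong_AE[OF bl[OF c1] e1' m] bl[OF c2] w2' by blast
  have "u \<in> H1 \<Omega>" unfolding H1_def using bl[OF cu] bl[OF c1] w1 by blast
  then show "u \<in> H2 \<Omega>" using h by (auto simp: H2_def)
  have e2: "AE x in \<mu>. wpd \<Omega> i (wpd \<Omega> j u) x = snd (snd (J x)) $ i $ j" for i j by (rule wpd_AE[OF w2'])
  have "AE x in \<mu>. (\<forall>i. wpd \<Omega> i u x = fst (snd (J x)) $ i) \<and>
      (\<forall>i j. wpd \<Omega> i (wpd \<Omega> j u) x = snd (snd (J x)) $ i $ j)"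
    using e1 e2 by (simp add: AE_conj_iff AE_all_countable)
  with AE_interior show "AE x in \<mu>. jet (wpd \<Omega>) u x = J x"
    by eventually_elim (use has_jet_D(1)[OF J] interior_subset[of \<Omega>] in
      \<open>auto simp: jet_def grad_def prod_eq_iff vec_eq_iff\<close>)
qed

lemma jet_measurable:
  assumes "u \<in> H2 \<Omega>"
  shows "jet (wpd \<Omega>) u \<in> borel_measurable \<mu>"
proof -
  have m: "u \<in> borel_measurable \<mu>" "wpd \<Omega> i u \<in> borel_measurable \<mu>" "wpd \<Omega> i (wpd \<Omega> j u) \<in> borel_measurable \<mu>" for i j
    using H2_D[OF assms] by (auto simp: L2_def)
  show ?thesis unfolding jet_def grad_def
    by (intro borel_measurable_Pair borel_measurable_vec_lambda m)
qed

lemma jet_square_integrable: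
  assumes "u \<in> H2 \<Omega>"
  shows "integrable \<mu> (\<lambda>x. (norm (jet (wpd \<Omega>) u x))\<^sup>2)"
  using H2_D[OF assms] unfolding norm_jet_squared
  by (intro Bochner_Integration.integrable_add Bochner_Integration.integrable_sum)
     (auto simp: jet_def grad_def L2_def)

text \<open>The Euclidean norm on jets is the one whose L^2 norm is exactly the H^2 norm, each entry
  of the Hessian being counted once.\<close>

lemma H2_norm_eq:
  assumes "u \<in> H2 \<Omega>"
  shows "H2_norm \<Omega> u = ennreal (sqrt (LINT x|\<mu>. (norm (jet (wpd \<Omega>) u x))\<^sup>2))"
proof -
  have sq: "(L2_norm \<Omega> v)\<^sup>2 = (LINT x|\<mu>. (v x)\<^sup>2)" for v
    by (simp add: L2_norm_def L2_inner_def power2_eq_square[symmetric] integral_nonneg_AE)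
  have i: "integrable \<mu> (\<lambda>x. (u x)\<^sup>2)" "integrable \<mu> (\<lambda>x. (wpd \<Omega> i u x)\<^sup>2)"
    "integrable \<mu> (\<lambda>x. (wpd \<Omega> i (wpd \<Omega> j u) x)\<^sup>2)" for i j using H2_D[OF assms] by (auto simp: L2_def)
  have "(LINT x|\<mu>. (norm (jet (wpd \<Omega>) u x))\<^sup>2) = (L2_norm \<Omega> u)\<^sup>2 + (\<Sum>i\<in>UNIV. (L2_norm \<Omega> (wpd \<Omega> i u))\<^sup>2)
             + (\<Sum>i\<in>UNIV. \<Sum>j\<in>UNIV. (L2_norm \<Omega> (wpd \<Omega> i (wpd \<Omega> j u)))\<^sup>2)"
    unfolding norm_jet_squared sq using i
    by (simp add: jet_def grad_def)
  then show ?thesis using assms by (simp add: H2_norm_def)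
qed

lemma H2_norm_le:
  assumes J: "has_jet \<Omega> u J" and B: "\<And>x. x \<in> \<Omega> \<Longrightarrow> norm (J x) \<le> B" "B \<ge> 0"
  shows "H2_norm \<Omega> u \<le> ennreal B"
proof -
  note h = has_jet_H2[OF J]
  have "(LINT x|\<mu>. (norm (jet (wpd \<Omega>) u x))\<^sup>2) \<le> (LINT x|\<mu>. B\<^sup>2)"
  proof (rule integral_mono_AE[OF jet_square_integrable[OF h(1)]])
    show "AE x in \<mu>. (norm (jet (wpd \<Omega>) u x))\<^sup>2 \<le> B\<^sup>2"
      using h(2) AE_space by eventually_elim (use B in \<open>auto intro: power_mono\<close>)
  qed auto
  also have "\<dots> = B\<^sup>2" using P.prob_space by simp
  finally show ?thesis unfolding H2_norm_eq[OF h(1)] using B(2) by (intro ennreal_leI real_le_lsqrt) auto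
qed

end

section \<open>The elliptic operator as a function of the jet\<close>

locale pde = smooth_domain \<Omega> for \<Omega> :: "(real^'n) set" +
  fixes a :: "'n \<Rightarrow> 'n \<Rightarrow> real^'n \<Rightarrow> real" and c :: "'n \<Rightarrow> real^'n \<Rightarrow> real" and d :: "real^'n \<Rightarrow> real"
    and f :: "real \<Rightarrow> real^'n \<Rightarrow> real" and g :: "real^'n \<Rightarrow> real"
  assumes a: "\<And>i j. smooth_on \<Omega> (a i j)" and c: "\<And>i. smooth_on \<Omega> (c i)" and d: "smooth_on \<Omega> d"
    and f: "bounded_nonlinearity f"
    and g: "g \<in> borel_measurable \<mu>" "bounded (g ` \<Omega>)"
begin

abbreviation "Lx \<equiv> Lj \<Omega> a c d"

lemma L_op_classical:
  assumes J: "has_jet \<Omega> u J" and x: "x \<in> \<Omega>"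
  shows "L_op (cpd \<Omega>) a c d u x = Lx x (J x)"
proof -
  have "cpd \<Omega> i (\<lambda>y. a i j y * cpd \<Omega> j u y) x = cpd \<Omega> i (a i j) x * fst (snd (J x)) $ j + a i j x * snd (snd (J x)) $ i $ j" for i j
  proof -
    have s: "(\<Sum>k\<in>UNIV. (axis i 1 :: real^'n) $ k * F k) = F i" for F :: "'n \<Rightarrow> real"
      by (subst sum.remove[of _ i]) (auto simp: axis_def)
    have s': "(\<Sum>k\<in>UNIV. F k * (axis i 1 :: real^'n) $ k) = F i" for F :: "'n \<Rightarrow> real"
      by (subst sum.remove[of _ i]) (auto simp: axis_def)
    have "cpd \<Omega> i (\<lambda>y. a i j y * cpd \<Omega> j u y) x = pd \<Omega> (axis i 1) (\<lambda>y. a i j y * fst (snd (J y)) $ j) x"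
      unfolding cpd_def[of \<Omega> i] by (rule pd_cong[OF x]) (simp add: has_jet_cpd(1)[OF thick J])
    also have "pd \<Omega> (axis i 1) (\<lambda>y. a i j y * fst (snd (J y)) $ j) x
        = cpd \<Omega> i (a i j) x * fst (snd (J x)) $ j + a i j x * snd (snd (J x)) $ i $ j"
      using pd_eq[OF thick x has_derivative_mult[OF smooth_on_cpd(3)[OF a x] has_jet_D(3)[OF J x]], of "axis i 1"]
      by (simp add: s s')
    finally show ?thesis .
  qed
  then show ?thesis
    unfolding L_op_def Lj_def using has_jet_D(1)[OF J x] has_jet_cpd(1)[OF thick J x] by simp
qed

text \<open>Each product in the divergence form has the weak derivative given by the Leibniz rule;
  the finitely many exceptional null sets are united.\<close>

lemma L_op_weak:
  assumes u: "u \<in> H2 \<Omega>"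
  shows "AE x in \<mu>. L_op (wpd \<Omega>) a c d u x = Lx x (jet (wpd \<Omega>) u x)"
proof -
  have "AE x in \<mu>. wpd \<Omega> i (\<lambda>y. a i j y * wpd \<Omega> j u y) x = cpd \<Omega> i (a i j) x * wpd \<Omega> j u x + a i j x * wpd \<Omega> i (wpd \<Omega> j u) x" for i j
    by (rule wpd_AE[OF weak_partial_mult[OF a H2_D(5)[OF u]]])
  then have "AE x in \<mu>. \<forall>i j. wpd \<Omega> i (\<lambda>y. a i j y * wpd \<Omega> j u y) x = cpd \<Omega> i (a i j) x * wpd \<Omega> j u x + a i j x * wpd \<Omega> i (wpd \<Omega> j u) x"
    by (simp add: AE_all_countable)
  then show ?thesis by eventually_elim (simp add: L_op_def Lj_def jet_def grad_def)
qed

lemma Lx_linear: "Lx x (p + q) = Lx x p + Lx x q" "Lx x (p - q) = Lx x p - Lx x q" "Lx x (k *\<^sub>R p) = k * Lx x p"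
proof -
  show "Lx x (p + q) = Lx x p + Lx x q" by (simp add: Lj_def distrib_left sum.distrib)
  show "Lx x (p - q) = Lx x p - Lx x q" by (simp add: Lj_def right_diff_distrib sum_subtractf sum.distrib)
  show "Lx x (k *\<^sub>R p) = k * Lx x p"
    by (simp add: Lj_def right_diff_distrib distrib_left sum_distrib_left mult.left_commute)
qed

lemma Lx_measurable_comp:
  assumes Y: "Y \<in> measurable M \<mu>" and p: "p \<in> borel_measurable M"
  shows "(\<lambda>z. Lx (Y z) (p z)) \<in> borel_measurable M"
proof -
  have c1: "(\<lambda>x. fst (snd (p x)) $ j) \<in> borel_measurable M" "(\<lambda>x. snd (snd (p x)) $ i $ j) \<in> borel_measurable M"
    "(\<lambda>x. fst (p x)) \<in> borel_measurable M" for i j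
    by (rule borel_measurable_continuous_on[OF _ p], intro continuous_intros)+
  have c2: "(\<lambda>z. u (Y z)) \<in> borel_measurable M" if "continuous_on \<Omega> u" for u :: "real^'n \<Rightarrow> real"
    by (rule measurable_compose[OF Y borel_measurable_continuous[OF that]])
  show ?thesis unfolding Lj_def
    by (intro borel_measurable_diff borel_measurable_add borel_measurable_uminus borel_measurable_sum
          borel_measurable_times c1 c2 smooth_on_cpd(1,2) a c d)
qed

lemma Lx_measurable: "p \<in> borel_measurable \<mu> \<Longrightarrow> (\<lambda>x. Lx x (p x)) \<in> borel_measurable \<mu>"
  by (rule Lx_measurable_comp) simp_all

lemma Lx_bounded: "\<exists>C>0. \<forall>x\<in>\<Omega>. \<forall>p. \<bar>Lx x p\<bar> \<le> C * norm p"
proof -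
  have "\<exists>B. \<forall>x\<in>\<Omega>. \<bar>u x\<bar> \<le> B" if "continuous_on \<Omega> u" for u :: "real^'n \<Rightarrow> real"
    using continuous_bounded[OF that] by (metis real_norm_def)
  then have b: "\<forall>i j. \<exists>B. \<forall>x\<in>\<Omega>. \<bar>cpd \<Omega> i (a i j) x\<bar> \<le> B" "\<forall>i j. \<exists>B. \<forall>x\<in>\<Omega>. \<bar>a i j x\<bar> \<le> B"
    "\<forall>i. \<exists>B. \<forall>x\<in>\<Omega>. \<bar>c i x\<bar> \<le> B" "\<exists>B. \<forall>x\<in>\<Omega>. \<bar>d x\<bar> \<le> B"
    using smooth_on_cpd(1,2) a c d by blast+
  obtain B1 where B1: "\<And>i j x. x \<in> \<Omega> \<Longrightarrow> \<bar>cpd \<Omega> i (a i j) x\<bar> \<le> B1 i j" using b(1) by metis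
  obtain B2 where B2: "\<And>i j x. x \<in> \<Omega> \<Longrightarrow> \<bar>a i j x\<bar> \<le> B2 i j" using b(2) by metis
  obtain B3 where B3: "\<And>i x. x \<in> \<Omega> \<Longrightarrow> \<bar>c i x\<bar> \<le> B3 i" using b(3) by metis
  obtain B4 where B4: "\<And>x. x \<in> \<Omega> \<Longrightarrow> \<bar>d x\<bar> \<le> B4" using b(4) by metis
  define C where "C = (\<Sum>i\<in>UNIV. \<Sum>j\<in>UNIV. B1 i j + B2 i j) + (\<Sum>i\<in>UNIV. B3 i) + B4"
  have le: "\<bar>Lx x p\<bar> \<le> C * norm p" if x: "x \<in> \<Omega>" for x p
  proof -
    have n: "\<bar>fst p\<bar> \<le> norm p" "\<bar>fst (snd p) $ j\<bar> \<le> norm p" "\<bar>snd (snd p) $ i $ j\<bar> \<le> norm p" for i j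
      using norm_le_triple[of p] component_le_norm_cart[of "fst (snd p)" j]
        component_le_norm_cart[of "snd (snd p) $ i" j] Finite_Cartesian_Product.norm_nth_le[of "snd (snd p)" i] by linarith+
    have m: "\<bar>s * t\<bar> \<le> B * norm p" if "\<bar>s\<bar> \<le> B" "\<bar>t\<bar> \<le> norm p" for s t B
      unfolding abs_mult using that by (intro mult_mono) auto
    have "\<bar>Lx x p\<bar> \<le> (\<Sum>i\<in>UNIV. \<Sum>j\<in>UNIV. \<bar>cpd \<Omega> i (a i j) x * fst (snd p) $ j\<bar> + \<bar>a i j x * snd (snd p) $ i $ j\<bar>)
       + (\<Sum>i\<in>UNIV. \<bar>c i x * fst (snd p) $ i\<bar>) + \<bar>d x * fst p\<bar>"
    proof -
      have 1: "\<bar>\<Sum>i\<in>UNIV. \<Sum>j\<in>UNIV. cpd \<Omega> i (a i j) x * fst (snd p) $ j + a i j x * snd (snd p) $ i $ j\<bar>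
         \<le> (\<Sum>i\<in>UNIV. \<Sum>j\<in>UNIV. \<bar>cpd \<Omega> i (a i j) x * fst (snd p) $ j\<bar> + \<bar>a i j x * snd (snd p) $ i $ j\<bar>)"
        by (intro order_trans[OF sum_abs] sum_mono abs_triangle_ineq)
      have 2: "\<bar>\<Sum>i\<in>UNIV. c i x * fst (snd p) $ i\<bar> \<le> (\<Sum>i\<in>UNIV. \<bar>c i x * fst (snd p) $ i\<bar>)" by (rule sum_abs)
      show ?thesis unfolding Lj_def using 1 2 by linarith
    qed
    also have "\<dots> \<le> (\<Sum>i\<in>UNIV. \<Sum>j\<in>UNIV. B1 i j * norm p + B2 i j * norm p) + (\<Sum>i\<in>UNIV. B3 i * norm p) + B4 * norm p"
      by (intro add_mono sum_mono m B1 B2 B3 B4 x n)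
    also have "\<dots> = C * norm p" by (simp add: C_def sum_distrib_right distrib_right sum.distrib)
    finally show ?thesis .
  qed
  then have "\<bar>Lx x p\<bar> \<le> (\<bar>C\<bar> + 1) * norm p" if "x \<in> \<Omega>" for x p
    using that order_trans[OF le mult_right_mono[of C "\<bar>C\<bar> + 1" "norm p"]] by auto
  then show ?thesis by (intro exI[of _ "\<bar>C\<bar> + 1"]) auto
qed

end

section \<open>Neurons and their features\<close>

definition sd :: "(real \<Rightarrow> real) \<Rightarrow> nat \<Rightarrow> real \<Rightarrow> real" where
  "sd \<sigma> k = pds UNIV (replicate k 1) \<sigma>"

lemma sd_0: "sd \<sigma> 0 = \<sigma>" by (simp add: sd_def)

lemma sd_deriv:
  assumes "Ckb_on 3 UNIV \<sigma>" "k < 3"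
  shows "(sd \<sigma> k has_real_derivative sd \<sigma> (Suc k) t) (at t)"
proof -
  have "sd \<sigma> k differentiable_on UNIV"
    using assms unfolding Ckb_on_def Ck_on_def sd_def by (auto dest!: bspec[of _ _ "replicate k 1"])
  then have "sd \<sigma> k differentiable (at t within UNIV)" by (simp add: differentiable_on_def)
  from differentiable_pd[OF this] show ?thesis
    by (simp add: has_field_derivative_def sd_def mult.commute[of _ "pd _ _ _ _"])
qed

lemma sd_continuous:
  assumes "Ckb_on 3 UNIV \<sigma>" "k \<le> 3"
  shows "continuous_on S (sd \<sigma> k)"
proof -
  have "continuous_on UNIV (sd \<sigma> k)"
    using assms unfolding Ckb_on_def Ck_on_def sd_def by (auto dest!: bspec[of _ _ "replicate k 1"])
  then show ?thesis by (rule continuous_on_subset) simp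
qed

lemma sd_bounded:
  assumes "Ckb_on 3 UNIV \<sigma>"
  obtains B where "B > 0" "\<And>k t. k \<le> 3 \<Longrightarrow> \<bar>sd \<sigma> k t\<bar> \<le> B"
proof -
  have "bounded (range (sd \<sigma> k))" if "k \<le> 3" for k
    using assms that unfolding Ckb_on_def sd_def by (auto dest!: bspec[of _ _ "replicate k 1"])
  then have "bounded (\<Union>k\<in>{..3}. range (sd \<sigma> k))" by (intro bounded_UN) auto
  then obtain B where B: "B > 0" "\<And>y. y \<in> (\<Union>k\<in>{..3}. range (sd \<sigma> k)) \<Longrightarrow> norm y \<le> B"
    unfolding bounded_pos by blast
  have "\<bar>sd \<sigma> k t\<bar> \<le> B" if "k \<le> 3" for k t using B(2)[of "sd \<sigma> k t"] that by auto
  then show ?thesis using B(1) that by blast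
qed

definition pre :: "'n::finite param \<Rightarrow> real^'n \<Rightarrow> real" where
  "pre \<theta> x = fst (snd \<theta>) \<bullet> x + snd (snd \<theta>)"

text \<open>The spatial jet of c \<sigma>(w . x + b): each spatial derivative raises the order of
  \<sigma> by one and brings down one factor w.\<close>

definition njet :: "(real \<Rightarrow> real) \<Rightarrow> 'n::finite param \<Rightarrow> real^'n \<Rightarrow> 'n jet" where
  "njet \<sigma> \<theta> x = (fst \<theta> * sd \<sigma> 0 (pre \<theta> x), (fst \<theta> * sd \<sigma> 1 (pre \<theta> x)) *\<^sub>R fst (snd \<theta>),
     (fst \<theta> * sd \<sigma> 2 (pre \<theta> x)) *\<^sub>R outer (fst (snd \<theta>)) (fst (snd \<theta>)))"

text \<open>The derivative of \<open>njet\<close> with respect to the parameter in the direction \<open>e\<close>; it is also the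
  spatial jet of the parameter derivative of the neuron.\<close>

definition fjet :: "(real \<Rightarrow> real) \<Rightarrow> 'n::finite param \<Rightarrow> 'n param \<Rightarrow> real^'n \<Rightarrow> 'n jet" where
  "fjet \<sigma> \<theta> e x =
     (fst e * sd \<sigma> 0 (pre \<theta> x) + fst \<theta> * pre e x * sd \<sigma> 1 (pre \<theta> x),
      (fst e * sd \<sigma> 1 (pre \<theta> x) + fst \<theta> * pre e x * sd \<sigma> 2 (pre \<theta> x)) *\<^sub>R fst (snd \<theta>)
        + (fst \<theta> * sd \<sigma> 1 (pre \<theta> x)) *\<^sub>R fst (snd e),
      (fst e * sd \<sigma> 2 (pre \<theta> x) + fst \<theta> * pre e x * sd \<sigma> 3 (pre \<theta> x)) *\<^sub>R outer (fst (snd \<theta>)) (fst (snd \<theta>))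
        + (fst \<theta> * sd \<sigma> 2 (pre \<theta> x)) *\<^sub>R (outer (fst (snd e)) (fst (snd \<theta>)) + outer (fst (snd \<theta>)) (fst (snd e))))"

text \<open>The weight behind all estimates in the parameter: linear in the output weight, quadratic
  in the input weight because a Hessian brings down two factors of it. The bias enters only through
  bounded derivatives of \<sigma> and is absent.\<close>

definition growth :: "'n::finite param \<Rightarrow> real" where
  "growth \<theta> = (1 + \<bar>fst \<theta>\<bar>) * (1 + norm (fst (snd \<theta>)))\<^sup>2"

lemma fst_njet: "fst (njet \<sigma> \<theta> x) = neuron \<sigma> \<theta> x"
  by (cases \<theta>) (simp add: njet_def neuron_def pre_def sd_0)

lemma has_derivative_sd_pre:
  assumes s: "Ckb_on 3 UNIV \<sigma>" and k: "k < 3"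
  shows "((\<lambda>x. sd \<sigma> k (pre \<theta> x)) has_derivative (\<lambda>h. sd \<sigma> (Suc k) (pre \<theta> x) * (fst (snd \<theta>) \<bullet> h))) (at x within S)"
    and "((\<lambda>\<theta>. sd \<sigma> k (pre \<theta> x)) has_derivative (\<lambda>e. sd \<sigma> (Suc k) (pre \<theta> x) * pre e x)) (at \<theta> within R)"
  by (rule has_derivative_compose[OF _ sd_deriv[OF s k, unfolded has_field_derivative_def]];
      auto simp: pre_def intro!: derivative_eq_intros)+

lemma has_derivative_njet:
  assumes s: "Ckb_on 3 UNIV \<sigma>"
  shows "((\<lambda>\<theta>. njet \<sigma> \<theta> x) has_derivative (\<lambda>e. fjet \<sigma> \<theta> e x)) (at \<theta> within R)"
proof -
  have f: "(fst has_derivative fst) (at \<theta> within R)"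
    "((\<lambda>\<theta>. fst (snd \<theta>)) has_derivative (\<lambda>e. fst (snd e))) (at \<theta> within R)"
    by (auto intro!: derivative_eq_intros)
  note s = has_derivative_sd_pre(2)[OF s, of 0 x \<theta> R] has_derivative_sd_pre(2)[OF s, of 1 x \<theta> R]
    has_derivative_sd_pre(2)[OF s, of 2 x \<theta> R]
  note o = bounded_bilinear.FDERIV[OF bounded_bilinear_outer f(2) f(2)]
  show ?thesis unfolding njet_def
    by (rule has_derivative_eq_rhs[OF has_derivative_Pair[OF has_derivative_mult[OF f(1) s(1)]
          has_derivative_Pair[OF has_derivative_scaleR[OF has_derivative_mult[OF f(1) s(2)] f(2)]
            has_derivative_scaleR[OF has_derivative_mult[OF f(1) s(3)] o]]]])
       (auto simp: fun_eq_iff fjet_def algebra_simps numeral_eq_Suc)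
qed

lemma continuous_on_sd_pre:
  assumes "Ckb_on 3 UNIV \<sigma>" "k \<le> 3" "continuous_on S F" "continuous_on S G"
  shows "continuous_on S (\<lambda>x. sd \<sigma> k (pre (F x) (G x)))"
  by (rule continuous_on_compose2[OF sd_continuous[OF assms(1,2), of UNIV]])
     (auto simp: pre_def intro!: continuous_intros assms)

lemma continuous_on_fjet:
  assumes s: "Ckb_on 3 UNIV \<sigma>" and c: "continuous_on S F" "continuous_on S G"
  shows "continuous_on S (\<lambda>x. fjet \<sigma> (F x) e (G x))" and "continuous_on S (\<lambda>x. njet \<sigma> (F x) (G x))"
proof -
  have p: "continuous_on S (\<lambda>x. pre e (G x))" unfolding pre_def by (intro continuous_intros c)
  note sc = continuous_on_sd_pre[OF s _ c]
  have "continuous_on S (\<lambda>x. sd \<sigma> 0 (pre (F x) (G x)))" "continuous_on S (\<lambda>x. sd \<sigma> 1 (pre (F x) (G x)))"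
    "continuous_on S (\<lambda>x. sd \<sigma> 2 (pre (F x) (G x)))" "continuous_on S (\<lambda>x. sd \<sigma> 3 (pre (F x) (G x)))"
    by (intro sc; simp)+
  note [continuous_intros] = this p c
  show "continuous_on S (\<lambda>x. fjet \<sigma> (F x) e (G x))" unfolding fjet_def by (intro continuous_intros)
  show "continuous_on S (\<lambda>x. njet \<sigma> (F x) (G x))" unfolding njet_def by (intro continuous_intros)
qed

lemma has_jet_neuron:
  assumes s: "Ckb_on 3 UNIV \<sigma>"
  shows "has_jet UNIV (neuron \<sigma> \<theta>) (njet \<sigma> \<theta>)"
  unfolding has_jet_def
proof (intro conjI ballI allI)
  show "continuous_on UNIV (njet \<sigma> \<theta>)" using continuous_on_fjet(2)[OF s, of UNIV "\<lambda>_. \<theta>" "\<lambda>x. x"] by simp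
  note d = has_derivative_sd_pre(1)[OF s]
  fix x
  show "fst (njet \<sigma> \<theta> x) = neuron \<sigma> \<theta> x" by (rule fst_njet)
  have neq: "neuron \<sigma> \<theta> = (\<lambda>x. fst \<theta> * sd \<sigma> 0 (pre \<theta> x))"
    by (simp add: fun_eq_iff fst_njet[symmetric] njet_def)
  have "((\<lambda>x. fst \<theta> * sd \<sigma> 0 (pre \<theta> x)) has_derivative (\<bullet>) (fst (snd (njet \<sigma> \<theta> x)))) (at x within UNIV)"
    by (rule has_derivative_eq_rhs[OF has_derivative_mult_right[OF d]])
       (auto simp: njet_def fun_eq_iff)
  then show "(neuron \<sigma> \<theta> has_derivative (\<bullet>) (fst (snd (njet \<sigma> \<theta> x)))) (at x within UNIV)"
    unfolding neq .
  fix j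
  have "((\<lambda>y. (fst \<theta> * sd \<sigma> 1 (pre \<theta> y)) * fst (snd \<theta>) $ j) has_derivative
       (\<lambda>h. \<Sum>i\<in>UNIV. snd (snd (njet \<sigma> \<theta> x)) $ i $ j * h $ i)) (at x within UNIV)"
    by (rule has_derivative_eq_rhs[OF has_derivative_mult_left[OF has_derivative_mult_right[OF d]]])
       (auto simp: njet_def outer_def fun_eq_iff inner_vec_def sum_distrib_left sum_distrib_right mult_ac numeral_eq_Suc)
  then show "((\<lambda>y. fst (snd (njet \<sigma> \<theta> y)) $ j) has_derivative
       (\<lambda>h. \<Sum>i\<in>UNIV. snd (snd (njet \<sigma> \<theta> x)) $ i $ j * h $ i)) (at x within UNIV)"
    by (simp add: njet_def)
qed

text \<open>Differentiations in the parameter and in space commute, so the formula found by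
  differentiating the jet in the parameter also passes the test in space. Its Hessian contains the
  third derivative of \<sigma>, for which continuity is enough.\<close>

lemma has_jet_feature:
  assumes s: "Ckb_on 3 UNIV \<sigma>"
  shows "has_jet UNIV (\<lambda>x. fst (fjet \<sigma> \<theta> e x)) (fjet \<sigma> \<theta> e)"
  unfolding has_jet_def
proof (intro conjI ballI allI)
  show "continuous_on UNIV (fjet \<sigma> \<theta> e)" using continuous_on_fjet(1)[OF s, of UNIV "\<lambda>_. \<theta>" "\<lambda>x. x"] by simp
  fix x
  have p: "((\<lambda>x. pre e x) has_derivative (\<lambda>h. fst (snd e) \<bullet> h)) (at x)"
    unfolding pre_def by (auto intro!: derivative_eq_intros)
  note d = has_derivative_sd_pre(1)[OF s, of 0 \<theta> x UNIV] has_derivative_sd_pre(1)[OF s, of 1 \<theta> x UNIV]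
    has_derivative_sd_pre(1)[OF s, of 2 \<theta> x UNIV]
  show "((\<lambda>x. fst (fjet \<sigma> \<theta> e x)) has_derivative (\<bullet>) (fst (snd (fjet \<sigma> \<theta> e x)))) (at x within UNIV)"
    unfolding fjet_def fst_conv snd_conv
    by (rule has_derivative_eq_rhs, (rule derivative_eq_intros d p refl | simp)+)
       (auto simp: fun_eq_iff inner_add_left numeral_eq_Suc algebra_simps)
  fix j
  show "((\<lambda>y. fst (snd (fjet \<sigma> \<theta> e y)) $ j) has_derivative
       (\<lambda>h. \<Sum>i\<in>UNIV. snd (snd (fjet \<sigma> \<theta> e x)) $ i $ j * h $ i)) (at x within UNIV)"
    unfolding fjet_def fst_conv snd_conv vector_add_component vector_scaleR_component
    by (rule has_derivative_eq_rhs, (rule derivative_eq_intros d p refl | simp)+)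
       (auto simp: fun_eq_iff outer_def inner_vec_def numeral_eq_Suc sum_distrib_left sum_distrib_right
          sum.distrib algebra_simps)
qed simp

lemma feature_grad_eq:
  assumes s: "Ckb_on 3 UNIV \<sigma>"
  shows "feature_grad \<eta> \<sigma> \<theta> e x = \<eta> x * fst (fjet \<sigma> \<theta> e x)"
proof -
  have "((\<lambda>\<theta>. \<eta> x * fst (njet \<sigma> \<theta> x)) has_derivative (\<lambda>e. \<eta> x * fst (fjet \<sigma> \<theta> e x))) (at \<theta>)"
    by (intro has_derivative_mult_right has_derivative_fst has_derivative_njet s)
  then show ?thesis unfolding feature_grad_def fst_njet
    by (intro pd_eq thick_open) auto
qed

lemma linear_fjet:
  assumes "Ckb_on 3 UNIV \<sigma>"
  shows "linear (\<lambda>e. fjet \<sigma> \<theta> e x)"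
  using has_derivative_linear[OF has_derivative_njet[OF assms]] .

lemma growth_ge_1: "growth \<theta> \<ge> 1"
proof -
  have "1 * 1 \<le> growth \<theta>" unfolding growth_def by (intro mult_mono one_le_power) auto
  then show ?thesis by simp
qed

text \<open>A move by at most 1 at most doubles \<open>1 + \<bar>c\<bar>\<close> and
  \<open>1 + norm w\<close>, and the second factor is squared.\<close>

lemma growth_perturb:
  assumes "norm (\<theta>' - \<theta>) \<le> 1"
  shows "growth \<theta>' \<le> 8 * growth \<theta>"
proof -
  have f: "\<bar>fst \<theta>' - fst \<theta>\<bar> \<le> 1"
    using assms by (metis norm_fst_le prod.collapse order_trans fst_diff real_norm_def)
  have "norm (fst (snd (\<theta>' - \<theta>))) \<le> norm (snd (\<theta>' - \<theta>))" by (metis norm_fst_le prod.collapse)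
  also have "\<dots> \<le> norm (\<theta>' - \<theta>)" by (metis norm_snd_le prod.collapse)
  finally have w: "norm (fst (snd \<theta>') - fst (snd \<theta>)) \<le> 1" using assms by simp
  have 1: "1 + \<bar>fst \<theta>'\<bar> \<le> 2 * (1 + \<bar>fst \<theta>\<bar>)"
    using f abs_ge_zero[of "fst \<theta>"] abs_triangle_ineq2[of "fst \<theta>'" "fst \<theta>"] by argo
  have "1 + norm (fst (snd \<theta>')) \<le> 2 * (1 + norm (fst (snd \<theta>)))"
    using w norm_triangle_ineq2[of "fst (snd \<theta>')" "fst (snd \<theta>)"] norm_ge_zero[of "fst (snd \<theta>)"] by argo
  then have "(1 + norm (fst (snd \<theta>')))\<^sup>2 \<le> (2 * (1 + norm (fst (snd \<theta>))))\<^sup>2" by (intro power_mono) auto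
  with 1 have "growth \<theta>' \<le> (2 * (1 + \<bar>fst \<theta>\<bar>)) * (2 * (1 + norm (fst (snd \<theta>))))\<^sup>2"
    unfolding growth_def by (intro mult_mono) auto
  also have "\<dots> = 8 * growth \<theta>" unfolding growth_def power_mult_distrib by simp
  finally show ?thesis .
qed

lemma growth_factors:
  fixes \<theta> :: "'n::finite param"
  defines "A \<equiv> 1 + \<bar>fst \<theta>\<bar>" and "W \<equiv> 1 + norm (fst (snd \<theta>))"
  shows "A \<ge> 1" "W \<ge> 1" "growth \<theta> = A * W\<^sup>2" "A \<le> growth \<theta>" "A * W \<le> growth \<theta>"
proof -
  show a: "A \<ge> 1" and w: "W \<ge> 1" by (auto simp: A_def W_def)
  show g: "growth \<theta> = A * W\<^sup>2" by (simp add: growth_def A_def W_def)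
  show "A \<le> growth \<theta>" unfolding g using a w mult_left_mono[OF one_le_power[OF w, of 2], of A] by simp
  have "W \<le> W\<^sup>2" using w by (simp add: power2_eq_square)
  then show "A * W \<le> growth \<theta>" unfolding g using a by (intro mult_left_mono) auto
qed

text \<open>A spatial increment of the jet costs one more factor of the input weight than the jet
  itself. That exceeds \<open>growth\<close> but fits below its square, to which the third bound is
  rounded up.\<close>

lemma fjet_bound:
  fixes \<sigma> :: "real \<Rightarrow> real"
  assumes s: "Ckb_on 3 UNIV \<sigma>" and "\<rho> \<ge> 0"
  obtains C where "C > 0"
    "\<And>(\<theta>::'n::finite param) e x. norm e \<le> 1 \<Longrightarrow> norm x \<le> \<rho> \<Longrightarrow> norm (fjet \<sigma> \<theta> e x) \<le> C * growth \<theta>"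
    "\<And>(\<theta>::'n::finite param) x. norm (njet \<sigma> \<theta> x) \<le> C * growth \<theta>"
    "\<And>(\<theta>::'n::finite param) x y. norm (njet \<sigma> \<theta> x - njet \<sigma> \<theta> y) \<le> C * (growth \<theta>)\<^sup>2 * norm (x - y)"
proof -
  obtain B where B: "B > 0" "\<And>k t. k \<le> 3 \<Longrightarrow> \<bar>sd \<sigma> k t\<bar> \<le> B" using sd_bounded[OF s] by blast
  \<comment> \<open>Three components contribute \<open>3 * B * (\<rho> + 2)\<close> from the
    coefficients with \<open>pre e x\<close>, and the derivatives of w in direction e add
    \<open>3 * B\<close>.\<close>
  define C where "C = B * (3 * \<rho> + 9)"
  have C: "C > 0" using B assms(2) by (simp add: C_def)
  have F: "norm (fjet \<sigma> \<theta> e x) \<le> C * growth \<theta>" if e: "norm e \<le> 1" and x: "norm x \<le> \<rho>" for \<theta> e :: "'n param" and x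
  proof -
    define c w where "c = fst \<theta>" and "w = fst (snd \<theta>)"
    define A W where "A = 1 + \<bar>c\<bar>" and "W = 1 + norm w"
    note AW = growth_factors[of \<theta>, folded c_def w_def, folded A_def W_def]
    have e0: "\<bar>fst e\<bar> \<le> 1" using norm_fst_le[of "fst e" "snd e"] e by simp
    have es: "norm (snd e) \<le> 1" using norm_snd_le[of "snd e" "fst e"] e by simp
    have ew: "norm (fst (snd e)) \<le> 1" using norm_fst_le[of "fst (snd e)" "snd (snd e)"] es by simp
    have eb: "\<bar>snd (snd e)\<bar> \<le> 1" using norm_snd_le[of "snd (snd e)" "fst (snd e)"] es by simp
    have "\<bar>fst (snd e) \<bullet> x\<bar> \<le> norm (fst (snd e)) * norm x" by (rule Cauchy_Schwarz_ineq2)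
    also have "\<dots> \<le> 1 * \<rho>" using ew x by (intro mult_mono) auto
    finally have pe: "\<bar>pre e x\<bar> \<le> \<rho> + 1" using eb by (simp add: pre_def)
    define z where "z = pre \<theta> x"
    define D where "D = B * (\<rho> + 2) * A"
    have lin: "\<bar>fst e * sd \<sigma> k z + c * pre e x * sd \<sigma> (Suc k) z\<bar> \<le> D" if k: "k < 3" for k
    proof -
      have "\<bar>fst e * sd \<sigma> k z + c * pre e x * sd \<sigma> (Suc k) z\<bar> \<le> \<bar>fst e\<bar> * \<bar>sd \<sigma> k z\<bar> + \<bar>c\<bar> * \<bar>pre e x\<bar> * \<bar>sd \<sigma> (Suc k) z\<bar>"
        by (metis abs_mult abs_triangle_ineq)
      also have "\<dots> \<le> 1 * B + \<bar>c\<bar> * (\<rho> + 1) * B"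
        using e0 pe B k assms(2) by (intro add_mono mult_mono) auto
      also have "\<dots> \<le> D" using B(1) assms(2) by (simp add: D_def A_def algebra_simps)
      finally show ?thesis .
    qed
    have cs: "\<bar>c * sd \<sigma> k z\<bar> \<le> B * A" if "k < 3" for k
    proof -
      have "\<bar>c * sd \<sigma> k z\<bar> \<le> A * B" unfolding abs_mult using B that AW(1) by (intro mult_mono) (auto simp: A_def)
      then show ?thesis by (simp add: mult.commute)
    qed
    have D0: "D \<ge> 0" using B(1) assms(2) AW(1) by (simp add: D_def)
    have nw: "norm w \<le> W" by (simp add: W_def)
    have W2: "W \<le> W\<^sup>2" "1 \<le> W\<^sup>2" using AW(2) by (auto simp: power2_eq_square intro: order_trans[OF _ mult_left_mono[of 1 W W]])
    have 1: "\<bar>fst (fjet \<sigma> \<theta> e x)\<bar> \<le> D * W\<^sup>2"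
      using lin[of 0] mult_left_mono[OF W2(2) D0] by (simp add: fjet_def z_def c_def)
    have 2: "norm (fst (snd (fjet \<sigma> \<theta> e x))) \<le> D * W\<^sup>2 + B * A * W\<^sup>2"
    proof -
      have "norm (fst (snd (fjet \<sigma> \<theta> e x))) \<le> \<bar>fst e * sd \<sigma> 1 z + c * pre e x * sd \<sigma> 2 z\<bar> * norm w + \<bar>c * sd \<sigma> 1 z\<bar> * norm (fst (snd e))"
        unfolding fjet_def fst_conv snd_conv z_def c_def w_def
        by (rule order_trans[OF norm_triangle_ineq]) simp
      also have "\<dots> \<le> D * W\<^sup>2 + B * A * W\<^sup>2"
        using lin[of 1] cs[of 1] nw ew W2 D0 B(1) AW(1) by (intro add_mono mult_mono) (auto simp: numeral_2_eq_2)
      finally show ?thesis .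
    qed
    have 3: "norm (snd (snd (fjet \<sigma> \<theta> e x))) \<le> D * W\<^sup>2 + B * A * (2 * W\<^sup>2)"
    proof -
      have "norm (snd (snd (fjet \<sigma> \<theta> e x))) \<le> \<bar>fst e * sd \<sigma> 2 z + c * pre e x * sd \<sigma> 3 z\<bar> * norm (outer w w)
          + \<bar>c * sd \<sigma> 2 z\<bar> * norm (outer (fst (snd e)) w + outer w (fst (snd e)))"
        unfolding fjet_def fst_conv snd_conv z_def c_def w_def
        by (rule order_trans[OF norm_triangle_ineq]) simp
      also have "\<dots> \<le> D * W\<^sup>2 + B * A * (2 * W\<^sup>2)"
      proof (intro add_mono mult_mono)
        show "norm (outer w w) \<le> W\<^sup>2" unfolding norm_outer power2_eq_square using nw AW(2) by (intro mult_mono) auto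
        have "norm (outer (fst (snd e)) w + outer w (fst (snd e))) \<le> norm (fst (snd e)) * norm w + norm w * norm (fst (snd e))"
          by (rule order_trans[OF norm_triangle_ineq]) (simp add: norm_outer)
        also have "\<dots> \<le> 1 * W + W * 1" using nw ew AW(2) by (intro add_mono mult_mono) auto
        finally show "norm (outer (fst (snd e)) w + outer w (fst (snd e))) \<le> 2 * W\<^sup>2" using W2 by simp
      qed (use lin[of 2] cs[of 2] D0 B(1) AW(1) in \<open>auto simp: numeral_2_eq_2 numeral_3_eq_3\<close>)
      finally show ?thesis .
    qed
    have "norm (fjet \<sigma> \<theta> e x) \<le> 3 * (D * W\<^sup>2) + 3 * (B * A * W\<^sup>2)"
      using norm_le_triple(4)[of "fjet \<sigma> \<theta> e x"] 1 2 3 by simp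
    also have "\<dots> = C * growth \<theta>" unfolding AW(3) C_def D_def by (simp add: algebra_simps)
    finally show ?thesis .
  qed
  have N: "norm (njet \<sigma> \<theta> x) \<le> C * growth \<theta>" for \<theta> :: "'n param" and x
  proof -
    define c w where "c = fst \<theta>" and "w = fst (snd \<theta>)"
    define A W where "A = 1 + \<bar>c\<bar>" and "W = 1 + norm w"
    note AW = growth_factors[of \<theta>, folded c_def w_def, folded A_def W_def]
    have nw: "norm w \<le> W" "1 \<le> W" by (auto simp: W_def)
    have cs: "\<bar>c * sd \<sigma> k z\<bar> \<le> A * B" if "k < 3" for k z
      unfolding abs_mult using B that AW(1) by (intro mult_mono) (auto simp: A_def)
    have AB: "A * B \<ge> 0" using AW(1) B(1) by simp
    have W2: "W \<le> W\<^sup>2" "1 \<le> W\<^sup>2" using AW(2) by (auto simp: power2_eq_square intro: order_trans[OF _ mult_left_mono[of 1 W W]])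
    have t: "\<bar>c * sd \<sigma> k z\<bar> * r \<le> A * B * W\<^sup>2" if "k < 3" "0 \<le> r" "r \<le> W\<^sup>2" for k z r
      using cs[OF that(1)] that AB by (intro mult_mono) auto
    have ww: "norm (outer w w) \<le> W\<^sup>2" unfolding norm_outer power2_eq_square using nw AW(2) by (intro mult_mono) auto
    have "norm (njet \<sigma> \<theta> x) \<le> \<bar>c * sd \<sigma> 0 (pre \<theta> x)\<bar> * 1 + \<bar>c * sd \<sigma> 1 (pre \<theta> x)\<bar> * norm w + \<bar>c * sd \<sigma> 2 (pre \<theta> x)\<bar> * norm (outer w w)"
      using norm_le_triple(4)[of "njet \<sigma> \<theta> x"] by (simp add: njet_def c_def w_def abs_mult)
    also have "\<dots> \<le> A * B * W\<^sup>2 + A * B * W\<^sup>2 + A * B * W\<^sup>2"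
      using nw W2 ww by (intro add_mono t) auto
    also have "\<dots> = (3 * B) * growth \<theta>" unfolding AW(3) by simp
    also have "\<dots> \<le> C * growth \<theta>" using B(1) assms(2) growth_ge_1[of \<theta>] by (intro mult_right_mono) (auto simp: C_def)
    finally show ?thesis .
  qed
  have Lp: "norm (njet \<sigma> \<theta> x - njet \<sigma> \<theta> y) \<le> C * (growth \<theta>)\<^sup>2 * norm (x - y)" for \<theta> :: "'n param" and x y
  proof -
    define c w where "c = fst \<theta>" and "w = fst (snd \<theta>)"
    define A W where "A = 1 + \<bar>c\<bar>" and "W = 1 + norm w"
    note AW = growth_factors[of \<theta>, folded c_def w_def, folded A_def W_def]
    have nw: "norm w \<le> W" by (auto simp: W_def)
    have ls: "\<bar>sd \<sigma> k (pre \<theta> x) - sd \<sigma> k (pre \<theta> y)\<bar> \<le> B * (W * norm (x - y))" if k: "k < 3" for k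
    proof -
      have "norm (sd \<sigma> k (pre \<theta> x) - sd \<sigma> k (pre \<theta> y)) \<le> B * norm (pre \<theta> x - pre \<theta> y)"
        by (rule field_differentiable_bound[of UNIV "sd \<sigma> k" "sd \<sigma> (Suc k)"])
           (use sd_deriv[OF s k] B(2)[of "Suc k"] k in auto)
      also have "pre \<theta> x - pre \<theta> y = w \<bullet> (x - y)" by (simp add: pre_def w_def inner_diff_right)
      also have "B * norm (w \<bullet> (x - y)) \<le> B * (norm w * norm (x - y))"
        using B(1) Cauchy_Schwarz_ineq2 by (intro mult_left_mono) auto
      also have "\<dots> \<le> B * (W * norm (x - y))" using B(1) nw by (intro mult_left_mono mult_right_mono) auto
      finally show ?thesis by simp
    qed
    have W4: "1 \<le> W ^ 3" "W \<le> W ^ 3" "W\<^sup>2 \<le> W ^ 3"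
      using AW(2) one_le_power[of W 3] power_increasing[of 1 3 W] power_increasing[of 2 3 W] by auto
    have ww: "norm (outer w w) \<le> W\<^sup>2" unfolding norm_outer power2_eq_square using nw AW(2) by (intro mult_mono) auto
    have t: "\<bar>c * (sd \<sigma> k (pre \<theta> x) - sd \<sigma> k (pre \<theta> y))\<bar> * r \<le> A * (B * (W * norm (x - y))) * W ^ 3"
      if "k < 3" "0 \<le> r" "r \<le> W ^ 3" for k r
      unfolding abs_mult using ls[OF that(1)] that AW(1,2) B(1)
      by (intro mult_mono) (auto simp: A_def)
    have "norm (njet \<sigma> \<theta> x - njet \<sigma> \<theta> y) \<le> \<bar>c * (sd \<sigma> 0 (pre \<theta> x) - sd \<sigma> 0 (pre \<theta> y))\<bar> * 1
        + \<bar>c * (sd \<sigma> 1 (pre \<theta> x) - sd \<sigma> 1 (pre \<theta> y))\<bar> * norm w + \<bar>c * (sd \<sigma> 2 (pre \<theta> x) - sd \<sigma> 2 (pre \<theta> y))\<bar> * norm (outer w w)"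
    proof -
      have "fst (snd (njet \<sigma> \<theta> x - njet \<sigma> \<theta> y)) = (c * (sd \<sigma> 1 (pre \<theta> x) - sd \<sigma> 1 (pre \<theta> y))) *\<^sub>R w"
        "snd (snd (njet \<sigma> \<theta> x - njet \<sigma> \<theta> y)) = (c * (sd \<sigma> 2 (pre \<theta> x) - sd \<sigma> 2 (pre \<theta> y))) *\<^sub>R outer w w"
        "fst (njet \<sigma> \<theta> x - njet \<sigma> \<theta> y) = c * (sd \<sigma> 0 (pre \<theta> x) - sd \<sigma> 0 (pre \<theta> y))"
        by (simp_all add: njet_def c_def w_def algebra_simps)
      then show ?thesis using norm_le_triple(4)[of "njet \<sigma> \<theta> x - njet \<sigma> \<theta> y"] by simp
    qed
    also have "\<dots> \<le> A * (B * (W * norm (x - y))) * W ^ 3 + A * (B * (W * norm (x - y))) * W ^ 3 + A * (B * (W * norm (x - y))) * W ^ 3"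
      using nw W4 ww by (intro add_mono t) auto
    also have "\<dots> = 3 * B * A * W ^ 4 * norm (x - y)" by (simp add: power_numeral_reduce algebra_simps)
    also have "\<dots> \<le> C * A\<^sup>2 * W ^ 4 * norm (x - y)"
    proof (intro mult_right_mono mult_mono)
      show "3 * B \<le> C" using B(1) assms(2) by (simp add: C_def)
      show "A \<le> A\<^sup>2" using AW(1) by (simp add: power2_eq_square)
    qed (use C AW(1,2) in auto)
    also have "C * A\<^sup>2 * W ^ 4 = C * (growth \<theta>)\<^sup>2" unfolding AW(3) by (simp add: power_mult_distrib)
    finally show ?thesis .
  qed
  show ?thesis by (rule that[OF C F N Lp])
qed

section \<open>The training functional\<close>

text \<open>The weighted inequality between arithmetic and geometric means, integrated with weights
  made from positive bounds for the two norms. Arbitrary upper bounds replace the norms, so that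
  they can be propagated.\<close>

lemma Cauchy_Schwarz_bound:
  fixes u v :: "'a \<Rightarrow> real"
  assumes m: "u \<in> borel_measurable M" "v \<in> borel_measurable M"
    and i: "integrable M (\<lambda>x. (u x)\<^sup>2)" "integrable M (\<lambda>x. (v x)\<^sup>2)"
    and b: "(LINT x|M. (u x)\<^sup>2) \<le> \<alpha>\<^sup>2" "(LINT x|M. (v x)\<^sup>2) \<le> \<beta>\<^sup>2" and p: "0 \<le> \<alpha>" "0 \<le> \<beta>"
  shows "integrable M (\<lambda>x. u x * v x)" "(LINT x|M. \<bar>u x * v x\<bar>) \<le> \<alpha> * \<beta>"
proof -
  have am: "\<bar>s * t\<bar> \<le> (s\<^sup>2 + t\<^sup>2) / 2" for s t :: real
    using zero_le_power2[of "\<bar>s\<bar> - \<bar>t\<bar>"] by (simp add: power2_eq_square algebra_simps abs_mult abs_mult_self_eq)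
  show I: "integrable M (\<lambda>x. u x * v x)"
    by (rule Bochner_Integration.integrable_bound[of _ "\<lambda>x. ((u x)\<^sup>2 + (v x)\<^sup>2) / 2"]) (use i m am in auto)
  have main: "(LINT x|M. \<bar>u x * v x\<bar>) \<le> r * s" if r: "r > 0" "(LINT x|M. (u x)\<^sup>2) \<le> r\<^sup>2"
    and s: "s > 0" "(LINT x|M. (v x)\<^sup>2) \<le> s\<^sup>2" for r s
  proof -
    have pt: "\<bar>u x * v x\<bar> \<le> (s / (2 * r)) * (u x)\<^sup>2 + (r / (2 * s)) * (v x)\<^sup>2" for x
    proof -
      have "\<bar>u x * v x\<bar> = r * s * \<bar>(u x / r) * (v x / s)\<bar>" using r s by (simp add: abs_mult)
      also have "\<dots> \<le> r * s * (((u x / r)\<^sup>2 + (v x / s)\<^sup>2) / 2)" using r s by (intro mult_left_mono am) auto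
      also have "\<dots> = (s / (2 * r)) * (u x)\<^sup>2 + (r / (2 * s)) * (v x)\<^sup>2"
        using r s by (simp add: field_simps power2_eq_square)
      finally show ?thesis .
    qed
    have "(LINT x|M. \<bar>u x * v x\<bar>) \<le> (LINT x|M. (s / (2 * r)) * (u x)\<^sup>2 + (r / (2 * s)) * (v x)\<^sup>2)"
      using I i pt by (intro integral_mono) auto
    also have "\<dots> = (s / (2 * r)) * (LINT x|M. (u x)\<^sup>2) + (r / (2 * s)) * (LINT x|M. (v x)\<^sup>2)" using i by simp
    also have "\<dots> \<le> (s / (2 * r)) * r\<^sup>2 + (r / (2 * s)) * s\<^sup>2" using r s by (intro add_mono mult_left_mono) auto
    also have "\<dots> = r * s" using r s by (simp add: field_simps power2_eq_square)
    finally show ?thesis .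
  qed
  \<comment> \<open>\<open>main\<close> divides by its bounds; adding a slack \<open>e\<close> that
    tends to 0 reaches bounds that may be zero.\<close>
  have "((\<lambda>e. (\<alpha> + e) * (\<beta> + e)) \<longlongrightarrow> (\<alpha> + 0) * (\<beta> + 0)) (at_right 0)" by (intro tendsto_intros)
  moreover have "\<forall>\<^sub>F e in at_right 0. (LINT x|M. \<bar>u x * v x\<bar>) \<le> (\<alpha> + e) * (\<beta> + e)"
  proof (rule eventually_at_right_less[THEN eventually_mono])
    fix e :: real assume "0 < e"
    moreover have "\<alpha>\<^sup>2 \<le> (\<alpha> + e)\<^sup>2" "\<beta>\<^sup>2 \<le> (\<beta> + e)\<^sup>2" using p \<open>0 < e\<close> by (auto intro: power_mono)
    ultimately show "(LINT x|M. \<bar>u x * v x\<bar>) \<le> (\<alpha> + e) * (\<beta> + e)"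
      using p by (intro main order_trans[OF b(1)] order_trans[OF b(2)]) auto
  qed
  ultimately show "(LINT x|M. \<bar>u x * v x\<bar>) \<le> \<alpha> * \<beta>" using tendsto_lowerbound by fastforce
qed

lemma lint_norm_bound:
  fixes f :: "'a \<Rightarrow> 'b::{banach, second_countable_topology}"
  assumes "integrable M f" "integrable M w" "\<And>x. x \<in> space M \<Longrightarrow> norm (f x) \<le> w x"
  shows "norm (integral\<^sup>L M f) \<le> integral\<^sup>L M w"
  by (rule order_trans[OF integral_norm_bound integral_mono]) (use assms in auto)

lemma lipschitz_of_bounded_pd:
  fixes u :: "'a::euclidean_space \<Rightarrow> real"
  assumes d: "u differentiable_on UNIV" and B: "\<And>b x. b \<in> Basis \<Longrightarrow> \<bar>pd UNIV b u x\<bar> \<le> B"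
  shows "\<bar>u x - u y\<bar> \<le> (real DIM('a) * B) * norm (x - y)"
proof -
  obtain b0 :: 'a where b0: "b0 \<in> Basis" using nonempty_Basis by blast
  have B0: "0 \<le> B" using B[OF b0, of 0] by linarith
  have "norm (u x - u y) \<le> (real DIM('a) * B) * norm (x - y)"
  proof (rule differentiable_bound[of UNIV u "\<lambda>z h. \<Sum>b\<in>Basis. (h \<bullet> b) * pd UNIV b u z"])
    fix z
    show "(u has_derivative (\<lambda>h. \<Sum>b\<in>Basis. (h \<bullet> b) * pd UNIV b u z)) (at z within UNIV)"
      using d by (intro differentiable_pd) (simp add: differentiable_on_def)
    show "onorm (\<lambda>h. \<Sum>b\<in>Basis. (h \<bullet> b) * pd UNIV b u z) \<le> real DIM('a) * B"
    proof (rule onorm_bound)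
      fix h :: 'a
      have "norm (\<Sum>b\<in>Basis. (h \<bullet> b) * pd UNIV b u z) \<le> (\<Sum>b\<in>(Basis::'a set). norm h * B)"
        by (intro sum_norm_le) (use B B0 Basis_le_norm in \<open>auto simp: abs_mult intro!: mult_mono\<close>)
      then show "norm (\<Sum>b\<in>Basis. (h \<bullet> b) * pd UNIV b u z) \<le> real DIM('a) * B * norm h" by (simp add: mult_ac)
    qed (use B0 in simp)
  qed auto
  then show ?thesis by simp
qed

lemma Basis_value_gradient:
  "(1::real, 0::real^'n) \<in> Basis" "(0::real, axis i 1 :: real^'n) \<in> Basis"
  by (auto simp: Basis_prod_def Basis_vec_real)

section \<open>Residual and linearised operator on jets\<close>

context pde
begin

text \<open>Bounded first partials make \<open>f\<close> Lipschitz and bounded second partials make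
  the first ones Lipschitz; a single constant covers all these bounds.\<close>

lemma nonlinearity_consts:
  obtains C where "C > 0" "\<And>p q. \<bar>case_prod f p - case_prod f q\<bar> \<le> C * norm (p - q)"
    "\<And>b p. b \<in> Basis \<Longrightarrow> \<bar>pd UNIV b (case_prod f) p\<bar> \<le> C"
    "\<And>b p q. b \<in> Basis \<Longrightarrow> \<bar>pd UNIV b (case_prod f) p - pd UNIV b (case_prod f) q\<bar> \<le> C * norm (p - q)"
    "\<And>p. \<bar>case_prod f p\<bar> \<le> C"
proof -
  let ?F = "case_prod f"
  let ?L = "{es \<in> lists (Basis :: (real \<times> (real^'n)) set). length es \<le> 2}"
  have fin: "finite ?L" using finite_lists_length_le[of "Basis :: (real \<times> (real^'n)) set" 2]
    by (simp add: lists_eq_set Collect_conj_eq inf_commute)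
  have "bounded (\<Union>es\<in>?L. range (pds UNIV es ?F))"
    using f fin unfolding bounded_nonlinearity_def by (intro bounded_UN) auto
  then obtain B where B: "B > 0" "\<And>y. y \<in> (\<Union>es\<in>?L. range (pds UNIV es ?F)) \<Longrightarrow> norm y \<le> B"
    unfolding bounded_pos by blast
  have b: "\<bar>pds UNIV es ?F p\<bar> \<le> B" if "es \<in> lists Basis" "length es \<le> 2" for es p
    using B(2)[of "pds UNIV es ?F p"] that by auto
  have d: "pds UNIV es ?F differentiable_on UNIV" if "es \<in> lists Basis" "length es < 2" for es
    using f that unfolding bounded_nonlinearity_def by auto
  define C where "C = (real DIM(real \<times> (real^'n)) + 1) * B"
  have C: "C > 0" "B \<le> C" "real DIM(real \<times> (real^'n)) * B \<le> C"
  proof -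
    show "C > 0" unfolding C_def using B(1) by (intro mult_pos_pos) auto
    show "B \<le> C" "real DIM(real \<times> (real^'n)) * B \<le> C" using B(1) by (auto simp: C_def distrib_right)
  qed
  have 1: "\<bar>?F p - ?F q\<bar> \<le> C * norm (p - q)" for p q
    using lipschitz_of_bounded_pd[OF d[of "[]"], of B p q] b[of "[_]"] mult_right_mono[OF C(3), of "norm (p - q)"] by auto
  have 2: "\<bar>pd UNIV b' ?F p - pd UNIV b' ?F q\<bar> \<le> C * norm (p - q)" if "b' \<in> Basis" for b' p q
    using lipschitz_of_bounded_pd[OF d[of "[b']"], of B p q] b[of "[_, b']"] mult_right_mono[OF C(3), of "norm (p - q)"] that by auto
  have 3: "\<bar>pd UNIV b' ?F p\<bar> \<le> C" if "b' \<in> Basis" for b' p using b[of "[b']" p] that C(2) by auto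
  have 4: "\<bar>?F p\<bar> \<le> C" for p using b[of "[]" p] C(2) by auto
  show ?thesis by (rule that[OF C(1) 1 3 2 4])
qed

text \<open>The residual of the equation, seen as a function of the point and the jet of the
  candidate solution.\<close>

definition Aop :: "real^'n \<Rightarrow> 'n jet \<Rightarrow> real" where
  "Aop x p = Lx x p + f (fst p) (fst (snd p)) - g x"

definition Bop :: "real^'n \<Rightarrow> 'n jet \<Rightarrow> 'n jet \<Rightarrow> real" where
  "Bop x p h = Lx x h + f_v f (fst p) (fst (snd p)) * fst h
     + (\<Sum>i\<in>UNIV. f_w f i (fst p) (fst (snd p)) * fst (snd h) $ i)"

text \<open>The integral driving the training, as a function of the jet \<open>p\<close> of the network and the jet \<open>h\<close> of
  a feature; through jets it covers classical and weak derivatives alike.\<close>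

definition Jf :: "(real^'n \<Rightarrow> 'n jet) \<Rightarrow> (real^'n \<Rightarrow> 'n jet) \<Rightarrow> real" where
  "Jf p h = (LINT x|\<mu>. Aop x (p x) * Bop x (p x) (h x))"

lemma Bop_linear: "Bop x p (h + k) = Bop x p h + Bop x p k" "Bop x p (h - k) = Bop x p h - Bop x p k"
  by (simp_all add: Bop_def Lx_linear distrib_left right_diff_distrib sum.distrib sum_subtractf)

text \<open>The residual grows linearly in the jet since the operator is linear and
  \<open>f\<close>, \<open>g\<close> are bounded. The linearised operator is bounded independently
  of \<open>p\<close> because the partials of \<open>f\<close> are bounded, and depends on
  \<open>p\<close> in a Lipschitz way because they are Lipschitz.\<close>

lemma Aop_Bop_bounds:
  obtains C where "C > 0"
    "\<And>x p q. x \<in> \<Omega> \<Longrightarrow> \<bar>Aop x p - Aop x q\<bar> \<le> C * norm (p - q)"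
    "\<And>x p. x \<in> \<Omega> \<Longrightarrow> \<bar>Aop x p\<bar> \<le> C * (1 + norm p)"
    "\<And>x p h. x \<in> \<Omega> \<Longrightarrow> \<bar>Bop x p h\<bar> \<le> C * norm h"
    "\<And>x p q h. x \<in> \<Omega> \<Longrightarrow> \<bar>Bop x p h - Bop x q h\<bar> \<le> C * norm (p - q) * norm h"
proof -
  obtain L where L: "L > 0" "\<And>x p. x \<in> \<Omega> \<Longrightarrow> \<bar>Lx x p\<bar> \<le> L * norm p" using Lx_bounded by blast
  obtain F where F: "F > 0" "\<And>p q. \<bar>case_prod f p - case_prod f q\<bar> \<le> F * norm (p - q)"
    "\<And>b p. b \<in> Basis \<Longrightarrow> \<bar>pd UNIV b (case_prod f) p\<bar> \<le> F"
    "\<And>b p q. b \<in> Basis \<Longrightarrow> \<bar>pd UNIV b (case_prod f) p - pd UNIV b (case_prod f) q\<bar> \<le> F * norm (p - q)"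
    "\<And>p. \<bar>case_prod f p\<bar> \<le> F"
    using nonlinearity_consts by blast
  obtain G where G: "G > 0" "\<And>x. x \<in> \<Omega> \<Longrightarrow> \<bar>g x\<bar> \<le> G" using g(2) unfolding bounded_pos by auto
  define n where "n = real CARD('n)"
  define C where "C = L + F + G + n * F"
  have n0: "n > 0" by (simp add: n_def)
  have C: "C > 0" using L(1) F(1) G(1) n0 by (simp add: C_def add_pos_pos)
  have low: "norm ((fst p, fst (snd p)) - (fst q, fst (snd q))) \<le> norm (p - q)" for p q :: "'n jet"
    by (cases p; cases q) (auto simp: norm_Pair intro!: real_sqrt_le_mono power_mono)
  note bas = Basis_value_gradient
  have A1: "\<bar>Aop x p - Aop x q\<bar> \<le> C * norm (p - q)" if x: "x \<in> \<Omega>" for x p q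
  proof -
    have "\<bar>f (fst p) (fst (snd p)) - f (fst q) (fst (snd q))\<bar> \<le> F * norm (p - q)"
      using order_trans[OF F(2)[of "(fst p, fst (snd p))" "(fst q, fst (snd q))"] mult_left_mono[OF low[of p q], of F]] F(1) by simp
    moreover have "\<bar>Lx x p - Lx x q\<bar> \<le> L * norm (p - q)" using L(2)[OF x, of "p - q"] by (simp add: Lx_linear)
    moreover have "(L + F) * norm (p - q) \<le> C * norm (p - q)" using n0 F(1) G(1) by (intro mult_right_mono) (auto simp: C_def)
    ultimately show ?thesis unfolding Aop_def by (simp add: distrib_right)
  qed
  have A0: "\<bar>Aop x p\<bar> \<le> C * (1 + norm p)" if x: "x \<in> \<Omega>" for x p
  proof -
    have "\<bar>Aop x p\<bar> \<le> L * norm p + F + G"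
      using L(2)[OF x, of p] F(5)[of "(fst p, fst (snd p))"] G(2)[OF x] unfolding Aop_def by auto
    also have "\<dots> \<le> C * norm p + C" using n0 F(1) G(1) L(1) by (intro order_trans[OF _ add_mono[OF mult_right_mono[of L C]]]) (auto simp: C_def)
    finally show ?thesis by (simp add: distrib_left)
  qed
  have hi: "\<bar>fst h\<bar> \<le> norm h" "\<bar>fst (snd h) $ i\<bar> \<le> norm h" for h :: "'n jet" and i
    using norm_le_triple[of h] component_le_norm_cart[of "fst (snd h)" i] by linarith+
  have B0: "\<bar>Bop x p h\<bar> \<le> C * norm h" if x: "x \<in> \<Omega>" for x p h
  proof -
    have "\<bar>f_v f (fst p) (fst (snd p)) * fst h\<bar> \<le> F * norm h"
      unfolding abs_mult f_v_def using F(1) F(3)[OF bas(1)] hi by (intro mult_mono) auto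
    moreover have "\<bar>\<Sum>i\<in>UNIV. f_w f i (fst p) (fst (snd p)) * fst (snd h) $ i\<bar> \<le> (\<Sum>i\<in>(UNIV::'n set). F * norm h)"
      by (intro order_trans[OF sum_abs] sum_mono) (unfold abs_mult f_w_def, intro mult_mono F(3) bas hi, use F(1) in auto)
    ultimately have "\<bar>Bop x p h\<bar> \<le> L * norm h + F * norm h + n * (F * norm h)"
      unfolding Bop_def n_def using L(2)[OF x, of h] by simp
    also have "\<dots> = (L + F + n * F) * norm h" by (simp add: algebra_simps)
    also have "\<dots> \<le> C * norm h" using G(1) by (intro mult_right_mono) (auto simp: C_def)
    finally show ?thesis .
  qed
  have B1: "\<bar>Bop x p h - Bop x q h\<bar> \<le> C * norm (p - q) * norm h" if x: "x \<in> \<Omega>" for x p q h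
  proof -
    define P Q where "P = (fst p, fst (snd p))" and "Q = (fst q, fst (snd q))"
    have pd: "\<bar>pd UNIV b (case_prod f) P - pd UNIV b (case_prod f) Q\<bar> \<le> F * norm (p - q)" if "b \<in> Basis" for b
      using order_trans[OF F(4)[OF that, of P Q, unfolded P_def Q_def] mult_left_mono[OF low[of p q], of F]] F(1)
      by (simp add: P_def Q_def)
    have t: "\<bar>(pd UNIV b (case_prod f) P - pd UNIV b (case_prod f) Q) * s\<bar> \<le> F * norm (p - q) * norm h"
      if "b \<in> Basis" "\<bar>s\<bar> \<le> norm h" for b s
      unfolding abs_mult using pd[OF that(1)] that(2) F(1) by (intro mult_mono) auto
    have "Bop x p h - Bop x q h = (pd UNIV (1,0) (case_prod f) P - pd UNIV (1,0) (case_prod f) Q) * fst h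
       + (\<Sum>i\<in>UNIV. (pd UNIV (0, axis i 1) (case_prod f) P - pd UNIV (0, axis i 1) (case_prod f) Q) * fst (snd h) $ i)"
      by (simp add: Bop_def f_v_def f_w_def P_def Q_def left_diff_distrib sum_subtractf)
    moreover have "\<bar>\<Sum>i\<in>UNIV. (pd UNIV (0, axis i 1) (case_prod f) P - pd UNIV (0, axis i 1) (case_prod f) Q) * fst (snd h) $ i\<bar>
        \<le> (\<Sum>i\<in>(UNIV::'n set). F * norm (p - q) * norm h)"
      by (intro order_trans[OF sum_abs] sum_mono t bas hi)
    ultimately have "\<bar>Bop x p h - Bop x q h\<bar> \<le> F * norm (p - q) * norm h + n * (F * norm (p - q) * norm h)"
      using t[OF bas(1) hi(1)[of h]] unfolding n_def by simp
    also have "\<dots> = (F + n * F) * (norm (p - q) * norm h)" by (simp add: algebra_simps)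
    also have "\<dots> \<le> C * (norm (p - q) * norm h)" using G(1) L(1) by (intro mult_right_mono) (auto simp: C_def)
    finally show ?thesis by simp
  qed
  show ?thesis by (rule that[OF C A1 A0 B0 B1])
qed

lemma Aop_measurable:
  assumes p: "p \<in> borel_measurable \<mu>"
  shows "(\<lambda>x. Aop x (p x)) \<in> borel_measurable \<mu>"
proof -
  have F: "case_prod f \<in> borel_measurable borel"
    using f unfolding bounded_nonlinearity_def by (auto dest!: bspec[of _ _ "[]"])
  have "(\<lambda>x. (fst (p x), fst (snd (p x)))) \<in> borel_measurable \<mu>"
    by (rule borel_measurable_continuous_on[OF _ p]) (intro continuous_intros)
  from measurable_compose[OF this F] have "(\<lambda>x. f (fst (p x)) (fst (snd (p x)))) \<in> borel_measurable \<mu>" by simp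
  then show ?thesis unfolding Aop_def using Lx_measurable[OF p] g(1) by auto
qed

lemma Bop_measurable_comp:
  assumes Y: "Y \<in> measurable M \<mu>" and p: "p \<in> borel_measurable M" and h: "h \<in> borel_measurable M"
  shows "(\<lambda>z. Bop (Y z) (p z) (h z)) \<in> borel_measurable M"
proof -
  have m: "(\<lambda>x. (fst (p x), fst (snd (p x)))) \<in> borel_measurable M"
    by (rule borel_measurable_continuous_on[OF _ p]) (intro continuous_intros)
  have m': "pd UNIV b (case_prod f) \<in> borel_measurable borel" if "b \<in> Basis" for b
    using f that unfolding bounded_nonlinearity_def by (auto dest!: bspec[of _ _ "[b]"])
  have F: "(\<lambda>x. f_v f (fst (p x)) (fst (snd (p x)))) \<in> borel_measurable M"
    "(\<lambda>x. f_w f i (fst (p x)) (fst (snd (p x)))) \<in> borel_measurable M" for i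
    unfolding f_v_def f_w_def
    by (rule measurable_compose[OF m m'[OF Basis_value_gradient(1)]] measurable_compose[OF m m'[OF Basis_value_gradient(2)]])+
  have H: "(\<lambda>x. fst (h x)) \<in> borel_measurable M" "(\<lambda>x. fst (snd (h x)) $ i) \<in> borel_measurable M" for i
    by (rule borel_measurable_continuous_on[OF _ h], intro continuous_intros)+
  show ?thesis unfolding Bop_def
    by (intro borel_measurable_add borel_measurable_sum borel_measurable_times F H Lx_measurable_comp[OF Y h])
qed

lemma Bop_measurable:
  "p \<in> borel_measurable \<mu> \<Longrightarrow> h \<in> borel_measurable \<mu> \<Longrightarrow> (\<lambda>x. Bop x (p x) (h x)) \<in> borel_measurable \<mu>"
  by (rule Bop_measurable_comp) simp_all

text \<open>The number \<open>m\<close> is any upper bound of the L^2 norm rather than the norm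
  itself, so that one constant can serve a whole trajectory or family.\<close>

definition sq_bound :: "(real^'n \<Rightarrow> 'n jet) \<Rightarrow> real \<Rightarrow> bool" where
  "sq_bound p m \<longleftrightarrow> p \<in> borel_measurable \<mu> \<and> integrable \<mu> (\<lambda>x. (norm (p x))\<^sup>2)
     \<and> 0 \<le> m \<and> (LINT x|\<mu>. (norm (p x))\<^sup>2) \<le> m\<^sup>2"

lemma sq_bound_L1:
  assumes "sq_bound p m"
  shows "integrable \<mu> (\<lambda>x. norm (p x))" "(LINT x|\<mu>. norm (p x)) \<le> m"
proof -
  have "(\<lambda>x. norm (p x)) \<in> borel_measurable \<mu>" "integrable \<mu> (\<lambda>x. (norm (p x))\<^sup>2)"
    "(LINT x|\<mu>. (norm (p x))\<^sup>2) \<le> m\<^sup>2" "0 \<le> m"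
    using assms by (auto simp: sq_bound_def)
  from Cauchy_Schwarz_bound[of _ \<mu> "\<lambda>x. 1" m 1, OF this(1) _ this(2) _ this(3) _ this(4)]
  show "integrable \<mu> (\<lambda>x. norm (p x))" "(LINT x|\<mu>. norm (p x)) \<le> m"
    by (simp_all add: P.prob_space)
qed

lemma sq_bound_bounded:
  assumes "p \<in> borel_measurable \<mu>" "\<And>x. x \<in> \<Omega> \<Longrightarrow> norm (p x) \<le> B" "0 \<le> B"
  shows "sq_bound p B"
proof -
  have i: "integrable \<mu> (\<lambda>x. (norm (p x))\<^sup>2)"
    by (rule integrable_bounded[where B = "B\<^sup>2"]) (use assms in \<open>auto intro: power_mono\<close>)
  have "(LINT x|\<mu>. (norm (p x))\<^sup>2) \<le> (LINT x|\<mu>. B\<^sup>2)"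
    using i assms by (intro integral_mono) (auto intro: power_mono)
  then show ?thesis using i assms P.prob_space by (simp add: sq_bound_def)
qed

text \<open>The feature is bounded in the supremum norm and the residual in L^1, which the L^2 norm
  dominates under a probability measure.\<close>

lemma Jf_bound:
  obtains C where "C > 0"
    "\<And>p h m H. sq_bound p m \<Longrightarrow> h \<in> borel_measurable \<mu> \<Longrightarrow> (\<And>x. x \<in> \<Omega> \<Longrightarrow> norm (h x) \<le> H) \<Longrightarrow> 0 \<le> H \<Longrightarrow>
       integrable \<mu> (\<lambda>x. Aop x (p x) * Bop x (p x) (h x)) \<and> \<bar>Jf p h\<bar> \<le> C * (1 + m) * H"
proof -
  obtain K where K: "K > 0"
    "\<And>x p q. x \<in> \<Omega> \<Longrightarrow> \<bar>Aop x p - Aop x q\<bar> \<le> K * norm (p - q)"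
    "\<And>x p. x \<in> \<Omega> \<Longrightarrow> \<bar>Aop x p\<bar> \<le> K * (1 + norm p)"
    "\<And>x p h. x \<in> \<Omega> \<Longrightarrow> \<bar>Bop x p h\<bar> \<le> K * norm h"
    "\<And>x p q h. x \<in> \<Omega> \<Longrightarrow> \<bar>Bop x p h - Bop x q h\<bar> \<le> K * norm (p - q) * norm h"
    using Aop_Bop_bounds by blast
  have I: "integrable \<mu> (\<lambda>x. Aop x (p x) * Bop x (p x) (h x)) \<and> \<bar>Jf p h\<bar> \<le> K * K * (1 + m) * H"
    if p: "sq_bound p m" and h: "h \<in> borel_measurable \<mu>" "\<And>x. x \<in> \<Omega> \<Longrightarrow> norm (h x) \<le> H" "0 \<le> H" for p h m H
  proof -
    note pm = p[unfolded sq_bound_def, THEN conjunct1] and p1 = sq_bound_L1[OF p]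
    have pt: "\<bar>Aop x (p x) * Bop x (p x) (h x)\<bar> \<le> K * K * H * (1 + norm (p x))" if x: "x \<in> \<Omega>" for x
    proof -
      have "\<bar>Bop x (p x) (h x)\<bar> \<le> K * H"
        by (rule order_trans[OF K(4)[OF x] mult_left_mono[OF h(2)[OF x]]]) (use K(1) in auto)
      then have "\<bar>Aop x (p x)\<bar> * \<bar>Bop x (p x) (h x)\<bar> \<le> (K * (1 + norm (p x))) * (K * H)"
        using K(3)[OF x, of "p x"] K(1) h(3) by (intro mult_mono) auto
      then show ?thesis by (simp add: abs_mult mult_ac)
    qed
    have w: "integrable \<mu> (\<lambda>x. K * K * H * (1 + norm (p x)))" using p1 by auto
    have i: "integrable \<mu> (\<lambda>x. Aop x (p x) * Bop x (p x) (h x))"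
      by (rule Bochner_Integration.integrable_bound[OF w])
         (use pt K(1) h(3) Aop_measurable[OF pm] Bop_measurable[OF pm h(1)] in \<open>auto intro!: AE_I2 intro: order_trans[OF _ abs_ge_self]\<close>)
    have "\<bar>Jf p h\<bar> \<le> (LINT x|\<mu>. K * K * H * (1 + norm (p x)))"
      unfolding Jf_def real_norm_def[symmetric]
      by (rule lint_norm_bound[OF i w]) (use pt in auto)
    also have "\<dots> = K * K * H * (1 + (LINT x|\<mu>. norm (p x)))" using p1 P.prob_space by simp
    also have "\<dots> \<le> K * K * H * (1 + m)" using p1(2) K(1) h(3) by (intro mult_left_mono) auto
    finally show ?thesis using i by (simp add: mult_ac)
  qed
  show ?thesis by (rule that[OF _ I]) (use K(1) in simp)
qed

lemma Jf_integrable: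
  assumes "sq_bound p m" "h \<in> borel_measurable \<mu>" "\<And>x. x \<in> \<Omega> \<Longrightarrow> norm (h x) \<le> H" "0 \<le> H"
  shows "integrable \<mu> (\<lambda>x. Aop x (p x) * Bop x (p x) (h x))"
proof (rule Jf_bound)
  fix C
  assume "\<And>p h m H. sq_bound p m \<Longrightarrow> h \<in> borel_measurable \<mu> \<Longrightarrow> (\<And>x. x \<in> \<Omega> \<Longrightarrow> norm (h x) \<le> H) \<Longrightarrow> 0 \<le> H \<Longrightarrow>
       integrable \<mu> (\<lambda>x. Aop x (p x) * Bop x (p x) (h x)) \<and> \<bar>Jf p h\<bar> \<le> C * (1 + m) * H"
  from this[OF assms] show ?thesis by simp
qed

text \<open>The constant involves the bound \<open>m\<close> of \<open>q\<close> but not the bound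
  \<open>m'\<close> of \<open>p\<close>. With the limit as \<open>q\<close> and the network as
  \<open>p\<close>, no a priori bound for the network is required.\<close>

lemma Jf_lipschitz:
  obtains C where "C > 0"
    "\<And>p q h m' m \<delta> H. sq_bound p m' \<Longrightarrow> sq_bound q m \<Longrightarrow> sq_bound (\<lambda>x. p x - q x) \<delta> \<Longrightarrow> h \<in> borel_measurable \<mu> \<Longrightarrow>
       (\<And>x. x \<in> \<Omega> \<Longrightarrow> norm (h x) \<le> H) \<Longrightarrow> 0 \<le> H \<Longrightarrow> \<bar>Jf p h - Jf q h\<bar> \<le> C * (1 + m) * H * \<delta>"
proof -
  obtain K where K: "K > 0"
    "\<And>x p q. x \<in> \<Omega> \<Longrightarrow> \<bar>Aop x p - Aop x q\<bar> \<le> K * norm (p - q)"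
    "\<And>x p. x \<in> \<Omega> \<Longrightarrow> \<bar>Aop x p\<bar> \<le> K * (1 + norm p)"
    "\<And>x p h. x \<in> \<Omega> \<Longrightarrow> \<bar>Bop x p h\<bar> \<le> K * norm h"
    "\<And>x p q h. x \<in> \<Omega> \<Longrightarrow> \<bar>Bop x p h - Bop x q h\<bar> \<le> K * norm (p - q) * norm h"
    using Aop_Bop_bounds by blast
  have D: "\<bar>Jf p h - Jf q h\<bar> \<le> (2 * K * K) * (1 + m) * H * \<delta>"
    if p: "sq_bound p m'" and q: "sq_bound q m" and r: "sq_bound (\<lambda>x. p x - q x) \<delta>"
      and h: "h \<in> borel_measurable \<mu>" "\<And>x. x \<in> \<Omega> \<Longrightarrow> norm (h x) \<le> H" "0 \<le> H" for p q h m' m \<delta> H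
  proof -
    note i = Jf_integrable[OF p h] Jf_integrable[OF q h]
    have "integrable \<mu> (\<lambda>x. norm (p x - q x) * norm (q x)) \<and> (LINT x|\<mu>. \<bar>norm (p x - q x) * norm (q x)\<bar>) \<le> \<delta> * m"
      using Cauchy_Schwarz_bound[of "\<lambda>x. norm (p x - q x)" \<mu> "\<lambda>x. norm (q x)" \<delta> m] q r unfolding sq_bound_def by auto
    then have cs: "integrable \<mu> (\<lambda>x. norm (p x - q x) * norm (q x))" "(LINT x|\<mu>. norm (p x - q x) * norm (q x)) \<le> \<delta> * m" by auto
    note r1 = sq_bound_L1[OF r]
    define W where "W = (\<lambda>x. K * K * H * (2 * norm (p x - q x) + norm (p x - q x) * norm (q x)))"
    have pt: "\<bar>Aop x (p x) * Bop x (p x) (h x) - Aop x (q x) * Bop x (q x) (h x)\<bar> \<le> W x" if x: "x \<in> \<Omega>" for x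
    proof -
      have bh: "\<bar>Bop x (p x) (h x)\<bar> \<le> K * H"
        by (rule order_trans[OF K(4)[OF x] mult_left_mono[OF h(2)[OF x]]]) (use K(1) in auto)
      have dh: "\<bar>Bop x (p x) (h x) - Bop x (q x) (h x)\<bar> \<le> K * norm (p x - q x) * H"
        by (rule order_trans[OF K(5)[OF x] mult_left_mono[OF h(2)[OF x]]]) (use K(1) in auto)
      \<comment> \<open>The splitting that causes the asymmetry: the residual that is not
        differenced is the one at \<open>q\<close>, and it meets the difference of the linearised
        operators; Cauchy-Schwarz bounds their product.\<close>
      have eq: "Aop x (p x) * Bop x (p x) (h x) - Aop x (q x) * Bop x (q x) (h x)
         = (Aop x (p x) - Aop x (q x)) * Bop x (p x) (h x) + Aop x (q x) * (Bop x (p x) (h x) - Bop x (q x) (h x))"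
        by (simp add: algebra_simps)
      have "\<bar>Aop x (p x) * Bop x (p x) (h x) - Aop x (q x) * Bop x (q x) (h x)\<bar> \<le> \<bar>Aop x (p x) - Aop x (q x)\<bar> * \<bar>Bop x (p x) (h x)\<bar> + \<bar>Aop x (q x)\<bar> * \<bar>Bop x (p x) (h x) - Bop x (q x) (h x)\<bar>"
        unfolding eq by (rule order_trans[OF abs_triangle_ineq]) (simp add: abs_mult)
      also have "\<dots> \<le> (K * norm (p x - q x)) * (K * H) + (K * (1 + norm (q x))) * (K * norm (p x - q x) * H)"
        using K(1) h(3) by (intro add_mono mult_mono K(2,3)[OF x] bh dh) auto
      also have "\<dots> = W x" by (simp add: W_def algebra_simps)
      finally show ?thesis .
    qed
    have w: "integrable \<mu> W" unfolding W_def using cs r1 by auto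
    have eq: "Jf p h - Jf q h = (LINT x|\<mu>. Aop x (p x) * Bop x (p x) (h x) - Aop x (q x) * Bop x (q x) (h x))"
      unfolding Jf_def using i by simp
    have "\<bar>Jf p h - Jf q h\<bar> \<le> (LINT x|\<mu>. W x)"
      unfolding eq real_norm_def[symmetric]
      by (rule lint_norm_bound[OF _ w]) (use pt i in auto)
    also have "\<dots> = K * K * H * (2 * (LINT x|\<mu>. norm (p x - q x)) + (LINT x|\<mu>. norm (p x - q x) * norm (q x)))"
      unfolding W_def using cs r1 by simp
    also have "\<dots> \<le> K * K * H * (2 * \<delta> + \<delta> * m)" using cs r1 K(1) h(3) by (intro mult_left_mono) auto
    also have "\<dots> \<le> K * K * H * (2 * (1 + m) * \<delta>)"
      using K(1) h(3) r q by (intro mult_left_mono) (auto simp: sq_bound_def algebra_simps)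
    finally show ?thesis by (simp add: mult_ac)
  qed
  show ?thesis by (rule that[OF _ D]) (use K(1) in simp)
qed

lemma Jf_diff:
  assumes "sq_bound p m" "h \<in> borel_measurable \<mu>" "h' \<in> borel_measurable \<mu>"
    "\<And>x. x \<in> \<Omega> \<Longrightarrow> norm (h x) \<le> H" "\<And>x. x \<in> \<Omega> \<Longrightarrow> norm (h' x) \<le> H"
  shows "Jf p h - Jf p h' = Jf p (\<lambda>x. h x - h' x)"
proof -
  obtain a where "a \<in> \<Omega>" using int_ne interior_subset by blast
  then have H: "0 \<le> H" using assms(4) norm_ge_zero order_trans by blast
  have "integrable \<mu> (\<lambda>x. Aop x (p x) * Bop x (p x) (h x))" "integrable \<mu> (\<lambda>x. Aop x (p x) * Bop x (p x) (h' x))"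
    using Jf_integrable[OF assms(1,2,4) H] Jf_integrable[OF assms(1,3,5) H] by auto
  then show ?thesis unfolding Jf_def by (simp add: Bop_linear right_diff_distrib)
qed

end

section \<open>Differentiation under the integral\<close>

lemma integrable_norm_bound:
  fixes F :: "'w \<Rightarrow> 'b::{banach, second_countable_topology}"
  assumes "integrable M B" "F \<in> borel_measurable M" "\<And>\<omega>. \<omega> \<in> space M \<Longrightarrow> norm (F \<omega>) \<le> B \<omega>"
  shows "integrable M F"
proof (rule Bochner_Integration.integrable_bound[OF assms(1,2)])
  show "AE \<omega> in M. norm (F \<omega>) \<le> norm (B \<omega>)"
    using assms(3) by (intro AE_I2) (metis abs_ge_self order_trans real_norm_def)
qed

text \<open>The normalised remainder tends to 0 pointwise and is dominated by \<open>2 * B\<close>,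
  one \<open>B\<close> from the mean value theorem on the unit ball and one from the linear
  term.\<close>

lemma has_derivative_integral_param:
  fixes v :: "'w \<Rightarrow> 'a::euclidean_space \<Rightarrow> real" and D :: "'w \<Rightarrow> 'a \<Rightarrow> 'a"
  assumes d: "\<And>\<omega> x. \<omega> \<in> space M \<Longrightarrow> (v \<omega> has_derivative (\<lambda>h. D \<omega> x \<bullet> h)) (at x)"
    and m: "\<And>x. (\<lambda>\<omega>. v \<omega> x) \<in> borel_measurable M" "\<And>x. (\<lambda>\<omega>. D \<omega> x) \<in> borel_measurable M"
    and B: "integrable M B" "\<And>\<omega> x. \<omega> \<in> space M \<Longrightarrow> x \<in> cball x0 1 \<Longrightarrow> norm (D \<omega> x) \<le> B \<omega>"
    and i: "\<And>x. integrable M (\<lambda>\<omega>. v \<omega> x)"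
  shows "((\<lambda>x. LINT \<omega>|M. v \<omega> x) has_derivative (\<lambda>h. (LINT \<omega>|M. D \<omega> x0) \<bullet> h)) (at x0)"
proof -
  have iD: "integrable M (\<lambda>\<omega>. D \<omega> x0)"
    by (rule integrable_norm_bound[OF B(1) m(2)]) (use B(2)[of _ x0] in auto)
  have lip: "\<bar>v \<omega> (x0 + h) - v \<omega> x0\<bar> \<le> B \<omega> * norm h" if w: "\<omega> \<in> space M" and h: "norm h \<le> 1" for \<omega> h
  proof -
    have B0: "0 \<le> B \<omega>" using order_trans[OF norm_ge_zero B(2)[OF w, of x0]] by simp
    have "norm (v \<omega> (x0 + h) - v \<omega> x0) \<le> B \<omega> * norm (x0 + h - x0)"
    proof (rule differentiable_bound[of "cball x0 1" "v \<omega>" "\<lambda>x h. D \<omega> x \<bullet> h"])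
      fix x assume x: "x \<in> cball x0 1"
      show "(v \<omega> has_derivative (\<bullet>) (D \<omega> x)) (at x within cball x0 1)"
        by (rule has_derivative_at_withinI[OF d[OF w]])
      show "onorm ((\<bullet>) (D \<omega> x)) \<le> B \<omega>"
      proof (rule onorm_bound[OF B0])
        fix k show "norm (D \<omega> x \<bullet> k) \<le> B \<omega> * norm k"
          using Cauchy_Schwarz_ineq2[of "D \<omega> x" k] mult_right_mono[OF B(2)[OF w x], of "norm k"] by simp
      qed
    qed (use h in \<open>auto simp: dist_norm\<close>)
    then show ?thesis by simp
  qed
  have "((\<lambda>h. norm ((LINT \<omega>|M. v \<omega> (x0 + h)) - (LINT \<omega>|M. v \<omega> x0) - (LINT \<omega>|M. D \<omega> x0) \<bullet> h) / norm h) \<longlongrightarrow> 0) (at 0)"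
    unfolding tendsto_at_iff_sequentially
  proof (intro allI impI)
    fix X :: "nat \<Rightarrow> 'a" assume X: "\<forall>i. X i \<in> UNIV - {0}" "X \<longlonglongrightarrow> 0"
    then obtain N where N: "\<And>n. n \<ge> N \<Longrightarrow> norm (X n) \<le> 1"
      using LIMSEQ_D[OF X(2), of 1] by (force simp: less_imp_le)
    \<comment> \<open>Dropping finitely many terms keeps all increments in the unit ball, where the
      dominating function is available.\<close>
    define Y where "Y = (\<lambda>n. X (n + N))"
    have Y: "Y \<longlonglongrightarrow> 0" "\<And>n. Y n \<noteq> 0" "\<And>n. norm (Y n) \<le> 1"
      using LIMSEQ_ignore_initial_segment[OF X(2)] X(1) N by (auto simp: Y_def)
    define r where "r = (\<lambda>n \<omega>. (v \<omega> (x0 + Y n) - v \<omega> x0 - D \<omega> x0 \<bullet> Y n) / norm (Y n))"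
    have "(\<lambda>n. LINT \<omega>|M. r n \<omega>) \<longlonglongrightarrow> (LINT \<omega>|M. 0)"
    proof (rule integral_dominated_convergence[where s = r and w = "\<lambda>\<omega>. 2 * B \<omega>"])
      show "r n \<in> borel_measurable M" for n unfolding r_def using m by auto
      show "integrable M (\<lambda>\<omega>. 2 * B \<omega>)" using B(1) by simp
      show "AE \<omega> in M. (\<lambda>n. r n \<omega>) \<longlonglongrightarrow> 0"
      proof (rule AE_I2)
        fix \<omega> assume w: "\<omega> \<in> space M"
        have "((\<lambda>h. norm (v \<omega> (x0 + h) - v \<omega> x0 - D \<omega> x0 \<bullet> h) / norm h) \<longlongrightarrow> 0) (at 0)"
          using d[OF w, of x0] by (simp add: has_derivative_at)
        then have "(\<lambda>n. norm (v \<omega> (x0 + Y n) - v \<omega> x0 - D \<omega> x0 \<bullet> Y n) / norm (Y n)) \<longlonglongrightarrow> 0"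
          unfolding tendsto_at_iff_sequentially using Y by (auto simp: comp_def)
        then show "(\<lambda>n. r n \<omega>) \<longlonglongrightarrow> 0"
          by (subst tendsto_rabs_zero_iff[symmetric]) (simp add: r_def)
      qed
      show "AE \<omega> in M. norm (r n \<omega>) \<le> 2 * B \<omega>" for n
      proof (rule AE_I2)
        fix \<omega> assume w: "\<omega> \<in> space M"
        have "\<bar>v \<omega> (x0 + Y n) - v \<omega> x0 - D \<omega> x0 \<bullet> Y n\<bar> \<le> \<bar>v \<omega> (x0 + Y n) - v \<omega> x0\<bar> + norm (D \<omega> x0) * norm (Y n)"
          using Cauchy_Schwarz_ineq2[of "D \<omega> x0" "Y n"] by linarith
        also have "\<dots> \<le> B \<omega> * norm (Y n) + B \<omega> * norm (Y n)"
          using lip[OF w Y(3)] B(2)[OF w, of x0] by (intro add_mono mult_right_mono) auto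
        finally have "\<bar>v \<omega> (x0 + Y n) - v \<omega> x0 - D \<omega> x0 \<bullet> Y n\<bar> \<le> (2 * B \<omega>) * norm (Y n)" by simp
        then show "norm (r n \<omega>) \<le> 2 * B \<omega>" using Y(2)[of n] by (simp add: r_def divide_le_eq)
      qed
    qed auto
    moreover have "(LINT \<omega>|M. r n \<omega>) = ((LINT \<omega>|M. v \<omega> (x0 + Y n)) - (LINT \<omega>|M. v \<omega> x0) - (LINT \<omega>|M. D \<omega> x0) \<bullet> Y n) / norm (Y n)" for n
      unfolding r_def using i iD by simp
    ultimately have "(\<lambda>n. ((LINT \<omega>|M. v \<omega> (x0 + Y n)) - (LINT \<omega>|M. v \<omega> x0) - (LINT \<omega>|M. D \<omega> x0) \<bullet> Y n) / norm (Y n)) \<longlonglongrightarrow> 0"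
      by simp
    from tendsto_rabs_zero[OF this]
    have "(\<lambda>n. norm ((LINT \<omega>|M. v \<omega> (x0 + X (n + N))) - (LINT \<omega>|M. v \<omega> x0) - (LINT \<omega>|M. D \<omega> x0) \<bullet> X (n + N)) / norm (X (n + N))) \<longlonglongrightarrow> 0"
      by (simp add: Y_def)
    from LIMSEQ_offset[OF this]
    show "((\<lambda>h. norm ((LINT \<omega>|M. v \<omega> (x0 + h)) - (LINT \<omega>|M. v \<omega> x0) - (LINT \<omega>|M. D \<omega> x0) \<bullet> h) / norm h) \<circ> X) \<longlonglongrightarrow> 0"
      by (simp add: comp_def)
  qed
  then show ?thesis by (simp add: has_derivative_at bounded_linear_inner_right)
qed

text \<open>Locally uniform integrable bounds on the jets allow differentiation under the integral
  twice, for the value and for each component of the gradient. Used both for the average over \<mu>0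
  and for the integral over time.\<close>

lemma has_jet_integral:
  fixes u :: "'w \<Rightarrow> real^'n \<Rightarrow> real" and J :: "'w \<Rightarrow> real^'n \<Rightarrow> 'n::finite jet"
  assumes J: "\<And>\<omega>. \<omega> \<in> space M \<Longrightarrow> has_jet UNIV (u \<omega>) (J \<omega>)"
    and m: "\<And>x. (\<lambda>\<omega>. J \<omega> x) \<in> borel_measurable M"
    and B: "\<And>R. R \<ge> 0 \<Longrightarrow> \<exists>B. integrable M B \<and> (\<forall>\<omega>\<in>space M. \<forall>x. norm x \<le> R \<longrightarrow> norm (J \<omega> x) \<le> B \<omega>)"
  shows "has_jet UNIV (\<lambda>x. LINT \<omega>|M. u \<omega> x) (\<lambda>x. LINT \<omega>|M. J \<omega> x)"
  unfolding has_jet_def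
proof (intro conjI ballI allI)
  have iJ: "integrable M (\<lambda>\<omega>. J \<omega> x)" for x
  proof -
    obtain B where "integrable M B" "\<forall>\<omega>\<in>space M. \<forall>y. norm y \<le> norm x \<longrightarrow> norm (J \<omega> y) \<le> B \<omega>"
      using B[of "norm x"] by auto
    then show ?thesis by (intro integrable_norm_bound[OF _ m]) auto
  qed
  have u: "(LINT \<omega>|M. u \<omega> x) = (LINT \<omega>|M. fst (J \<omega> x))" for x
    by (rule Bochner_Integration.integral_cong) (use has_jet_D(1)[OF J] in auto)
  have l1: "fst (LINT \<omega>|M. J \<omega> x) = (LINT \<omega>|M. fst (J \<omega> x))" for x
    by (rule integral_bounded_linear[OF bounded_linear_fst iJ, symmetric])
  have bl2: "bounded_linear (\<lambda>p::'n jet. fst (snd p))"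
    by (rule bounded_linear_compose[OF bounded_linear_fst bounded_linear_snd])
  \<comment> \<open>The derivative of the j-th gradient component pairs the increment with column
    \<open>j\<close> of the Hessian, so that column is extracted as a vector.\<close>
  have bl4: "bounded_linear (\<lambda>p::'n jet. (\<chi> i. snd (snd p) $ i $ j))" for j
    by (rule bounded_linear_intro[of _ 1])
       (auto simp: vec_eq_iff intro!: order_trans[OF _ norm_le_triple(3)]
         norm_le_componentwise_cart component_le_norm_cart Finite_Cartesian_Product.norm_nth_le)
  have l2: "fst (snd (LINT \<omega>|M. J \<omega> x)) = (LINT \<omega>|M. fst (snd (J \<omega> x)))" for x
    by (rule integral_bounded_linear[OF bl2 iJ, symmetric])
  have l4: "(\<chi> i. snd (snd (LINT \<omega>|M. J \<omega> x)) $ i $ j) = (LINT \<omega>|M. (\<chi> i. snd (snd (J \<omega> x)) $ i $ j))" for x j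
    by (rule integral_bounded_linear[OF bl4 iJ, symmetric])
  have l5: "fst (snd (LINT \<omega>|M. J \<omega> x)) $ j = (LINT \<omega>|M. fst (snd (J \<omega> x)) $ j)" for x j
    using integral_bounded_linear[OF bounded_linear_compose[OF bounded_linear_vec_nth[of j] bl2] iJ[of x]] by simp
  note meas = borel_measurable_continuous_on[OF linear_continuous_on m]
  fix x
  show "fst (LINT \<omega>|M. J \<omega> x) = (LINT \<omega>|M. u \<omega> x)" using l1 u by simp
  obtain B0 where B0: "integrable M B0" "\<And>\<omega> y. \<omega> \<in> space M \<Longrightarrow> y \<in> cball x 1 \<Longrightarrow> norm (J \<omega> y) \<le> B0 \<omega>"
  proof -
    obtain B0 where "integrable M B0" "\<forall>\<omega>\<in>space M. \<forall>y. norm y \<le> norm x + 1 \<longrightarrow> norm (J \<omega> y) \<le> B0 \<omega>"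
      using B[of "norm x + 1"] by auto
    moreover have "norm y \<le> norm x + 1" if "y \<in> cball x 1" for y
      using that norm_triangle_ineq2[of y x] by (simp add: dist_norm norm_minus_commute)
    ultimately show ?thesis using that by blast
  qed
  show "((\<lambda>x. LINT \<omega>|M. u \<omega> x) has_derivative (\<bullet>) (fst (snd (LINT \<omega>|M. J \<omega> x)))) (at x within UNIV)"
    unfolding l2 u
  proof (rule has_derivative_integral_param[OF _ _ _ B0(1)])
    show "((\<lambda>x. fst (J \<omega> x)) has_derivative (\<bullet>) (fst (snd (J \<omega> x)))) (at x)" if "\<omega> \<in> space M" for \<omega> x
      using has_jet_D(1,2)[OF J[OF that]] by simp
    show "(\<lambda>\<omega>. fst (J \<omega> x)) \<in> borel_measurable M" "(\<lambda>\<omega>. fst (snd (J \<omega> x))) \<in> borel_measurable M" for x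
      by (intro meas bounded_linear_fst bl2)+
    show "norm (fst (snd (J \<omega> y))) \<le> B0 \<omega>" if "\<omega> \<in> space M" "y \<in> cball x 1" for \<omega> y
      by (rule order_trans[OF norm_le_triple(2) B0(2)[OF that]])
    show "integrable M (\<lambda>\<omega>. fst (J \<omega> x))" for x by (rule integrable_bounded_linear[OF bounded_linear_fst iJ])
  qed
  fix j
  have "((\<lambda>y. LINT \<omega>|M. fst (snd (J \<omega> y)) $ j) has_derivative (\<bullet>) (\<chi> i. snd (snd (LINT \<omega>|M. J \<omega> x)) $ i $ j)) (at x)"
    unfolding l4
  proof (rule has_derivative_integral_param[OF _ _ _ B0(1)])
    show "((\<lambda>x. fst (snd (J \<omega> x)) $ j) has_derivative (\<bullet>) (\<chi> i. snd (snd (J \<omega> x)) $ i $ j)) (at x)" if "\<omega> \<in> space M" for \<omega> x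
      by (rule has_derivative_eq_rhs[OF has_jet_D(3)[OF J[OF that] UNIV_I]]) (simp add: fun_eq_iff inner_vec_def)
    show "(\<lambda>\<omega>. fst (snd (J \<omega> x)) $ j) \<in> borel_measurable M" "(\<lambda>\<omega>. \<chi> i. snd (snd (J \<omega> x)) $ i $ j) \<in> borel_measurable M" for x
      by (intro meas bl4 bounded_linear_compose[OF bounded_linear_vec_nth bl2])+
    show "norm (\<chi> i. snd (snd (J \<omega> y)) $ i $ j) \<le> B0 \<omega>" if w: "\<omega> \<in> space M" "y \<in> cball x 1" for \<omega> y
      by (rule order_trans[OF _ order_trans[OF norm_le_triple(3) B0(2)[OF w]]])
         (auto intro!: norm_le_componentwise_cart component_le_norm_cart Finite_Cartesian_Product.norm_nth_le)
    show "integrable M (\<lambda>\<omega>. fst (snd (J \<omega> x)) $ j)" for x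
      by (rule integrable_bounded_linear[OF bounded_linear_compose[OF bounded_linear_vec_nth bl2] iJ])
  qed
  then show "((\<lambda>y. fst (snd (LINT \<omega>|M. J \<omega> y)) $ j) has_derivative
       (\<lambda>h. \<Sum>i\<in>UNIV. snd (snd (LINT \<omega>|M. J \<omega> x)) $ i $ j * h $ i)) (at x within UNIV)"
    unfolding l5 by (rule has_derivative_eq_rhs) (simp add: fun_eq_iff inner_vec_def)
next
  show "continuous_on UNIV (\<lambda>x. LINT \<omega>|M. J \<omega> x)"
    unfolding continuous_on_sequentially
  proof (intro allI ballI impI)
    fix X :: "nat \<Rightarrow> real^'n" and x assume "x \<in> UNIV" and X: "(\<forall>n. X n \<in> UNIV) \<and> X \<longlonglongrightarrow> x"
    then have "Bseq X" using convergent_imp_Bseq convergentI by blast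
    then obtain R where R: "R > 0" "\<And>n. norm (X n) \<le> R" by (auto simp: Bseq_def)
    obtain B0 where B0: "integrable M B0" "\<forall>\<omega>\<in>space M. \<forall>y. norm y \<le> R \<longrightarrow> norm (J \<omega> y) \<le> B0 \<omega>"
      using B[of R] R(1) by auto
    have "(\<lambda>n. LINT \<omega>|M. J \<omega> (X n)) \<longlonglongrightarrow> (LINT \<omega>|M. J \<omega> x)"
    proof (rule integral_dominated_convergence[where s = "\<lambda>n \<omega>. J \<omega> (X n)", OF m m B0(1)])
      show "AE \<omega> in M. norm (J \<omega> (X n)) \<le> B0 \<omega>" for n using B0(2) R(2) by auto
      show "AE \<omega> in M. (\<lambda>n. J \<omega> (X n)) \<longlonglongrightarrow> J \<omega> x"
      proof (rule AE_I2)
        fix \<omega> assume "\<omega> \<in> space M"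
        then have "continuous_on UNIV (J \<omega>)" using J by (auto simp: has_jet_def)
        then show "(\<lambda>n. J \<omega> (X n)) \<longlonglongrightarrow> J \<omega> x" using X unfolding continuous_on_sequentially by (auto simp: comp_def)
      qed
    qed
    then show "((\<lambda>x. LINT \<omega>|M. J \<omega> x) \<circ> X) \<longlonglongrightarrow> (LINT \<omega>|M. J \<omega> x)" by (simp add: comp_def)
  qed
qed

section \<open>The network features in the training functional\<close>

locale nn = pde \<Omega> a c d f g
  for \<Omega> :: "(real^'n) set" and a c d f g +
  fixes \<eta> :: "real^'n \<Rightarrow> real" and \<sigma> :: "real \<Rightarrow> real"
  assumes eta: "Ckb_on 3 \<Omega> \<eta>" and sig: "Ckb_on 3 UNIV \<sigma>"
begin

definition ej :: "real^'n \<Rightarrow> 'n jet" where "ej = jet (cpd \<Omega>) \<eta>"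

text \<open>The jet of the full feature, with the factor \<eta>. Against it stands
  \<open>fjet\<close>, without that factor, which moves the quotient of network and \<eta>.\<close>

definition hj :: "'n param \<Rightarrow> 'n param \<Rightarrow> real^'n \<Rightarrow> 'n jet" where
  "hj \<theta> e x = jmul (ej x) (fjet \<sigma> \<theta> e x)"

lemma has_jet_eta: "has_jet \<Omega> \<eta> ej"
  unfolding ej_def by (rule has_jet_C2[OF thick]) (use eta in \<open>auto simp: Ckb_on_def Ck_on_def\<close>)

lemma ej_continuous: "continuous_on \<Omega> ej" using has_jet_eta by (simp add: has_jet_def)

lemma ej_bounded: obtains E where "E > 0" "\<And>x. x \<in> \<Omega> \<Longrightarrow> norm (ej x) \<le> E"
  using continuous_bounded[OF ej_continuous] by blast

lemma has_jet_feature_grad: "has_jet \<Omega> (feature_grad \<eta> \<sigma> \<theta> e) (hj \<theta> e)"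
proof -
  have "feature_grad \<eta> \<sigma> \<theta> e = (\<lambda>x. \<eta> x * fst (fjet \<sigma> \<theta> e x))" using feature_grad_eq[OF sig] by blast
  then show ?thesis
    using has_jet_mult[OF has_jet_eta has_jet_subset[OF has_jet_feature[OF sig] subset_UNIV]] by (simp add: hj_def[abs_def])
qed

lemma dom_bounded: obtains \<rho> where "\<rho> \<ge> 0" "\<And>x. x \<in> \<Omega> \<Longrightarrow> norm x \<le> \<rho>"
  using compact_imp_bounded[OF compact_dom] unfolding bounded_pos by (metis less_imp_le)

lemma features_bound:
  obtains C where "C > 0"
    "\<And>\<theta> e x. e \<in> Basis \<Longrightarrow> x \<in> \<Omega> \<Longrightarrow> norm (fjet \<sigma> \<theta> e x) \<le> C * growth \<theta>"
    "\<And>\<theta> e x. e \<in> Basis \<Longrightarrow> x \<in> \<Omega> \<Longrightarrow> norm (hj \<theta> e x) \<le> C * growth \<theta>"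
    "\<And>x p. x \<in> \<Omega> \<Longrightarrow> norm (jmul (ej x) p) \<le> C * norm p"
proof -
  obtain \<rho> where r: "\<rho> \<ge> 0" "\<And>x. x \<in> \<Omega> \<Longrightarrow> norm x \<le> \<rho>" using dom_bounded by blast
  obtain E where E: "E > 0" "\<And>x. x \<in> \<Omega> \<Longrightarrow> norm (ej x) \<le> E" using ej_bounded by blast
  obtain C where C: "C > 0" "\<And>(\<theta>::'n param) e x. norm e \<le> 1 \<Longrightarrow> norm x \<le> \<rho> \<Longrightarrow> norm (fjet \<sigma> \<theta> e x) \<le> C * growth \<theta>"
    using fjet_bound[OF sig r(1)] by metis
  define D where "D = C + 7 * E + 7 * E * C"
  have D: "D > 0" "C \<le> D" "7 * E \<le> D" "7 * E * C \<le> D" using C(1) E(1) by (auto simp: D_def add_pos_pos)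
  have g0: "0 \<le> growth \<theta>" for \<theta> :: "'n param" using growth_ge_1[of \<theta>] by linarith
  have f: "norm (fjet \<sigma> \<theta> e x) \<le> C * growth \<theta>" if "e \<in> Basis" "x \<in> \<Omega>" for \<theta> e x
    using C(2)[of e x \<theta>] r that by (simp add: norm_Basis)
  have j: "norm (jmul (ej x) p) \<le> 7 * E * norm p" if "x \<in> \<Omega>" for x p
    by (rule order_trans[OF norm_jmul mult_right_mono]) (use E(2)[OF that] in auto)
  have h: "norm (hj \<theta> e x) \<le> 7 * E * (C * growth \<theta>)" if "e \<in> Basis" "x \<in> \<Omega>" for \<theta> e x
    unfolding hj_def by (rule order_trans[OF j[OF that(2)] mult_left_mono[OF f[OF that]]]) (use E(1) in simp)
  show ?thesis
  proof (rule that[OF D(1)])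
    show "norm (fjet \<sigma> \<theta> e x) \<le> D * growth \<theta>" if "e \<in> Basis" "x \<in> \<Omega>" for \<theta> e x
      by (rule order_trans[OF f[OF that] mult_right_mono[OF D(2) g0]])
    show "norm (hj \<theta> e x) \<le> D * growth \<theta>" if "e \<in> Basis" "x \<in> \<Omega>" for \<theta> e x
      using order_trans[OF h[OF that, of \<theta>], of "D * growth \<theta>"] mult_right_mono[OF D(4) g0[of \<theta>]] by (simp add: mult.assoc)
    show "norm (jmul (ej x) p) \<le> D * norm p" if "x \<in> \<Omega>" for x p
      by (rule order_trans[OF j[OF that] mult_right_mono[OF D(3)]]) simp
  qed
qed

lemma hj_measurable: "hj \<theta> e \<in> borel_measurable \<mu>"
  using has_jet_feature_grad[of \<theta> e] by (intro borel_measurable_continuous) (simp add: has_jet_def)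

lemma features_uniformly_continuous:
  assumes "\<epsilon> > 0"
  obtains \<delta> where "\<delta> > 0"
    "\<And>\<theta> \<theta>' x. norm \<theta> \<le> K \<Longrightarrow> norm \<theta>' \<le> K \<Longrightarrow> norm (\<theta>' - \<theta>) < \<delta> \<Longrightarrow> x \<in> \<Omega> \<Longrightarrow>
       norm (fjet \<sigma> \<theta>' e x - fjet \<sigma> \<theta> e x) \<le> \<epsilon> \<and> norm (hj \<theta>' e x - hj \<theta> e x) \<le> \<epsilon>"
proof -
  have cp: "compact (cball (0::'n param) K \<times> \<Omega>)" by (intro compact_Times compact_cball compact_dom)
  have cf: "continuous_on (cball 0 K \<times> \<Omega>) (\<lambda>z. fjet \<sigma> (fst z) e (snd z))"
    by (intro continuous_on_fjet sig continuous_intros)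
  have "continuous_on (cball 0 K \<times> \<Omega>) (\<lambda>z. ej (snd z))"
    by (rule continuous_on_compose2[OF ej_continuous]) (auto intro: continuous_intros)
  then have ch: "continuous_on (cball 0 K \<times> \<Omega>) (\<lambda>z. hj (fst z) e (snd z))"
    unfolding hj_def by (intro continuous_on_jmul cf)
  obtain d1 where d1: "d1 > 0" "\<And>z z'. z \<in> cball 0 K \<times> \<Omega> \<Longrightarrow> z' \<in> cball 0 K \<times> \<Omega> \<Longrightarrow> dist z' z < d1 \<Longrightarrow>
      dist (fjet \<sigma> (fst z') e (snd z')) (fjet \<sigma> (fst z) e (snd z)) < \<epsilon>"
    using compact_uniformly_continuous[OF cf cp] assms unfolding uniformly_continuous_on_def by metis
  obtain d2 where d2: "d2 > 0" "\<And>z z'. z \<in> cball 0 K \<times> \<Omega> \<Longrightarrow> z' \<in> cball 0 K \<times> \<Omega> \<Longrightarrow> dist z' z < d2 \<Longrightarrow>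
      dist (hj (fst z') e (snd z')) (hj (fst z) e (snd z)) < \<epsilon>"
    using compact_uniformly_continuous[OF ch cp] assms unfolding uniformly_continuous_on_def by metis
  show ?thesis
  proof (rule that[of "min d1 d2"])
    show "min d1 d2 > 0" using d1 d2 by simp
    fix \<theta> \<theta>' :: "'n param" and x assume A: "norm \<theta> \<le> K" "norm \<theta>' \<le> K" "norm (\<theta>' - \<theta>) < min d1 d2" "x \<in> \<Omega>"
    have "dist (\<theta>', x) (\<theta>, x) = norm (\<theta>' - \<theta>)" by (simp add: dist_Pair_Pair dist_norm)
    then show "norm (fjet \<sigma> \<theta>' e x - fjet \<sigma> \<theta> e x) \<le> \<epsilon> \<and> norm (hj \<theta>' e x - hj \<theta> e x) \<le> \<epsilon>"
      using d1(2)[of "(\<theta>, x)" "(\<theta>', x)"] d2(2)[of "(\<theta>, x)" "(\<theta>', x)"] A by (auto simp: dist_norm)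
  qed
qed

text \<open>The integral is linear in the feature, so uniform continuity of the features carries
  over with the same \<delta> for all jets \<open>p\<close> of L^2 norm at most \<open>M\<close>.
  This uniformity is the source of equicontinuity along the trajectory.\<close>

lemma Jf_hj_uniformly_continuous:
  assumes e: "e \<in> Basis" and "\<epsilon> > 0" and M: "M \<ge> 0"
  obtains \<delta> where "\<delta> > 0"
    "\<And>\<theta> \<theta>' p. norm \<theta> \<le> K \<Longrightarrow> norm \<theta>' \<le> K \<Longrightarrow> norm (\<theta>' - \<theta>) < \<delta> \<Longrightarrow> sq_bound p M \<Longrightarrow>
       \<bar>Jf p (hj \<theta>' e) - Jf p (hj \<theta> e)\<bar> \<le> \<epsilon>"
proof -
  obtain C where C: "C > 0" "\<And>\<theta> e x. e \<in> Basis \<Longrightarrow> x \<in> \<Omega> \<Longrightarrow> norm (hj \<theta> e x) \<le> C * growth \<theta>"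
    using features_bound by metis
  show ?thesis
  proof (rule Jf_bound)
    fix B
    assume B: "B > 0" and J: "\<And>p h m H. sq_bound p m \<Longrightarrow> h \<in> borel_measurable \<mu> \<Longrightarrow> (\<And>x. x \<in> \<Omega> \<Longrightarrow> norm (h x) \<le> H) \<Longrightarrow> 0 \<le> H \<Longrightarrow>
       integrable \<mu> (\<lambda>x. Aop x (p x) * Bop x (p x) (h x)) \<and> \<bar>Jf p h\<bar> \<le> B * (1 + m) * H"
    define \<epsilon>' where "\<epsilon>' = \<epsilon> / (B * (1 + M))"
    have e': "\<epsilon>' > 0" using assms B by (simp add: \<epsilon>'_def)
    obtain \<delta> where \<delta>: "\<delta> > 0" "\<And>\<theta> \<theta>' x. norm \<theta> \<le> K \<Longrightarrow> norm \<theta>' \<le> K \<Longrightarrow> norm (\<theta>' - \<theta>) < \<delta> \<Longrightarrow> x \<in> \<Omega> \<Longrightarrow>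
       norm (fjet \<sigma> \<theta>' e x - fjet \<sigma> \<theta> e x) \<le> \<epsilon>' \<and> norm (hj \<theta>' e x - hj \<theta> e x) \<le> \<epsilon>'"
      using features_uniformly_continuous[OF e', of K e] by metis
    have "\<bar>Jf p (hj \<theta>' e) - Jf p (hj \<theta> e)\<bar> \<le> \<epsilon>"
      if A: "norm \<theta> \<le> K" "norm \<theta>' \<le> K" "norm (\<theta>' - \<theta>) < \<delta>" and p: "sq_bound p M" for \<theta> \<theta>' p
    proof -
      have "Jf p (hj \<theta>' e) - Jf p (hj \<theta> e) = Jf p (\<lambda>x. hj \<theta>' e x - hj \<theta> e x)"
        by (rule Jf_diff[OF p hj_measurable hj_measurable, where H = "max (C * growth \<theta>) (C * growth \<theta>')"])
           (use C(2)[OF e] in \<open>auto simp: le_max_iff_disj\<close>)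
      moreover have "\<bar>Jf p (\<lambda>x. hj \<theta>' e x - hj \<theta> e x)\<bar> \<le> B * (1 + M) * \<epsilon>'"
        using J[OF p borel_measurable_diff[OF hj_measurable hj_measurable], of \<theta>' e \<theta> e \<epsilon>'] \<delta>(2)[OF A] e' by simp
      moreover have "B * (1 + M) * \<epsilon>' = \<epsilon>" using B M by (simp add: \<epsilon>'_def)
      ultimately show ?thesis by simp
    qed
    then show ?thesis using \<delta>(1) that by blast
  qed
qed

lemma Jf_hj_continuous:
  assumes e: "e \<in> Basis" and p: "sq_bound p M"
  shows "continuous_on UNIV (\<lambda>\<theta>. Jf p (hj \<theta> e))"
  unfolding continuous_on_iff
proof (intro ballI allI impI)
  fix \<theta> :: "'n param" and \<epsilon> :: real assume "\<epsilon> > 0"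
  then have e2: "\<epsilon> / 2 > 0" by simp
  have M: "M \<ge> 0" using p by (simp add: sq_bound_def)
  obtain \<delta> where \<delta>: "\<delta> > 0" "\<And>\<theta>1 \<theta>' p. norm \<theta>1 \<le> norm \<theta> + 1 \<Longrightarrow> norm \<theta>' \<le> norm \<theta> + 1 \<Longrightarrow> norm (\<theta>' - \<theta>1) < \<delta> \<Longrightarrow> sq_bound p M \<Longrightarrow>
       \<bar>Jf p (hj \<theta>' e) - Jf p (hj \<theta>1 e)\<bar> \<le> \<epsilon> / 2"
    using Jf_hj_uniformly_continuous[OF e e2 M, of "norm \<theta> + 1"] by metis
  show "\<exists>d>0. \<forall>x'\<in>UNIV. dist x' \<theta> < d \<longrightarrow> dist (Jf p (hj x' e)) (Jf p (hj \<theta> e)) < \<epsilon>"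
  proof (intro exI[of _ "min \<delta> 1"] conjI ballI impI)
    fix \<theta>' assume d: "dist \<theta>' \<theta> < min \<delta> 1"
    then have "norm \<theta>' \<le> norm \<theta> + 1" using norm_triangle_ineq2[of \<theta>' \<theta>] by (simp add: dist_norm)
    then have "\<bar>Jf p (hj \<theta>' e) - Jf p (hj \<theta> e)\<bar> \<le> \<epsilon> / 2" using d by (intro \<delta>(2)[OF _ _ _ p]) (auto simp: dist_norm)
    then show "dist (Jf p (hj \<theta>' e)) (Jf p (hj \<theta> e)) < \<epsilon>" using \<open>\<epsilon> > 0\<close> by (simp add: dist_real_def)
  qed (use \<delta> in simp)
qed

text \<open>\<open>D_op\<close> sees \<open>q\<close> only through its value and gradient, so the
  same identity serves the classical derivatives of the network and the weak ones of the
  limit.\<close>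

lemma D_op_eq_Bop:
  assumes x: "x \<in> \<Omega>" and J: "fst (J x) = q x" "fst (snd (J x)) = grad D q x"
  shows "D_op D \<Omega> a c d f q (feature_grad \<eta> \<sigma> \<theta> e) x = Bop x (J x) (hj \<theta> e x)"
  using L_op_classical[OF has_jet_feature_grad x] has_jet_D(1)[OF has_jet_feature_grad x]
    has_jet_cpd(1)[OF thick has_jet_feature_grad x]
  by (simp add: D_op_def Bop_def J)

lemma training_integral_network:
  assumes q: "has_jet \<Omega> q J"
  shows "(LINT x|\<mu>. (A_op (cpd \<Omega>) a c d f q x - g x) * D_op (cpd \<Omega>) \<Omega> a c d f q (feature_grad \<eta> \<sigma> \<theta> e) x)
    = Jf J (hj \<theta> e)"
  unfolding Jf_def
proof (rule Bochner_Integration.integral_cong)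
  fix x assume "x \<in> space \<mu>"
  then have x: "x \<in> \<Omega>" by simp
  have g: "fst (snd (J x)) = grad (cpd \<Omega>) q x" using has_jet_cpd(1)[OF thick q x] by (simp add: grad_def vec_eq_iff)
  show "(A_op (cpd \<Omega>) a c d f q x - g x) * D_op (cpd \<Omega>) \<Omega> a c d f q (feature_grad \<eta> \<sigma> \<theta> e) x = Aop x (J x) * Bop x (J x) (hj \<theta> e x)"
    using D_op_eq_Bop[of x J q "cpd \<Omega>"] has_jet_D(1)[OF q x] g x L_op_classical[OF q x]
    by (simp add: A_op_def Aop_def)
qed simp

lemma A_op_weak:
  assumes q: "q \<in> H2 \<Omega>"
  shows "AE x in \<mu>. A_op (wpd \<Omega>) a c d f q x - g x = Aop x (jet (wpd \<Omega>) q x)"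
  using L_op_weak[OF q] by eventually_elim (simp add: A_op_def Aop_def, simp add: jet_def)

end

section \<open>The limit equation\<close>

lemma growth_continuous: "continuous_on S growth"
  unfolding growth_def by (intro continuous_intros)

lemma one_plus_power_le:
  assumes "(t::real) \<ge> 0"
  shows "(1 + t) ^ m \<le> 2 ^ m * (1 + t ^ m)"
proof -
  have "(1 + t) ^ m \<le> (2 * max 1 t) ^ m" using assms by (intro power_mono) auto
  also have "\<dots> = 2 ^ m * (max 1 t) ^ m" by (simp add: power_mult_distrib)
  also have "(max 1 t) ^ m \<le> 1 + t ^ m" using assms by (cases "t \<le> 1") (auto simp: max_def)
  finally show ?thesis by simp
qed

text \<open>The output weight is almost surely bounded and the input weight has moments of every
  order; a power \<open>(1 + t) ^ m\<close> is reduced to these by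
  \<open>one_plus_power_le\<close>.\<close>

lemma growth_power_integrable:
  fixes \<mu>0 :: "'n::finite param measure"
  assumes "initial_law \<mu>0"
  shows "integrable \<mu>0 (\<lambda>\<theta>. growth \<theta> ^ k)"
proof -
  interpret prob_space \<mu>0 using assms by (simp add: initial_law_def)
  have s: "sets \<mu>0 = sets borel" using assms by (simp add: initial_law_def)
  obtain C where C: "AE \<theta> in \<mu>0. \<bar>fst \<theta>\<bar> \<le> C" using assms by (auto simp: initial_law_def)
  have i: "integrable \<mu>0 (\<lambda>\<theta>. norm (fst (snd \<theta>)) ^ (2 * k))" using assms by (auto simp: initial_law_def)
  define B where "B = (\<lambda>\<theta>::'n param. (1 + \<bar>C\<bar>) ^ k * (2 ^ (2 * k) * (1 + norm (fst (snd \<theta>)) ^ (2 * k))))"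
  show ?thesis
  proof (rule Bochner_Integration.integrable_bound)
    show "integrable \<mu>0 B" unfolding B_def using i by auto
    have "(\<lambda>\<theta>::'n param. growth \<theta> ^ k) \<in> borel_measurable borel"
      by (intro borel_measurable_continuous_onI continuous_intros growth_continuous)
    then show "(\<lambda>\<theta>. growth \<theta> ^ k) \<in> borel_measurable \<mu>0" using s measurable_cong_sets by blast
    show "AE \<theta> in \<mu>0. norm (growth \<theta> ^ k) \<le> norm (B \<theta>)"
      using C
    proof eventually_elim
      fix \<theta> :: "'n param" assume c: "\<bar>fst \<theta>\<bar> \<le> C"
      have "growth \<theta> ^ k = (1 + \<bar>fst \<theta>\<bar>) ^ k * (1 + norm (fst (snd \<theta>))) ^ (2 * k)"
        by (simp add: growth_def power_mult_distrib power_mult)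
      also have "\<dots> \<le> B \<theta>" unfolding B_def
        using c by (intro mult_mono one_plus_power_le power_mono) auto
      finally have "growth \<theta> ^ k \<le> B \<theta>" .
      moreover have "0 \<le> growth \<theta> ^ k" using growth_ge_1[of \<theta>] by simp
      ultimately show "norm (growth \<theta> ^ k) \<le> norm (B \<theta>)" by simp
    qed
  qed
qed

lemma has_jet_cong:
  assumes J: "has_jet S u J" and eq: "\<And>x. x \<in> S \<Longrightarrow> v x = u x"
  shows "has_jet S v J"
  unfolding has_jet_def
proof (intro conjI ballI allI)
  show "continuous_on S J" using J by (simp add: has_jet_def)
  fix x assume x: "x \<in> S"
  note d = has_jet_D[OF J x]
  show "fst (J x) = v x" using d(1) eq[OF x] by simp
  show "(v has_derivative (\<bullet>) (fst (snd (J x)))) (at x within S)"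
    by (rule has_derivative_transform[OF x eq d(2)])
  show "((\<lambda>y. fst (snd (J y)) $ j) has_derivative (\<lambda>h. \<Sum>i\<in>UNIV. snd (snd (J x)) $ i $ j * h $ i)) (at x within S)" for j
    by (rule d(3))
qed

section \<open>The averaged velocity of the limit\<close>

locale lim = nn \<Omega> a c d f g \<eta> \<sigma>
  for \<Omega> :: "(real^'n) set" and a c d f g \<eta> \<sigma> +
  fixes \<mu>0 :: "'n param measure" and \<alpha> :: real and Q :: "real \<Rightarrow> real^'n \<Rightarrow> real"
  assumes init: "initial_law \<mu>0" and sol: "limit_solution \<Omega> a c d f g \<alpha> \<eta> \<sigma> \<mu>0 Q"
begin

sublocale M0: prob_space \<mu>0 using init by (simp add: initial_law_def)

lemma sets_\<mu>0: "sets \<mu>0 = sets borel" using init by (simp add: initial_law_def)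

lemma space_\<mu>0 [simp]: "space \<mu>0 = UNIV" using sets_eq_imp_space_eq[OF sets_\<mu>0] by simp

lemma measurable_\<mu>0: "measurable \<mu>0 N = measurable borel N"
  by (rule measurable_cong_sets) (simp_all add: sets_\<mu>0)

text \<open>Up to the factor \<open>-\<alpha>\<close>, the velocity that a parameter \<open>\<theta>\<close> contributes to the jet of the network
  without its factor \<open>\<eta>\<close>.\<close>

definition V :: "(real^'n \<Rightarrow> 'n jet) \<Rightarrow> real^'n \<Rightarrow> 'n param \<Rightarrow> 'n jet" where
  "V p x \<theta> = (\<Sum>e\<in>Basis. Jf p (hj \<theta> e) *\<^sub>R fjet \<sigma> \<theta> e x)"

lemma V_measurable:
  assumes "sq_bound p m"
  shows "V p x \<in> borel_measurable \<mu>0"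
proof -
  have "continuous_on UNIV (V p x)" unfolding V_def
    by (intro continuous_on_sum continuous_on_scaleR Jf_hj_continuous[OF _ assms] continuous_on_fjet(1)[OF sig] continuous_intros)
  then show ?thesis unfolding measurable_\<mu>0 by (rule borel_measurable_continuous_onI)
qed

text \<open>One factor of \<open>growth\<close> comes from the feature inside the training integral
  and one from the feature it multiplies. As in \<open>Jf_lipschitz\<close>, the Lipschitz constant
  involves the bound of the second argument only.\<close>

lemma V_bound:
  assumes R: "R \<ge> 0"
  obtains C where "C > 0"
    "\<And>p m x \<theta>. sq_bound p m \<Longrightarrow> norm x \<le> R \<Longrightarrow> norm (V p x \<theta>) \<le> C * (1 + m) * growth \<theta> ^ 2"
    "\<And>p m p' m' \<delta> x \<theta>. sq_bound p m \<Longrightarrow> sq_bound p' m' \<Longrightarrow> sq_bound (\<lambda>y. p y - p' y) \<delta> \<Longrightarrow> norm x \<le> R \<Longrightarrow>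
        norm (V p x \<theta> - V p' x \<theta>) \<le> C * (1 + m') * growth \<theta> ^ 2 * \<delta>"
proof -
  obtain F where F: "F > 0" "\<And>(\<theta>::'n param) e x. norm e \<le> 1 \<Longrightarrow> norm x \<le> R \<Longrightarrow> norm (fjet \<sigma> \<theta> e x) \<le> F * growth \<theta>"
    using fjet_bound[OF sig R] by metis
  obtain H where H: "H > 0" "\<And>\<theta> e x. e \<in> Basis \<Longrightarrow> x \<in> \<Omega> \<Longrightarrow> norm (hj \<theta> e x) \<le> H * growth \<theta>"
    using features_bound by metis
  show ?thesis
  proof (rule Jf_bound, rule Jf_lipschitz)
    fix B L
    assume B: "B > 0" and JB: "\<And>p h m H. sq_bound p m \<Longrightarrow> h \<in> borel_measurable \<mu> \<Longrightarrow> (\<And>x. x \<in> \<Omega> \<Longrightarrow> norm (h x) \<le> H) \<Longrightarrow> 0 \<le> H \<Longrightarrow>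
       integrable \<mu> (\<lambda>x. Aop x (p x) * Bop x (p x) (h x)) \<and> \<bar>Jf p h\<bar> \<le> B * (1 + m) * H"
    and L: "L > 0" and JL: "\<And>p q h m' m \<delta> H. sq_bound p m' \<Longrightarrow> sq_bound q m \<Longrightarrow> sq_bound (\<lambda>x. p x - q x) \<delta> \<Longrightarrow> h \<in> borel_measurable \<mu> \<Longrightarrow>
       (\<And>x. x \<in> \<Omega> \<Longrightarrow> norm (h x) \<le> H) \<Longrightarrow> 0 \<le> H \<Longrightarrow> \<bar>Jf p h - Jf q h\<bar> \<le> L * (1 + m) * H * \<delta>"
    define n where "n = real (card (Basis :: 'n param set))"
    have n: "n > 0" by (simp add: n_def)
    define C where "C = n * ((B + L) * H * F)"
    have C: "C > 0" unfolding C_def using n B L H(1) F(1) by (intro mult_pos_pos add_pos_pos) auto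
    have g0: "0 \<le> growth \<theta>" for \<theta> :: "'n param" using growth_ge_1[of \<theta>] by linarith
    have gH: "0 \<le> H * growth \<theta>" for \<theta> :: "'n param" using g0 H(1) by simp
    have e1: "norm (fjet \<sigma> \<theta> e x) \<le> F * growth \<theta>" if "e \<in> Basis" "norm x \<le> R" for \<theta> e :: "'n param" and x
      using F(2)[of e x \<theta>] that by (simp add: norm_Basis)
    have 1: "norm (V p x \<theta>) \<le> C * (1 + m) * growth \<theta> ^ 2" if p: "sq_bound p m" and x: "norm x \<le> R" for p m x \<theta>
    proof -
      have m: "0 \<le> m" using p by (simp add: sq_bound_def)
      have "norm (V p x \<theta>) \<le> (\<Sum>e\<in>(Basis::'n param set). (B * (1 + m) * (H * growth \<theta>)) * (F * growth \<theta>))"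
        unfolding V_def
      proof (rule sum_norm_le)
        fix e :: "'n param" assume e: "e \<in> Basis"
        have "\<bar>Jf p (hj \<theta> e)\<bar> \<le> B * (1 + m) * (H * growth \<theta>)"
          using JB[OF p hj_measurable, of \<theta> e "H * growth \<theta>"] H(2)[OF e] gH by blast
        then show "norm (Jf p (hj \<theta> e) *\<^sub>R fjet \<sigma> \<theta> e x) \<le> (B * (1 + m) * (H * growth \<theta>)) * (F * growth \<theta>)"
          unfolding norm_scaleR using e1[OF e x] B m gH by (intro mult_mono) auto
      qed
      also have "\<dots> = n * (B * H * F) * ((1 + m) * growth \<theta> ^ 2)" by (simp add: n_def power2_eq_square mult_ac)
      also have "\<dots> \<le> C * ((1 + m) * growth \<theta> ^ 2)"
        unfolding C_def using n B L H(1) F(1) m by (intro mult_right_mono mult_left_mono) auto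
      finally show ?thesis by (simp add: mult.assoc)
    qed
    have 2: "norm (V p x \<theta> - V p' x \<theta>) \<le> C * (1 + m') * growth \<theta> ^ 2 * \<delta>"
      if p: "sq_bound p m" and p': "sq_bound p' m'" and d: "sq_bound (\<lambda>y. p y - p' y) \<delta>" and x: "norm x \<le> R" for p m p' m' \<delta> x \<theta>
    proof -
      have m: "0 \<le> m'" "0 \<le> \<delta>" using p' d by (auto simp: sq_bound_def)
      have "norm (V p x \<theta> - V p' x \<theta>) \<le> (\<Sum>e\<in>(Basis::'n param set). (L * (1 + m') * (H * growth \<theta>) * \<delta>) * (F * growth \<theta>))"
        unfolding V_def sum_subtractf[symmetric] scaleR_left_diff_distrib[symmetric]
      proof (rule sum_norm_le)
        fix e :: "'n param" assume e: "e \<in> Basis"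
        have "\<bar>Jf p (hj \<theta> e) - Jf p' (hj \<theta> e)\<bar> \<le> L * (1 + m') * (H * growth \<theta>) * \<delta>"
          by (rule JL[OF p p' d hj_measurable H(2)[OF e] gH])
        then show "norm ((Jf p (hj \<theta> e) - Jf p' (hj \<theta> e)) *\<^sub>R fjet \<sigma> \<theta> e x) \<le> (L * (1 + m') * (H * growth \<theta>) * \<delta>) * (F * growth \<theta>)"
          unfolding norm_scaleR using e1[OF e x] L m gH by (intro mult_mono) auto
      qed
      also have "\<dots> = n * (L * H * F) * ((1 + m') * growth \<theta> ^ 2 * \<delta>)" by (simp add: n_def power2_eq_square mult_ac)
      also have "\<dots> \<le> C * ((1 + m') * growth \<theta> ^ 2 * \<delta>)"
        unfolding C_def using n B L H(1) F(1) m by (intro mult_right_mono mult_left_mono) auto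
      finally show ?thesis by (simp add: mult.assoc)
    qed
    show ?thesis by (rule that[OF C 1 2])
  qed
qed

lemma V_norm_bound:
  assumes "R \<ge> 0"
  shows "\<exists>C>0. \<forall>p m x \<theta>. sq_bound p m \<longrightarrow> norm x \<le> R \<longrightarrow> norm (V p x \<theta>) \<le> C * (1 + m) * growth \<theta> ^ 2"
  by (rule V_bound[OF assms]) blast

lemma V_lipschitz:
  assumes "R \<ge> 0"
  shows "\<exists>C>0. \<forall>p m p' m' \<delta> x \<theta>. sq_bound p m \<longrightarrow> sq_bound p' m' \<longrightarrow> sq_bound (\<lambda>y. p y - p' y) \<delta> \<longrightarrow> norm x \<le> R \<longrightarrow>
        norm (V p x \<theta> - V p' x \<theta>) \<le> C * (1 + m') * growth \<theta> ^ 2 * \<delta>"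
  by (rule V_bound[OF assms]) blast

lemma V_integrable:
  assumes p: "sq_bound p m"
  shows "integrable \<mu>0 (V p x)"
proof -
  obtain C where C: "C > 0" "\<And>p m y \<theta>. sq_bound p m \<Longrightarrow> norm y \<le> norm x \<Longrightarrow> norm (V p y \<theta>) \<le> C * (1 + m) * growth \<theta> ^ 2"
    using V_norm_bound[OF norm_ge_zero[of x]] by blast
  show ?thesis
    by (rule integrable_norm_bound[of _ "\<lambda>\<theta>. C * (1 + m) * growth \<theta> ^ 2", OF _ V_measurable[OF p]])
       (use C(2)[OF p] growth_power_integrable[OF init] in auto)
qed

lemma sq_bound_jet:
  assumes "q \<in> H2 \<Omega>"
  shows "sq_bound (jet (wpd \<Omega>) q) (sqrt (LINT x|\<mu>. (norm (jet (wpd \<Omega>) q x))\<^sup>2))"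
  using jet_measurable[OF assms] jet_square_integrable[OF assms]
  by (simp add: sq_bound_def integral_nonneg_AE)

lemma A_op_weak_measurable:
  assumes q: "q \<in> H2 \<Omega>"
  shows "A_op (wpd \<Omega>) a c d f q \<in> borel_measurable \<mu>"
proof -
  have m1: "wpd \<Omega> i (\<lambda>y. a i j y * wpd \<Omega> j q y) \<in> borel_measurable \<mu>" for i j
    by (rule weak_partial_measurable(2)[OF weak_partial_wpd[OF weak_partial_mult[OF a H2_D(5)[OF q]]]])
  have m2: "q \<in> borel_measurable \<mu>" "wpd \<Omega> i q \<in> borel_measurable \<mu>" for i
    using H2_D[OF q] by (auto simp: L2_def)
  have L: "L_op (wpd \<Omega>) a c d q \<in> borel_measurable \<mu>" unfolding L_op_def
    by (intro borel_measurable_diff borel_measurable_add borel_measurable_uminus borel_measurable_sum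
          borel_measurable_times m1 m2 borel_measurable_continuous smooth_on_cpd(1) c d)
  \<comment> \<open>Measurability of the composition with \<open>f\<close> is obtained by
    subtracting the linear part from the residual, whose measurability is known.\<close>
  have "(\<lambda>x. Aop x (jet (wpd \<Omega>) q x) - Lx x (jet (wpd \<Omega>) q x) + g x) \<in> borel_measurable \<mu>"
    by (intro borel_measurable_diff borel_measurable_add Aop_measurable Lx_measurable jet_measurable q g(1))
  then have "(\<lambda>x. f (q x) (grad (wpd \<Omega>) q x)) \<in> borel_measurable \<mu>" by (simp add: Aop_def jet_def)
  then show ?thesis unfolding A_op_def using L by auto
qed

text \<open>The kernel averages over \<mu>0 a product of a function of x and a function of y. Fubini
  brings the integral over y inside, where it becomes the training integral of the feature, and
  \<eta> factors out.\<close>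

lemma limit_rhs:
  assumes q: "q \<in> H2 \<Omega>" and x: "x \<in> \<Omega>"
  shows "(LINT y|\<mu>. U_ker \<Omega> a c d f \<eta> \<sigma> \<mu>0 q x y * (A_op (wpd \<Omega>) a c d f q y - g y))
    = \<eta> x * fst (LINT \<theta>|\<mu>0. V (jet (wpd \<Omega>) q) x \<theta>)"
proof -
  define p where "p = jet (wpd \<Omega>) q"
  define m where "m = sqrt (LINT x|\<mu>. (norm (p x))\<^sup>2)"
  have p: "sq_bound p m" using sq_bound_jet[OF q] by (simp add: p_def m_def)
  have pm: "p \<in> borel_measurable \<mu>" using p by (simp add: sq_bound_def)
  define u where "u = (\<lambda>e \<theta>. \<eta> x * fst (fjet \<sigma> \<theta> e x))"
  define G where "G = (\<lambda>y \<theta>. \<Sum>e\<in>Basis. u e \<theta> * Bop y (p y) (hj \<theta> e y))"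
  define F where "F = (\<lambda>y \<theta>. G y \<theta> * Aop y (p y))"
  have U: "U_ker \<Omega> a c d f \<eta> \<sigma> \<mu>0 q x y = (LINT \<theta>|\<mu>0. G y \<theta>)" if y: "y \<in> \<Omega>" for y
    unfolding U_ker_def G_def u_def
    by (simp add: feature_grad_eq[OF sig, of \<eta> _ _ x] D_op_eq_Bop[OF y, of p q "wpd \<Omega>"] p_def jet_def)
  let ?M = "\<mu> \<Otimes>\<^sub>M \<mu>0"
  have bor: "(\<lambda>z. z) \<in> measurable \<mu> borel"
    using borel_measurable_continuous[OF continuous_on_id] by simp
  have mfst: "fst \<in> measurable ?M borel" and msnd: "snd \<in> measurable ?M borel"
    using measurable_compose[OF measurable_fst bor] measurable_snd[of \<mu> \<mu>0] measurable_cong_sets[OF refl sets_\<mu>0, of ?M] by auto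
  have mf: "(\<lambda>z. fjet \<sigma> (snd z) e (fst z)) \<in> borel_measurable ?M" for e
  proof -
    have "continuous_on UNIV (\<lambda>w. fjet \<sigma> (fst w) e (snd w))" by (intro continuous_on_fjet sig continuous_intros)
    from measurable_compose[OF borel_measurable_Pair[OF msnd mfst] borel_measurable_continuous_onI[OF this]]
    show ?thesis by simp
  qed
  have me: "(\<lambda>z. ej (fst z)) \<in> borel_measurable ?M"
    by (rule measurable_compose[OF measurable_fst borel_measurable_continuous[OF ej_continuous]])
  have mh: "(\<lambda>z. hj (snd z) e (fst z)) \<in> borel_measurable ?M" for e
  proof -
    have "continuous_on UNIV (\<lambda>w. jmul (fst w) (snd w) :: 'n jet)" by (intro continuous_intros)
    from measurable_compose[OF borel_measurable_Pair[OF me mf] borel_measurable_continuous_onI[OF this]]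
    show ?thesis by (simp add: hj_def)
  qed
  have mp: "(\<lambda>z. p (fst z)) \<in> borel_measurable ?M" by (rule measurable_compose[OF measurable_fst pm])
  have mB: "(\<lambda>z. Bop (fst z) (p (fst z)) (hj (snd z) e (fst z))) \<in> borel_measurable ?M" for e
    by (rule Bop_measurable_comp[OF measurable_fst mp mh])
  have "continuous_on UNIV (u e)" for e unfolding u_def by (intro continuous_intros continuous_on_fjet sig)
  from measurable_compose[OF msnd borel_measurable_continuous_onI[OF this]]
  have mu: "(\<lambda>z. u e (snd z)) \<in> borel_measurable ?M" for e .
  have mA: "(\<lambda>z. Aop (fst z) (p (fst z))) \<in> borel_measurable ?M"
    by (rule measurable_compose[OF measurable_fst Aop_measurable[OF pm]])
  have mG: "case_prod G \<in> borel_measurable ?M" unfolding G_def case_prod_beta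
    by (intro borel_measurable_sum borel_measurable_times mu mB)
  have mF: "case_prod F \<in> borel_measurable ?M" unfolding F_def case_prod_beta
    using mG[unfolded case_prod_beta] mA by (intro borel_measurable_times)
  obtain K where K: "K > 0" "\<And>x p. x \<in> \<Omega> \<Longrightarrow> \<bar>Aop x p\<bar> \<le> K * (1 + norm p)"
    "\<And>x p h. x \<in> \<Omega> \<Longrightarrow> \<bar>Bop x p h\<bar> \<le> K * norm h" using Aop_Bop_bounds by metis
  obtain H where H: "H > 0" "\<And>\<theta> e x. e \<in> Basis \<Longrightarrow> x \<in> \<Omega> \<Longrightarrow> norm (fjet \<sigma> \<theta> e x) \<le> H * growth \<theta>"
    "\<And>\<theta> e x. e \<in> Basis \<Longrightarrow> x \<in> \<Omega> \<Longrightarrow> norm (hj \<theta> e x) \<le> H * growth \<theta>"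
    using features_bound by metis
  define n where "n = real (card (Basis :: 'n param set))"
  define D where "D = n * \<bar>\<eta> x\<bar> * H * K * H * K"
  have g0: "0 \<le> growth \<theta>" for \<theta> :: "'n param" using growth_ge_1[of \<theta>] by linarith
  \<comment> \<open>The joint bound separates into an integrable function of y and an integrable
    power of \<open>growth\<close>, which is all that Fubini needs.\<close>
  have Fb: "norm (F y \<theta>) \<le> (D * (1 + norm (p y))) * growth \<theta> ^ 2" if y: "y \<in> \<Omega>" for y \<theta>
  proof -
    have "norm (G y \<theta>) \<le> (\<Sum>e\<in>(Basis::'n param set). (\<bar>\<eta> x\<bar> * (H * growth \<theta>)) * (K * (H * growth \<theta>)))"
      unfolding G_def
    proof (rule sum_norm_le)
      fix e :: "'n param" assume e: "e \<in> Basis"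
      have 1: "\<bar>u e \<theta>\<bar> \<le> \<bar>\<eta> x\<bar> * (H * growth \<theta>)"
        unfolding u_def abs_mult using order_trans[OF norm_le_triple(1) H(2)[OF e x]] by (intro mult_left_mono) auto
      have 2: "\<bar>Bop y (p y) (hj \<theta> e y)\<bar> \<le> K * (H * growth \<theta>)"
        by (rule order_trans[OF K(3)[OF y] mult_left_mono[OF H(3)[OF e y]]]) (use K(1) in simp)
      show "norm (u e \<theta> * Bop y (p y) (hj \<theta> e y)) \<le> (\<bar>\<eta> x\<bar> * (H * growth \<theta>)) * (K * (H * growth \<theta>))"
        unfolding real_norm_def abs_mult using 1 2 H(1) K(1) g0[of \<theta>] by (intro mult_mono) auto
    qed
    then have "\<bar>G y \<theta>\<bar> \<le> n * ((\<bar>\<eta> x\<bar> * (H * growth \<theta>)) * (K * (H * growth \<theta>)))" by (simp add: n_def)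
    then have "\<bar>G y \<theta>\<bar> * \<bar>Aop y (p y)\<bar> \<le> (n * ((\<bar>\<eta> x\<bar> * (H * growth \<theta>)) * (K * (H * growth \<theta>)))) * (K * (1 + norm (p y)))"
      using K(1) K(2)[OF y] H(1) g0[of \<theta>] by (intro mult_mono) (auto simp: n_def)
    also have "\<dots> = (D * (1 + norm (p y))) * growth \<theta> ^ 2" by (simp add: D_def power2_eq_square mult_ac)
    finally show ?thesis by (simp add: F_def abs_mult)
  qed
  interpret PS: pair_sigma_finite \<mu> \<mu>0 by unfold_locales
  note g2 = growth_power_integrable[OF init, of 2]
  have Fi: "integrable \<mu>0 (F y)" if y: "y \<in> \<Omega>" for y
    by (rule integrable_norm_bound[of _ "\<lambda>\<theta>. (D * (1 + norm (p y))) * growth \<theta> ^ 2"])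
       (use g2 Fb[OF y] measurable_compose[OF measurable_Pair1'[of y \<mu> \<mu>0] mF] y in auto)
  have IF: "integrable ?M (case_prod F)"
  proof (rule PS.Fubini_integrable)
    show "case_prod F \<in> borel_measurable ?M" by (rule mF)
    show "AE y in \<mu>. integrable \<mu>0 (\<lambda>\<theta>. case_prod F (y, \<theta>))" using Fi by auto
    show "integrable \<mu> (\<lambda>y. LINT \<theta>|\<mu>0. norm (case_prod F (y, \<theta>)))"
    proof (rule integrable_norm_bound[of _ "\<lambda>y. (D * (1 + norm (p y))) * (LINT \<theta>|\<mu>0. growth \<theta> ^ 2)"])
      show "integrable \<mu> (\<lambda>y. (D * (1 + norm (p y))) * (LINT \<theta>|\<mu>0. growth \<theta> ^ 2))"
        using sq_bound_L1(1)[OF p] by auto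
      show "(\<lambda>y. LINT \<theta>|\<mu>0. norm (case_prod F (y, \<theta>))) \<in> borel_measurable \<mu>"
        by (rule M0.borel_measurable_lebesgue_integral) (use mF in auto)
      fix y assume "y \<in> space \<mu>"
      then have y: "y \<in> \<Omega>" by simp
      have "(LINT \<theta>|\<mu>0. norm (F y \<theta>)) \<le> (LINT \<theta>|\<mu>0. (D * (1 + norm (p y))) * growth \<theta> ^ 2)"
        using Fi[OF y] g2 Fb[OF y] by (intro integral_mono) auto
      then show "norm (LINT \<theta>|\<mu>0. norm (case_prod F (y, \<theta>))) \<le> (D * (1 + norm (p y))) * (LINT \<theta>|\<mu>0. growth \<theta> ^ 2)"
        by (simp add: integral_nonneg_AE)
    qed
  qed
  have "(LINT y|\<mu>. U_ker \<Omega> a c d f \<eta> \<sigma> \<mu>0 q x y * (A_op (wpd \<Omega>) a c d f q y - g y)) = (LINT y|\<mu>. (LINT \<theta>|\<mu>0. F y \<theta>))"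
  proof (rule integral_cong_AE)
    have mUG: "(\<lambda>y. LINT \<theta>|\<mu>0. G y \<theta>) \<in> borel_measurable \<mu>" by (rule M0.borel_measurable_lebesgue_integral[OF mG])
    have "U_ker \<Omega> a c d f \<eta> \<sigma> \<mu>0 q x \<in> borel_measurable \<mu>"
      by (rule measurable_cong[THEN iffD2, OF _ mUG]) (simp add: U)
    then show "(\<lambda>y. U_ker \<Omega> a c d f \<eta> \<sigma> \<mu>0 q x y * (A_op (wpd \<Omega>) a c d f q y - g y)) \<in> borel_measurable \<mu>"
      using A_op_weak_measurable[OF q] g(1) by auto
    show "(\<lambda>y. LINT \<theta>|\<mu>0. F y \<theta>) \<in> borel_measurable \<mu>" by (rule M0.borel_measurable_lebesgue_integral[OF mF])
    show "AE y in \<mu>. U_ker \<Omega> a c d f \<eta> \<sigma> \<mu>0 q x y * (A_op (wpd \<Omega>) a c d f q y - g y) = (LINT \<theta>|\<mu>0. F y \<theta>)"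
      using A_op_weak[OF q] AE_space by eventually_elim (simp add: U F_def p_def)
  qed
  also have "\<dots> = (LINT \<theta>|\<mu>0. (LINT y|\<mu>. F y \<theta>))" using PS.Fubini_integral[OF IF] by simp
  also have "\<dots> = (LINT \<theta>|\<mu>0. \<eta> x * fst (V p x \<theta>))"
  proof (rule Bochner_Integration.integral_cong)
    fix \<theta>
    have "(LINT y|\<mu>. F y \<theta>) = (LINT y|\<mu>. (\<Sum>e\<in>Basis. u e \<theta> * (Aop y (p y) * Bop y (p y) (hj \<theta> e y))))"
      unfolding F_def G_def sum_distrib_right by (intro Bochner_Integration.integral_cong sum.cong) (auto simp: mult_ac)
    also have "\<dots> = (\<Sum>e\<in>Basis. (LINT y|\<mu>. u e \<theta> * (Aop y (p y) * Bop y (p y) (hj \<theta> e y))))"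
      by (intro Bochner_Integration.integral_sum integrable_mult_right Jf_integrable[OF p hj_measurable H(3)])
         (use H(1) g0 in auto)
    also have "\<dots> = \<eta> x * fst (V p x \<theta>)"
      by (simp add: V_def Jf_def u_def fst_sum sum_distrib_left mult_ac)
    finally show "(LINT y|\<mu>. F y \<theta>) = \<eta> x * fst (V p x \<theta>)" .
  qed simp
  also have "\<dots> = \<eta> x * fst (LINT \<theta>|\<mu>0. V p x \<theta>)"
    using integral_bounded_linear[OF bounded_linear_fst V_integrable[OF p, of x]] by simp
  finally show ?thesis by (simp add: p_def)
qed

section \<open>Regularity of the limit in time and space\<close>

definition pQ :: "real \<Rightarrow> real^'n \<Rightarrow> 'n jet" where "pQ s = jet (wpd \<Omega>) (Q s)"

definition Kj :: "real \<Rightarrow> real^'n \<Rightarrow> 'n jet" where "Kj s x = (LINT \<theta>|\<mu>0. V (pQ s) x \<theta>)"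

definition msq :: "real \<Rightarrow> real" where "msq s = sqrt (LINT x|\<mu>. (norm (pQ s x))\<^sup>2)"

definition dQ :: "real \<Rightarrow> real \<Rightarrow> real" where "dQ t s = sqrt (LINT x|\<mu>. (norm (pQ s x - pQ t x))\<^sup>2)"

lemma Q_H2: "t \<ge> 0 \<Longrightarrow> Q t \<in> H2 \<Omega>" using sol by (auto simp: limit_solution_def H2_0_def)

lemma pQ_sq: "t \<ge> 0 \<Longrightarrow> sq_bound (pQ t) (msq t)"
  unfolding pQ_def msq_def by (rule sq_bound_jet[OF Q_H2])

lemma dQ_sq:
  assumes s: "s \<ge> 0" and t: "t \<ge> 0"
  shows "sq_bound (\<lambda>x. pQ s x - pQ t x) (dQ t s)" "H2_norm \<Omega> (\<lambda>x. Q s x - Q t x) = ennreal (dQ t s)"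
proof -
  note h = H2_diff[OF Q_H2[OF s] Q_H2[OF t]]
  have m: "(\<lambda>x. pQ s x - pQ t x) \<in> borel_measurable \<mu>"
    using pQ_sq[OF s] pQ_sq[OF t] by (auto simp: sq_bound_def)
  have eq: "AE x in \<mu>. (norm (jet (wpd \<Omega>) (\<lambda>x. Q s x - Q t x) x))\<^sup>2 = (norm (pQ s x - pQ t x))\<^sup>2"
    using h(2) by eventually_elim (simp add: pQ_def)
  have mm: "(\<lambda>x. (norm (pQ s x - pQ t x))\<^sup>2) \<in> borel_measurable \<mu>" using m by auto
  have i: "integrable \<mu> (\<lambda>x. (norm (pQ s x - pQ t x))\<^sup>2)"
    by (rule integrable_cong_AE_imp[OF jet_square_integrable[OF h(1)] mm eq])
  have I: "(LINT x|\<mu>. (norm (jet (wpd \<Omega>) (\<lambda>x. Q s x - Q t x) x))\<^sup>2) = (LINT x|\<mu>. (norm (pQ s x - pQ t x))\<^sup>2)"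
    by (rule integral_cong_AE) (use eq mm jet_square_integrable[OF h(1)] in auto)
  show "sq_bound (\<lambda>x. pQ s x - pQ t x) (dQ t s)" using m i by (simp add: sq_bound_def dQ_def integral_nonneg_AE)
  show "H2_norm \<Omega> (\<lambda>x. Q s x - Q t x) = ennreal (dQ t s)" using H2_norm_eq[OF h(1)] I by (simp add: dQ_def)
qed

lemma dQ_tendsto:
  assumes t: "t \<ge> 0"
  shows "((\<lambda>s. dQ t s) \<longlongrightarrow> 0) (at t within {0..})"
proof -
  have A: "((\<lambda>s. H2_norm \<Omega> (\<lambda>x. Q s x - Q t x)) \<longlongrightarrow> 0) (at t within {0..})"
    using sol t by (auto simp: limit_solution_def)
  have B: "\<forall>\<^sub>F s in at t within {0..}. H2_norm \<Omega> (\<lambda>x. Q s x - Q t x) = ennreal (dQ t s)"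
    using dQ_sq(2)[OF _ t] by (auto simp: eventually_at_filter)
  from Lim_transform_eventually[OF A B]
  have "((\<lambda>s. ennreal (dQ t s)) \<longlongrightarrow> ennreal 0) (at t within {0..})" by simp
  moreover have "0 \<le> dQ t s" for s by (simp add: dQ_def integral_nonneg_AE)
  ultimately show ?thesis
    using tendsto_ennreal_iff[of "dQ t" "at t within {0..}" 0] by simp
qed

text \<open>Pointwise (a + b)^2 <= 2 a^2 + 2 b^2, integrated. The factor 2 is harmless because only
  boundedness near each time is wanted.\<close>

lemma msq_locally_bounded:
  assumes s: "s \<ge> 0" and t: "t \<ge> 0"
  shows "msq s \<le> 2 * msq t + 2 * dQ t s"
proof -
  note S = pQ_sq[OF s] and T = pQ_sq[OF t] and D = dQ_sq(1)[OF s t]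
  have nn: "0 \<le> msq s" "0 \<le> msq t" "0 \<le> dQ t s" using S T D by (auto simp: sq_bound_def)
  have pt: "(norm (pQ s x))\<^sup>2 \<le> 2 * (norm (pQ t x))\<^sup>2 + 2 * (norm (pQ s x - pQ t x))\<^sup>2" for x
  proof -
    have "norm (pQ s x) \<le> norm (pQ t x) + norm (pQ s x - pQ t x)" by (metis add.commute diff_add_cancel norm_triangle_ineq)
    then have "(norm (pQ s x))\<^sup>2 \<le> (norm (pQ t x) + norm (pQ s x - pQ t x))\<^sup>2" by (intro power_mono) auto
    also have "\<dots> \<le> 2 * (norm (pQ t x))\<^sup>2 + 2 * (norm (pQ s x - pQ t x))\<^sup>2"
      using zero_le_power2[of "norm (pQ t x) - norm (pQ s x - pQ t x)"] by (simp add: power2_eq_square algebra_simps)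
    finally show ?thesis .
  qed
  have "(msq s)\<^sup>2 = (LINT x|\<mu>. (norm (pQ s x))\<^sup>2)" by (simp add: msq_def integral_nonneg_AE)
  also have "\<dots> \<le> (LINT x|\<mu>. 2 * (norm (pQ t x))\<^sup>2 + 2 * (norm (pQ s x - pQ t x))\<^sup>2)"
    using S T D pt by (intro integral_mono) (auto simp: sq_bound_def)
  also have "\<dots> = 2 * (LINT x|\<mu>. (norm (pQ t x))\<^sup>2) + 2 * (LINT x|\<mu>. (norm (pQ s x - pQ t x))\<^sup>2)"
    using T D by (simp add: sq_bound_def)
  also have "\<dots> = 2 * (msq t)\<^sup>2 + 2 * (dQ t s)\<^sup>2" by (simp add: msq_def dQ_def integral_nonneg_AE)
  also have "\<dots> \<le> (2 * msq t + 2 * dQ t s)\<^sup>2" using nn by (simp add: power2_sum power_mult_distrib)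
  finally have "(msq s)\<^sup>2 \<le> (2 * msq t + 2 * dQ t s)\<^sup>2" .
  then show ?thesis by (rule power2_le_imp_le) (use nn in simp)
qed

text \<open>If the norms were unbounded, times with growing norms would accumulate at some
  \<open>t\<close>, near which continuity in H^2 bounds them. One constant then serves the whole
  time interval.\<close>

lemma msq_bounded:
  obtains M where "M \<ge> 0" "\<And>s. s \<in> {0..T} \<Longrightarrow> sq_bound (pQ s) M"
proof -
  have "\<exists>B. \<forall>s\<in>{0..T}. msq s \<le> B"
  proof (rule ccontr)
    assume "\<not> (\<exists>B. \<forall>s\<in>{0..T}. msq s \<le> B)"
    then have "\<forall>n::nat. \<exists>s\<in>{0..T}. msq s > real n" by (metis not_le)
    then obtain S where S: "\<And>n::nat. S n \<in> {0..T}" "\<And>n. msq (S n) > real n" by metis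
    obtain t r where t: "t \<in> {0..T}" "strict_mono r" "(S \<circ> r) \<longlonglongrightarrow> t"
      using compact_imp_seq_compact[OF compact_Icc[of 0 T]] S(1) unfolding seq_compact_def by metis
    have lim: "filterlim (S \<circ> r) (nhds t) sequentially" using t(3) .
    have "\<forall>\<^sub>F s in at t within {0..}. dQ t s < 1" using dQ_tendsto[of t] t(1) by (intro order_tendstoD(2)) auto
    then have "\<forall>\<^sub>F s in nhds t. s \<noteq> t \<longrightarrow> s \<in> {0..} \<longrightarrow> dQ t s < 1" by (simp add: eventually_at_filter)
    then have "\<forall>\<^sub>F n in sequentially. S (r n) \<noteq> t \<longrightarrow> S (r n) \<in> {0..} \<longrightarrow> dQ t (S (r n)) < 1"
      using lim by (auto simp: filterlim_iff comp_def)
    then obtain N where N: "\<And>n. n \<ge> N \<Longrightarrow> S (r n) \<noteq> t \<longrightarrow> S (r n) \<in> {0..} \<longrightarrow> dQ t (S (r n)) < 1"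
      unfolding eventually_sequentially by blast
    have bd: "msq (S (r n)) \<le> 2 * msq t + 2" if n: "n \<ge> N" for n
    proof -
      have pos: "S (r n) \<ge> 0" "t \<ge> 0" using S(1)[of "r n"] t(1) by auto
      have "dQ t (S (r n)) \<le> 1"
        using N[OF n] pos by (cases "S (r n) = t") (auto simp: dQ_def)
      then show ?thesis using msq_locally_bounded[OF pos] by linarith
    qed
    obtain n where n: "real n > 2 * msq t + 2" using reals_Archimedean2 by blast
    have "real (max n N) \<le> real (r (max n N))" using seq_suble[OF t(2), of "max n N"] by simp
    then show False using S(2)[of "r (max n N)"] bd[of "max n N"] n by auto
  qed
  then obtain B where B: "\<And>s. s \<in> {0..T} \<Longrightarrow> msq s \<le> B" by blast
  have "sq_bound (pQ s) (max B 0)" if s: "s \<in> {0..T}" for s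
  proof -
    have "(msq s)\<^sup>2 \<le> (max B 0)\<^sup>2" using B[OF s] pQ_sq[of s] s by (intro power_mono) (auto simp: sq_bound_def)
    then have "(LINT x|\<mu>. (norm (pQ s x))\<^sup>2) \<le> (max B 0)\<^sup>2"
      using pQ_sq[of s] s unfolding sq_bound_def by (meson atLeastAtMost_iff order_trans)
    then show ?thesis using pQ_sq[of s] s by (auto simp: sq_bound_def)
  qed
  then show ?thesis using that[of "max B 0"] by auto
qed

lemma Kj_bound:
  assumes R: "R \<ge> 0"
  obtains B where "B \<ge> 0" "\<And>s x. s \<in> {0..T} \<Longrightarrow> norm x \<le> R \<Longrightarrow> norm (Kj s x) \<le> B"
proof -
  obtain C where C: "C > 0" "\<And>p m x \<theta>. sq_bound p m \<Longrightarrow> norm x \<le> R \<Longrightarrow> norm (V p x \<theta>) \<le> C * (1 + m) * growth \<theta> ^ 2"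
    using V_norm_bound[OF R] by blast
  obtain M where M: "M \<ge> 0" "\<And>s. s \<in> {0..T} \<Longrightarrow> sq_bound (pQ s) M" using msq_bounded by blast
  note g2 = growth_power_integrable[OF init, of 2]
  have "norm (Kj s x) \<le> (LINT \<theta>|\<mu>0. C * (1 + M) * growth \<theta> ^ 2)" if "s \<in> {0..T}" "norm x \<le> R" for s x
    unfolding Kj_def by (rule lint_norm_bound[OF V_integrable[OF M(2)]]) (use g2 C(2)[OF M(2)] that in auto)
  moreover have "0 \<le> (LINT \<theta>|\<mu>0. C * (1 + M) * growth \<theta> ^ 2)" using C(1) M(1) by (intro integral_nonneg_AE) auto
  ultimately show ?thesis using that by blast
qed

text \<open>The field is Lipschitz in the L^2 norm of the jet, so continuity of the solution in H^2
  makes the velocity continuous in time at each fixed point.\<close>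

lemma Kj_continuous_time: "continuous_on {0..} (\<lambda>s. Kj s x)"
  unfolding continuous_on_def
proof
  fix t :: real assume "t \<in> {0..}"
  then have t: "t \<ge> 0" by simp
  obtain C where C: "C > 0" "\<And>p m p' m' \<delta> y \<theta>. sq_bound p m \<Longrightarrow> sq_bound p' m' \<Longrightarrow> sq_bound (\<lambda>y. p y - p' y) \<delta> \<Longrightarrow> norm y \<le> norm x \<Longrightarrow>
        norm (V p y \<theta> - V p' y \<theta>) \<le> C * (1 + m') * growth \<theta> ^ 2 * \<delta>"
    using V_lipschitz[OF norm_ge_zero[of x]] by blast
  note g2 = growth_power_integrable[OF init, of 2]
  define L where "L = C * (1 + msq t) * (LINT \<theta>|\<mu>0. growth \<theta> ^ 2)"
  have le: "norm (Kj s x - Kj t x) \<le> L * dQ t s" if s: "s \<ge> 0" for s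
  proof -
    have eq: "Kj s x - Kj t x = (LINT \<theta>|\<mu>0. V (pQ s) x \<theta> - V (pQ t) x \<theta>)"
      unfolding Kj_def using V_integrable[OF pQ_sq[OF s]] V_integrable[OF pQ_sq[OF t]] by simp
    have "norm (Kj s x - Kj t x) \<le> (LINT \<theta>|\<mu>0. C * (1 + msq t) * growth \<theta> ^ 2 * dQ t s)"
      unfolding eq by (rule lint_norm_bound)
         (use V_integrable[OF pQ_sq[OF s]] V_integrable[OF pQ_sq[OF t]] g2 C(2)[OF pQ_sq[OF s] pQ_sq[OF t] dQ_sq(1)[OF s t]] in auto)
    also have "\<dots> = L * dQ t s" by (simp add: L_def)
    finally show ?thesis .
  qed
  have lim: "((\<lambda>s. L * dQ t s) \<longlongrightarrow> 0) (at t within {0..})"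
    using tendsto_mult_right_zero[OF dQ_tendsto[OF t], of L] by simp
  have "\<forall>\<^sub>F s in at t within {0..}. norm (Kj s x - Kj t x) \<le> L * dQ t s"
    unfolding eventually_at_filter using le by (intro always_eventually) simp
  then have "((\<lambda>s. Kj s x - Kj t x) \<longlongrightarrow> 0) (at t within {0..})"
    by (rule Lim_null_comparison[OF _ lim])
  then show "((\<lambda>s. Kj s x) \<longlongrightarrow> Kj t x) (at t within {0..})" by (simp add: LIM_zero_iff)
qed

lemma has_jet_Kj:
  assumes s: "s \<ge> 0"
  shows "has_jet UNIV (\<lambda>x. fst (Kj s x)) (Kj s)"
proof -
  have J: "has_jet UNIV (\<lambda>x. fst (V (pQ s) x \<theta>)) (\<lambda>x. V (pQ s) x \<theta>)" for \<theta>
  proof -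
    have "has_jet UNIV (\<lambda>x. \<Sum>e\<in>Basis. Jf (pQ s) (hj \<theta> e) * fst (fjet \<sigma> \<theta> e x)) (\<lambda>x. V (pQ s) x \<theta>)"
      unfolding V_def by (intro has_jet_sum has_jet_scale has_jet_feature sig)
    then show ?thesis by (simp add: V_def fst_sum)
  qed
  have "has_jet UNIV (\<lambda>x. LINT \<theta>|\<mu>0. fst (V (pQ s) x \<theta>)) (\<lambda>x. LINT \<theta>|\<mu>0. V (pQ s) x \<theta>)"
  proof (rule has_jet_integral[OF J V_measurable[OF pQ_sq[OF s]]])
    fix R :: real assume R: "R \<ge> 0"
    obtain C where C: "C > 0" "\<And>p m x \<theta>. sq_bound p m \<Longrightarrow> norm x \<le> R \<Longrightarrow> norm (V p x \<theta>) \<le> C * (1 + m) * growth \<theta> ^ 2"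
      using V_norm_bound[OF R] by blast
    show "\<exists>B. integrable \<mu>0 B \<and> (\<forall>\<theta>\<in>space \<mu>0. \<forall>x. norm x \<le> R \<longrightarrow> norm (V (pQ s) x \<theta>) \<le> B \<theta>)"
      using C(2)[OF pQ_sq[OF s]] growth_power_integrable[OF init, of 2]
      by (intro exI[of _ "\<lambda>\<theta>. C * (1 + msq s) * growth \<theta> ^ 2"]) auto
  qed
  moreover have "(LINT \<theta>|\<mu>0. fst (V (pQ s) x \<theta>)) = fst (Kj s x)" for x
    unfolding Kj_def by (rule integral_bounded_linear[OF bounded_linear_fst V_integrable[OF pQ_sq[OF s]]])
  ultimately show ?thesis by (simp add: Kj_def[abs_def])
qed

text \<open>The jet of the factor R in Q = \<eta> R, defined as a time integral of the velocity. The
  features live on the whole space, so R does too, and no boundary enters its regularity.\<close>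

definition Rj :: "real \<Rightarrow> real^'n \<Rightarrow> 'n jet" where
  "Rj t x = integral {0..t} (\<lambda>s. (- \<alpha>) *\<^sub>R Kj s x)"

lemma Rj_has_integral: "t \<ge> 0 \<Longrightarrow> ((\<lambda>s. (- \<alpha>) *\<^sub>R Kj s x) has_integral Rj t x) {0..t}"
  unfolding Rj_def
  by (intro integrable_integral integrable_continuous_interval continuous_intros continuous_on_subset[OF Kj_continuous_time]) auto

text \<open>The time integral is rewritten as a Lebesgue integral, to which differentiation under
  the integral sign applies.\<close>

lemma has_jet_Rj:
  assumes t: "t \<ge> 0"
  shows "has_jet UNIV (\<lambda>x. fst (Rj t x)) (Rj t)"
proof -
  let ?M = "lebesgue_on {0..t}"
  have cont: "continuous_on {0..t} (\<lambda>s. (- \<alpha>) *\<^sub>R Kj s x)" for x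
    by (intro continuous_intros continuous_on_subset[OF Kj_continuous_time]) auto
  have meas: "(\<lambda>s. (- \<alpha>) *\<^sub>R Kj s x) \<in> borel_measurable ?M" for x
    by (rule continuous_imp_measurable_on_sets_lebesgue[OF cont]) auto
  have I: "integrable ?M (\<lambda>s. (- \<alpha>) *\<^sub>R Kj s x)" for x
    by (rule continuous_imp_integrable_real) (rule cont)
  have "has_jet UNIV (\<lambda>x. LINT s|?M. (- \<alpha>) * fst (Kj s x)) (\<lambda>x. LINT s|?M. (- \<alpha>) *\<^sub>R Kj s x)"
  proof (rule has_jet_integral[OF _ meas])
    show "has_jet UNIV (\<lambda>x. (- \<alpha>) * fst (Kj s x)) (\<lambda>x. (- \<alpha>) *\<^sub>R Kj s x)" if "s \<in> space ?M" for s
      by (rule has_jet_scale[OF has_jet_Kj]) (use that in simp)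
    fix R :: real assume R: "R \<ge> 0"
    obtain B where B: "B \<ge> 0" "\<And>s x. s \<in> {0..t} \<Longrightarrow> norm x \<le> R \<Longrightarrow> norm (Kj s x) \<le> B" using Kj_bound[OF R] by metis
    have "integrable ?M (\<lambda>s. \<bar>\<alpha>\<bar> * B)" by (rule continuous_imp_integrable_real) (rule continuous_on_const)
    then show "\<exists>B. integrable ?M B \<and> (\<forall>s\<in>space ?M. \<forall>x. norm x \<le> R \<longrightarrow> norm ((- \<alpha>) *\<^sub>R Kj s x) \<le> B s)"
      using B(2) by (intro exI[of _ "\<lambda>s. \<bar>\<alpha>\<bar> * B"]) (auto intro: mult_left_mono)
  qed
  moreover have R: "(LINT s|?M. (- \<alpha>) *\<^sub>R Kj s x) = Rj t x" for x
    unfolding Rj_def by (rule lebesgue_integral_eq_integral[OF I]) simp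
  moreover have "(LINT s|?M. (- \<alpha>) * fst (Kj s x)) = fst (Rj t x)" for x
    unfolding R[symmetric] using integral_bounded_linear[OF bounded_linear_fst I[of x]] by simp
  ultimately show ?thesis by simp
qed

text \<open>The factor \<eta> comes out of the right-hand side, and the integrated equation holds at
  every point; hence the identity is pointwise and not merely almost everywhere.\<close>

lemma Q_eq:
  assumes t: "t \<ge> 0" and x: "x \<in> \<Omega>"
  shows "Q t x = \<eta> x * fst (Rj t x)"
proof -
  have "((\<lambda>s. - \<alpha> * (LINT y|\<mu>. U_ker \<Omega> a c d f \<eta> \<sigma> \<mu>0 (Q s) x y * (A_op (wpd \<Omega>) a c d f (Q s) y - g y)))
          has_integral Q t x) {0..t}"
    using sol t x by (auto simp: limit_solution_def)
  then have 1: "((\<lambda>s. \<eta> x * fst ((- \<alpha>) *\<^sub>R Kj s x)) has_integral Q t x) {0..t}"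
    by (rule has_integral_eq[rotated]) (use limit_rhs[OF Q_H2 x] in \<open>simp add: Kj_def pQ_def\<close>)
  have bl: "bounded_linear (\<lambda>p::'n jet. \<eta> x * fst p)"
    by (rule bounded_linear_compose[OF bounded_linear_mult_right bounded_linear_fst])
  have 2: "((\<lambda>s. \<eta> x * fst ((- \<alpha>) *\<^sub>R Kj s x)) has_integral \<eta> x * fst (Rj t x)) {0..t}"
    using has_integral_linear[OF Rj_has_integral[OF t] bl] by (simp add: comp_def)
  show ?thesis by (rule has_integral_unique[OF 1 2])
qed

text \<open>The gain of regularity: a solution assumed only in H^2 has a classical second-order jet,
  which also represents its weak derivatives almost everywhere.\<close>

lemma has_jet_Q:
  assumes t: "t \<ge> 0"
  shows "has_jet \<Omega> (Q t) (\<lambda>x. jmul (ej x) (Rj t x))" "AE x in \<mu>. pQ t x = jmul (ej x) (Rj t x)"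
proof -
  have J: "has_jet \<Omega> (\<lambda>x. \<eta> x * fst (Rj t x)) (\<lambda>x. jmul (ej x) (Rj t x))"
    by (intro has_jet_mult has_jet_eta has_jet_subset[OF has_jet_Rj[OF t]]) simp
  then show J': "has_jet \<Omega> (Q t) (\<lambda>x. jmul (ej x) (Rj t x))"
    by (rule has_jet_cong) (simp add: Q_eq[OF t])
  show "AE x in \<mu>. pQ t x = jmul (ej x) (Rj t x)" unfolding pQ_def by (rule has_jet_H2(2)[OF J'])
qed

end

section \<open>Independent initial parameters\<close>

lemma summable_powr_exp_powr:
  fixes c s p :: real
  assumes "s > 0" "c > 0"
  shows "summable (\<lambda>N. real N powr p * exp (- c * real N powr s))"
proof (rule summable_comparison_test_ev[OF _ inverse_power_summable[of 2]])
  have "eventually (\<lambda>N. real N powr p * exp (- c * real N powr s) \<le> inverse (real N ^ 2)) sequentially"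
    using assms by real_asymp
  then show "\<forall>\<^sub>F N in sequentially. norm (real N powr p * exp (- c * real N powr s)) \<le> inverse (real N ^ 2)"
    by eventually_elim simp
qed simp

locale iid_params =
  fixes P :: "'w measure" and \<theta>0 :: "nat \<Rightarrow> 'w \<Rightarrow> 'n::finite param" and \<mu>0 :: "'n param measure"
  assumes prob: "prob_space P"
    and indep: "prob_space.indep_vars P (\<lambda>_. borel) \<theta>0 UNIV"
    and law: "\<And>i. distr P borel (\<theta>0 i) = \<mu>0"
    and init: "initial_law \<mu>0"
begin

sublocale P: prob_space P by (rule prob)

sublocale M0: prob_space \<mu>0 using init by (simp add: initial_law_def)

lemma sets_\<mu>0: "sets \<mu>0 = sets borel" using init by (simp add: initial_law_def)

lemma measurable_\<mu>0: "measurable \<mu>0 N = measurable borel N"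
  by (rule measurable_cong_sets) (simp_all add: sets_\<mu>0)

lemma space_\<mu>0 [simp]: "space \<mu>0 = UNIV" using sets_eq_imp_space_eq[OF sets_\<mu>0] by simp

lemma rv: "\<theta>0 i \<in> borel_measurable P"
  using indep unfolding P.indep_vars_def by auto

lemma AE_params:
  assumes "AE \<theta> in \<mu>0. R \<theta>"
  shows "AE \<omega> in P. R (\<theta>0 i \<omega>)"
proof -
  have "AE \<theta> in distr P borel (\<theta>0 i). R \<theta>" unfolding law by (rule assms)
  then show ?thesis by (rule AE_distrD[OF rv])
qed

lemma expectation_params:
  fixes h :: "'n param \<Rightarrow> real"
  assumes "h \<in> borel_measurable borel"
  shows "P.expectation (\<lambda>\<omega>. h (\<theta>0 i \<omega>)) = (LINT \<theta>|\<mu>0. h \<theta>)"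
  unfolding law[of i, symmetric] using rv assms by (subst integral_distr) auto

lemma Hoeffding_params:
  fixes h :: "'n param \<Rightarrow> real"
  assumes h: "h \<in> borel_measurable borel" and b: "\<And>\<theta>. \<bar>h \<theta>\<bar> \<le> b" "b > 0" and N: "N \<ge> 1" and \<epsilon>: "\<epsilon> \<ge> 0"
  shows "P.prob {\<omega>\<in>space P. \<bar>(\<Sum>i<N. h (\<theta>0 i \<omega>)) - real N * (LINT \<theta>|\<mu>0. h \<theta>)\<bar> \<ge> \<epsilon>}
     \<le> 2 * exp (- \<epsilon>\<^sup>2 / (2 * real N * b\<^sup>2))"
proof -
  have ind: "P.indep_vars (\<lambda>_. borel) (\<lambda>i \<omega>. h (\<theta>0 i \<omega>)) {..<N}"
    by (rule P.indep_vars_compose2[OF P.indep_vars_subset[OF indep]]) (use h in auto)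
  interpret H: Hoeffding_ineq_iid P "{..<N}" "\<lambda>i \<omega>. h (\<theta>0 i \<omega>)" "\<lambda>\<omega>. h (\<theta>0 0 \<omega>)" "-b" b "LINT \<theta>|\<mu>0. h \<theta>"
  proof unfold_locales
    show "P.indep_vars (\<lambda>_. borel) (\<lambda>i \<omega>. h (\<theta>0 i \<omega>)) {..<N}" by (rule ind)
    have "distr P borel (\<lambda>\<omega>. h (\<theta>0 i \<omega>)) = distr \<mu>0 borel h" for i
      unfolding law[of i, symmetric] using distr_distr[OF h rv[of i]] by (simp add: comp_def)
    then show "distr P borel (\<lambda>\<omega>. h (\<theta>0 i \<omega>)) = distr P borel (\<lambda>\<omega>. h (\<theta>0 0 \<omega>))" for i by simp
    show "P.random_variable borel (\<lambda>\<omega>. h (\<theta>0 0 \<omega>))" by (rule measurable_compose[OF rv h])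
    show "AE \<omega> in P. h (\<theta>0 0 \<omega>) \<in> {- b..b}" using b(1) by (intro AE_I2) (auto simp: abs_le_iff minus_le_iff)
    show "LINT \<theta>|\<mu>0. h \<theta> \<equiv> P.expectation (\<lambda>\<omega>. h (\<theta>0 0 \<omega>))" using expectation_params[OF h, of 0] by simp
  qed auto
  have "(2 * real N) * (b * 2)\<^sup>2 / 2 = 4 * real N * b\<^sup>2" by (simp add: power2_eq_square)
  have e: "- 2 * \<epsilon>\<^sup>2 / (real N * (b - - b)\<^sup>2) = - \<epsilon>\<^sup>2 / (2 * real N * b\<^sup>2)"
    using N b(2) by (simp add: power2_eq_square field_simps)
  show ?thesis using H.Hoeffding_ineq_abs_ge[OF \<epsilon>] b(2) N unfolding card_lessThan e
    by (auto simp: lessThan_empty_iff)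
qed

text \<open>Truncations at a growing level \<open>D N\<^sup>q\<close> of families of polynomially growing size
  concentrate at every scale \<open>N\<^sup>r\<close> with \<open>2 r > 1 + 2 q\<close>.\<close>

lemma concentration:
  fixes h :: "nat \<Rightarrow> 'j \<Rightarrow> 'n param \<Rightarrow> real" and F :: "nat \<Rightarrow> 'j set"
  assumes F: "\<And>N. finite (F N)" "\<And>N. N \<ge> 1 \<Longrightarrow> real (card (F N)) \<le> C * real N powr p"
    and h: "\<And>N j. h N j \<in> borel_measurable borel" "\<And>N j \<theta>. N \<ge> 1 \<Longrightarrow> \<bar>h N j \<theta>\<bar> \<le> D * real N powr q"
    and D: "D > 0" and r: "2 * r - 1 - 2 * q > 0" and \<delta>: "\<delta> > 0"
  shows "AE \<omega> in P. \<forall>\<^sub>F N in sequentially. \<forall>j\<in>F N.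
     \<bar>(\<Sum>i<N. h N j (\<theta>0 i \<omega>)) - real N * (LINT \<theta>|\<mu>0. h N j \<theta>)\<bar> < \<delta> * real N powr r"
proof -
  define A where "A = (\<lambda>N. if N = 0 then {} else (\<Union>j\<in>F N. {\<omega>\<in>space P.
     \<bar>(\<Sum>i<N. h N j (\<theta>0 i \<omega>)) - real N * (LINT \<theta>|\<mu>0. h N j \<theta>)\<bar> \<ge> \<delta> * real N powr r}))"
  have hm: "(\<lambda>\<omega>. h N j (\<theta>0 i \<omega>)) \<in> borel_measurable P" for N j i by (rule measurable_compose[OF rv h(1)])
  have Am: "A N \<in> sets P" for N unfolding A_def using F(1) hm by auto
  \<comment> \<open>With deviation \<delta> N^r and truncation level D N^q the Hoeffding exponent is
    (\<delta>^2 / (2 D^2)) N^(2r - 1 - 2q).\<close>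
  define c where "c = \<delta>\<^sup>2 / (2 * D\<^sup>2)"
  define s where "s = 2 * r - 1 - 2 * q"
  have c: "c > 0" "s > 0" using D \<delta> r by (auto simp: c_def s_def)
  have Ab: "P.prob (A N) \<le> 2 * C * (real N powr p * exp (- c * real N powr s))" if N: "N \<ge> 1" for N
  proof -
    have b: "D * real N powr q > 0" using D N by simp
    have "\<delta> * real N powr r \<ge> 0" using \<delta> by simp
    have ex: "- (\<delta> * real N powr r)\<^sup>2 / (2 * real N * (D * real N powr q)\<^sup>2) = - c * real N powr s"
    proof -
      have "(real N powr r)\<^sup>2 = real N powr (2 * r)" "(real N powr q)\<^sup>2 = real N powr (2 * q)"
        using N by (simp_all add: powr_power mult.commute)
      then have "(\<delta> * real N powr r)\<^sup>2 / (2 * real N * (D * real N powr q)\<^sup>2)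
          = c * (real N powr (2 * r) / (real N * real N powr (2 * q)))"
        using N D by (simp add: power_mult_distrib c_def divide_simps)
      also have "real N powr (2 * r) / (real N * real N powr (2 * q)) = real N powr s"
        using N by (simp add: s_def powr_diff)
      finally show ?thesis by simp
    qed
    have "P.prob (A N) \<le> (\<Sum>j\<in>F N. P.prob {\<omega>\<in>space P.
       \<bar>(\<Sum>i<N. h N j (\<theta>0 i \<omega>)) - real N * (LINT \<theta>|\<mu>0. h N j \<theta>)\<bar> \<ge> \<delta> * real N powr r})"
      using N F(1) hm by (auto simp: A_def intro!: P.finite_measure_subadditive_finite)
    also have "\<dots> \<le> (\<Sum>j\<in>F N. 2 * exp (- c * real N powr s))"
      unfolding ex[symmetric] by (intro sum_mono Hoeffding_params h b N) (use N \<delta> in auto)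
    also have "\<dots> = real (card (F N)) * (2 * exp (- c * real N powr s))" by simp
    also have "\<dots> \<le> (C * real N powr p) * (2 * exp (- c * real N powr s))"
      by (intro mult_right_mono F N) simp
    finally show ?thesis by (simp add: mult_ac)
  qed
  have "summable (\<lambda>N. P.prob (A N))"
  proof (rule summable_comparison_test_ev)
    show "summable (\<lambda>N. 2 * C * (real N powr p * exp (- c * real N powr s)))"
      by (intro summable_mult summable_powr_exp_powr c)
    show "\<forall>\<^sub>F N in sequentially. norm (P.prob (A N)) \<le> 2 * C * (real N powr p * exp (- c * real N powr s))"
      using eventually_ge_at_top[of 1] by eventually_elim (use Ab in simp)
  qed
  then have "AE \<omega> in P. eventually (\<lambda>N. \<omega> \<in> space P - A N) sequentially"
    by (intro borel_cantelli_AE1) (use Am in \<open>auto simp: P.emeasure_eq_measure\<close>)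
  then show ?thesis
  proof eventually_elim
    fix \<omega> assume "eventually (\<lambda>N. \<omega> \<in> space P - A N) sequentially"
    with eventually_ge_at_top[of 1]
    show "\<forall>\<^sub>F N in sequentially. \<forall>j\<in>F N.
     \<bar>(\<Sum>i<N. h N j (\<theta>0 i \<omega>)) - real N * (LINT \<theta>|\<mu>0. h N j \<theta>)\<bar> < \<delta> * real N powr r"
    proof eventually_elim
      fix N assume "\<omega> \<in> space P - A N" "1 \<le> N"
      then show "\<forall>j\<in>F N. \<bar>(\<Sum>i<N. h N j (\<theta>0 i \<omega>)) - real N * (LINT \<theta>|\<mu>0. h N j \<theta>)\<bar> < \<delta> * real N powr r"
        by (auto simp: A_def not_le)
    qed
  qed
qed

text \<open>A strong law for indicators: concentration with bounded summands, q = 0 and r = 1, at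
  the countably many accuracies \<open>1 / real (Suc k)\<close>.\<close>

lemma indicator_average:
  assumes A: "A \<in> sets borel"
  shows "AE \<omega> in P. (\<lambda>N. (\<Sum>i<N. indicator A (\<theta>0 i \<omega>)) / real N) \<longlonglongrightarrow> measure \<mu>0 A"
proof -
  have "AE \<omega> in P. \<forall>\<^sub>F N in sequentially. \<forall>j\<in>{()}.
     \<bar>(\<Sum>i<N. indicator A (\<theta>0 i \<omega>)) - real N * (LINT \<theta>|\<mu>0. indicator A \<theta>)\<bar> < 1 / real (Suc k) * real N powr 1" for k
    by (rule concentration[where C = 1 and p = 0 and D = 1 and q = 0])
       (use A in \<open>auto split: split_indicator simp: \<close>)
  then have "AE \<omega> in P. \<forall>k. \<forall>\<^sub>F N in sequentially. \<forall>j\<in>{()}.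
     \<bar>(\<Sum>i<N. indicator A (\<theta>0 i \<omega>)) - real N * (LINT \<theta>|\<mu>0. indicator A \<theta>)\<bar> < 1 / real (Suc k) * real N powr 1"
    by (simp only: AE_all_countable) blast
  then show ?thesis
  proof eventually_elim
    fix \<omega> assume E: "\<forall>k. \<forall>\<^sub>F N in sequentially. \<forall>j\<in>{()}.
     \<bar>(\<Sum>i<N. indicator A (\<theta>0 i \<omega>)) - real N * (LINT \<theta>|\<mu>0. indicator A \<theta>)\<bar> < 1 / real (Suc k) * real N powr 1"
    show "(\<lambda>N. (\<Sum>i<N. indicator A (\<theta>0 i \<omega>)) / real N) \<longlonglongrightarrow> measure \<mu>0 A"
    proof (rule tendstoI)
      fix e :: real assume "e > 0"
      then obtain k where k: "1 / real (Suc k) < e" using nat_approx_posE by blast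
      from spec[OF E, of k] eventually_ge_at_top[of 1]
      show "\<forall>\<^sub>F N in sequentially. dist ((\<Sum>i<N. indicator A (\<theta>0 i \<omega>)) / real N) (measure \<mu>0 A) < e"
      proof eventually_elim
        fix N :: nat
        assume N: "1 \<le> N" and a: "\<forall>j\<in>{()}. \<bar>(\<Sum>i<N. indicator A (\<theta>0 i \<omega>)) - real N * (LINT \<theta>|\<mu>0. indicator A \<theta>)\<bar> < 1 / real (Suc k) * real N powr 1"
        have "(LINT \<theta>|\<mu>0. indicator A \<theta>) = measure \<mu>0 A" using A sets_\<mu>0 by simp
        then have "\<bar>(\<Sum>i<N. indicator A (\<theta>0 i \<omega>)) - real N * measure \<mu>0 A\<bar> < 1 / real (Suc k) * real N" using a N by simp
        then have "\<bar>(\<Sum>i<N. indicator A (\<theta>0 i \<omega>)) / real N - measure \<mu>0 A\<bar> < 1 / real (Suc k)"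
        proof -
          assume b: "\<bar>(\<Sum>i<N. indicator A (\<theta>0 i \<omega>)) - real N * measure \<mu>0 A\<bar> < 1 / real (Suc k) * real N"
          have "(\<Sum>i<N. indicator A (\<theta>0 i \<omega>)) / real N - measure \<mu>0 A = ((\<Sum>i<N. indicator A (\<theta>0 i \<omega>)) - real N * measure \<mu>0 A) / real N"
            using N by (simp add: diff_divide_distrib)
          then show ?thesis using b N by (simp add: divide_less_eq del: of_nat_Suc)
        qed
        then show "dist ((\<Sum>i<N. indicator A (\<theta>0 i \<omega>)) / real N) (measure \<mu>0 A) < e"
          using k by (simp add: dist_real_def)
      qed
    qed
  qed
qed

text \<open>Markov's inequality with a moment of order m such that m \<kappa> >= 3 makes a single
  exceedance O(N^-3). The union over N weights is O(N^-2), which is summable.\<close>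

lemma weights_polynomial:
  assumes k: "\<kappa> > 0"
  shows "AE \<omega> in P. \<forall>\<^sub>F N in sequentially. \<forall>i<N. norm (fst (snd (\<theta>0 i \<omega>))) \<le> real N powr \<kappa>"
proof -
  obtain m :: nat where m: "real m * \<kappa> \<ge> 3" using reals_Archimedean3[OF k] by (meson less_imp_le)
  define E where "E = (LINT \<theta>|\<mu>0. norm (fst (snd \<theta>)) ^ m)"
  have i: "integrable \<mu>0 (\<lambda>\<theta>. norm (fst (snd \<theta>)) ^ m)" using init by (auto simp: initial_law_def)
  define A where "A = (\<lambda>N::nat. \<Union>i<N. {\<omega>\<in>space P. norm (fst (snd (\<theta>0 i \<omega>))) > real N powr \<kappa>})"
  have bm: "(\<lambda>\<theta>::'n param. norm (fst (snd \<theta>))) \<in> borel_measurable borel"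
    by (intro borel_measurable_continuous_onI continuous_intros)
  have wm: "(\<lambda>\<omega>. norm (fst (snd (\<theta>0 i \<omega>)))) \<in> borel_measurable P" for i
    by (rule measurable_compose[OF rv bm])
  have Am: "A N \<in> sets P" for N unfolding A_def using wm by auto
  have one: "P.prob {\<omega>\<in>space P. norm (fst (snd (\<theta>0 i \<omega>))) > real N powr \<kappa>} \<le> E * inverse (real N ^ 3)" if N: "N \<ge> 1" for i N
  proof -
    define t where "t = real N powr \<kappa>"
    have t: "t > 0" using N by (simp add: t_def)
    have tm: "real N ^ 3 \<le> t ^ m"
    proof -
      have "real N ^ 3 = real N powr 3" using N by (simp add: powr_numeral)
      also have "\<dots> \<le> real N powr (\<kappa> * real m)" using N m by (intro powr_mono) (auto simp: mult.commute)
      also have "\<dots> = t ^ m" using N by (simp add: t_def powr_powr[symmetric] powr_realpow)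
      finally show ?thesis .
    qed
    have S: "{\<omega>\<in>space P. norm (fst (snd (\<theta>0 i \<omega>))) > t} \<in> sets P" using wm by auto
    have "P.prob {\<omega>\<in>space P. norm (fst (snd (\<theta>0 i \<omega>))) > t} = P.expectation (indicator {\<omega>\<in>space P. norm (fst (snd (\<theta>0 i \<omega>))) > t})"
      using S by simp
    also have "\<dots> \<le> P.expectation (\<lambda>\<omega>. norm (fst (snd (\<theta>0 i \<omega>))) ^ m * inverse (t ^ m))"
    proof (rule integral_mono)
      show "integrable P (\<lambda>\<omega>. norm (fst (snd (\<theta>0 i \<omega>))) ^ m * inverse (t ^ m))"
      proof -
        have "integrable (distr P borel (\<theta>0 i)) (\<lambda>\<theta>. norm (fst (snd \<theta>)) ^ m)" using i law by simp
        then show ?thesis using integrable_distr[OF rv] by (intro integrable_mult_left) auto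
      qed
      fix \<omega>
      show "indicator {\<omega>\<in>space P. norm (fst (snd (\<theta>0 i \<omega>))) > t} \<omega> \<le> norm (fst (snd (\<theta>0 i \<omega>))) ^ m * inverse (t ^ m)"
      proof (cases "norm (fst (snd (\<theta>0 i \<omega>))) > t")
        case True
        then have "t ^ m \<le> norm (fst (snd (\<theta>0 i \<omega>))) ^ m" using t by (intro power_mono) auto
        then show ?thesis using t by (auto split: split_indicator simp: field_simps)
      qed (use t in \<open>auto split: split_indicator\<close>)
    qed (use S in \<open>auto intro!: integrable_real_indicator simp: P.emeasure_eq_measure\<close>)
    also have "\<dots> = E * inverse (t ^ m)"
      using expectation_params[of "\<lambda>\<theta>. norm (fst (snd \<theta>)) ^ m" i] bm by (simp add: E_def)
    also have "\<dots> \<le> E * inverse (real N ^ 3)"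
      using tm N by (intro mult_left_mono le_imp_inverse_le) (auto simp: E_def)
    finally show ?thesis by (simp add: t_def)
  qed
  have Ab: "P.prob (A N) \<le> E * inverse (real N ^ 2)" if N: "N \<ge> 1" for N
  proof -
    have "P.prob (A N) \<le> (\<Sum>i<N. P.prob {\<omega>\<in>space P. norm (fst (snd (\<theta>0 i \<omega>))) > real N powr \<kappa>})"
      unfolding A_def using wm by (intro P.finite_measure_subadditive_finite) auto
    also have "\<dots> \<le> (\<Sum>i<N. E * inverse (real N ^ 3))" by (intro sum_mono one N)
    also have "\<dots> = E * inverse (real N ^ 2)" using N by (simp add: field_simps power_numeral_reduce)
    finally show ?thesis .
  qed
  have "summable (\<lambda>N. P.prob (A N))"
  proof (rule summable_comparison_test_ev)
    show "summable (\<lambda>N. E * inverse (real N ^ 2))" by (intro summable_mult inverse_power_summable) simp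
    show "\<forall>\<^sub>F N in sequentially. norm (P.prob (A N)) \<le> E * inverse (real N ^ 2)"
      using eventually_ge_at_top[of 1] by eventually_elim (use Ab in simp)
  qed
  then have "AE \<omega> in P. eventually (\<lambda>N. \<omega> \<in> space P - A N) sequentially"
    by (intro borel_cantelli_AE1) (use Am in \<open>auto simp: P.emeasure_eq_measure\<close>)
  then show ?thesis
    by (rule AE_mp) (auto intro!: AE_I2 elim!: eventually_mono simp: A_def not_less)
qed

lemma output_weights_bounded:
  obtains C where "C > 0" "AE \<theta> in \<mu>0. \<bar>fst \<theta>\<bar> \<le> C" "AE \<omega> in P. \<forall>i. \<bar>fst (\<theta>0 i \<omega>)\<bar> \<le> C"
proof -
  obtain C where C: "AE \<theta> in \<mu>0. \<bar>fst \<theta>\<bar> \<le> C" using init by (auto simp: initial_law_def)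
  then have C': "AE \<theta> in \<mu>0. \<bar>fst \<theta>\<bar> \<le> max C 1" by eventually_elim auto
  have "AE \<omega> in P. \<forall>i. \<bar>fst (\<theta>0 i \<omega>)\<bar> \<le> max C 1" using AE_params[OF C'] by (simp add: AE_all_countable)
  then show ?thesis using that[of "max C 1"] C' by auto
qed

lemma growth_measurable: "(\<lambda>\<theta>::'n param. growth \<theta> ^ k) \<in> borel_measurable borel"
  by (intro borel_measurable_continuous_onI continuous_intros growth_continuous)

text \<open>Eventually the truncated and the true summands coincide, and the truncated ones
  concentrate around a mean that the fourth moment bounds. The fourth power is what the tail and
  clipping estimates consume.\<close>

lemma average_growth_bounded:
  "AE \<omega> in P. \<exists>B. \<forall>\<^sub>F N in sequentially. (\<Sum>i<N. growth (\<theta>0 i \<omega>) ^ 4) / real N \<le> B"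
proof -
  obtain C where C: "C > 0" "AE \<omega> in P. \<forall>i. \<bar>fst (\<theta>0 i \<omega>)\<bar> \<le> C" using output_weights_bounded by metis
  \<comment> \<open>The fourth power of \<open>growth\<close> contains the eighth power of the input
    weight, so this level bounds it by a multiple of N^(1/4); with r = 1 the exponent 2r - 1 - 2q is
    then 1/2.\<close>
  define \<kappa> where "\<kappa> = (1/32 :: real)"
  define h where "h = (\<lambda>N (j::unit) \<theta>::'n param. if \<bar>fst \<theta>\<bar> \<le> C \<and> norm (fst (snd \<theta>)) \<le> real N powr \<kappa> then growth \<theta> ^ 4 else 0)"
  have hm: "h N j \<in> borel_measurable borel" for N j
  proof -
    have "{\<theta>::'n param. \<bar>fst \<theta>\<bar> \<le> C \<and> norm (fst (snd \<theta>)) \<le> real N powr \<kappa>} \<in> sets borel"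
      by (intro borel_closed closed_Collect_conj closed_Collect_le continuous_intros)
    then show ?thesis unfolding h_def
      by (intro measurable_If growth_measurable) auto
  qed
  define D where "D = (1 + C) ^ 4 * 2 ^ 8"
  have D: "D > 0" using C(1) by (simp add: D_def)
  have hb: "\<bar>h N j \<theta>\<bar> \<le> D * real N powr (1/4)" if N: "N \<ge> 1" for N j \<theta>
  proof (cases "\<bar>fst \<theta>\<bar> \<le> C \<and> norm (fst (snd \<theta>)) \<le> real N powr \<kappa>")
    case True
    have N1: "1 \<le> real N powr \<kappa>" using N by (intro ge_one_powr_ge_zero) (auto simp: \<kappa>_def)
    have "growth \<theta> ^ 4 = (1 + \<bar>fst \<theta>\<bar>) ^ 4 * (1 + norm (fst (snd \<theta>))) ^ 8"
      by (simp add: growth_def power_mult_distrib power_mult[symmetric])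
    also have "\<dots> \<le> (1 + C) ^ 4 * (2 * real N powr \<kappa>) ^ 8"
      using True N1 by (intro mult_mono power_mono) auto
    also have "\<dots> = D * (real N powr \<kappa>) ^ 8" by (simp add: D_def power_mult_distrib)
    also have "(real N powr \<kappa>) ^ 8 = real N powr (1/4)" using N by (simp add: powr_power \<kappa>_def)
    finally show ?thesis using True growth_ge_1[of \<theta>] by (simp add: h_def)
  qed (use D in \<open>auto simp: h_def\<close>)
  have "AE \<omega> in P. \<forall>\<^sub>F N in sequentially. \<forall>j\<in>{()}.
     \<bar>(\<Sum>i<N. h N j (\<theta>0 i \<omega>)) - real N * (LINT \<theta>|\<mu>0. h N j \<theta>)\<bar> < 1 * real N powr 1"
    by (rule concentration[where C = 1 and p = 0 and D = D and q = "1/4"]) (use hm hb D in auto)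
  moreover have "AE \<omega> in P. \<forall>\<^sub>F N in sequentially. \<forall>i<N. norm (fst (snd (\<theta>0 i \<omega>))) \<le> real N powr \<kappa>"
    by (rule weights_polynomial) (simp add: \<kappa>_def)
  ultimately show ?thesis using C(2)
  proof eventually_elim
    fix \<omega>
    assume a: "\<forall>\<^sub>F N in sequentially. \<forall>j\<in>{()}. \<bar>(\<Sum>i<N. h N j (\<theta>0 i \<omega>)) - real N * (LINT \<theta>|\<mu>0. h N j \<theta>)\<bar> < 1 * real N powr 1"
      and b: "\<forall>\<^sub>F N in sequentially. \<forall>i<N. norm (fst (snd (\<theta>0 i \<omega>))) \<le> real N powr \<kappa>"
      and c: "\<forall>i. \<bar>fst (\<theta>0 i \<omega>)\<bar> \<le> C"
    define m where "m = (LINT \<theta>|\<mu>0. growth \<theta> ^ 4)"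
    note i4 = growth_power_integrable[OF init, of 4]
    have "\<forall>\<^sub>F N in sequentially. (\<Sum>i<N. growth (\<theta>0 i \<omega>) ^ 4) / real N \<le> m + 1"
      using a b eventually_ge_at_top[of 1]
    proof eventually_elim
      fix N :: nat
      assume a: "\<forall>j\<in>{()}. \<bar>(\<Sum>i<N. h N j (\<theta>0 i \<omega>)) - real N * (LINT \<theta>|\<mu>0. h N j \<theta>)\<bar> < 1 * real N powr 1"
        and b: "\<forall>i<N. norm (fst (snd (\<theta>0 i \<omega>))) \<le> real N powr \<kappa>" and N: "1 \<le> N"
      have "(\<Sum>i<N. growth (\<theta>0 i \<omega>) ^ 4) = (\<Sum>i<N. h N () (\<theta>0 i \<omega>))"
        by (rule sum.cong) (use b c in \<open>auto simp: h_def\<close>)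
      also have "\<dots> \<le> real N * (LINT \<theta>|\<mu>0. h N () \<theta>) + real N" using a N by (auto simp: abs_less_iff)
      finally have A: "(\<Sum>i<N. growth (\<theta>0 i \<omega>) ^ 4) \<le> real N * (LINT \<theta>|\<mu>0. h N () \<theta>) + real N" .
      have "(LINT \<theta>|\<mu>0. h N () \<theta>) \<le> m"
        unfolding m_def
      proof (rule integral_mono[OF _ i4])
        have p: "0 \<le> growth \<theta> ^ 4" for \<theta> :: "'n param" using growth_ge_1[of \<theta>] by simp
        show "integrable \<mu>0 (h N ())"
          by (rule integrable_norm_bound[OF i4]) (use hm p in \<open>auto simp: measurable_\<mu>0 h_def\<close>)
        show "h N () \<theta> \<le> growth \<theta> ^ 4" for \<theta> using p[of \<theta>] by (simp add: h_def)
      qed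
      then have "real N * (LINT \<theta>|\<mu>0. h N () \<theta>) \<le> real N * m" by (intro mult_left_mono) auto
      with A have "(\<Sum>i<N. growth (\<theta>0 i \<omega>) ^ 4) \<le> real N * m + real N" by linarith
      then show "(\<Sum>i<N. growth (\<theta>0 i \<omega>) ^ 4) / real N \<le> m + 1" using N by (simp add: field_simps)
    qed
    then show "\<exists>B. \<forall>\<^sub>F N in sequentially. (\<Sum>i<N. growth (\<theta>0 i \<omega>) ^ 4) / real N \<le> B" by blast
  qed
qed

text \<open>\<open>initial_law\<close> states independence only on sets
  \<open>A \<times> B \<times> C\<close>. For fixed \<open>A\<close> it is extended from rectangles
  to all Borel sets of pairs (w, b), which identifies the law as a product of two factors.\<close>

lemma law_product:
  "distr \<mu>0 borel fst \<Otimes>\<^sub>M distr \<mu>0 borel snd = \<mu>0"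
proof (rule pair_measure_eqI)
  have mf: "fst \<in> measurable \<mu>0 borel" and ms: "snd \<in> measurable \<mu>0 borel"
    unfolding measurable_\<mu>0 by (auto intro!: borel_measurable_continuous_onI continuous_intros)
  show "sigma_finite_measure (distr \<mu>0 borel fst)" "sigma_finite_measure (distr \<mu>0 borel snd)"
    using M0.prob_space_distr[OF mf] M0.prob_space_distr[OF ms]
    by (auto simp: prob_space_def finite_measure_def)
  show "sets (distr \<mu>0 borel fst \<Otimes>\<^sub>M distr \<mu>0 borel snd) = sets \<mu>0"
  proof -
    have "sets (distr \<mu>0 borel fst \<Otimes>\<^sub>M distr \<mu>0 borel snd) = sets (borel \<Otimes>\<^sub>M borel)"
      by (rule sets_pair_measure_cong) simp_all
    then show ?thesis unfolding sets_\<mu>0 by (simp only: borel_prod)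
  qed
  fix A :: "real set" and B :: "((real^'n) \<times> real) set" assume "A \<in> sets (distr \<mu>0 borel fst)" "B \<in> sets (distr \<mu>0 borel snd)"
  then have A: "A \<in> sets borel" and B: "B \<in> sets borel" by auto
  have prodb: "X \<times> Y \<in> sets borel" if "X \<in> sets borel" "Y \<in> sets borel"
    for X :: "'a::second_countable_topology set" and Y :: "'b::second_countable_topology set"
    using that by (metis borel_prod pair_measureI)
  \<comment> \<open>For the fixed set \<open>A\<close>, the law of (w, b) restricted to the event
    that the output weight lies in \<open>A\<close>, against the unrestricted law scaled by the
    probability of \<open>A\<close>; they agree on rectangles.\<close>
  define \<nu>1 where "\<nu>1 = distr (density \<mu>0 (indicator (A \<times> UNIV))) borel snd"
  define \<nu>2 where "\<nu>2 = density (distr \<mu>0 borel snd) (\<lambda>_. emeasure \<mu>0 (A \<times> UNIV))"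
  have AU: "A \<times> UNIV \<in> sets \<mu>0" unfolding sets_\<mu>0 using A by (intro prodb) auto
  have e1: "emeasure \<nu>1 D = emeasure \<mu>0 (A \<times> D)" if D: "D \<in> sets borel" for D
  proof -
    have V: "snd -` D \<inter> space \<mu>0 \<in> sets \<mu>0" by (rule measurable_sets[OF ms D])
    have "emeasure \<nu>1 D = emeasure (density \<mu>0 (indicator (A \<times> UNIV))) (snd -` D \<inter> space \<mu>0)"
      unfolding \<nu>1_def using D ms by (subst emeasure_distr) auto
    also have "\<dots> = (\<integral>\<^sup>+\<theta>. indicator (A \<times> UNIV) \<theta> * indicator (snd -` D) \<theta> \<partial>\<mu>0)"
      using V AU by (subst emeasure_density) auto
    also have "\<dots> = (\<integral>\<^sup>+\<theta>. indicator (A \<times> D) \<theta> \<partial>\<mu>0)"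
      by (rule nn_integral_cong) (auto split: split_indicator)
    also have "\<dots> = emeasure \<mu>0 (A \<times> D)"
      using prodb[OF A D] by (simp add: sets_\<mu>0)
    finally show ?thesis .
  qed
  have e2: "emeasure \<nu>2 D = emeasure \<mu>0 (A \<times> UNIV) * emeasure \<mu>0 (UNIV \<times> D)" if D: "D \<in> sets borel" for D
  proof -
    have "emeasure \<nu>2 D = emeasure \<mu>0 (A \<times> UNIV) * emeasure (distr \<mu>0 borel snd) D"
      unfolding \<nu>2_def using D by (subst emeasure_density) (auto simp: nn_integral_cmult)
    also have "emeasure (distr \<mu>0 borel snd) D = emeasure \<mu>0 (snd -` D \<inter> space \<mu>0)"
      using D ms by (subst emeasure_distr) auto
    also have "snd -` D \<inter> space \<mu>0 = UNIV \<times> D" by auto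
    finally show ?thesis .
  qed
  have rect: "emeasure \<nu>1 (X \<times> Y) = emeasure \<nu>2 (X \<times> Y)" if X: "X \<in> sets borel" and Y: "Y \<in> sets borel" for X Y
  proof -
    have law3: "measure \<mu>0 (A \<times> X \<times> Y) =
          measure \<mu>0 (A \<times> UNIV) * measure \<mu>0 (UNIV \<times> X \<times> UNIV) * measure \<mu>0 (UNIV \<times> UNIV \<times> Y)"
      if "A \<in> sets borel" for A using init that X Y unfolding initial_law_def by blast
    have "measure \<mu>0 UNIV = 1" using M0.prob_space by simp
    then have "measure \<mu>0 (UNIV \<times> X \<times> Y) = measure \<mu>0 (UNIV \<times> X \<times> UNIV) * measure \<mu>0 (UNIV \<times> UNIV \<times> Y)"
      using law3[of UNIV] by simp
    then have "measure \<mu>0 (A \<times> X \<times> Y) = measure \<mu>0 (A \<times> UNIV) * measure \<mu>0 (UNIV \<times> X \<times> Y)"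
      using law3[OF A] by simp
    then show ?thesis using e1[OF prodb[OF X Y]] e2[OF prodb[OF X Y]]
      by (simp add: M0.emeasure_eq_measure ennreal_mult)
  qed
  have eq: "\<nu>1 = \<nu>2"
  proof (rule measure_eqI_generator_eq)
    let ?E = "{X \<times> Y |X Y. X \<in> sets (borel :: (real^'n) measure) \<and> Y \<in> sets (borel :: real measure)}"
    show "Int_stable ?E"
    proof (rule Int_stableI)
      fix S T assume "S \<in> ?E" "T \<in> ?E"
      then obtain X Y X' Y' where "S = X \<times> Y" "T = X' \<times> Y'" "X \<in> sets borel" "Y \<in> sets borel" "X' \<in> sets borel" "Y' \<in> sets borel"
        by auto
      moreover have "(X \<times> Y) \<inter> (X' \<times> Y') = (X \<inter> X') \<times> (Y \<inter> Y')" by auto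
      ultimately show "S \<inter> T \<in> ?E"
        by (intro CollectI exI[of _ "X \<inter> X'"] exI[of _ "Y \<inter> Y'"]) auto
    qed
    show "?E \<subseteq> Pow UNIV" by simp
    have g: "sets (borel :: ((real^'n) \<times> real) measure) = sigma_sets UNIV ?E"
      unfolding borel_prod[symmetric] sets_pair_measure by simp
    show "sets \<nu>1 = sigma_sets UNIV ?E" "sets \<nu>2 = sigma_sets UNIV ?E" unfolding g[symmetric] \<nu>1_def \<nu>2_def by simp_all
    show "range (\<lambda>n::nat. UNIV) \<subseteq> ?E"
      by (auto intro!: exI[of _ UNIV])
    show "(\<Union>n::nat. UNIV) = UNIV" by simp
    show "emeasure \<nu>1 UNIV \<noteq> \<infinity>" using e1[of UNIV] M0.emeasure_finite by simp
    show "emeasure \<nu>1 S = emeasure \<nu>2 S" if "S \<in> ?E" for S using that rect by auto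
  qed
  have "emeasure (distr \<mu>0 borel fst) A = emeasure \<mu>0 (A \<times> UNIV)"
    using A mf by (subst emeasure_distr) (auto intro!: arg_cong[where f = "emeasure \<mu>0"])
  moreover have "emeasure (distr \<mu>0 borel snd) B = emeasure \<mu>0 (UNIV \<times> B)"
    using B ms by (subst emeasure_distr) (auto intro!: arg_cong[where f = "emeasure \<mu>0"])
  ultimately show "emeasure (distr \<mu>0 borel fst) A * emeasure (distr \<mu>0 borel snd) B = emeasure \<mu>0 (A \<times> B)"
    using e1[OF B] e2[OF B] eq by simp
qed

text \<open>The function \<open>u\<close> is a truncation that changes the output weight only on a
  null set. Independence factors out its mean, so any truncation of the remaining parameters,
  absorbed in \<open>m\<close>, keeps the product centred.\<close>

lemma centered_output_weight:
  fixes u :: "real \<Rightarrow> real" and m :: "(real^'n) \<times> real \<Rightarrow> real"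
  assumes u: "u \<in> borel_measurable borel" "AE \<theta> in \<mu>0. u (fst \<theta>) = fst \<theta>"
    and m: "m \<in> borel_measurable borel" and i: "integrable \<mu>0 (\<lambda>\<theta>. u (fst \<theta>) * m (snd \<theta>))"
  shows "(LINT \<theta>|\<mu>0. u (fst \<theta>) * m (snd \<theta>)) = 0"
proof -
  have mf: "fst \<in> measurable \<mu>0 borel" and ms: "snd \<in> measurable \<mu>0 borel"
    unfolding measurable_\<mu>0 by (auto intro!: borel_measurable_continuous_onI continuous_intros)
  let ?C = "distr \<mu>0 borel fst" and ?Z = "distr \<mu>0 borel snd"
  interpret C: prob_space ?C by (rule M0.prob_space_distr[OF mf])
  interpret Z: prob_space ?Z by (rule M0.prob_space_distr[OF ms])
  interpret CZ: pair_sigma_finite ?C ?Z by unfold_locales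
  have "(LINT \<theta>|\<mu>0. u (fst \<theta>) * m (snd \<theta>)) = (LINT \<theta>|(?C \<Otimes>\<^sub>M ?Z). u (fst \<theta>) * m (snd \<theta>))"
    by (simp add: law_product)
  also have "\<dots> = (LINT s|?C. (LINT z|?Z. u (fst (s, z)) * m (snd (s, z))))"
    by (rule CZ.integral_fst'[symmetric]) (use i law_product in simp)
  also have "\<dots> = (LINT s|?C. u s) * (LINT z|?Z. m z)" by simp
  also have "(LINT s|?C. u s) = (LINT \<theta>|\<mu>0. u (fst \<theta>))" using mf u(1) by (intro integral_distr) auto
  also have "\<dots> = (LINT \<theta>|\<mu>0. fst \<theta>)"
    using u mf by (intro integral_cong_AE measurable_compose[OF mf]) auto
  also have "\<dots> = 0" using init by (simp add: initial_law_def)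
  finally show ?thesis by simp
qed

end

section \<open>A uniform law of large numbers\<close>

definition dense_seq :: "nat \<Rightarrow> 'a::second_countable_topology" where
  "dense_seq = from_nat_into (SOME D. countable D \<and> (\<forall>X. open X \<longrightarrow> X \<noteq> {} \<longrightarrow> (\<exists>d\<in>D. d \<in> X)))"

lemma dense_seq:
  fixes X :: "'a::second_countable_topology set"
  assumes "open X" "X \<noteq> {}"
  shows "\<exists>k. dense_seq k \<in> X"
proof -
  let ?P = "\<lambda>D::'a set. countable D \<and> (\<forall>X. open X \<longrightarrow> X \<noteq> {} \<longrightarrow> (\<exists>d\<in>D. d \<in> X))"
  have "\<exists>D. ?P D" using countable_dense_exists by blast
  then have D: "?P (SOME D. ?P D)" by (rule someI_ex)
  then obtain d where d: "d \<in> (SOME D. ?P D)" "d \<in> X" using assms by blast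
  have "(SOME D. ?P D) \<noteq> {}" using d by blast
  then have "range (dense_seq :: nat \<Rightarrow> 'a) = (SOME D. ?P D)"
    unfolding dense_seq_def using D by (intro range_from_nat_into) auto
  then show ?thesis using d by (metis rangeE)
qed

text \<open>Balls of radius \<open>1 / real (Suc m)\<close> about a dense sequence, made disjoint: a
  countable Borel partition with pieces of small diameter.\<close>

definition cell :: "nat \<Rightarrow> nat \<Rightarrow> 'a::{metric_space, second_countable_topology} set" where
  "cell m k = ball (dense_seq k) (1 / real (Suc m)) - (\<Union>l<k. ball (dense_seq l) (1 / real (Suc m)))"

lemma cell_disjoint: "x \<in> cell m k \<Longrightarrow> x \<in> cell m l \<Longrightarrow> k = l"
  unfolding cell_def by (cases k l rule: linorder_cases) auto

lemma cell_cover: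
  fixes C :: "'a::{metric_space, second_countable_topology} set"
  assumes "compact C"
  obtains L where "C \<subseteq> (\<Union>k<L. cell m k)"
proof -
  have "C \<subseteq> (\<Union>k\<in>UNIV. ball (dense_seq k) (1 / real (Suc m)))"
  proof
    fix x :: 'a
    obtain k where "dense_seq k \<in> ball x (1 / real (Suc m))" using dense_seq[of "ball x (1 / real (Suc m))"] by auto
    then show "x \<in> (\<Union>k\<in>UNIV. ball (dense_seq k) (1 / real (Suc m)))" by (auto simp: dist_commute)
  qed
  from compactE_image[OF assms open_ball this] obtain F where F: "finite F" "C \<subseteq> (\<Union>k\<in>F. ball (dense_seq k) (1 / real (Suc m)))"
    by metis
  obtain L where L: "F \<subseteq> {..<L}" using F(1) finite_nat_iff_bounded by blast
  have "C \<subseteq> (\<Union>k<L. cell m k)"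
  proof
    fix x assume "x \<in> C"
    then obtain k where k: "k \<in> F" "x \<in> ball (dense_seq k) (1 / real (Suc m))" using F by blast
    \<comment> \<open>The least index of a ball containing \<open>x\<close> is the index of its
      cell; it cannot exceed an index from the finite subcover.\<close>
    define k0 where "k0 = (LEAST k. x \<in> ball (dense_seq k) (1 / real (Suc m)))"
    have "x \<in> ball (dense_seq k0) (1 / real (Suc m))" unfolding k0_def using k(2) by (rule LeastI)
    moreover have "x \<notin> ball (dense_seq l) (1 / real (Suc m))" if "l < k0" for l
      using not_less_Least[OF that[unfolded k0_def]] .
    ultimately have "x \<in> cell m k0" by (auto simp: cell_def)
    moreover have "k0 \<le> k" unfolding k0_def using k(2) by (rule Least_le)
    then have "k0 < L" using k L by auto
    ultimately show "x \<in> (\<Union>k<L. cell m k)" by blast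
  qed
  then show ?thesis by (rule that)
qed

lemma cell_borel: "cell m k \<in> sets borel" unfolding cell_def by auto

lemma njet_bound:
  assumes "Ckb_on 3 UNIV \<sigma>"
  shows "\<exists>C>0. (\<forall>(\<theta>::'n::finite param) x. norm (njet \<sigma> \<theta> x) \<le> C * growth \<theta>) \<and>
    (\<forall>(\<theta>::'n param) x y. norm (njet \<sigma> \<theta> x - njet \<sigma> \<theta> y) \<le> C * (growth \<theta>)\<^sup>2 * norm (x - y))"
  by (rule fjet_bound[OF assms order_refl]) blast

section \<open>Typical samples and the uniform law\<close>

context iid_params
begin

definition avg :: "(nat \<Rightarrow> 'n param) \<Rightarrow> nat \<Rightarrow> ('n param \<Rightarrow> real) \<Rightarrow> real" where
  "avg \<xi> N h = (\<Sum>i<N. h (\<xi> i)) / real N"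

text \<open>All randomness is confined to these countably many conditions. For a sample satisfying
  them the uniform law is deterministic, so it can treat uncountable families and perturbed
  parameters.\<close>

definition typical :: "(nat \<Rightarrow> 'n param) \<Rightarrow> bool" where
  "typical \<xi> \<longleftrightarrow>
     (\<forall>m k K. (\<lambda>N. avg \<xi> N (indicator (cell m k \<inter> cball 0 (real K)))) \<longlonglongrightarrow> measure \<mu>0 (cell m k \<inter> cball 0 (real K))) \<and>
     (\<forall>K. (\<lambda>N. avg \<xi> N (indicator (- cball 0 (real K)))) \<longlonglongrightarrow> measure \<mu>0 (- cball 0 (real K))) \<and>
     (\<exists>B. \<forall>\<^sub>F N in sequentially. avg \<xi> N (\<lambda>\<theta>. growth \<theta> ^ 4) \<le> B)"

lemma AE_typical: "AE \<omega> in P. typical (\<lambda>i. \<theta>0 i \<omega>)"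
proof -
  have 1: "AE \<omega> in P. \<forall>m k K. (\<lambda>N. avg (\<lambda>i. \<theta>0 i \<omega>) N (indicator (cell m k \<inter> cball 0 (real K)))) \<longlonglongrightarrow> measure \<mu>0 (cell m k \<inter> cball 0 (real K))"
    unfolding AE_all_countable avg_def by (intro allI indicator_average sets.Int cell_borel) auto
  have 2: "AE \<omega> in P. \<forall>K. (\<lambda>N. avg (\<lambda>i. \<theta>0 i \<omega>) N (indicator (- cball 0 (real K)))) \<longlonglongrightarrow> measure \<mu>0 (- cball 0 (real K))"
    unfolding AE_all_countable avg_def by (intro allI indicator_average) auto
  show ?thesis using 1 2 average_growth_bounded unfolding typical_def avg_def by eventually_elim blast
qed

lemma measure_tail_tendsto: "(\<lambda>K. measure \<mu>0 (- cball 0 (real K))) \<longlonglongrightarrow> 0"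
proof -
  have "(\<lambda>K. measure \<mu>0 (- cball 0 (real K))) \<longlonglongrightarrow> measure \<mu>0 (\<Inter>K. - cball 0 (real K))"
  proof (rule M0.finite_Lim_measure_decseq)
    have "- cball 0 (real n) \<subseteq> (- cball 0 (real m) :: 'n param set)" if "m \<le> n" for m n
      using that by (intro Compl_anti_mono subset_cball) simp
    then show "decseq (\<lambda>K. - cball 0 (real K) :: 'n param set)" unfolding decseq_def by blast
  qed (auto simp: sets_\<mu>0)
  moreover have "(\<Inter>K. - cball 0 (real K)) = ({} :: 'n param set)"
  proof -
    have "\<theta> \<notin> (\<Inter>K. - cball 0 (real K))" for \<theta> :: "'n param"
    proof
      assume a: "\<theta> \<in> (\<Inter>K. - cball 0 (real K))"
      obtain K where K: "norm \<theta> \<le> real K" using real_arch_simple by blast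
      have "\<theta> \<in> - cball 0 (real K)" using a by blast
      then show False using K by simp
    qed
    then show ?thesis by blast
  qed
  ultimately show ?thesis by simp
qed

text \<open>Small cells partition a large ball, so by equicontinuity the empirical frequencies of countably
  many cells control the averages over the whole family; outside the ball the fourth moment of the
  growth does.\<close>

lemma uniform_law:
  fixes \<H> :: "('n param \<Rightarrow> 'b::euclidean_space) set"
  assumes tp: "typical \<xi>" and M: "M \<ge> 0"
    and m: "\<And>H. H \<in> \<H> \<Longrightarrow> H \<in> borel_measurable borel"
    and b: "\<And>H \<theta>. H \<in> \<H> \<Longrightarrow> norm (H \<theta>) \<le> M * growth \<theta> ^ 2"
    and eq: "\<And>K \<epsilon>. \<epsilon> > 0 \<Longrightarrow> \<exists>\<delta>>0. \<forall>H\<in>\<H>. \<forall>\<theta> \<theta>'. norm \<theta> \<le> K \<longrightarrow> norm \<theta>' \<le> K \<longrightarrow> norm (\<theta>' - \<theta>) < \<delta> \<longrightarrow> norm (H \<theta>' - H \<theta>) \<le> \<epsilon>"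
    and \<epsilon>: "\<epsilon> > 0"
  shows "\<exists>\<delta>>0. \<forall>\<^sub>F N in sequentially. \<forall>H\<in>\<H>. \<forall>\<xi>'. (\<forall>i<N. norm (\<xi>' i - \<xi> i) \<le> \<delta>) \<longrightarrow>
     norm ((1 / real N) *\<^sub>R (\<Sum>i<N. H (\<xi>' i)) - (LINT \<theta>|\<mu>0. H \<theta>)) \<le> \<epsilon>"
proof -
  \<comment> \<open>The denominator collects the final decomposition: four errors \<open>e\<close>,
    and \<open>195 + 3 + 2\<close> multiples of \<open>M * e\<close>.\<close>
  define e where "e = \<epsilon> / (4 + 200 * M)"
  have e: "e > 0" using \<epsilon> M by (simp add: e_def add_pos_nonneg)
  note g4 = growth_power_integrable[OF init, of 4] and g2 = growth_power_integrable[OF init, of 2]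
  obtain B0 where B0: "\<forall>\<^sub>F N in sequentially. avg \<xi> N (\<lambda>\<theta>. growth \<theta> ^ 4) \<le> B0" using tp by (auto simp: typical_def)
  define B where "B = max 1 (max B0 (LINT \<theta>|\<mu>0. growth \<theta> ^ 4))"
  have B: "B > 0" "B0 \<le> B" "(LINT \<theta>|\<mu>0. growth \<theta> ^ 4) \<le> B" by (auto simp: B_def)
  \<comment> \<open>The tail uses g^2 <= \<tau> g^4 + 1/(4 \<tau>), where g is the growth; this
    \<tau> makes the first term integrate to at most \<open>e\<close>.\<close>
  define \<tau> where "\<tau> = e / B"
  have \<tau>: "\<tau> > 0" "\<tau> * B = e" using e B by (auto simp: \<tau>_def)
  \<comment> \<open>With this tail mass the second term, 1/(4 \<tau>) times the mass, is at most
    \<open>e\<close> as well.\<close>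
  obtain K :: nat where K: "measure \<mu>0 (- cball 0 (real K)) \<le> 4 * \<tau> * e"
  proof -
    have "\<forall>\<^sub>F K in sequentially. measure \<mu>0 (- cball 0 (real K)) < 4 * \<tau> * e"
      using \<tau> e by (intro order_tendstoD(2)[OF measure_tail_tendsto]) auto
    then show ?thesis using that by (auto simp: eventually_sequentially intro: less_imp_le)
  qed
  define t where "t = (\<lambda>\<theta>::'n param. growth \<theta> ^ 2 * indicator (- cball 0 (real K)) \<theta>)"
  have tpt: "t \<theta> \<le> \<tau> * growth \<theta> ^ 4 + (1 / (4 * \<tau>)) * indicator (- cball 0 (real K)) \<theta>" for \<theta>
  proof -
    have "growth \<theta> ^ 2 \<le> \<tau> * growth \<theta> ^ 4 + 1 / (4 * \<tau>)"
    proof -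
      have "0 \<le> \<tau> * (growth \<theta> ^ 2 - 1 / (2 * \<tau>))\<^sup>2" using \<tau> by simp
      also have "\<dots> = \<tau> * growth \<theta> ^ 4 - growth \<theta> ^ 2 + 1 / (4 * \<tau>)"
        using \<tau>(1) by (simp add: power2_eq_square field_simps power4_eq_xxxx)
      finally show ?thesis by simp
    qed
    moreover have "0 \<le> \<tau> * growth \<theta> ^ 4" using \<tau> growth_ge_1[of \<theta>] by simp
    ultimately show ?thesis by (auto simp: t_def split: split_indicator)
  qed
  have t0: "t \<theta> \<ge> 0" for \<theta> by (simp add: t_def)
  have tm: "t \<in> borel_measurable borel" unfolding t_def using growth_measurable[of 2] by auto
  have ti: "integrable \<mu>0 t"
    by (rule integrable_norm_bound[OF g2]) (use tm in \<open>auto simp: measurable_\<mu>0 t_def split: split_indicator\<close>)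
  have ii: "integrable \<mu>0 (indicator A :: _ \<Rightarrow> real)" if "A \<in> sets borel" for A
    using that by (intro integrable_real_indicator) (auto simp: sets_\<mu>0 M0.emeasure_eq_measure)
  have it: "(LINT \<theta>|\<mu>0. t \<theta>) \<le> 2 * e"
  proof -
    have "(LINT \<theta>|\<mu>0. t \<theta>) \<le> (LINT \<theta>|\<mu>0. \<tau> * growth \<theta> ^ 4 + (1 / (4 * \<tau>)) * indicator (- cball 0 (real K)) \<theta>)"
      using ti g4 ii[of "- cball 0 (real K)"] tpt
      by (intro integral_mono Bochner_Integration.integrable_add integrable_mult_right) auto
    also have "\<dots> = \<tau> * (LINT \<theta>|\<mu>0. growth \<theta> ^ 4) + (1 / (4 * \<tau>)) * measure \<mu>0 (- cball 0 (real K))"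
      using g4 ii[of "- cball 0 (real K)"] by (simp add: sets_\<mu>0)
    also have "\<dots> \<le> \<tau> * B + (1 / (4 * \<tau>)) * (4 * \<tau> * e)"
      using B \<tau>(1) K by (intro add_mono mult_left_mono) auto
    also have "\<dots> = 2 * e" using \<tau> by simp
    finally show ?thesis .
  qed
  have avg_mono: "avg \<xi> N u \<le> avg \<xi> N v" if "\<And>\<theta>. u \<theta> \<le> v \<theta>" for N u v
    unfolding avg_def by (intro divide_right_mono sum_mono that) auto
  have avg_lin: "avg \<xi> N (\<lambda>\<theta>. r * u \<theta> + s * v \<theta>) = r * avg \<xi> N u + s * avg \<xi> N v" for N r s u v
    by (simp add: avg_def sum.distrib sum_distrib_left add_divide_distrib)
  have evt: "\<forall>\<^sub>F N in sequentially. avg \<xi> N t \<le> 3 * e"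
  proof -
    \<comment> \<open>Empirical tail frequencies may exceed their limit, so twice its bound is
      allowed; the empirical tail is then \<open>e + 2 * e\<close>.\<close>
    have "\<forall>\<^sub>F N in sequentially. avg \<xi> N (indicator (- cball 0 (real K))) < 8 * \<tau> * e"
    proof (rule order_tendstoD(2))
      show "(\<lambda>N. avg \<xi> N (indicator (- cball 0 (real K)))) \<longlonglongrightarrow> measure \<mu>0 (- cball 0 (real K))"
        using tp by (simp add: typical_def)
      have "4 * \<tau> * e < 8 * \<tau> * e" using \<tau> e by simp
      then show "measure \<mu>0 (- cball 0 (real K)) < 8 * \<tau> * e" using K by linarith
    qed
    with B0 show ?thesis
    proof eventually_elim
      fix N
      assume a: "avg \<xi> N (\<lambda>\<theta>. growth \<theta> ^ 4) \<le> B0" and c: "avg \<xi> N (indicator (- cball 0 (real K))) < 8 * \<tau> * e"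
      have "avg \<xi> N t \<le> \<tau> * avg \<xi> N (\<lambda>\<theta>. growth \<theta> ^ 4) + (1 / (4 * \<tau>)) * avg \<xi> N (indicator (- cball 0 (real K)))"
        unfolding avg_lin[symmetric] by (rule avg_mono[OF tpt])
      also have "\<dots> \<le> \<tau> * B + (1 / (4 * \<tau>)) * (8 * \<tau> * e)"
        using a c B \<tau>(1) by (intro add_mono mult_left_mono) auto
      also have "\<dots> = 3 * e" using \<tau> by simp
      finally show "avg \<xi> N t \<le> 3 * e" .
    qed
  qed
  \<comment> \<open>The radius \<open>K + 1\<close> leaves room for perturbed parameters, which may
    leave the ball of radius \<open>K\<close> by at most 1.\<close>
  obtain d where d: "d > 0" "\<And>H \<theta> \<theta>'. H \<in> \<H> \<Longrightarrow> norm \<theta> \<le> real K + 1 \<Longrightarrow> norm \<theta>' \<le> real K + 1 \<Longrightarrow> norm (\<theta>' - \<theta>) < d \<Longrightarrow> norm (H \<theta>' - H \<theta>) \<le> e"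
    using eq[OF e, of "real K + 1"] by blast
  obtain l :: nat where l: "1 / real (Suc l) < d / 2" using nat_approx_posE[of "d / 2"] d(1) by auto
  obtain L where L: "cball (0::'n param) (real K) \<subseteq> (\<Union>k<L. cell l k)" using cell_cover[OF compact_cball] by blast
  define C where "C = (\<lambda>k. cell l k \<inter> cball (0::'n param) (real K))"
  \<comment> \<open>A representative of each cell, arbitrary if the cell is empty; then the
    indicator of the cell vanishes anyway.\<close>
  define r where "r = (\<lambda>k. SOME \<theta>. \<theta> \<in> C k)"
  have r: "r k \<in> C k" if "\<theta> \<in> C k" for k \<theta> unfolding r_def using that by (rule someI)
  have Cb: "C k \<in> sets borel" for k unfolding C_def by (intro sets.Int cell_borel) auto
  have Cdist: "norm (\<theta> - \<theta>') < d" if "\<theta> \<in> C k" "\<theta>' \<in> C k" for \<theta> \<theta>' k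
  proof -
    have "dist (dense_seq k) \<theta> < 1 / real (Suc l)" "dist (dense_seq k) \<theta>' < 1 / real (Suc l)"
      using that by (auto simp: C_def cell_def)
    then have "dist \<theta> \<theta>' < d" using l dist_triangle3[of \<theta> \<theta>' "dense_seq k"] by linarith
    then show ?thesis by (simp add: dist_norm)
  qed
  \<comment> \<open>A step function, constant on the cells and zero outside the ball. Its averages
    depend on the sample only through finitely many cell frequencies.\<close>
  define A where "A = (\<lambda>H \<theta>. \<Sum>k<L. indicator (C k) \<theta> *\<^sub>R (H (r k) :: 'b))"
  have HA: "norm (H \<theta> - A H \<theta>) \<le> e + M * t \<theta>" if H: "H \<in> \<H>" for H \<theta>
  proof (cases "norm \<theta> \<le> real K")
    case True
    then obtain k where k: "k < L" "\<theta> \<in> C k" using L by (auto simp: C_def)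
    have "A H \<theta> = (\<Sum>j\<in>{k}. indicator (C j) \<theta> *\<^sub>R H (r j))" unfolding A_def
      using k cell_disjoint[of \<theta> l k] by (intro sum.mono_neutral_right) (auto simp: C_def split: split_indicator)
    then have "A H \<theta> = H (r k)" using k by simp
    moreover have "norm (H \<theta> - H (r k)) \<le> e"
      using d(2)[OF H, of "r k" \<theta>] Cdist[OF k(2) r[OF k(2)]] r[OF k(2)] True by (auto simp: C_def)
    ultimately show ?thesis using M t0[of \<theta>] by (simp add: add_increasing2)
  next
    case False
    then have "A H \<theta> = 0" "t \<theta> = growth \<theta> ^ 2" by (auto simp: A_def t_def C_def intro!: sum.neutral)
    then show ?thesis using b[OF H, of \<theta>] e by simp
  qed
  have Ai: "integrable \<mu>0 (A H)" for H
    unfolding A_def by (intro Bochner_Integration.integrable_sum integrable_scaleR_left ii Cb)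
  have AI: "(LINT \<theta>|\<mu>0. A H \<theta>) = (\<Sum>k<L. measure \<mu>0 (C k) *\<^sub>R H (r k))" for H
  proof -
    have "(LINT \<theta>|\<mu>0. A H \<theta>) = (\<Sum>k<L. (LINT \<theta>|\<mu>0. indicator (C k) \<theta> *\<^sub>R H (r k)))"
      unfolding A_def by (intro Bochner_Integration.integral_sum integrable_scaleR_left ii Cb)
    also have "\<dots> = (\<Sum>k<L. measure \<mu>0 (C k) *\<^sub>R H (r k))"
    proof (rule sum.cong)
      fix k
      have "(LINT \<theta>|\<mu>0. indicator (C k) \<theta> *\<^sub>R H (r k)) = (LINT \<theta>|\<mu>0. indicator (C k) \<theta>) *\<^sub>R H (r k)"
        by (rule integral_scaleR_left) (rule ii[OF Cb])
      then show "(LINT \<theta>|\<mu>0. indicator (C k) \<theta> *\<^sub>R H (r k)) = measure \<mu>0 (C k) *\<^sub>R H (r k)"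
        using Cb[of k] by (simp add: sets_\<mu>0)
    qed simp
    finally show ?thesis .
  qed
  have Hi: "integrable \<mu>0 H" if H: "H \<in> \<H>" for H
    by (rule integrable_norm_bound[of _ "\<lambda>\<theta>. M * growth \<theta> ^ 2"]) (use g2 m[OF H] b[OF H] in \<open>auto simp: measurable_\<mu>0\<close>)
  have evC: "\<forall>\<^sub>F N in sequentially. (\<Sum>k<L. \<bar>avg \<xi> N (indicator (C k)) - measure \<mu>0 (C k)\<bar> * (M * growth (r k) ^ 2)) \<le> e"
  proof -
    have "(\<lambda>N. \<Sum>k<L. \<bar>avg \<xi> N (indicator (C k)) - measure \<mu>0 (C k)\<bar> * (M * growth (r k) ^ 2))
        \<longlonglongrightarrow> (\<Sum>k<L. \<bar>measure \<mu>0 (C k) - measure \<mu>0 (C k)\<bar> * (M * growth (r k) ^ 2))"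
      using tp unfolding typical_def C_def by (intro tendsto_intros) auto
    then have "\<forall>\<^sub>F N in sequentially. (\<Sum>k<L. \<bar>avg \<xi> N (indicator (C k)) - measure \<mu>0 (C k)\<bar> * (M * growth (r k) ^ 2)) < e"
      using e by (intro order_tendstoD(2)) auto
    then show ?thesis by (auto elim: eventually_mono)
  qed
  define \<delta> where "\<delta> = min 1 (d / 2)"
  show ?thesis
  proof (intro exI[of _ \<delta>] conjI)
    show "\<delta> > 0" using d by (simp add: \<delta>_def)
    show "\<forall>\<^sub>F N in sequentially. \<forall>H\<in>\<H>. \<forall>\<xi>'. (\<forall>i<N. norm (\<xi>' i - \<xi> i) \<le> \<delta>) \<longrightarrow>
       norm ((1 / real N) *\<^sub>R (\<Sum>i<N. H (\<xi>' i)) - (LINT \<theta>|\<mu>0. H \<theta>)) \<le> \<epsilon>"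
      using evt evC eventually_ge_at_top[of 1]
    proof eventually_elim
      fix N :: nat
      assume at: "avg \<xi> N t \<le> 3 * e" and aC: "(\<Sum>k<L. \<bar>avg \<xi> N (indicator (C k)) - measure \<mu>0 (C k)\<bar> * (M * growth (r k) ^ 2)) \<le> e"
        and N: "1 \<le> N"
      show "\<forall>H\<in>\<H>. \<forall>\<xi>'. (\<forall>i<N. norm (\<xi>' i - \<xi> i) \<le> \<delta>) \<longrightarrow>
       norm ((1 / real N) *\<^sub>R (\<Sum>i<N. H (\<xi>' i)) - (LINT \<theta>|\<mu>0. H \<theta>)) \<le> \<epsilon>"
      proof (intro ballI allI impI)
        fix H \<xi>' assume H: "H \<in> \<H>" and p: "\<forall>i<N. norm (\<xi>' i - \<xi> i) \<le> \<delta>"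
        have nrm: "norm ((1 / real N) *\<^sub>R (\<Sum>i<N. u i)) \<le> avg \<xi> N v" if "\<And>i. i < N \<Longrightarrow> norm (u i) \<le> v (\<xi> i)" for u :: "nat \<Rightarrow> 'b" and v
        proof -
          have "norm (\<Sum>i<N. u i) \<le> (\<Sum>i<N. v (\<xi> i))" by (rule sum_norm_le) (use that in auto)
          then show ?thesis using N by (simp add: avg_def divide_right_mono)
        qed
        \<comment> \<open>Outside the ball the two values are bounded separately: the perturbed one
          by \<open>8\<^sup>2 = 64\<close> times the unperturbed bound, hence 65 in total.\<close>
        have "norm ((1 / real N) *\<^sub>R (\<Sum>i<N. H (\<xi>' i) - H (\<xi> i))) \<le> avg \<xi> N (\<lambda>\<theta>. e * 1 + (65 * M) * t \<theta>)"
        proof (rule nrm)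
          fix i assume i: "i < N"
          have d1: "norm (\<xi>' i - \<xi> i) \<le> 1" "norm (\<xi>' i - \<xi> i) < d" using p i d(1) by (auto simp: \<delta>_def)
          show "norm (H (\<xi>' i) - H (\<xi> i)) \<le> e * 1 + (65 * M) * t (\<xi> i)"
          proof (cases "norm (\<xi> i) \<le> real K")
            case True
            have "norm (\<xi>' i) \<le> real K + 1" using True d1(1) norm_triangle_ineq2[of "\<xi>' i" "\<xi> i"] by linarith
            then have "norm (H (\<xi>' i) - H (\<xi> i)) \<le> e" using d(2)[OF H, of "\<xi> i" "\<xi>' i"] True d1(2) by simp
            then show ?thesis using M t0[of "\<xi> i"] by (simp add: add_increasing2)
          next
            case False
            have "growth (\<xi>' i) ^ 2 \<le> (8 * growth (\<xi> i)) ^ 2"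
              using growth_perturb[OF d1(1)] growth_ge_1[of "\<xi>' i"] by (intro power_mono) auto
            then have "M * growth (\<xi>' i) ^ 2 \<le> M * (64 * growth (\<xi> i) ^ 2)" using M by (intro mult_left_mono) (auto simp: power_mult_distrib)
            moreover have "norm (H (\<xi>' i) - H (\<xi> i)) \<le> M * growth (\<xi>' i) ^ 2 + M * growth (\<xi> i) ^ 2"
              by (rule order_trans[OF norm_triangle_ineq4 add_mono[OF b[OF H] b[OF H]]])
            moreover have "t (\<xi> i) = growth (\<xi> i) ^ 2" using False by (simp add: t_def)
            ultimately show ?thesis using e by simp
          qed
        qed
        also have "\<dots> = e * avg \<xi> N (\<lambda>_. 1) + (65 * M) * avg \<xi> N t" by (rule avg_lin)
        also have "\<dots> \<le> e + (65 * M) * (3 * e)" using N at M by (intro add_mono mult_left_mono) (auto simp: avg_def)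
        finally have S1: "norm ((1 / real N) *\<^sub>R (\<Sum>i<N. H (\<xi>' i) - H (\<xi> i))) \<le> e + 195 * M * e" by simp
        have "norm ((1 / real N) *\<^sub>R (\<Sum>i<N. H (\<xi> i) - A H (\<xi> i))) \<le> avg \<xi> N (\<lambda>\<theta>. e * 1 + M * t \<theta>)"
          by (rule nrm) (use HA[OF H] in simp)
        also have "\<dots> = e * avg \<xi> N (\<lambda>_. 1) + M * avg \<xi> N t" by (rule avg_lin)
        also have "\<dots> \<le> e + M * (3 * e)" using N at M by (intro add_mono mult_left_mono) (auto simp: avg_def)
        finally have S2: "norm ((1 / real N) *\<^sub>R (\<Sum>i<N. H (\<xi> i) - A H (\<xi> i))) \<le> e + 3 * M * e" by simp
        have "(1 / real N) *\<^sub>R (\<Sum>i<N. A H (\<xi> i)) = (\<Sum>k<L. avg \<xi> N (indicator (C k)) *\<^sub>R H (r k))"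
          unfolding A_def avg_def by (subst sum.swap) (simp add: scaleR_sum_right scaleR_sum_left[symmetric] sum_divide_distrib[symmetric])
        then have "(1 / real N) *\<^sub>R (\<Sum>i<N. A H (\<xi> i)) - (LINT \<theta>|\<mu>0. A H \<theta>) = (\<Sum>k<L. (avg \<xi> N (indicator (C k)) - measure \<mu>0 (C k)) *\<^sub>R H (r k))"
          by (simp add: AI sum_subtractf scaleR_left_diff_distrib)
        also have "norm \<dots> \<le> (\<Sum>k<L. \<bar>avg \<xi> N (indicator (C k)) - measure \<mu>0 (C k)\<bar> * (M * growth (r k) ^ 2))"
          by (rule sum_norm_le) (unfold norm_scaleR, intro mult_left_mono b[OF H] abs_ge_zero)
        finally have S3: "norm ((1 / real N) *\<^sub>R (\<Sum>i<N. A H (\<xi> i)) - (LINT \<theta>|\<mu>0. A H \<theta>)) \<le> e" using aC by linarith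
        have "norm (LINT \<theta>|\<mu>0. A H \<theta> - H \<theta>) \<le> (LINT \<theta>|\<mu>0. e + M * t \<theta>)"
          by (rule lint_norm_bound) (use Ai Hi[OF H] ti HA[OF H] in \<open>auto simp: norm_minus_commute\<close>)
        also have "\<dots> = e + M * (LINT \<theta>|\<mu>0. t \<theta>)" using ti M0.prob_space by simp
        also have "\<dots> \<le> e + M * (2 * e)" using it M by (intro add_left_mono mult_left_mono)
        finally have S4: "norm ((LINT \<theta>|\<mu>0. A H \<theta>) - (LINT \<theta>|\<mu>0. H \<theta>)) \<le> e + 2 * M * e" using Ai Hi[OF H] by simp
        \<comment> \<open>Four errors: moving the parameters, discretising the empirical average,
          frequencies against probabilities, and discretising the limit.\<close>
        have "(1 / real N) *\<^sub>R (\<Sum>i<N. H (\<xi>' i)) - (LINT \<theta>|\<mu>0. H \<theta>) =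
           (1 / real N) *\<^sub>R (\<Sum>i<N. H (\<xi>' i) - H (\<xi> i)) + (1 / real N) *\<^sub>R (\<Sum>i<N. H (\<xi> i) - A H (\<xi> i))
           + ((1 / real N) *\<^sub>R (\<Sum>i<N. A H (\<xi> i)) - (LINT \<theta>|\<mu>0. A H \<theta>)) + ((LINT \<theta>|\<mu>0. A H \<theta>) - (LINT \<theta>|\<mu>0. H \<theta>))"
          by (simp add: sum_subtractf scaleR_diff_right)
        then have "norm ((1 / real N) *\<^sub>R (\<Sum>i<N. H (\<xi>' i)) - (LINT \<theta>|\<mu>0. H \<theta>))
           \<le> (e + 195 * M * e) + (e + 3 * M * e) + e + (e + 2 * M * e)"
          by (simp only:, intro order_trans[OF norm_triangle_ineq] add_mono S1 S2 S3 S4)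
        also have "\<dots> = (4 + 200 * M) * e" by (simp add: algebra_simps)
        also have "\<dots> = \<epsilon>" using M by (simp add: e_def add_pos_nonneg)
        finally show "norm ((1 / real N) *\<^sub>R (\<Sum>i<N. H (\<xi>' i)) - (LINT \<theta>|\<mu>0. H \<theta>)) \<le> \<epsilon>" .
      qed
    qed
  qed
qed

section \<open>The network at initialisation\<close>

text \<open>Lattice points of mesh 1/N in a cube. Their number is polynomial in N, which the
  stretched exponential tails of the concentration bound outweigh.\<close>

definition grid :: "nat \<Rightarrow> nat \<Rightarrow> (real^'n) set" where
  "grid r N = (\<lambda>k. \<chi> i. of_int (k i) / real N) ` (UNIV \<rightarrow> {- int (r * N) - 1..int (r * N)})"

lemma finite_grid: "finite (grid r N)"
  unfolding grid_def by (intro finite_imageI) (simp add: PiE_UNIV_domain[symmetric] finite_PiE)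

lemma card_grid:
  assumes "N \<ge> 1"
  shows "real (card (grid r N)) \<le> (2 * real r + 2) ^ CARD('n) * real N powr real CARD('n)"
proof -
  have f: "finite (UNIV \<rightarrow> {- int (r * N) - 1..int (r * N)} :: ('n \<Rightarrow> int) set)"
    by (simp add: PiE_UNIV_domain[symmetric] finite_PiE)
  have "card (grid r N) \<le> card (UNIV \<rightarrow> {- int (r * N) - 1..int (r * N)} :: ('n \<Rightarrow> int) set)"
    unfolding grid_def by (rule card_image_le[OF f])
  also have "\<dots> = (2 * r * N + 2) ^ CARD('n)"
    by (simp add: PiE_UNIV_domain[symmetric] card_PiE nat_add_distrib[symmetric] algebra_simps nat_plus_as_int)
  finally have "real (card (grid r N)) \<le> real ((2 * r * N + 2) ^ CARD('n))" by (simp only: of_nat_le_iff)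
  also have "\<dots> = (2 * real r * real N + 2) ^ CARD('n)" by (simp add: add.commute)
  also have "\<dots> \<le> ((2 * real r + 2) * real N) ^ CARD('n)"
    using assms by (intro power_mono) (auto simp: algebra_simps)
  also have "\<dots> = (2 * real r + 2) ^ CARD('n) * real N powr real CARD('n)"
    using assms by (simp add: power_mult_distrib powr_realpow)
  finally show ?thesis .
qed

lemma grid_approx:
  fixes x :: "real^'n"
  assumes N: "N \<ge> 1" and x: "norm x \<le> real r"
  obtains y where "y \<in> grid r N" "norm (x - y) \<le> real CARD('n) / real N"
proof -
  define k where "k = (\<lambda>i. \<lfloor>real N * x $ i\<rfloor>)"
  define y :: "real^'n" where "y = (\<chi> i. of_int (k i) / real N)"
  have "k i \<in> {- int (r * N) - 1..int (r * N)}" for i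
  proof -
    have xi: "\<bar>x $ i\<bar> \<le> real r" using component_le_norm_cart[of x i] x by linarith
    then have "\<bar>real N * x $ i\<bar> \<le> real (r * N)" using N by (simp add: abs_mult mult.commute mult_left_mono)
    then have "- real (r * N) \<le> real N * x $ i" "real N * x $ i \<le> real (r * N)" by linarith+
    then show ?thesis unfolding k_def by (auto simp: floor_le_iff le_floor_iff)
  qed
  then have "y \<in> grid r N" unfolding grid_def y_def by (intro image_eqI[of _ _ k]) auto
  moreover have "norm (x - y) \<le> real CARD('n) / real N"
  proof -
    have "\<bar>(x - y) $ i\<bar> \<le> 1 / real N" for i
    proof -
      have "\<bar>real N * x $ i - of_int (k i)\<bar> \<le> 1" unfolding k_def by linarith
      moreover have "(x - y) $ i = (real N * x $ i - of_int (k i)) / real N" using N by (simp add: y_def field_simps)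
      ultimately show ?thesis using N by (simp add: divide_right_mono)
    qed
    then have "norm (x - y) \<le> (\<Sum>i\<in>(UNIV::'n set). 1 / real N)"
      by (intro order_trans[OF norm_le_l1_cart sum_mono])
    then show ?thesis by simp
  qed
  ultimately show ?thesis by (rule that)
qed

text \<open>Since the output weights are centred and \<open>\<beta> > 1/2\<close>, the sum concentrates at every point of a
  grid of polynomial size, and it is Lipschitz in between.\<close>

lemma initial_jet_uniform:
  assumes s: "Ckb_on 3 UNIV \<sigma>" and \<beta>: "1/2 < \<beta>" and \<rho>: "\<rho> \<ge> 0"
  shows "AE \<omega> in P. \<forall>\<epsilon>>0. \<forall>\<^sub>F N in sequentially. \<forall>x. norm x \<le> \<rho> \<longrightarrow>
     norm ((real N powr (- \<beta>)) *\<^sub>R (\<Sum>i<N. njet \<sigma> (\<theta>0 i \<omega>) x)) \<le> \<epsilon>"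
proof -
  obtain Cn where Cn: "Cn > 0" "\<And>(\<theta>::'n param) x. norm (njet \<sigma> \<theta> x) \<le> Cn * growth \<theta>"
    "\<And>(\<theta>::'n param) x y. norm (njet \<sigma> \<theta> x - njet \<sigma> \<theta> y) \<le> Cn * (growth \<theta>)\<^sup>2 * norm (x - y)"
    using njet_bound[OF s] by blast
  obtain C where C: "C > 0" "AE \<theta> in \<mu>0. \<bar>fst \<theta>\<bar> \<le> C" "AE \<omega> in P. \<forall>i. \<bar>fst (\<theta>0 i \<omega>)\<bar> \<le> C"
    by (rule output_weights_bounded)
  \<comment> \<open>Truncated summands are of size N^(2 \<kappa>), so the concentration exponent 2
    \<beta> - 1 - 4 \<kappa> equals (2 \<beta> - 1)/2, which is positive.\<close>
  define \<kappa> where "\<kappa> = (2 * \<beta> - 1) / 8"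
  have \<kappa>: "\<kappa> > 0" using \<beta> by (simp add: \<kappa>_def)
  obtain r :: nat where r: "\<rho> \<le> real r" using real_arch_simple by blast
  define n where "n = real CARD('n)"
  define dj where "dj = real (card (Basis :: 'n jet set))"
  have n: "n > 0" and dj: "dj > 0"
    unfolding n_def dj_def using of_nat_0_less_iff[THEN iffD2, OF DIM_positive] by (simp, blast)
  define F where "F = (\<lambda>N. grid r N \<times> (Basis :: 'n jet set))"
  \<comment> \<open>Truncation at the almost sure bound does not change the law of the output
    weight, so it stays centred; only the input weights are cut at a growing level.\<close>
  define u where "u = (\<lambda>c::real. if \<bar>c\<bar> \<le> C then c else 0)"
  define m where "m = (\<lambda>N (j :: (real^'n) \<times> 'n jet) (z :: (real^'n) \<times> real).
     if norm (fst z) \<le> real N powr \<kappa> then njet \<sigma> (1, z) (fst j) \<bullet> snd j else 0)"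
  define h where "h = (\<lambda>N j (\<theta>::'n param). if snd j \<in> Basis then u (fst \<theta>) * m N j (snd \<theta>) else 0)"
  \<comment> \<open>The jet of a neuron is linear in its output weight, which gives the product form
    to which independence applies.\<close>
  have scale: "njet \<sigma> \<theta> x = fst \<theta> *\<^sub>R njet \<sigma> (1, snd \<theta>) x" for \<theta> :: "'n param" and x
    by (simp add: njet_def pre_def)
  have um: "u \<in> borel_measurable borel" unfolding u_def by measurable
  have mm: "m N j \<in> borel_measurable borel" for N j
  proof -
    have "continuous_on UNIV (\<lambda>z. njet \<sigma> (1, z) (fst j) \<bullet> snd j)"
      by (intro continuous_on_inner continuous_on_const continuous_on_fjet(2)[OF s, of UNIV "\<lambda>z. (1, z)" "\<lambda>_. fst j"]
            continuous_on_Pair continuous_on_id)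
    then have 1: "(\<lambda>z. njet \<sigma> (1, z) (fst j) \<bullet> snd j) \<in> borel_measurable borel" by (rule borel_measurable_continuous_onI)
    have 2: "{z :: (real^'n) \<times> real. norm (fst z) \<le> real N powr \<kappa>} \<in> sets borel"
      by (intro borel_closed closed_Collect_le continuous_intros)
    show ?thesis unfolding m_def
      by (rule measurable_If[OF 1 measurable_const]) (simp_all only: space_borel UNIV_I simp_thms 2)
  qed
  have mf: "fst \<in> measurable (borel :: 'n param measure) borel" and ms: "snd \<in> measurable (borel :: 'n param measure) borel"
    by (auto intro!: borel_measurable_continuous_onI continuous_intros)
  have hm: "h N j \<in> borel_measurable borel" for N j
    unfolding h_def using measurable_compose[OF mf um] measurable_compose[OF ms mm[of N j]] by auto
  define D where "D = Cn * (1 + C) * 4"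
  have D: "D > 0" using Cn(1) C(1) by (simp add: D_def)
  have hb: "\<bar>h N j \<theta>\<bar> \<le> D * real N powr (2 * \<kappa>)" if N: "N \<ge> 1" for N j \<theta>
  proof (cases "snd j \<in> Basis \<and> \<bar>fst \<theta>\<bar> \<le> C \<and> norm (fst (snd \<theta>)) \<le> real N powr \<kappa>")
    case True
    have N1: "1 \<le> real N powr \<kappa>" using N \<kappa> by (intro ge_one_powr_ge_zero) auto
    have "h N j \<theta> = njet \<sigma> \<theta> (fst j) \<bullet> snd j" using True by (simp add: h_def u_def m_def scale[of \<theta>])
    also have "\<bar>\<dots>\<bar> \<le> norm (njet \<sigma> \<theta> (fst j))" using True Basis_le_norm by blast
    also have "\<dots> \<le> Cn * growth \<theta>" by (rule Cn(2))
    also have "growth \<theta> \<le> (1 + C) * (2 * real N powr \<kappa>) ^ 2"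
      unfolding growth_def using True N1 by (intro mult_mono power_mono) auto
    then have "Cn * growth \<theta> \<le> Cn * ((1 + C) * (2 * real N powr \<kappa>) ^ 2)" using Cn(1) by (intro mult_left_mono) auto
    also have "\<dots> = D * (real N powr \<kappa>) ^ 2" by (simp add: D_def power_mult_distrib)
    also have "(real N powr \<kappa>) ^ 2 = real N powr (2 * \<kappa>)" using N by (simp add: powr_power mult.commute)
    finally show ?thesis .
  next
    case False
    then have "h N j \<theta> = 0" by (auto simp: h_def u_def m_def)
    then show ?thesis using D by simp
  qed
  have hz: "(LINT \<theta>|\<mu>0. h N j \<theta>) = 0" if N: "N \<ge> 1" for N j
  proof (cases "snd j \<in> Basis")
    case True
    have i: "integrable \<mu>0 (h N j)"
      by (rule M0.integrable_const_bound[of _ "D * real N powr (2 * \<kappa>)"]) (use hb[OF N] hm in \<open>auto simp: measurable_\<mu>0\<close>)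
    have eq: "h N j = (\<lambda>\<theta>. u (fst \<theta>) * m N j (snd \<theta>))" using True by (simp add: h_def fun_eq_iff)
    have "AE \<theta> in \<mu>0. u (fst \<theta>) = fst \<theta>" using C(2) by eventually_elim (simp add: u_def)
    from centered_output_weight[OF um this mm i[unfolded eq]] show ?thesis unfolding eq .
  qed (simp add: h_def)
  have "AE \<omega> in P. \<forall>\<^sub>F N in sequentially. \<forall>j\<in>F N.
     \<bar>(\<Sum>i<N. h N j (\<theta>0 i \<omega>)) - real N * (LINT \<theta>|\<mu>0. h N j \<theta>)\<bar> < 1 / real (Suc k) * real N powr \<beta>" for k
  proof (rule concentration[where C = "(2 * real r + 2) ^ CARD('n) * dj" and p = n and D = D and q = "2 * \<kappa>"])
    show "finite (F N)" for N unfolding F_def using finite_grid by auto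
    show "real (card (F N)) \<le> (2 * real r + 2) ^ CARD('n) * dj * real N powr n" if "N \<ge> 1" for N
    proof -
      have "real (card (F N)) = real (card (grid r N)) * dj"
        unfolding F_def dj_def card_cartesian_product by (rule of_nat_mult)
      also have "\<dots> \<le> ((2 * real r + 2) ^ CARD('n) * real N powr real CARD('n)) * dj"
        by (rule mult_right_mono[OF card_grid[OF that] less_imp_le[OF dj]])
      finally show ?thesis by (simp only: n_def mult_ac)
    qed
    show "2 * \<beta> - 1 - 2 * (2 * \<kappa>) > 0" using \<beta> by (simp add: \<kappa>_def)
  qed (use hm hb D in auto)
  then have E1: "AE \<omega> in P. \<forall>k. \<forall>\<^sub>F N in sequentially. \<forall>j\<in>F N.
     \<bar>(\<Sum>i<N. h N j (\<theta>0 i \<omega>)) - real N * (LINT \<theta>|\<mu>0. h N j \<theta>)\<bar> < 1 / real (Suc k) * real N powr \<beta>"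
    by (simp only: AE_all_countable) blast
  have E2: "AE \<omega> in P. \<forall>\<^sub>F N in sequentially. \<forall>i<N. norm (fst (snd (\<theta>0 i \<omega>))) \<le> real N powr \<kappa>"
    by (rule weights_polynomial[OF \<kappa>])
  show ?thesis using E1 E2 C(3) average_growth_bounded
  proof eventually_elim
    fix \<omega>
    assume e1: "\<forall>k. \<forall>\<^sub>F N in sequentially. \<forall>j\<in>F N.
       \<bar>(\<Sum>i<N. h N j (\<theta>0 i \<omega>)) - real N * (LINT \<theta>|\<mu>0. h N j \<theta>)\<bar> < 1 / real (Suc k) * real N powr \<beta>"
      and e2: "\<forall>\<^sub>F N in sequentially. \<forall>i<N. norm (fst (snd (\<theta>0 i \<omega>))) \<le> real N powr \<kappa>"
      and e3: "\<forall>i. \<bar>fst (\<theta>0 i \<omega>)\<bar> \<le> C"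
      and e4: "\<exists>B. \<forall>\<^sub>F N in sequentially. (\<Sum>i<N. growth (\<theta>0 i \<omega>) ^ 4) / real N \<le> B"
    obtain B where B: "\<forall>\<^sub>F N in sequentially. (\<Sum>i<N. growth (\<theta>0 i \<omega>) ^ 4) / real N \<le> B" using e4 by blast
    show "\<forall>\<epsilon>>0. \<forall>\<^sub>F N in sequentially. \<forall>x. norm x \<le> \<rho> \<longrightarrow>
       norm ((real N powr (- \<beta>)) *\<^sub>R (\<Sum>i<N. njet \<sigma> (\<theta>0 i \<omega>) x)) \<le> \<epsilon>"
    proof (intro allI impI)
      fix \<epsilon> :: real assume \<epsilon>: "\<epsilon> > 0"
      then have "\<epsilon> / (2 * dj) > 0" using dj by simp
      then obtain k where k: "1 / real (Suc k) < \<epsilon> / (2 * dj)" using nat_approx_posE by blast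
      have "\<forall>\<^sub>F N in sequentially. Cn * \<bar>B\<bar> * n * real N powr (- \<beta>) < \<epsilon> / 2"
      proof (rule order_tendstoD(2))
        have "(\<lambda>N. real N powr (- \<beta>)) \<longlonglongrightarrow> 0"
          using \<beta> by (intro tendsto_neg_powr filterlim_real_sequentially) auto
        then show "(\<lambda>N. Cn * \<bar>B\<bar> * n * real N powr (- \<beta>)) \<longlonglongrightarrow> 0" by (rule tendsto_mult_right_zero)
      qed (use \<epsilon> in simp)
      with spec[OF e1, of k] e2 B eventually_ge_at_top[of 1]
      show "\<forall>\<^sub>F N in sequentially. \<forall>x. norm x \<le> \<rho> \<longrightarrow>
         norm ((real N powr (- \<beta>)) *\<^sub>R (\<Sum>i<N. njet \<sigma> (\<theta>0 i \<omega>) x)) \<le> \<epsilon>"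
      proof eventually_elim
        fix N :: nat
        assume f1: "\<forall>j\<in>F N. \<bar>(\<Sum>i<N. h N j (\<theta>0 i \<omega>)) - real N * (LINT \<theta>|\<mu>0. h N j \<theta>)\<bar> < 1 / real (Suc k) * real N powr \<beta>"
          and f2: "\<forall>i<N. norm (fst (snd (\<theta>0 i \<omega>))) \<le> real N powr \<kappa>"
          and f3: "(\<Sum>i<N. growth (\<theta>0 i \<omega>) ^ 4) / real N \<le> B" and N: "1 \<le> N"
          and f4: "Cn * \<bar>B\<bar> * n * real N powr (- \<beta>) < \<epsilon> / 2"
        show "\<forall>x. norm x \<le> \<rho> \<longrightarrow> norm ((real N powr (- \<beta>)) *\<^sub>R (\<Sum>i<N. njet \<sigma> (\<theta>0 i \<omega>) x)) \<le> \<epsilon>"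
        proof (intro allI impI)
          fix x :: "real^'n" assume "norm x \<le> \<rho>"
          then have "norm x \<le> real r" using r by simp
          then obtain y where y: "y \<in> grid r N" "norm (x - y) \<le> n / real N" using grid_approx[OF N] by (auto simp: n_def)
          define b where "b = real N powr (- \<beta>)"
          have b: "b > 0" "b * real N powr \<beta> = 1" using N by (auto simp: b_def powr_minus)
          have comp: "\<bar>(b *\<^sub>R (\<Sum>i<N. njet \<sigma> (\<theta>0 i \<omega>) y)) \<bullet> v\<bar> \<le> \<epsilon> / (2 * dj)" if v: "v \<in> Basis" for v
          proof -
            have "(\<Sum>i<N. h N (y, v) (\<theta>0 i \<omega>)) = (\<Sum>i<N. njet \<sigma> (\<theta>0 i \<omega>) y \<bullet> v)"
            proof (rule sum.cong)
              fix i assume "i \<in> {..<N}"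
              then show "h N (y, v) (\<theta>0 i \<omega>) = njet \<sigma> (\<theta>0 i \<omega>) y \<bullet> v"
                using f2 e3 v by (simp add: h_def u_def m_def scale[of "\<theta>0 i \<omega>"])
            qed simp
            moreover have "\<bar>(\<Sum>i<N. h N (y, v) (\<theta>0 i \<omega>))\<bar> < 1 / real (Suc k) * real N powr \<beta>"
              using f1 y v hz[OF N] by (auto simp: F_def)
            ultimately have "b * \<bar>\<Sum>i<N. njet \<sigma> (\<theta>0 i \<omega>) y \<bullet> v\<bar> \<le> b * (1 / real (Suc k) * real N powr \<beta>)"
              using b(1) by (intro mult_left_mono) auto
            also have "\<dots> = 1 / real (Suc k)" using b(2) by (simp add: mult.left_commute)
            finally show ?thesis using k b(1) by (simp add: inner_sum_left abs_mult)
          qed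
          have "norm (b *\<^sub>R (\<Sum>i<N. njet \<sigma> (\<theta>0 i \<omega>) y)) \<le> (\<Sum>v\<in>(Basis::'n jet set). \<epsilon> / (2 * dj))"
            by (intro order_trans[OF norm_le_l1 sum_mono] comp)
          also have "(\<Sum>v\<in>(Basis::'n jet set). \<epsilon> / (2 * dj)) = dj * (\<epsilon> / (2 * dj))" unfolding dj_def by (rule sum_constant)
          also have "dj * (\<epsilon> / (2 * dj)) = \<epsilon> / 2" using dj by simp
          finally have p1: "norm (b *\<^sub>R (\<Sum>i<N. njet \<sigma> (\<theta>0 i \<omega>) y)) \<le> \<epsilon> / 2" .
          \<comment> \<open>The mesh 1/N compensates the number of neurons. What remains is a
            bounded empirical moment times N^(-\<beta>), the second power of \<open>growth\<close>
            being raised to the controlled fourth.\<close>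
          have "norm (\<Sum>i<N. njet \<sigma> (\<theta>0 i \<omega>) x - njet \<sigma> (\<theta>0 i \<omega>) y) \<le> (\<Sum>i<N. growth (\<theta>0 i \<omega>) ^ 4 * (Cn * (n / real N)))"
          proof (rule sum_norm_le)
            fix i
            have "norm (njet \<sigma> (\<theta>0 i \<omega>) x - njet \<sigma> (\<theta>0 i \<omega>) y) \<le> Cn * (growth (\<theta>0 i \<omega>))\<^sup>2 * norm (x - y)" by (rule Cn(3))
            also have "\<dots> \<le> Cn * (growth (\<theta>0 i \<omega>)) ^ 4 * (n / real N)"
              using y(2) Cn(1) growth_ge_1[of "\<theta>0 i \<omega>"] by (intro mult_mono mult_left_mono power_increasing) auto
            finally show "norm (njet \<sigma> (\<theta>0 i \<omega>) x - njet \<sigma> (\<theta>0 i \<omega>) y) \<le> growth (\<theta>0 i \<omega>) ^ 4 * (Cn * (n / real N))"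
              by (simp add: mult_ac)
          qed
          also have "\<dots> = Cn * n * ((\<Sum>i<N. growth (\<theta>0 i \<omega>) ^ 4) / real N)" unfolding sum_distrib_right[symmetric] by simp
          also have "\<dots> \<le> Cn * n * \<bar>B\<bar>" using f3 Cn(1) n by (intro mult_left_mono) auto
          finally have "b * norm (\<Sum>i<N. njet \<sigma> (\<theta>0 i \<omega>) x - njet \<sigma> (\<theta>0 i \<omega>) y) \<le> b * (Cn * n * \<bar>B\<bar>)"
            using b(1) by (intro mult_left_mono) auto
          moreover have "b * (Cn * n * \<bar>B\<bar>) = Cn * \<bar>B\<bar> * n * real N powr (- \<beta>)" by (simp add: b_def)
          moreover have "norm (b *\<^sub>R (\<Sum>i<N. njet \<sigma> (\<theta>0 i \<omega>) x - njet \<sigma> (\<theta>0 i \<omega>) y))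
            = b * norm (\<Sum>i<N. njet \<sigma> (\<theta>0 i \<omega>) x - njet \<sigma> (\<theta>0 i \<omega>) y)" using b(1) by (simp only: norm_scaleR abs_of_pos)
          ultimately have p2: "norm (b *\<^sub>R (\<Sum>i<N. njet \<sigma> (\<theta>0 i \<omega>) x - njet \<sigma> (\<theta>0 i \<omega>) y)) \<le> \<epsilon> / 2"
            using f4 by linarith
          have "b *\<^sub>R (\<Sum>i<N. njet \<sigma> (\<theta>0 i \<omega>) x) = b *\<^sub>R (\<Sum>i<N. njet \<sigma> (\<theta>0 i \<omega>) y) + b *\<^sub>R (\<Sum>i<N. njet \<sigma> (\<theta>0 i \<omega>) x - njet \<sigma> (\<theta>0 i \<omega>) y)"
            by (simp add: sum_subtractf scaleR_diff_right)
          with norm_triangle_mono[OF p1 p2] have "norm (b *\<^sub>R (\<Sum>i<N. njet \<sigma> (\<theta>0 i \<omega>) x)) \<le> \<epsilon>" by simp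
          then show "norm ((real N powr (- \<beta>)) *\<^sub>R (\<Sum>i<N. njet \<sigma> (\<theta>0 i \<omega>) x)) \<le> \<epsilon>" by (simp add: b_def)
        qed
      qed
    qed
  qed
qed

end

section \<open>Stability estimates\<close>

text \<open>The supremum over \<open>x\<close> need not be measurable in time, so instead of integrating it the
  exponentially weighted supremum over both variables is bounded by half of itself plus the data.\<close>

lemma gronwall_sup:
  fixes D I :: "real \<Rightarrow> 'x \<Rightarrow> 'b::euclidean_space"
  assumes B: "\<And>t x. t \<in> {0..T} \<Longrightarrow> x \<in> X \<Longrightarrow> norm (D t x) \<le> B"
    and int: "\<And>t x. t \<in> {0..T} \<Longrightarrow> x \<in> X \<Longrightarrow> ((\<lambda>s. I s x) has_integral D t x - u x) {0..t}"
    and u: "\<And>x. x \<in> X \<Longrightarrow> norm (u x) \<le> \<epsilon>0"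
    and I: "\<And>s x \<delta>. s \<in> {0..T} \<Longrightarrow> x \<in> X \<Longrightarrow> (\<And>y. y \<in> X \<Longrightarrow> norm (D s y) \<le> \<delta>) \<Longrightarrow> norm (I s x) \<le> L * \<delta> + \<epsilon>1"
    and L: "L \<ge> 0" and \<epsilon>1: "\<epsilon>1 \<ge> 0" and t: "t \<in> {0..T}" and x: "x \<in> X"
  shows "norm (D t x) \<le> 2 * exp ((2 * L + 1) * T) * (\<epsilon>0 + T * \<epsilon>1)"
proof -
  \<comment> \<open>Integrating \<open>L * exp (l * s)\<close> yields the factor
    \<open>L / l\<close>; this weight makes it at most one half, so it can be absorbed.\<close>
  define l where "l = 2 * L + 1"
  have l: "l > 0" "L / l \<le> 1 / 2" using L by (auto simp: l_def field_simps)
  define S where "S = (\<lambda>z. exp (- l * fst z) * norm (D (fst z) (snd z))) ` ({0..T} \<times> X)"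
  define M where "M = Sup S"
  define E where "E = \<epsilon>0 + T * \<epsilon>1"
  have T: "T \<ge> 0" using t by simp
  have E: "E \<ge> 0" using order_trans[OF norm_ge_zero u[OF x]] T \<epsilon>1 by (simp add: E_def)
  have bd: "bdd_above S"
  proof (rule bdd_aboveI)
    fix y assume "y \<in> S"
    then obtain s z where s: "s \<in> {0..T}" "z \<in> X" "y = exp (- l * s) * norm (D s z)" by (auto simp: S_def)
    have "exp (- l * s) * norm (D s z) \<le> 1 * B" using B[OF s(1,2)] s(1) l by (intro mult_mono) auto
    then show "y \<le> 1 * B" using s by simp
  qed
  have up: "norm (D s y) \<le> exp (l * s) * M" if "s \<in> {0..T}" "y \<in> X" for s y
  proof -
    have "exp (- l * s) * norm (D s y) \<le> M"
      unfolding M_def by (rule cSup_upper[OF _ bd]) (use that in \<open>force simp: S_def\<close>)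
    then have "exp (l * s) * (exp (- l * s) * norm (D s y)) \<le> exp (l * s) * M" by (intro mult_left_mono) auto
    moreover have "exp (l * s) * exp (- l * s) = 1" by (simp add: exp_minus)
    ultimately show ?thesis by (metis mult.assoc mult_1)
  qed
  have M0: "M \<ge> 0" using order_trans[OF norm_ge_zero up[OF t x]] by (simp add: zero_le_mult_iff)
  \<comment> \<open>\<open>M\<close> is finite by the crude bound \<open>B\<close>, so half of it
    can be subtracted from both sides.\<close>
  have "M \<le> E + M / 2"
    unfolding M_def
  proof (rule cSup_least)
    show "S \<noteq> {}" using t x by (auto simp: S_def)
    fix y assume "y \<in> S"
    then obtain s z where s: "s \<in> {0..T}" "z \<in> X" "y = exp (- l * s) * norm (D s z)" by (auto simp: S_def)
    define h where "h = (\<lambda>r. L * (exp (l * r) * M) + \<epsilon>1)"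
    have h: "(h has_integral (L / l * M * exp (l * s) + \<epsilon>1 * s) - (L / l * M * exp (l * 0) + \<epsilon>1 * 0)) {0..s}"
      unfolding h_def
      by (rule fundamental_theorem_of_calculus)
         (use s l in \<open>auto intro!: derivative_eq_intros simp flip: has_real_derivative_iff_has_vector_derivative\<close>)
    have i: "((\<lambda>r. I r z) has_integral D s z - u z) {0..s}" using int s by blast
    have "norm (integral {0..s} (\<lambda>r. I r z)) \<le> integral {0..s} h"
    proof (rule integral_norm_bound_integral)
      show "(\<lambda>r. I r z) integrable_on {0..s}" "h integrable_on {0..s}" using i h by (auto simp: integrable_on_def)
      fix r assume r: "r \<in> {0..s}"
      then have r: "r \<in> {0..T}" using s by auto
      show "norm (I r z) \<le> h r" unfolding h_def by (rule I[OF r s(2) up[OF r]])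
    qed
    then have "norm (D s z - u z) \<le> L / l * M * exp (l * s) + \<epsilon>1 * s - L / l * M"
      using integral_unique[OF i] integral_unique[OF h] by simp
    also have "L / l * M * exp (l * s) + \<epsilon>1 * s - L / l * M \<le> M / 2 * exp (l * s) + \<epsilon>1 * T"
    proof -
      have "L / l * M \<ge> 0" "L / l * M * exp (l * s) \<le> 1 / 2 * M * exp (l * s)" "\<epsilon>1 * s \<le> \<epsilon>1 * T"
        using L l M0 \<epsilon>1 s by (auto intro!: mult_right_mono mult_left_mono simp del: times_divide_eq_left)
      then show ?thesis by linarith
    qed
    finally have "norm (D s z) \<le> E + M / 2 * exp (l * s)"
      using u[OF s(2)] norm_triangle_ineq2[of "D s z" "u z"] by (simp add: E_def mult.commute)
    then have "exp (- l * s) * norm (D s z) \<le> exp (- l * s) * (E + M / 2 * exp (l * s))" by (intro mult_left_mono) auto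
    also have "exp (- l * s) * (E + M / 2 * exp (l * s)) = exp (- l * s) * E + M / 2" by (simp add: distrib_left exp_minus)
    also have "exp (- l * s) * E + M / 2 \<le> 1 * E + M / 2" using E l s by (intro add_right_mono mult_right_mono) auto
    finally show "y \<le> E + Sup S / 2" using s by (simp add: M_def)
  qed
  then have M: "M \<le> 2 * E" by simp
  have "norm (D t x) \<le> exp (l * t) * M" by (rule up[OF t x])
  also have "exp (l * t) * M \<le> exp (l * T) * (2 * E)" using t l M M0 by (intro mult_mono) auto
  finally show ?thesis by (simp add: l_def E_def algebra_simps)
qed

lemma ennreal_tendsto_0:
  fixes X :: "nat \<Rightarrow> ennreal"
  assumes "\<And>e. e > 0 \<Longrightarrow> \<forall>\<^sub>F N in sequentially. X N \<le> ennreal e"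
  shows "X \<longlonglongrightarrow> 0"
proof (rule order_tendstoI)
  fix a :: ennreal assume "0 < a"
  then obtain b where b: "0 < b" "b < a" using dense by blast
  have "b < top" by (rule less_le_trans[OF b(2) top_greatest])
  then have "enn2real b > 0" "ennreal (enn2real b) = b" using b by (auto simp: enn2real_positive_iff)
  with assms[of "enn2real b"] have "\<forall>\<^sub>F N in sequentially. X N \<le> b" by simp
  then show "\<forall>\<^sub>F N in sequentially. X N < a" by eventually_elim (use b in auto)
qed simp

text \<open>Being the identity near 0 and having slope at most 1 in absolute value, the clipping
  moves z by at most \<open>2 * \<bar>z\<bar>\<close>. It moves z only when
  \<open>\<bar>z\<bar>\<close> exceeds \<open>N powr \<gamma>\<close>, which trades one factor
  N^(-\<gamma>) for a second power of z.\<close>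

lemma clipping_facts:
  assumes "smooth_clipping \<gamma> \<phi>" "N \<ge> 1" "\<gamma> > 0"
  shows "\<bar>\<phi> N z\<bar> \<le> 2 * real N powr \<gamma>" and "\<bar>\<phi> N z - \<phi> N w\<bar> \<le> \<bar>z - w\<bar>"
    and "\<bar>\<phi> N z - z\<bar> \<le> 2 * z\<^sup>2 * real N powr (- \<gamma>)"
proof -
  have a: "Ckb_on 2 UNIV (\<phi> N)" "\<And>z. \<bar>\<phi> N z\<bar> \<le> 2 * real N powr \<gamma>"
    "\<And>z. \<bar>z\<bar> \<le> real N powr \<gamma> \<Longrightarrow> \<phi> N z = z" "\<And>z. \<bar>deriv (\<phi> N) z\<bar> \<le> 1"
    using assms by (auto simp: smooth_clipping_def)
  show "\<bar>\<phi> N z\<bar> \<le> 2 * real N powr \<gamma>" by (rule a(2))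
  have "\<phi> N differentiable_on UNIV"
    using bspec[OF a(1)[unfolded Ckb_on_def Ck_on_def, THEN conjunct1], of "[]"] by simp
  then have df: "(\<phi> N has_real_derivative deriv (\<phi> N) y) (at y)" for y
    using DERIV_imp_deriv by (fastforce simp: differentiable_on_def real_differentiable_def)
  have lip: "\<bar>\<phi> N z - \<phi> N w\<bar> \<le> \<bar>z - w\<bar>" for z w
    using field_differentiable_bound[of UNIV "\<phi> N" "deriv (\<phi> N)" 1 z w] df a(4) by simp
  show "\<bar>\<phi> N z - \<phi> N w\<bar> \<le> \<bar>z - w\<bar>" by (rule lip)
  define k where "k = real N powr \<gamma>"
  have k: "k > 0" using assms by (simp add: k_def)
  show "\<bar>\<phi> N z - z\<bar> \<le> 2 * z\<^sup>2 * real N powr (- \<gamma>)"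
  proof (cases "\<bar>z\<bar> \<le> k")
    case False
    have "\<phi> N 0 = 0" by (rule a(3)) simp
    then have "\<bar>\<phi> N z\<bar> \<le> \<bar>z\<bar>" using lip[of z 0] by simp
    then have "\<bar>\<phi> N z - z\<bar> \<le> 2 * \<bar>z\<bar>" by linarith
    also have "2 * \<bar>z\<bar> \<le> 2 * (\<bar>z\<bar> * (\<bar>z\<bar> / k))"
      using False k mult_left_mono[of 1 "\<bar>z\<bar> / k" "\<bar>z\<bar>"] by simp
    also have "2 * (\<bar>z\<bar> * (\<bar>z\<bar> / k)) = 2 * z\<^sup>2 * real N powr (- \<gamma>)"
      by (simp add: k_def powr_minus divide_inverse power2_eq_square flip: abs_mult)
    finally show ?thesis .
  qed (use a(3)[of z] in \<open>simp add: k_def\<close>)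
qed

context pde
begin

lemma sq_bound_cong_AE:
  assumes "sq_bound p m" "AE x in \<mu>. p x = q x" "q \<in> borel_measurable \<mu>"
  shows "sq_bound q m"
proof -
  have p: "p \<in> borel_measurable \<mu>" using assms by (simp add: sq_bound_def)
  have e: "AE x in \<mu>. (norm (p x))\<^sup>2 = (norm (q x))\<^sup>2" using assms(2) by eventually_elim simp
  have m: "(\<lambda>x. (norm (p x))\<^sup>2) \<in> borel_measurable \<mu>" "(\<lambda>x. (norm (q x))\<^sup>2) \<in> borel_measurable \<mu>"
    using p assms(3) by auto
  show ?thesis using assms integral_cong_AE[OF m e] integrable_cong_AE[OF m e] by (simp add: sq_bound_def)
qed

end

section \<open>Jets of the network\<close>

context nn
begin

text \<open>The jet of the network without the factor \<eta>, the counterpart of \<open>Rj\<close>.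
  Comparing these two avoids dividing by \<eta> at the boundary.\<close>

definition netj :: "real \<Rightarrow> nat \<Rightarrow> (nat \<Rightarrow> 'n param) \<Rightarrow> real^'n \<Rightarrow> 'n jet" where
  "netj \<beta> N \<xi> x = real N powr (- \<beta>) *\<^sub>R (\<Sum>i<N. njet \<sigma> (\<xi> i) x)"

definition qj :: "real \<Rightarrow> nat \<Rightarrow> (nat \<Rightarrow> 'n param) \<Rightarrow> real^'n \<Rightarrow> 'n jet" where
  "qj \<beta> N \<xi> x = jmul (ej x) (netj \<beta> N \<xi> x)"

lemma has_jet_net: "has_jet \<Omega> (net \<beta> \<eta> \<sigma> N \<xi>) (qj \<beta> N \<xi>)"
proof -
  have "has_jet UNIV (\<lambda>x. real N powr (- \<beta>) * (\<Sum>i<N. neuron \<sigma> (\<xi> i) x)) (netj \<beta> N \<xi>)"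
    unfolding netj_def by (intro has_jet_scale has_jet_sum has_jet_neuron[OF sig])
  from has_jet_mult[OF has_jet_eta has_jet_subset[OF this subset_UNIV]] show ?thesis
    by (simp add: net_def[abs_def] qj_def[abs_def] mult.assoc)
qed

lemma qj_measurable: "qj \<beta> N \<xi> \<in> borel_measurable \<mu>"
  using has_jet_net by (intro borel_measurable_continuous) (auto simp: has_jet_def)

lemma qj_sq_bound: "\<exists>m. sq_bound (qj \<beta> N \<xi>) m"
proof -
  have "continuous_on \<Omega> (qj \<beta> N \<xi>)" using has_jet_net by (auto simp: has_jet_def)
  then obtain B where "B > 0" "\<And>x. x \<in> \<Omega> \<Longrightarrow> norm (qj \<beta> N \<xi> x) \<le> B" using continuous_bounded by blast
  then show ?thesis using sq_bound_bounded[OF qj_measurable] by (metis less_imp_le)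
qed

lemma G_step_network:
  "G_step \<Omega> a c d f g \<beta> \<eta> \<sigma> \<phi> N \<xi> i =
     real N powr (- \<beta>) *\<^sub>R (\<Sum>e\<in>Basis. \<phi> N (Jf (qj \<beta> N \<xi>) (hj (\<xi> i) e)) *\<^sub>R e)"
  by (simp add: G_step_def Let_def training_integral_network[OF has_jet_net])

end

section \<open>Equicontinuity of the fields and the clipping error\<close>

context lim
begin

text \<open>On bounded parameter sets both factors of each summand are bounded and uniformly
  continuous, with moduli that do not depend on the jet below its L^2 bound nor on the point of the
  domain.\<close>

lemma V_equicontinuous:
  assumes M: "M \<ge> 0" and \<epsilon>: "\<epsilon> > 0"
  shows "\<exists>\<delta>>0. \<forall>p x (\<theta>::'n param) \<theta>'. sq_bound p M \<longrightarrow> x \<in> \<Omega> \<longrightarrow> norm \<theta> \<le> K \<longrightarrow> norm \<theta>' \<le> K \<longrightarrow> norm (\<theta>' - \<theta>) < \<delta> \<longrightarrow>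
           norm (V p x \<theta>' - V p x \<theta>) \<le> \<epsilon>"
proof -
  obtain C where C: "C > 0" "\<And>\<theta> e x. e \<in> Basis \<Longrightarrow> x \<in> \<Omega> \<Longrightarrow> norm (fjet \<sigma> \<theta> e x) \<le> C * growth \<theta>"
    "\<And>\<theta> e x. e \<in> Basis \<Longrightarrow> x \<in> \<Omega> \<Longrightarrow> norm (hj \<theta> e x) \<le> C * growth \<theta>"
    using features_bound by metis
  have "bounded (growth ` cball (0::'n param) K)"
    by (intro compact_imp_bounded compact_continuous_image growth_continuous compact_cball)
  then obtain G where G: "G > 0" "\<And>\<theta>::'n param. norm \<theta> \<le> K \<Longrightarrow> growth \<theta> \<le> G"
    unfolding bounded_pos by force
  show ?thesis
  proof (rule Jf_bound)
    fix B
    assume B: "B > 0" and J: "\<And>p h m H. sq_bound p m \<Longrightarrow> h \<in> borel_measurable \<mu> \<Longrightarrow> (\<And>x. x \<in> \<Omega> \<Longrightarrow> norm (h x) \<le> H) \<Longrightarrow> 0 \<le> H \<Longrightarrow>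
       integrable \<mu> (\<lambda>x. Aop x (p x) * Bop x (p x) (h x)) \<and> \<bar>Jf p h\<bar> \<le> B * (1 + m) * H"
    define A1 A2 n where "A1 = B * (1 + M) * (C * G)" and "A2 = C * G" and "n = real (card (Basis :: 'n param set))"
    define \<epsilon>' where "\<epsilon>' = \<epsilon> / (n * (A1 + A2))"
    have A: "A1 > 0" "A2 > 0" "n > 0" using B M C(1) G(1) by (auto simp: A1_def A2_def n_def)
    have e': "\<epsilon>' > 0" using \<epsilon> A by (simp add: \<epsilon>'_def)
    have fb: "norm (fjet \<sigma> \<theta> e x) \<le> A2" "norm (hj \<theta> e x) \<le> A2" if "e \<in> Basis" "x \<in> \<Omega>" "norm \<theta> \<le> K" for e x \<theta>
      using order_trans[OF C(2)[OF that(1,2)] mult_left_mono[OF G(2)[OF that(3)] less_imp_le[OF C(1)]]]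
        order_trans[OF C(3)[OF that(1,2)] mult_left_mono[OF G(2)[OF that(3)] less_imp_le[OF C(1)]]]
      by (auto simp: A2_def)
    have jb: "\<bar>Jf p (hj \<theta> e)\<bar> \<le> A1" if "e \<in> Basis" "sq_bound p M" "norm \<theta> \<le> K" for e p \<theta>
      using J[OF that(2) hj_measurable, of \<theta> e A2] fb(2)[OF that(1) _ that(3)] A by (simp add: A1_def A2_def)
    have "\<forall>e\<in>Basis. \<exists>\<delta>>0. \<forall>p x (\<theta>::'n param) \<theta>'. sq_bound p M \<longrightarrow> x \<in> \<Omega> \<longrightarrow> norm \<theta> \<le> K \<longrightarrow> norm \<theta>' \<le> K \<longrightarrow> norm (\<theta>' - \<theta>) < \<delta> \<longrightarrow>
       norm (fjet \<sigma> \<theta>' e x - fjet \<sigma> \<theta> e x) \<le> \<epsilon>' \<and> \<bar>Jf p (hj \<theta>' e) - Jf p (hj \<theta> e)\<bar> \<le> \<epsilon>'"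
    proof
      fix e :: "'n param" assume e: "e \<in> Basis"
      obtain d1 where d1: "d1 > 0" "\<And>\<theta> \<theta>' x. norm \<theta> \<le> K \<Longrightarrow> norm \<theta>' \<le> K \<Longrightarrow> norm (\<theta>' - \<theta>) < d1 \<Longrightarrow> x \<in> \<Omega> \<Longrightarrow>
         norm (fjet \<sigma> \<theta>' e x - fjet \<sigma> \<theta> e x) \<le> \<epsilon>'"
        using features_uniformly_continuous[OF e', of K e] by metis
      obtain d2 where d2: "d2 > 0" "\<And>\<theta> \<theta>' p. norm \<theta> \<le> K \<Longrightarrow> norm \<theta>' \<le> K \<Longrightarrow> norm (\<theta>' - \<theta>) < d2 \<Longrightarrow> sq_bound p M \<Longrightarrow>
         \<bar>Jf p (hj \<theta>' e) - Jf p (hj \<theta> e)\<bar> \<le> \<epsilon>'"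
        using Jf_hj_uniformly_continuous[OF e e' M, of K] by metis
      show "\<exists>\<delta>>0. \<forall>p x (\<theta>::'n param) \<theta>'. sq_bound p M \<longrightarrow> x \<in> \<Omega> \<longrightarrow> norm \<theta> \<le> K \<longrightarrow> norm \<theta>' \<le> K \<longrightarrow> norm (\<theta>' - \<theta>) < \<delta> \<longrightarrow>
         norm (fjet \<sigma> \<theta>' e x - fjet \<sigma> \<theta> e x) \<le> \<epsilon>' \<and> \<bar>Jf p (hj \<theta>' e) - Jf p (hj \<theta> e)\<bar> \<le> \<epsilon>'"
        by (rule exI[of _ "min d1 d2"]) (use d1 d2 in simp)
    qed
    then obtain D where D: "\<And>e. e \<in> Basis \<Longrightarrow> D e > 0"
      "\<And>e p x \<theta> \<theta>'. e \<in> Basis \<Longrightarrow> sq_bound p M \<Longrightarrow> x \<in> \<Omega> \<Longrightarrow> norm \<theta> \<le> K \<Longrightarrow> norm \<theta>' \<le> K \<Longrightarrow> norm (\<theta>' - \<theta>) < D e \<Longrightarrow>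
       norm (fjet \<sigma> \<theta>' e x - fjet \<sigma> \<theta> e x) \<le> \<epsilon>' \<and> \<bar>Jf p (hj \<theta>' e) - Jf p (hj \<theta> e)\<bar> \<le> \<epsilon>'"
      by metis
    show ?thesis
    proof (intro exI[of _ "Min (D ` Basis)"] conjI allI impI)
      show "Min (D ` Basis) > 0" using D(1) by (subst Min_gr_iff) auto
      fix p x and \<theta> \<theta>' :: "'n param" assume p: "sq_bound p M" and x: "x \<in> \<Omega>" and t: "norm \<theta> \<le> K" "norm \<theta>' \<le> K" and d: "norm (\<theta>' - \<theta>) < Min (D ` Basis)"
      have "norm (V p x \<theta>' - V p x \<theta>) \<le> (\<Sum>e\<in>(Basis :: 'n param set). (A1 + A2) * \<epsilon>')"
        unfolding V_def sum_subtractf[symmetric]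
      proof (rule sum_norm_le)
        fix e :: "'n param" assume e: "e \<in> Basis"
        have "norm (\<theta>' - \<theta>) < D e" using d e by (subst (asm) Min_gr_iff) auto
        note D = D(2)[OF e p x t this]
        have "Jf p (hj \<theta>' e) *\<^sub>R fjet \<sigma> \<theta>' e x - Jf p (hj \<theta> e) *\<^sub>R fjet \<sigma> \<theta> e x
          = Jf p (hj \<theta>' e) *\<^sub>R (fjet \<sigma> \<theta>' e x - fjet \<sigma> \<theta> e x) + (Jf p (hj \<theta>' e) - Jf p (hj \<theta> e)) *\<^sub>R fjet \<sigma> \<theta> e x"
          by (simp add: algebra_simps)
        moreover have "norm (Jf p (hj \<theta>' e) *\<^sub>R (fjet \<sigma> \<theta>' e x - fjet \<sigma> \<theta> e x)) \<le> A1 * \<epsilon>'"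
          unfolding norm_scaleR real_norm_def using D jb[OF e p t(2)] A by (intro mult_mono) auto
        moreover have "norm ((Jf p (hj \<theta>' e) - Jf p (hj \<theta> e)) *\<^sub>R fjet \<sigma> \<theta> e x) \<le> \<epsilon>' * A2"
          unfolding norm_scaleR using D fb(1)[OF e x t(1)] e' by (intro mult_mono) auto
        ultimately show "norm (Jf p (hj \<theta>' e) *\<^sub>R fjet \<sigma> \<theta>' e x - Jf p (hj \<theta> e) *\<^sub>R fjet \<sigma> \<theta> e x) \<le> (A1 + A2) * \<epsilon>'"
          by (smt (verit) distrib_right mult.commute norm_triangle_ineq)
      qed
      also have "(\<Sum>e\<in>(Basis :: 'n param set). (A1 + A2) * \<epsilon>') = n * (A1 + A2) * \<epsilon>'" by (simp add: n_def)
      also have "n * (A1 + A2) * \<epsilon>' = \<epsilon>" using A by (simp add: \<epsilon>'_def)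
      finally show "norm (V p x \<theta>' - V p x \<theta>) \<le> \<epsilon>" .
    qed
  qed
qed

text \<open>The analogue of \<open>V\<close> for the clipped gradient.\<close>

definition W :: "(real \<Rightarrow> real) \<Rightarrow> (real^'n \<Rightarrow> 'n jet) \<Rightarrow> real^'n \<Rightarrow> 'n param \<Rightarrow> 'n jet" where
  "W \<psi> p x \<theta> = (\<Sum>e\<in>Basis. \<psi> (Jf p (hj \<theta> e)) *\<^sub>R fjet \<sigma> \<theta> e x)"

text \<open>Compared through \<psi> at the integral belonging to \<open>p'\<close>: the contraction
  property controls the change of the argument, and the clipping error is paid at \<open>p'\<close>.
  Hence only \<open>m'\<close>, the bound of the limit, appears.\<close>

lemma clipped_field_error:
  "\<exists>C>0. \<forall>\<psi> k p m p' m' \<delta> x (\<theta>::'n param).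
     (\<forall>z w. \<bar>\<psi> z - \<psi> w\<bar> \<le> \<bar>z - w\<bar>) \<longrightarrow> (\<forall>z. \<bar>\<psi> z - z\<bar> \<le> 2 * z\<^sup>2 * k) \<longrightarrow> k \<ge> 0 \<longrightarrow>
     sq_bound p m \<longrightarrow> sq_bound p' m' \<longrightarrow> sq_bound (\<lambda>y. p y - p' y) \<delta> \<longrightarrow> x \<in> \<Omega> \<longrightarrow>
     norm (W \<psi> p x \<theta> - V p' x \<theta>) \<le> C * (1 + m')\<^sup>2 * (\<delta> + k) * growth \<theta> ^ 4"
proof -
  obtain F where F: "F > 0" "\<And>\<theta> e x. e \<in> Basis \<Longrightarrow> x \<in> \<Omega> \<Longrightarrow> norm (fjet \<sigma> \<theta> e x) \<le> F * growth \<theta>"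
    "\<And>\<theta> e x. e \<in> Basis \<Longrightarrow> x \<in> \<Omega> \<Longrightarrow> norm (hj \<theta> e x) \<le> F * growth \<theta>"
    using features_bound by metis
  show ?thesis
  proof (rule Jf_bound, rule Jf_lipschitz)
    fix B L
    assume B: "B > 0" and JB: "\<And>p h m H. sq_bound p m \<Longrightarrow> h \<in> borel_measurable \<mu> \<Longrightarrow> (\<And>x. x \<in> \<Omega> \<Longrightarrow> norm (h x) \<le> H) \<Longrightarrow> 0 \<le> H \<Longrightarrow>
       integrable \<mu> (\<lambda>x. Aop x (p x) * Bop x (p x) (h x)) \<and> \<bar>Jf p h\<bar> \<le> B * (1 + m) * H"
    and L: "L > 0" and JL: "\<And>p q h m' m \<delta> H. sq_bound p m' \<Longrightarrow> sq_bound q m \<Longrightarrow> sq_bound (\<lambda>x. p x - q x) \<delta> \<Longrightarrow> h \<in> borel_measurable \<mu> \<Longrightarrow>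
       (\<And>x. x \<in> \<Omega> \<Longrightarrow> norm (h x) \<le> H) \<Longrightarrow> 0 \<le> H \<Longrightarrow> \<bar>Jf p h - Jf q h\<bar> \<le> L * (1 + m) * H * \<delta>"
    define n where "n = real (card (Basis :: 'n param set))"
    \<comment> \<open>One constant for both parts: linear in the Lipschitz bound for the change of
      the jet, quadratic in the size bound for the clipping error.\<close>
    define C0 where "C0 = max (L * F) (2 * (B * F)\<^sup>2)"
    define C where "C = n * (C0 * F)"
    have n: "n > 0" by (simp add: n_def)
    have C0: "C0 > 0" "L * F \<le> C0" "2 * (B * F)\<^sup>2 \<le> C0" using L F(1) by (auto simp: C0_def less_max_iff_disj)
    have C: "C > 0" using n C0 F(1) by (simp add: C_def)
    show ?thesis
    proof (intro exI[of _ C] conjI C allI impI)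
      fix \<psi> :: "real \<Rightarrow> real" and k p m p' m' \<delta> x and \<theta> :: "'n param"
      assume lip: "\<forall>z w. \<bar>\<psi> z - \<psi> w\<bar> \<le> \<bar>z - w\<bar>" and near: "\<forall>z. \<bar>\<psi> z - z\<bar> \<le> 2 * z\<^sup>2 * k" and k: "k \<ge> 0"
        and p: "sq_bound p m" and p': "sq_bound p' m'" and d: "sq_bound (\<lambda>y. p y - p' y) \<delta>" and x: "x \<in> \<Omega>"
      define r where "r = growth \<theta>"
      define u where "u = 1 + m'"
      have r: "r \<ge> 1" using growth_ge_1 by (simp add: r_def)
      have m': "u \<ge> 1" "\<delta> \<ge> 0" using p' d by (auto simp: sq_bound_def u_def)
      have Fr: "0 \<le> F * r" using F(1) r by simp
      have "norm (W \<psi> p x \<theta> - V p' x \<theta>) \<le> (\<Sum>e\<in>(Basis :: 'n param set). (C0 * u\<^sup>2 * (\<delta> + k) * r\<^sup>2) * (F * r))"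
        unfolding W_def V_def sum_subtractf[symmetric] scaleR_left_diff_distrib[symmetric]
      proof (rule sum_norm_le)
        fix e :: "'n param" assume e: "e \<in> Basis"
        define z z' where "z = Jf p (hj \<theta> e)" and "z' = Jf p' (hj \<theta> e)"
        have hb: "norm (hj \<theta> e y) \<le> F * r" if "y \<in> \<Omega>" for y using F(3)[OF e that] by (simp add: r_def)
        have 1: "\<bar>z - z'\<bar> \<le> L * u * (F * r) * \<delta>"
          unfolding z_def z'_def u_def by (rule JL[OF p p' d hj_measurable hb Fr])
        have "\<bar>z'\<bar> \<le> B * u * (F * r)"
          using JB[OF p' hj_measurable hb Fr] by (simp add: z'_def u_def)
        then have 2: "z'\<^sup>2 \<le> (B * u * (F * r))\<^sup>2" by (metis abs_ge_zero power2_abs power_mono)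
        have "\<bar>\<psi> z - z'\<bar> \<le> \<bar>z - z'\<bar> + 2 * z'\<^sup>2 * k"
          using lip[rule_format, of z z'] near[rule_format, of z'] by linarith
        also have "\<bar>z - z'\<bar> + 2 * z'\<^sup>2 * k \<le> L * u * (F * r) * \<delta> + 2 * (B * u * (F * r))\<^sup>2 * k"
          using 1 2 k by (intro add_mono mult_right_mono) auto
        also have "L * u * (F * r) * \<delta> + 2 * (B * u * (F * r))\<^sup>2 * k \<le> C0 * (u * r) * \<delta> + C0 * (u * r)\<^sup>2 * k"
        proof (intro add_mono)
          have "(L * F) * (u * r * \<delta>) \<le> C0 * (u * r * \<delta>)" using C0 m' r by (intro mult_right_mono) auto
          then show "L * u * (F * r) * \<delta> \<le> C0 * (u * r) * \<delta>" by (simp add: mult_ac)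
          have "(2 * (B * F)\<^sup>2) * ((u * r)\<^sup>2 * k) \<le> C0 * ((u * r)\<^sup>2 * k)" using C0 k by (intro mult_right_mono) auto
          then show "2 * (B * u * (F * r))\<^sup>2 * k \<le> C0 * (u * r)\<^sup>2 * k" by (simp add: power_mult_distrib mult_ac)
        qed
        also have "C0 * (u * r) * \<delta> + C0 * (u * r)\<^sup>2 * k \<le> C0 * (u * r)\<^sup>2 * \<delta> + C0 * (u * r)\<^sup>2 * k"
        proof -
          have "1 \<le> u * r" using m' r mult_mono[of 1 u 1 r] by simp
          then have "u * r \<le> (u * r)\<^sup>2" using power_increasing[of 1 2 "u * r"] by simp
          then show ?thesis using C0 m' by (intro add_right_mono mult_right_mono mult_left_mono) auto
        qed
        also have "C0 * (u * r)\<^sup>2 * \<delta> + C0 * (u * r)\<^sup>2 * k = C0 * u\<^sup>2 * (\<delta> + k) * r\<^sup>2" by (simp add: power_mult_distrib algebra_simps)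
        finally have "\<bar>\<psi> z - z'\<bar> \<le> C0 * u\<^sup>2 * (\<delta> + k) * r\<^sup>2" .
        moreover have "norm (fjet \<sigma> \<theta> e x) \<le> F * r" using F(2)[OF e x] by (simp add: r_def)
        ultimately show "norm ((\<psi> (Jf p (hj \<theta> e)) - Jf p' (hj \<theta> e)) *\<^sub>R fjet \<sigma> \<theta> e x) \<le> (C0 * u\<^sup>2 * (\<delta> + k) * r\<^sup>2) * (F * r)"
          unfolding norm_scaleR real_norm_def z_def z'_def by (intro mult_mono) (auto intro: order_trans[OF abs_ge_zero])
      qed
      also have "(\<Sum>e\<in>(Basis :: 'n param set). (C0 * u\<^sup>2 * (\<delta> + k) * r\<^sup>2) * (F * r)) = C * u\<^sup>2 * (\<delta> + k) * r ^ 3"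
        by (simp add: n_def C_def power3_eq_cube power2_eq_square)
      \<comment> \<open>The squared training integral and the feature give a third power, raised to
        the fourth to match the controlled empirical moment.\<close>
      also have "C * u\<^sup>2 * (\<delta> + k) * r ^ 3 \<le> C * u\<^sup>2 * (\<delta> + k) * r ^ 4"
        using C m' k r by (intro mult_left_mono power_increasing) auto
      finally show "norm (W \<psi> p x \<theta> - V p' x \<theta>) \<le> C * (1 + m')\<^sup>2 * (\<delta> + k) * growth \<theta> ^ 4" by (simp add: u_def r_def)
    qed
  qed
qed

end

section \<open>Training dynamics\<close>

locale training = lim \<Omega> a c d f g \<eta> \<sigma> \<mu>0 \<alpha> Q + iid: iid_params P \<theta>0 \<mu>0
  for \<Omega> :: "(real^'n) set" and a c d f g \<eta> \<sigma> \<mu>0 \<alpha> Q and P :: "'w measure" and \<theta>0 +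
  fixes \<phi> :: "nat \<Rightarrow> real \<Rightarrow> real" and \<beta> \<gamma> :: real and \<theta> :: "nat \<Rightarrow> 'w \<Rightarrow> real \<Rightarrow> nat \<Rightarrow> 'n param"
  assumes \<alpha>: "0 < \<alpha>" and \<beta>: "1/2 < \<beta>" and \<gamma>: "0 < \<gamma>" "\<gamma> + \<beta> < 1"
    and clip: "smooth_clipping \<gamma> \<phi>"
    and trained: "\<And>N \<omega>. N \<ge> 1 \<Longrightarrow> \<omega> \<in> space P \<Longrightarrow> trained \<Omega> a c d f g \<alpha> \<beta> \<eta> \<sigma> \<phi> N (\<lambda>i. \<theta>0 i \<omega>) (\<theta> N \<omega>)"
begin

lemma initial_parameters:
  assumes "N \<ge> 1" "\<omega> \<in> space P" "i < N"
  shows "\<theta> N \<omega> 0 i = \<theta>0 i \<omega>"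
  using trained[OF assms(1,2)] assms(3) by (simp add: trained_def)

lemma flow_derivative:
  assumes N: "N \<ge> 1" and \<omega>: "\<omega> \<in> space P" and i: "i < N" and t: "t \<ge> 0"
  shows "((\<lambda>s. \<theta> N \<omega> s i) has_vector_derivative
      (- \<alpha> * real N powr (\<beta> - 1)) *\<^sub>R (\<Sum>e\<in>Basis. \<phi> N (Jf (qj \<beta> N (\<theta> N \<omega> t)) (hj (\<theta> N \<omega> t i) e)) *\<^sub>R e)) (at t within {0..})"
proof -
  have "real N powr (2 * \<beta> - 1) * real N powr (- \<beta>) = real N powr (\<beta> - 1)"
    by (simp flip: powr_add)
  then have k: "- \<alpha> * real N powr (2 * \<beta> - 1) * real N powr (- \<beta>) = - \<alpha> * real N powr (\<beta> - 1)" by simp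
  show ?thesis
    using trained[OF N \<omega>] i t unfolding trained_def G_step_network scaleR_scaleR k by blast
qed

text \<open>The clipping level bounds each coordinate of the velocity by a multiple of N^(\<beta> -
  1) N^\<gamma>, although the training integral itself has no a priori bound.\<close>

lemma displacement:
  assumes N: "N \<ge> 1" and \<omega>: "\<omega> \<in> space P" and i: "i < N" and t: "t \<ge> 0"
  shows "norm (\<theta> N \<omega> t i - \<theta>0 i \<omega>) \<le> 2 * \<alpha> * real (card (Basis :: 'n param set)) * t * real N powr (\<beta> + \<gamma> - 1)"
proof -
  define n where "n = real (card (Basis :: 'n param set))"
  define v where "v s = (- \<alpha> * real N powr (\<beta> - 1)) *\<^sub>R (\<Sum>e\<in>Basis. \<phi> N (Jf (qj \<beta> N (\<theta> N \<omega> s)) (hj (\<theta> N \<omega> s i) e)) *\<^sub>R e)" for s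
  have "(v has_integral \<theta> N \<omega> t i - \<theta> N \<omega> 0 i) {0..t}"
    unfolding v_def
    by (rule fundamental_theorem_of_calculus[OF t])
       (rule has_vector_derivative_within_subset[OF flow_derivative[OF N \<omega> i]], auto)
  moreover have "norm (v s) \<le> \<alpha> * real N powr (\<beta> - 1) * (n * (2 * real N powr \<gamma>))" for s
  proof -
    have "norm (\<Sum>e\<in>(Basis::'n param set). \<phi> N (Jf (qj \<beta> N (\<theta> N \<omega> s)) (hj (\<theta> N \<omega> s i) e)) *\<^sub>R e) \<le> (\<Sum>e\<in>(Basis::'n param set). 2 * real N powr \<gamma>)"
      by (rule sum_norm_le) (use clipping_facts(1)[OF clip N \<gamma>(1)] in simp)
    also have "(\<Sum>e\<in>(Basis::'n param set). 2 * real N powr \<gamma>) = n * (2 * real N powr \<gamma>)" unfolding n_def by (rule sum_constant)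
    finally show ?thesis unfolding v_def norm_scaleR using \<alpha> by (intro mult_mono) auto
  qed
  ultimately have "norm (\<theta> N \<omega> t i - \<theta> N \<omega> 0 i) \<le> \<alpha> * real N powr (\<beta> - 1) * (n * (2 * real N powr \<gamma>)) * measure lborel {0..t}"
    using \<alpha> by (intro has_integral_bound_real) (auto simp: n_def)
  also have "\<alpha> * real N powr (\<beta> - 1) * (n * (2 * real N powr \<gamma>)) * measure lborel {0..t} = 2 * \<alpha> * n * t * (real N powr (\<beta> - 1) * real N powr \<gamma>)"
    using t by simp
  also have "real N powr (\<beta> - 1) * real N powr \<gamma> = real N powr (\<beta> + \<gamma> - 1)" by (simp add: algebra_simps flip: powr_add)
  finally show ?thesis using initial_parameters[OF N \<omega> i] by (simp add: n_def)
qed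

lemma displacement_small:
  assumes "\<delta> > 0"
  shows "\<forall>\<^sub>F N in sequentially. \<forall>\<omega>\<in>space P. \<forall>t\<in>{0..T}. \<forall>i<N. norm (\<theta> N \<omega> t i - \<theta>0 i \<omega>) \<le> \<delta>"
proof -
  define A where "A = 2 * \<alpha> * real (card (Basis :: 'n param set))"
  have A: "A \<ge> 0" using \<alpha> by (simp add: A_def)
  have "(\<lambda>N. real N powr (\<beta> + \<gamma> - 1)) \<longlonglongrightarrow> 0"
    using \<gamma> by (intro tendsto_neg_powr filterlim_real_sequentially) auto
  then have "(\<lambda>N. A * T * real N powr (\<beta> + \<gamma> - 1)) \<longlonglongrightarrow> 0" by (rule tendsto_mult_right_zero)
  from order_tendstoD(2)[OF this assms] eventually_ge_at_top[of 1]
  show ?thesis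
  proof eventually_elim
    fix N :: nat assume a: "A * T * real N powr (\<beta> + \<gamma> - 1) < \<delta>" and N: "1 \<le> N"
    show "\<forall>\<omega>\<in>space P. \<forall>t\<in>{0..T}. \<forall>i<N. norm (\<theta> N \<omega> t i - \<theta>0 i \<omega>) \<le> \<delta>"
    proof (intro ballI allI impI)
      fix \<omega> t i assume "\<omega> \<in> space P" "t \<in> {0..T}" "i < N"
      then have "norm (\<theta> N \<omega> t i - \<theta>0 i \<omega>) \<le> A * t * real N powr (\<beta> + \<gamma> - 1)"
        using displacement[OF N, of \<omega> i t] by (simp add: A_def)
      also have "A * t * real N powr (\<beta> + \<gamma> - 1) \<le> A * T * real N powr (\<beta> + \<gamma> - 1)"
        using A \<open>t \<in> {0..T}\<close> by (intro mult_right_mono mult_left_mono) auto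
      finally show "norm (\<theta> N \<omega> t i - \<theta>0 i \<omega>) \<le> \<delta>" using a by linarith
    qed
  qed
qed

text \<open>The factor N^(-\<beta>) of the network, that of the gradient and the learning rate N^(2
  \<beta> - 1) multiply to 1/N, so the velocity of the jet is a plain average over neurons.
  Linearity of \<open>fjet\<close> in the direction converts the parameter velocity into the
  field.\<close>

lemma network_has_integral:
  assumes N: "N \<ge> 1" and \<omega>: "\<omega> \<in> space P" and t: "t \<ge> 0"
  shows "((\<lambda>s. (- \<alpha>) *\<^sub>R (1 / real N) *\<^sub>R (\<Sum>i<N. W (\<phi> N) (qj \<beta> N (\<theta> N \<omega> s)) x (\<theta> N \<omega> s i)))
     has_integral netj \<beta> N (\<theta> N \<omega> t) x - netj \<beta> N (\<lambda>i. \<theta>0 i \<omega>) x) {0..t}"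
proof -
  define I where "I s = (- \<alpha>) *\<^sub>R (1 / real N) *\<^sub>R (\<Sum>i<N. W (\<phi> N) (qj \<beta> N (\<theta> N \<omega> s)) x (\<theta> N \<omega> s i))" for s
  have "((\<lambda>s. netj \<beta> N (\<theta> N \<omega> s) x) has_vector_derivative I s) (at s within {0..t})" if s: "s \<in> {0..t}" for s
  proof -
    define z where "z i e = \<phi> N (Jf (qj \<beta> N (\<theta> N \<omega> s)) (hj (\<theta> N \<omega> s i) e))" for i e
    define v where "v i = (- \<alpha> * real N powr (\<beta> - 1)) *\<^sub>R (\<Sum>e\<in>Basis. z i e *\<^sub>R e)" for i
    have v: "((\<lambda>s. \<theta> N \<omega> s i) has_vector_derivative v i) (at s within {0..t})" if "i < N" for i
      unfolding v_def z_def
      by (rule has_vector_derivative_within_subset[OF flow_derivative[OF N \<omega> that]]) (use s in auto)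
    have "((\<lambda>s. njet \<sigma> (\<theta> N \<omega> s i) x) has_vector_derivative fjet \<sigma> (\<theta> N \<omega> s i) (v i) x) (at s within {0..t})" if "i < N" for i
      using vector_derivative_diff_chain_within[OF v[OF that] has_derivative_njet[OF sig]] by (simp add: o_def)
    then have "((\<lambda>s. netj \<beta> N (\<theta> N \<omega> s) x) has_vector_derivative real N powr (- \<beta>) *\<^sub>R (\<Sum>i<N. fjet \<sigma> (\<theta> N \<omega> s i) (v i) x)) (at s within {0..t})"
      unfolding netj_def by (intro bounded_linear.has_vector_derivative[OF bounded_linear_scaleR_right] has_vector_derivative_sum) auto
    moreover have "real N powr (- \<beta>) *\<^sub>R (\<Sum>i<N. fjet \<sigma> (\<theta> N \<omega> s i) (v i) x) = I s"
    proof -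
      have "fjet \<sigma> (\<theta> N \<omega> s i) (v i) x = (- \<alpha> * real N powr (\<beta> - 1)) *\<^sub>R W (\<phi> N) (qj \<beta> N (\<theta> N \<omega> s)) x (\<theta> N \<omega> s i)" for i
        unfolding v_def W_def z_def
        by (simp only: linear_scale[OF linear_fjet[OF sig]] linear_sum[OF linear_fjet[OF sig]])
      moreover have "real N powr (- \<beta>) * (- \<alpha> * real N powr (\<beta> - 1)) = - \<alpha> * (1 / real N)"
      proof -
        have "real N powr (- \<beta>) * real N powr (\<beta> - 1) = real N powr (- 1)" by (simp flip: powr_add)
        also have "real N powr (- 1) = 1 / real N" using N by (simp add: powr_minus_divide)
        finally show ?thesis by (simp add: mult.left_commute)
      qed
      ultimately show ?thesis by (simp only: scaleR_sum_right[symmetric] scaleR_scaleR I_def)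
    qed
    ultimately show ?thesis by simp
  qed
  from fundamental_theorem_of_calculus[OF t this]
  have "(I has_integral netj \<beta> N (\<theta> N \<omega> t) x - netj \<beta> N (\<theta> N \<omega> 0) x) {0..t}" by simp
  moreover have "netj \<beta> N (\<theta> N \<omega> 0) x = netj \<beta> N (\<lambda>i. \<theta>0 i \<omega>) x"
    using initial_parameters[OF N \<omega>] by (simp add: netj_def)
  ultimately show ?thesis by (simp add: I_def[abs_def])
qed

text \<open>Multiplication by the bounded jet of \<eta> turns a supremum bound for the jets without
  \<eta> into an L^2 bound; the weak jet of the limit is replaced by its classical one off a null
  set.\<close>

lemma sq_bound_network_error:
  assumes F: "F \<ge> 0" "\<And>x p. x \<in> \<Omega> \<Longrightarrow> norm (jmul (ej x) p) \<le> F * norm p"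
    and s: "s \<ge> 0" and D: "\<And>y. y \<in> \<Omega> \<Longrightarrow> norm (netj \<beta> N \<xi> y - Rj s y) \<le> \<delta>"
  shows "sq_bound (\<lambda>y. qj \<beta> N \<xi> y - pQ s y) (F * \<delta>)"
proof (rule sq_bound_cong_AE)
  have m: "(\<lambda>x. jmul (ej x) (Rj s x)) \<in> borel_measurable \<mu>"
    using has_jet_Q(1)[OF s] by (intro borel_measurable_continuous) (auto simp: has_jet_def)
  obtain y where "y \<in> \<Omega>" using int_ne interior_subset by blast
  then have \<delta>: "\<delta> \<ge> 0" using D norm_ge_zero order_trans by blast
  show "sq_bound (\<lambda>x. qj \<beta> N \<xi> x - jmul (ej x) (Rj s x)) (F * \<delta>)"
  proof (rule sq_bound_bounded)
    show "(\<lambda>x. qj \<beta> N \<xi> x - jmul (ej x) (Rj s x)) \<in> borel_measurable \<mu>" by (intro borel_measurable_diff qj_measurable m)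
    show "norm (qj \<beta> N \<xi> x - jmul (ej x) (Rj s x)) \<le> F * \<delta>" if x: "x \<in> \<Omega>" for x
      unfolding qj_def jmul_linear(2)[symmetric]
      by (rule order_trans[OF F(2)[OF x] mult_left_mono[OF D[OF x] F(1)]])
  qed (use F \<delta> in simp)
  show "AE x in \<mu>. qj \<beta> N \<xi> x - jmul (ej x) (Rj s x) = qj \<beta> N \<xi> x - pQ s x"
    using has_jet_Q(2)[OF s] by eventually_elim simp
  have "pQ s \<in> borel_measurable \<mu>" using pQ_sq[OF s] by (simp add: sq_bound_def)
  then show "(\<lambda>y. qj \<beta> N \<xi> y - pQ s y) \<in> borel_measurable \<mu>" by (intro borel_measurable_diff qj_measurable)
qed

lemma network_converges:
  "AE \<omega> in P. \<forall>\<epsilon>>0. \<forall>\<^sub>F N in sequentially. \<forall>t\<in>{0..T}. \<forall>x\<in>\<Omega>. norm (netj \<beta> N (\<theta> N \<omega> t) x - Rj t x) \<le> \<epsilon>"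
proof -
  obtain \<rho> where \<rho>: "\<rho> \<ge> 0" "\<And>x. x \<in> \<Omega> \<Longrightarrow> norm x \<le> \<rho>" using dom_bounded by blast
  obtain F where F: "F > 0" "\<And>x p. x \<in> \<Omega> \<Longrightarrow> norm (jmul (ej x) p) \<le> F * norm p" using features_bound by metis
  obtain M where M: "M \<ge> 0" "\<And>s. s \<in> {0..T} \<Longrightarrow> sq_bound (pQ s) M" using msq_bounded by metis
  obtain C where C: "C > 0" and Cb: "\<forall>\<psi> k p m p' m' \<delta> x (\<theta>::'n param).
     (\<forall>z w. \<bar>\<psi> z - \<psi> w\<bar> \<le> \<bar>z - w\<bar>) \<longrightarrow> (\<forall>z. \<bar>\<psi> z - z\<bar> \<le> 2 * z\<^sup>2 * k) \<longrightarrow> k \<ge> 0 \<longrightarrow>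
     sq_bound p m \<longrightarrow> sq_bound p' m' \<longrightarrow> sq_bound (\<lambda>y. p y - p' y) \<delta> \<longrightarrow> x \<in> \<Omega> \<longrightarrow>
     norm (W \<psi> p x \<theta> - V p' x \<theta>) \<le> C * (1 + m')\<^sup>2 * (\<delta> + k) * growth \<theta> ^ 4"
    using clipped_field_error by blast
  obtain CV where CV: "CV > 0" "\<forall>p m x \<theta>. sq_bound p m \<longrightarrow> norm x \<le> \<rho> \<longrightarrow> norm (V p x \<theta>) \<le> CV * (1 + m) * growth \<theta> ^ 2"
    using V_norm_bound[OF \<rho>(1)] by blast
  obtain Cn where Cn: "Cn > 0" "\<And>(\<theta>::'n param) x. norm (njet \<sigma> \<theta> x) \<le> Cn * growth \<theta>"
    using njet_bound[OF sig] by blast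
  obtain BK where BK: "BK \<ge> 0" "\<And>s x. s \<in> {0..T} \<Longrightarrow> norm x \<le> \<rho> \<Longrightarrow> norm (Kj s x) \<le> BK" using Kj_bound[OF \<rho>(1), of T] by metis
  \<comment> \<open>Only fields along the limit trajectory enter the uniform law. The family is
    deterministic and bounded uniformly in time and space, relative to the second power of
    \<open>growth\<close>.\<close>
  define \<H> where "\<H> = (\<lambda>z. V (pQ (fst z)) (snd z)) ` ({0..T} \<times> \<Omega>)"
  from iid.AE_typical iid.initial_jet_uniform[OF sig \<beta> \<rho>(1)] AE_space
  show ?thesis
  proof eventually_elim
    fix \<omega> assume tp: "iid.typical (\<lambda>i. \<theta>0 i \<omega>)" and \<omega>: "\<omega> \<in> space P"
      and ini: "\<forall>\<epsilon>>0. \<forall>\<^sub>F N in sequentially. \<forall>x. norm x \<le> \<rho> \<longrightarrow> norm (real N powr (- \<beta>) *\<^sub>R (\<Sum>i<N. njet \<sigma> (\<theta>0 i \<omega>) x)) \<le> \<epsilon>"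
    obtain B0 where B0: "\<forall>\<^sub>F N in sequentially. iid.avg (\<lambda>i. \<theta>0 i \<omega>) N (\<lambda>\<theta>. growth \<theta> ^ 4) \<le> B0"
      using tp by (auto simp: iid.typical_def)
    \<comment> \<open>The factor \<open>8 ^ 4\<close> accounts for evaluating the fourth power of
      \<open>growth\<close> at moved parameters, and \<open>B0\<close> bounds its empirical mean.
      Neither depends on \<open>N\<close>, so the stability constant is uniform.\<close>
    define A where "A = C * (1 + M)\<^sup>2 * (8 ^ 4 * \<bar>B0\<bar>)"
    define L where "L = \<alpha> * (A * F)"
    define \<kappa> where "\<kappa> = 2 * exp ((2 * L + 1) * T)"
    have A: "A \<ge> 0" using C by (simp add: A_def)
    have L: "L \<ge> 0" using \<alpha> A F(1) by (simp add: L_def)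
    show "\<forall>\<epsilon>>0. \<forall>\<^sub>F N in sequentially. \<forall>t\<in>{0..T}. \<forall>x\<in>\<Omega>. norm (netj \<beta> N (\<theta> N \<omega> t) x - Rj t x) \<le> \<epsilon>"
    proof (intro allI impI)
      fix \<epsilon> :: real assume \<epsilon>: "\<epsilon> > 0"
      \<comment> \<open>Solves
        \<open>\<kappa> * (e + T * (\<alpha> * (2 * e))) = \<epsilon>\<close>: one \<open>e\<close>
        from the initial jet, and two in the velocity, from clipping and from the law of large
        numbers.\<close>
      define e where "e = \<epsilon> / (\<kappa> * (1 + \<bar>T\<bar> * (2 * \<alpha>)))"
      have \<kappa>: "\<kappa> > 0" by (simp add: \<kappa>_def)
      have pos: "1 + \<bar>T\<bar> * (2 * \<alpha>) > 0" using \<alpha> by (intro add_pos_nonneg) auto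
      have e: "e > 0" using \<epsilon> \<kappa> pos by (simp add: e_def)
      have "\<exists>\<delta>>0. \<forall>\<^sub>F N in sequentially. \<forall>H\<in>\<H>. \<forall>\<xi>'. (\<forall>i<N. norm (\<xi>' i - \<theta>0 i \<omega>) \<le> \<delta>) \<longrightarrow>
         norm ((1 / real N) *\<^sub>R (\<Sum>i<N. H (\<xi>' i)) - (LINT \<theta>|\<mu>0. H \<theta>)) \<le> e"
      proof (rule iid.uniform_law[OF tp, where M = "CV * (1 + M)"])
        show "CV * (1 + M) \<ge> 0" using CV M by simp
        show "H \<in> borel_measurable borel" if "H \<in> \<H>" for H
          using that V_measurable[OF M(2)] by (auto simp: \<H>_def measurable_\<mu>0)
        show "norm (H \<theta>) \<le> CV * (1 + M) * growth \<theta> ^ 2" if h: "H \<in> \<H>" for H \<theta>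
        proof -
          obtain s x where "H = V (pQ s) x" "s \<in> {0..T}" "x \<in> \<Omega>" using h by (auto simp: \<H>_def)
          then show ?thesis using CV(2)[rule_format, OF M(2) \<rho>(2)] by simp
        qed
        show "\<exists>\<delta>>0. \<forall>H\<in>\<H>. \<forall>\<theta> \<theta>'. norm \<theta> \<le> K \<longrightarrow> norm \<theta>' \<le> K \<longrightarrow> norm (\<theta>' - \<theta>) < \<delta> \<longrightarrow> norm (H \<theta>' - H \<theta>) \<le> \<epsilon>'" if e': "\<epsilon>' > 0" for K \<epsilon>'
        proof -
          obtain \<delta> where \<delta>: "\<delta> > 0" "\<forall>p x (\<theta>::'n param) \<theta>'. sq_bound p M \<longrightarrow> x \<in> \<Omega> \<longrightarrow> norm \<theta> \<le> K \<longrightarrow> norm \<theta>' \<le> K \<longrightarrow> norm (\<theta>' - \<theta>) < \<delta> \<longrightarrow>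
             norm (V p x \<theta>' - V p x \<theta>) \<le> \<epsilon>'"
            using V_equicontinuous[OF M(1) e'] by blast
          show ?thesis by (intro exI[of _ \<delta>] conjI \<delta>(1)) (use \<delta>(2) M(2) in \<open>auto simp: \<H>_def\<close>)
        qed
      qed (rule e)
      then obtain \<delta> where \<delta>: "\<delta> > 0" and ul: "\<forall>\<^sub>F N in sequentially. \<forall>H\<in>\<H>. \<forall>\<xi>'. (\<forall>i<N. norm (\<xi>' i - \<theta>0 i \<omega>) \<le> \<delta>) \<longrightarrow>
         norm ((1 / real N) *\<^sub>R (\<Sum>i<N. H (\<xi>' i)) - (LINT \<theta>|\<mu>0. H \<theta>)) \<le> e"
        by blast
      have "(\<lambda>N. real N powr (- \<gamma>)) \<longlonglongrightarrow> 0"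
        using \<gamma> by (intro tendsto_neg_powr filterlim_real_sequentially) auto
      then have Az: "(\<lambda>N. A * real N powr (- \<gamma>)) \<longlonglongrightarrow> 0" by (rule tendsto_mult_right_zero)
      have "min \<delta> 1 > 0" using \<delta> by simp
      from displacement_small[OF this, of T] order_tendstoD(2)[OF Az e] ul B0 ini[rule_format, OF e] eventually_ge_at_top[of 1]
      show "\<forall>\<^sub>F N in sequentially. \<forall>t\<in>{0..T}. \<forall>x\<in>\<Omega>. norm (netj \<beta> N (\<theta> N \<omega> t) x - Rj t x) \<le> \<epsilon>"
      proof eventually_elim
        fix N :: nat
        assume small: "A * real N powr (- \<gamma>) < e"
          and u: "\<forall>H\<in>\<H>. \<forall>\<xi>'. (\<forall>i<N. norm (\<xi>' i - \<theta>0 i \<omega>) \<le> \<delta>) \<longrightarrow>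
             norm ((1 / real N) *\<^sub>R (\<Sum>i<N. H (\<xi>' i)) - (LINT \<theta>|\<mu>0. H \<theta>)) \<le> e"
          and g4: "iid.avg (\<lambda>i. \<theta>0 i \<omega>) N (\<lambda>\<theta>. growth \<theta> ^ 4) \<le> B0"
          and i0: "\<forall>x. norm x \<le> \<rho> \<longrightarrow> norm (real N powr (- \<beta>) *\<^sub>R (\<Sum>i<N. njet \<sigma> (\<theta>0 i \<omega>) x)) \<le> e"
          and N: "1 \<le> N"
          and disp: "\<forall>\<omega>\<in>space P. \<forall>t\<in>{0..T}. \<forall>i<N. norm (\<theta> N \<omega> t i - \<theta>0 i \<omega>) \<le> min \<delta> 1"
        show "\<forall>t\<in>{0..T}. \<forall>x\<in>\<Omega>. norm (netj \<beta> N (\<theta> N \<omega> t) x - Rj t x) \<le> \<epsilon>"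
        proof (intro ballI)
          fix t x assume t: "t \<in> {0..T}" and x: "x \<in> \<Omega>"
          define D where "D s y = netj \<beta> N (\<theta> N \<omega> s) y - Rj s y" for s y
          define S where "S s y = (1 / real N) *\<^sub>R (\<Sum>i<N. W (\<phi> N) (qj \<beta> N (\<theta> N \<omega> s)) y (\<theta> N \<omega> s i))" for s y
          define I where "I s y = (- \<alpha>) *\<^sub>R S s y - (- \<alpha>) *\<^sub>R Kj s y" for s y
          have gr: "growth (\<theta> N \<omega> s i) \<le> 8 * growth (\<theta>0 i \<omega>)" if "s \<in> {0..T}" "i < N" for s i
            using disp \<omega> that by (intro growth_perturb) auto
          have N0: "real N > 0" using N by simp
          have "norm (D t x) \<le> 2 * exp ((2 * L + 1) * T) * (e + T * (\<alpha> * (2 * e)))"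
          proof (rule gronwall_sup[where u = "netj \<beta> N (\<lambda>i. \<theta>0 i \<omega>)", OF _ _ _ _ L _ t x])
            fix s y assume s: "s \<in> {0..T}" and y: "y \<in> \<Omega>"
            have s0: "s \<ge> 0" using s by simp
            have "norm (Rj s y) \<le> (\<alpha> * BK) * measure lborel {0..s}"
              by (rule has_integral_bound_real[OF _ finite.emptyI Rj_has_integral[OF s0]])
                 (use \<alpha> BK(1) BK(2)[OF _ \<rho>(2)[OF y]] s in \<open>auto intro!: mult_left_mono\<close>)
            also have "(\<alpha> * BK) * measure lborel {0..s} \<le> (\<alpha> * BK) * T" using s \<alpha> BK(1) by (intro mult_left_mono) auto
            finally have R: "norm (Rj s y) \<le> (\<alpha> * BK) * T" .
            have "norm (\<Sum>i<N. njet \<sigma> (\<theta> N \<omega> s i) y) \<le> (\<Sum>i<N. Cn * (8 * growth (\<theta>0 i \<omega>)))"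
              by (rule sum_norm_le, rule order_trans[OF Cn(2) mult_left_mono[OF gr[OF s]]]) (use Cn(1) in auto)
            then have "norm (netj \<beta> N (\<theta> N \<omega> s) y) \<le> real N powr (- \<beta>) * (\<Sum>i<N. Cn * (8 * growth (\<theta>0 i \<omega>)))"
              unfolding netj_def norm_scaleR by (intro mult_mono) auto
            with R norm_triangle_ineq4[of "netj \<beta> N (\<theta> N \<omega> s) y" "Rj s y"]
            \<comment> \<open>A bound for fixed \<open>N\<close> that may grow with
              \<open>N\<close>; it serves only to make the weighted supremum finite.\<close>
            show "norm (D s y) \<le> real N powr (- \<beta>) * (\<Sum>i<N. Cn * (8 * growth (\<theta>0 i \<omega>))) + (\<alpha> * BK) * T"
              unfolding D_def by linarith
            have "((\<lambda>s. I s y) has_integral (netj \<beta> N (\<theta> N \<omega> s) y - netj \<beta> N (\<lambda>i. \<theta>0 i \<omega>) y) - Rj s y) {0..s}"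
              unfolding I_def S_def by (rule has_integral_diff[OF network_has_integral[OF N \<omega> s0] Rj_has_integral[OF s0]])
            then show "((\<lambda>s. I s y) has_integral D s y - netj \<beta> N (\<lambda>i. \<theta>0 i \<omega>) y) {0..s}" by (simp add: D_def algebra_simps)
          next
            fix y assume "y \<in> \<Omega>"
            then show "norm (netj \<beta> N (\<lambda>i. \<theta>0 i \<omega>) y) \<le> e" using i0 e \<rho>(2) by (simp add: netj_def)
          next
            show "0 \<le> \<alpha> * (2 * e)" using \<alpha> e by simp
          next
            fix s y \<delta>' assume s: "s \<in> {0..T}" and y: "y \<in> \<Omega>" and b: "\<And>y. y \<in> \<Omega> \<Longrightarrow> norm (D s y) \<le> \<delta>'"
            have s0: "s \<ge> 0" using s by simp
            define k where "k = real N powr (- \<gamma>)"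
            define w where "w = C * (1 + M)\<^sup>2 * (F * \<delta>' + k)"
            have k: "k \<ge> 0" by (simp add: k_def)
            have \<delta>': "\<delta>' \<ge> 0" using order_trans[OF norm_ge_zero b[OF y]] .
            have w: "w \<ge> 0" using C F(1) k \<delta>' by (simp add: w_def)
            obtain m where m: "sq_bound (qj \<beta> N (\<theta> N \<omega> s)) m" using qj_sq_bound by blast
            have sq: "sq_bound (\<lambda>y. qj \<beta> N (\<theta> N \<omega> s) y - pQ s y) (F * \<delta>')"
              by (rule sq_bound_network_error[OF less_imp_le[OF F(1)] F(2) s0]) (use b in \<open>auto simp: D_def\<close>)
            have lip: "\<forall>z w. \<bar>\<phi> N z - \<phi> N w\<bar> \<le> \<bar>z - w\<bar>" and near: "\<forall>z. \<bar>\<phi> N z - z\<bar> \<le> 2 * z\<^sup>2 * k"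
              unfolding k_def using clipping_facts[OF clip N \<gamma>(1)] by blast+
            have "norm (\<Sum>i<N. W (\<phi> N) (qj \<beta> N (\<theta> N \<omega> s)) y (\<theta> N \<omega> s i) - V (pQ s) y (\<theta> N \<omega> s i))
              \<le> (\<Sum>i<N. w * 8 ^ 4 * growth (\<theta>0 i \<omega>) ^ 4)"
            proof (rule sum_norm_le)
              fix i assume "i \<in> {..<N}"
              then have i: "i < N" by simp
              have "norm (W (\<phi> N) (qj \<beta> N (\<theta> N \<omega> s)) y (\<theta> N \<omega> s i) - V (pQ s) y (\<theta> N \<omega> s i)) \<le> w * growth (\<theta> N \<omega> s i) ^ 4"
                unfolding w_def by (rule Cb[rule_format, OF lip[rule_format] near[rule_format] k m M(2)[OF s] sq y])
              also have "w * growth (\<theta> N \<omega> s i) ^ 4 \<le> w * (8 * growth (\<theta>0 i \<omega>)) ^ 4"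
                using gr[OF s i] growth_ge_1[of "\<theta> N \<omega> s i"] w by (intro mult_left_mono power_mono) auto
              finally show "norm (W (\<phi> N) (qj \<beta> N (\<theta> N \<omega> s)) y (\<theta> N \<omega> s i) - V (pQ s) y (\<theta> N \<omega> s i)) \<le> w * 8 ^ 4 * growth (\<theta>0 i \<omega>) ^ 4"
                by (simp add: power_mult_distrib mult.assoc)
            qed
            also have "(\<Sum>i<N. w * 8 ^ 4 * growth (\<theta>0 i \<omega>) ^ 4) = real N * (w * 8 ^ 4 * iid.avg (\<lambda>i. \<theta>0 i \<omega>) N (\<lambda>\<theta>. growth \<theta> ^ 4))"
              unfolding sum_distrib_left[symmetric] using N0 by (simp add: iid.avg_def)
            also have "real N * (w * 8 ^ 4 * iid.avg (\<lambda>i. \<theta>0 i \<omega>) N (\<lambda>\<theta>. growth \<theta> ^ 4)) \<le> real N * (w * 8 ^ 4 * \<bar>B0\<bar>)"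
              using w g4 by (intro mult_left_mono) auto
            finally have "norm ((1 / real N) *\<^sub>R (\<Sum>i<N. W (\<phi> N) (qj \<beta> N (\<theta> N \<omega> s)) y (\<theta> N \<omega> s i) - V (pQ s) y (\<theta> N \<omega> s i))) \<le> w * 8 ^ 4 * \<bar>B0\<bar>"
              using N0 by (simp add: field_simps)
            also have "w * 8 ^ 4 * \<bar>B0\<bar> = A * (F * \<delta>' + k)" by (simp add: w_def A_def)
            finally have 1: "norm (S s y - (1 / real N) *\<^sub>R (\<Sum>i<N. V (pQ s) y (\<theta> N \<omega> s i))) \<le> A * (F * \<delta>' + k)"
              by (simp only: S_def sum_subtractf scaleR_diff_right)
            have "V (pQ s) y \<in> \<H>" unfolding \<H>_def by (rule image_eqI[of _ _ "(s, y)"]) (use s y in auto)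
            \<comment> \<open>The uniform law is applied directly at the trained parameters, which
              is why it allows a displacement of the sample.\<close>
            then have 2: "norm ((1 / real N) *\<^sub>R (\<Sum>i<N. V (pQ s) y (\<theta> N \<omega> s i)) - Kj s y) \<le> e"
              using u disp \<omega> s unfolding Kj_def by (metis min.boundedE)
            have "norm (S s y - Kj s y) \<le> A * (F * \<delta>' + k) + e" by (rule norm_diff_triangle_le[OF 1 2])
            also have "A * (F * \<delta>' + k) + e \<le> A * F * \<delta>' + 2 * e" using small by (simp add: k_def algebra_simps)
            finally have "\<alpha> * norm (S s y - Kj s y) \<le> \<alpha> * (A * F * \<delta>' + 2 * e)" using \<alpha> by (intro mult_left_mono) auto
            moreover have "norm (I s y) = \<alpha> * norm (S s y - Kj s y)"
              unfolding I_def scaleR_diff_right[symmetric] norm_scaleR using \<alpha> by simp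
            ultimately show "norm (I s y) \<le> L * \<delta>' + \<alpha> * (2 * e)" by (simp add: L_def algebra_simps)
          qed
          also have "2 * exp ((2 * L + 1) * T) * (e + T * (\<alpha> * (2 * e))) = \<kappa> * (1 + \<bar>T\<bar> * (2 * \<alpha>)) * e"
            using t by (simp add: \<kappa>_def algebra_simps)
          also have "\<kappa> * (1 + \<bar>T\<bar> * (2 * \<alpha>)) * e = \<epsilon>" using \<kappa> pos by (simp add: e_def)
          finally show "norm (netj \<beta> N (\<theta> N \<omega> t) x - Rj t x) \<le> \<epsilon>" by (simp add: D_def)
        qed
      qed
    qed
  qed
qed

text \<open>Multiplying by the jet of \<eta> costs a constant factor and returns to the network and
  the solution themselves. A single null set serves all multi-indices and the H^2 norm.\<close>

theorem training_converges:
  "AE \<omega> in P. (\<forall>js :: 'n list. length js \<le> 2 \<longrightarrow> (\<lambda>N. SUP t\<in>{0..T}. SUP x\<in>\<Omega>.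
       ennreal \<bar>pds \<Omega> (map (\<lambda>i. axis i 1) js) (net \<beta> \<eta> \<sigma> N (\<theta> N \<omega> t)) x - pds \<Omega> (map (\<lambda>i. axis i 1) js) (Q t) x\<bar>) \<longlonglongrightarrow> 0)
     \<and> (\<lambda>N. SUP t\<in>{0..T}. H2_norm \<Omega> (\<lambda>x. net \<beta> \<eta> \<sigma> N (\<theta> N \<omega> t) x - Q t x)) \<longlonglongrightarrow> 0"
proof -
  obtain F where F: "F > 0" "\<And>x p. x \<in> \<Omega> \<Longrightarrow> norm (jmul (ej x) p) \<le> F * norm p" using features_bound by metis
  from network_converges[of T] show ?thesis
  proof eventually_elim
    fix \<omega> assume conv: "\<forall>\<epsilon>>0. \<forall>\<^sub>F N in sequentially. \<forall>t\<in>{0..T}. \<forall>x\<in>\<Omega>. norm (netj \<beta> N (\<theta> N \<omega> t) x - Rj t x) \<le> \<epsilon>"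
    define K where "K N t x = qj \<beta> N (\<theta> N \<omega> t) x - jmul (ej x) (Rj t x)" for N t x
    have small: "\<forall>\<^sub>F N in sequentially. \<forall>t\<in>{0..T}. \<forall>x\<in>\<Omega>. norm (K N t x) \<le> \<epsilon>" if "\<epsilon> > 0" for \<epsilon>
    proof -
      have "\<epsilon> / F > 0" using that F by simp
      with conv have "\<forall>\<^sub>F N in sequentially. \<forall>t\<in>{0..T}. \<forall>x\<in>\<Omega>. norm (netj \<beta> N (\<theta> N \<omega> t) x - Rj t x) \<le> \<epsilon> / F" by blast
      then show ?thesis
      proof eventually_elim
        fix N assume n: "\<forall>t\<in>{0..T}. \<forall>x\<in>\<Omega>. norm (netj \<beta> N (\<theta> N \<omega> t) x - Rj t x) \<le> \<epsilon> / F"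
        show "\<forall>t\<in>{0..T}. \<forall>x\<in>\<Omega>. norm (K N t x) \<le> \<epsilon>"
        proof (intro ballI)
          fix t x assume t: "t \<in> {0..T}" and x: "x \<in> \<Omega>"
          have "norm (K N t x) \<le> F * norm (netj \<beta> N (\<theta> N \<omega> t) x - Rj t x)"
            unfolding K_def qj_def jmul_linear(2)[symmetric] by (rule F(2)[OF x])
          also have "F * norm (netj \<beta> N (\<theta> N \<omega> t) x - Rj t x) \<le> F * (\<epsilon> / F)" using n t x F(1) by (intro mult_left_mono) auto
          finally show "norm (K N t x) \<le> \<epsilon>" using F(1) by simp
        qed
      qed
    qed
    have pt: "(\<lambda>N. SUP t\<in>{0..T}. SUP x\<in>\<Omega>.
       ennreal \<bar>pds \<Omega> (map (\<lambda>i. axis i 1) js) (net \<beta> \<eta> \<sigma> N (\<theta> N \<omega> t)) x - pds \<Omega> (map (\<lambda>i. axis i 1) js) (Q t) x\<bar>) \<longlonglongrightarrow> 0"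
      if js: "length js \<le> 2" for js :: "'n list"
    proof (rule ennreal_tendsto_0)
      fix \<epsilon> :: real assume "\<epsilon> > 0"
      from small[OF this] show "\<forall>\<^sub>F N in sequentially. (SUP t\<in>{0..T}. SUP x\<in>\<Omega>.
        ennreal \<bar>pds \<Omega> (map (\<lambda>i. axis i 1) js) (net \<beta> \<eta> \<sigma> N (\<theta> N \<omega> t)) x - pds \<Omega> (map (\<lambda>i. axis i 1) js) (Q t) x\<bar>) \<le> ennreal \<epsilon>"
      proof eventually_elim
        fix N assume n: "\<forall>t\<in>{0..T}. \<forall>x\<in>\<Omega>. norm (K N t x) \<le> \<epsilon>"
        show "(SUP t\<in>{0..T}. SUP x\<in>\<Omega>.
          ennreal \<bar>pds \<Omega> (map (\<lambda>i. axis i 1) js) (net \<beta> \<eta> \<sigma> N (\<theta> N \<omega> t)) x - pds \<Omega> (map (\<lambda>i. axis i 1) js) (Q t) x\<bar>) \<le> ennreal \<epsilon>"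
        proof (intro SUP_least ennreal_leI)
          fix t x assume t: "t \<in> {0..T}" and x: "x \<in> \<Omega>"
          then have t0: "t \<ge> 0" by simp
          have "norm (K N t x) \<le> \<epsilon>" using n t x by blast
          with jet_pds_diff[OF thick has_jet_net has_jet_Q(1)[OF t0] x js, of \<beta> N "\<theta> N \<omega> t"]
          show "\<bar>pds \<Omega> (map (\<lambda>i. axis i 1) js) (net \<beta> \<eta> \<sigma> N (\<theta> N \<omega> t)) x - pds \<Omega> (map (\<lambda>i. axis i 1) js) (Q t) x\<bar> \<le> \<epsilon>"
            unfolding K_def by linarith
        qed
      qed
    qed
    have "(\<lambda>N. SUP t\<in>{0..T}. H2_norm \<Omega> (\<lambda>x. net \<beta> \<eta> \<sigma> N (\<theta> N \<omega> t) x - Q t x)) \<longlonglongrightarrow> 0"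
    proof (rule ennreal_tendsto_0)
      fix \<epsilon> :: real assume \<epsilon>: "\<epsilon> > 0"
      from small[OF this] show "\<forall>\<^sub>F N in sequentially. (SUP t\<in>{0..T}. H2_norm \<Omega> (\<lambda>x. net \<beta> \<eta> \<sigma> N (\<theta> N \<omega> t) x - Q t x)) \<le> ennreal \<epsilon>"
      proof eventually_elim
        fix N assume n: "\<forall>t\<in>{0..T}. \<forall>x\<in>\<Omega>. norm (K N t x) \<le> \<epsilon>"
        show "(SUP t\<in>{0..T}. H2_norm \<Omega> (\<lambda>x. net \<beta> \<eta> \<sigma> N (\<theta> N \<omega> t) x - Q t x)) \<le> ennreal \<epsilon>"
        proof (intro SUP_least H2_norm_le)
          fix t assume t: "t \<in> {0..T}"
          then have t0: "t \<ge> 0" by simp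
          show "has_jet \<Omega> (\<lambda>x. net \<beta> \<eta> \<sigma> N (\<theta> N \<omega> t) x - Q t x) (K N t)"
            using has_jet_add[OF has_jet_net has_jet_scale[OF has_jet_Q(1)[OF t0], of "-1"], of \<beta> N "\<theta> N \<omega> t"]
            by (simp add: K_def[abs_def])
          show "norm (K N t x) \<le> \<epsilon>" if "x \<in> \<Omega>" for x using n t that by blast
        qed (use \<epsilon> in simp)
      qed
    qed
    with pt show "(\<forall>js :: 'n list. length js \<le> 2 \<longrightarrow> (\<lambda>N. SUP t\<in>{0..T}. SUP x\<in>\<Omega>.
       ennreal \<bar>pds \<Omega> (map (\<lambda>i. axis i 1) js) (net \<beta> \<eta> \<sigma> N (\<theta> N \<omega> t)) x - pds \<Omega> (map (\<lambda>i. axis i 1) js) (Q t) x\<bar>) \<longlonglongrightarrow> 0)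
     \<and> (\<lambda>N. SUP t\<in>{0..T}. H2_norm \<Omega> (\<lambda>x. net \<beta> \<eta> \<sigma> N (\<theta> N \<omega> t) x - Q t x)) \<longlonglongrightarrow> 0" by blast
  qed
qed

end

theorem theorem6p5:
  fixes \<Omega> :: "(real^'n) set"
    and a :: "'n \<Rightarrow> 'n \<Rightarrow> real^'n \<Rightarrow> real" and c :: "'n \<Rightarrow> real^'n \<Rightarrow> real" and d :: "real^'n \<Rightarrow> real"
    and f :: "real \<Rightarrow> real^'n \<Rightarrow> real" and g :: "real^'n \<Rightarrow> real"
    and \<eta> :: "real^'n \<Rightarrow> real" and \<sigma> :: "real \<Rightarrow> real" and \<phi> :: "nat \<Rightarrow> real \<Rightarrow> real"
    and \<alpha> \<beta> \<gamma> :: real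
    and \<mu>\<^sub>0 :: "'n param measure"
    and P :: "'w measure"
    and \<theta>\<^sub>0 :: "nat \<Rightarrow> 'w \<Rightarrow> 'n param"
    and \<theta> :: "nat \<Rightarrow> 'w \<Rightarrow> real \<Rightarrow> nat \<Rightarrow> 'n param"
    and Q :: "real \<Rightarrow> real^'n \<Rightarrow> real"
  assumes "compact_smooth_domain \<Omega>"
    and "\<And>i j. smooth_on \<Omega> (a i j)" and "\<And>i. smooth_on \<Omega> (c i)" and "smooth_on \<Omega> d"
    and "uniformly_elliptic \<Omega> a"
    and "\<exists>l>0. \<forall>r. dirichlet_eigenvalue \<Omega> a c d r \<longrightarrow> l \<le> r"
    and "coercive \<Omega> a c d"
    and "bounded_nonlinearity f"
    and "g \<in> borel_measurable (unif \<Omega>)" and "bounded (g ` \<Omega>)"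
    and "auxiliary_function \<Omega> \<eta>"
    and "activation TYPE('n) \<sigma>"
    and "0 < \<alpha>" and "1/2 < \<beta>" and "\<beta> < 1" and "0 < \<gamma>" and "\<gamma> + \<beta> < 1"
    and "smooth_clipping \<gamma> \<phi>"
    and "initial_law \<mu>\<^sub>0"
    and "prob_space P"
    and "prob_space.indep_vars P (\<lambda>_. borel) \<theta>\<^sub>0 UNIV"
    and "\<And>i. distr P borel (\<theta>\<^sub>0 i) = \<mu>\<^sub>0"
    and "\<And>N \<omega>. N \<ge> 1 \<Longrightarrow> \<omega> \<in> space P \<Longrightarrow>
           trained \<Omega> a c d f g \<alpha> \<beta> \<eta> \<sigma> \<phi> N (\<lambda>i. \<theta>\<^sub>0 i \<omega>) (\<theta> N \<omega>)"
    and "limit_solution \<Omega> a c d f g \<alpha> \<eta> \<sigma> \<mu>\<^sub>0 Q"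
  shows "(\<forall>T\<ge>0. \<forall>js :: 'n list. length js \<le> 2 \<longrightarrow>
            (AE \<omega> in P. (\<lambda>N. SUP t\<in>{0..T}. SUP x\<in>\<Omega>.
                ennreal \<bar>pds \<Omega> (map (\<lambda>i. axis i 1) js) (net \<beta> \<eta> \<sigma> N (\<theta> N \<omega> t)) x
                         - pds \<Omega> (map (\<lambda>i. axis i 1) js) (Q t) x\<bar>) \<longlonglongrightarrow> 0))
       \<and> (\<forall>T\<ge>0. AE \<omega> in P. (\<lambda>N. SUP t\<in>{0..T}.
                H2_norm \<Omega> (\<lambda>x. net \<beta> \<eta> \<sigma> N (\<theta> N \<omega> t) x - Q t x)) \<longlonglongrightarrow> 0)"
proof -
  have eta: "Ckb_on 3 \<Omega> \<eta>" using assms(11) by (simp add: auxiliary_function_def)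
  have sig: "Ckb_on 3 UNIV \<sigma>" using assms(12) by (simp add: activation_def)
  interpret lim \<Omega> a c d f g \<eta> \<sigma> \<mu>\<^sub>0 \<alpha> Q
    by unfold_locales (rule assms eta sig)+
  have iid: "iid_params P \<theta>\<^sub>0 \<mu>\<^sub>0"
    by (rule iid_params.intro) (rule assms)+
  interpret training \<Omega> a c d f g \<eta> \<sigma> \<mu>\<^sub>0 \<alpha> Q P \<theta>\<^sub>0 \<phi> \<beta> \<gamma> \<theta>
    by (intro training.intro lim_axioms iid training_axioms.intro) (rule assms; assumption?)+
  show ?thesis
  proof (intro conjI allI impI)
    fix T :: real and js :: "'n list" assume "length js \<le> 2"
    then show "AE \<omega> in P. (\<lambda>N. SUP t\<in>{0..T}. SUP x\<in>\<Omega>.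
        ennreal \<bar>pds \<Omega> (map (\<lambda>i. axis i 1) js) (net \<beta> \<eta> \<sigma> N (\<theta> N \<omega> t)) x
                 - pds \<Omega> (map (\<lambda>i. axis i 1) js) (Q t) x\<bar>) \<longlonglongrightarrow> 0"
      using training_converges[of T] by (auto elim!: eventually_mono)
  next
    fix T :: real
    show "AE \<omega> in P. (\<lambda>N. SUP t\<in>{0..T}. H2_norm \<Omega> (\<lambda>x. net \<beta> \<eta> \<sigma> N (\<theta> N \<omega> t) x - Q t x)) \<longlonglongrightarrow> 0"
      using training_converges[of T] by (auto elim!: eventually_mono)
  qed
qed

end
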